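(* Suppose that $V$ satisfies Hypotheses A and B and that $W=g^2\omega^{-1}v^2$ satisfies Hypothesis C (all stated in the context). There exists $\varepsilon_V>0$, depending on $V$, such that, if $$\|W\|_{L^1+L^{3,\infty}}\le\varepsilon_V,$$ then for all $\Lambda>0$, $\mathcal{E}_\Lambda$ and $\mathcal{E}$ have unique minimizers $(u_{\Lambda,\mathrm{gs}},f_{\Lambda,\mathrm{gs}})$ and $(u_{\mathrm{gs}},f_{\mathrm{gs}})$ in $\mathcal{U}\times\mathcal{Z}_\omega$, respectively, such that $\langle u_{\Lambda,\mathrm{gs}},u_V\rangle_{L^2}>0$ and $\langle u_{\mathrm{gs}},u_V\rangle_{L^2}>0$. They satisfy $$\big\|(u_{\Lambda,\mathrm{gs}},f_{\Lambda,\mathrm{gs}})-(u_{\mathrm{gs}},f_{\mathrm{gs}})\big\|_{\mathcal{Q}_V\times\mathcal{Z}_\omega}\longrightarrow0\qquad\text{as }\Lambda\to\infty.$$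
   Context: Weak Lebesgue space: $L^{3,\infty}=L^{3,\infty}(\mathbb{R}^3)$ is the set of measurable $f$ with $\|f\|_{L^{3,\infty}}=\sup_{t>0}t\,\lambda(\{|f|>t\})^{1/3}<\infty$, $\lambda$ being Lebesgue measure. $\|W\|_{L^1+L^{3,\infty}}$ is the infimum of $\|W_1\|_{L^1}+\|W_2\|_{L^{3,\infty}}$ over decompositions $W=W_1+W_2$. Particle. $V:\mathbb{R}^3\to\mathbb{R}$ is a measurable potential, $V_+=\max(V,0)$, $V_-=\max(-V,0)$. $H_V=-\Delta+V$ on $L^2(\mathbb{R}^3)$ is defined through its quadratic form, and $\mu_V=\inf\sigma(H_V)$ (similarly $H_U,\mu_U$ for other potentials $U$). Hypothesis A on $V$: there are $0\le a<1$ and $b\in\mathbb{R}$ with $V_-\le -a\Delta+b$ as quadratic forms on $H^1(\mathbb{R}^3)$, and $V=V_1+V_2$ with (i) $V_1\in L^1_{\mathrm{loc}}(\mathbb{R}^3;\mathbb{R}^+)$; (ii) $V_2\in L^{3/2}_{\mathrm{loc}}(\mathbb{R}^3;\mathbb{R})$ and $\lim_{|x|\to\infty}V_2(x)=0$; (iii) $\mu_V<\mu_{V_1}$. Under Hypothesis A, $H_V$ is a semibounded self-adjoint operator with form domain $\mathcal{Q}_V=\{u\in H^1(\mathbb{R}^3): \int V_+|u|^2<\infty\}$, a Hilbert space with norm $\|u\|_{\mathcal{Q}_V}^2=\|u\|_{H^1}^2+\|V_+^{1/2}u\|_{L^2}^2$. Set $\mathcal{U}=\{u\in\mathcal{Q}_V:\|u\|_{L^2}=1\}$.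 Hypothesis B: $\mu_V$ is a simple isolated eigenvalue of $H_V$ associated to a unique positive ground state $u_V\in L^2(\mathbb{R}^3;\mathbb{R}_+)$ with $\|u_V\|_{L^2}=1$. Field. $\omega:\mathbb{R}^3\to[0,\infty)$ is measurable with $\omega>0$ almost everywhere, $v:\mathbb{R}^3\to\mathbb{R}$ is measurable, $g\in\mathbb{R}$, and $W=g^2\omega^{-1}v^2$. $\mathcal{Z}_\omega=\{f:\mathbb{R}^3\to\mathbb{C}\text{ measurable}:\omega^{1/2}f\in L^2(\mathbb{R}^3)\}$, with norm $\|f\|_{\mathcal{Z}_\omega}=\|\omega^{1/2}f\|_{L^2}$; $\mathcal{Q}_V\times\mathcal{Z}_\omega$ carries the product norm. Hypothesis C on $W$: $W=W_1+W_2$ with $W_1\in L^1(\mathbb{R}^3)$ and $W_2\in L^{3,\infty}(\mathbb{R}^3)$. Energy. For $(u,f)\in\mathcal{U}\times\mathcal{Z}_\omega$, $$\mathcal{E}(u,f)=\int|\nabla u|^2dx+\int V|u|^2dx+\int\omega|f|^2dk+2g\,\mathrm{Re}\int_{\mathbb{R}^6}e^{ik\cdot x}v(k)f(k)|u(x)|^2dx\,dk,$$ where the last integral is understood as $\int v(k)f(k)\big(\int e^{ik\cdot x}|u(x)|^2dx\big)dk$. For $0<\Lambda<\infty$, $\mathcal{E}_\Lambda$ is the same functional with $v$ replaced by $v_\Lambda=v\,\mathbf{1}_{|k|\le\Lambda}$. The constant $\varepsilon_V$ depends on $V$ but not on $\omega,v,g,\Lambda$. *)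

theory Defs
  imports "HOL-Analysis.Analysis"
begin

text \<open>
  Elements of Lebesgue and Sobolev spaces are represented by Lebesgue measurable functions;
  equality in these spaces is equality almost everywhere.
\<close>

section \<open>Lebesgue spaces\<close>

definition L2 :: "(real^3 \<Rightarrow> 'a::{banach, second_countable_topology}) set" where
  "L2 = {u \<in> borel_measurable lebesgue. integrable lebesgue (\<lambda>x. (norm (u x))\<^sup>2)}"

definition L2_norm :: "(real^3 \<Rightarrow> 'a::{banach, second_countable_topology}) \<Rightarrow> real" where
  "L2_norm u = sqrt (\<integral>x. (norm (u x))\<^sup>2 \<partial>lebesgue)"

definition L2_inner :: "(real^3 \<Rightarrow> complex) \<Rightarrow> (real^3 \<Rightarrow> complex) \<Rightarrow> complex" where
  "L2_inner u w = (\<integral>x. cnj (u x) * w x \<partial>lebesgue)"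

definition Lp_loc :: "real \<Rightarrow> (real^3 \<Rightarrow> real) set" where
  "Lp_loc p = {f \<in> borel_measurable lebesgue.
     \<forall>K. compact K \<longrightarrow> set_integrable lebesgue K (\<lambda>x. \<bar>f x\<bar> powr p)}"

definition L1_norm :: "(real^3 \<Rightarrow> real) \<Rightarrow> ennreal" where
  "L1_norm f = (\<integral>\<^sup>+x. ennreal \<bar>f x\<bar> \<partial>lebesgue)"

definition ennreal_cbrt :: "ennreal \<Rightarrow> ennreal" where
  "ennreal_cbrt a = (if a = top then top else ennreal (root 3 (enn2real a)))"

definition L3w_norm :: "(real^3 \<Rightarrow> real) \<Rightarrow> ennreal" where
  "L3w_norm f = (SUP t\<in>{0<..}. ennreal t * ennreal_cbrt (emeasure lebesgue {x. t < \<bar>f x\<bar>}))"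

definition L1 :: "(real^3 \<Rightarrow> real) set" where
  "L1 = {f \<in> borel_measurable lebesgue. L1_norm f < top}"

definition L3w :: "(real^3 \<Rightarrow> real) set" where
  "L3w = {f \<in> borel_measurable lebesgue. L3w_norm f < top}"

definition L1_L3w_decomp ::
    "(real^3 \<Rightarrow> real) \<Rightarrow> (real^3 \<Rightarrow> real) \<Rightarrow> (real^3 \<Rightarrow> real) \<Rightarrow> bool" where
  "L1_L3w_decomp W W1 W2 \<longleftrightarrow> W1 \<in> L1 \<and> W2 \<in> L3w \<and> (AE x in lebesgue. W x = W1 x + W2 x)"

text \<open>The infimum is \<open>top\<close> if there is no decomposition.\<close>

definition L1_L3w_norm :: "(real^3 \<Rightarrow> real) \<Rightarrow> ennreal" where
  "L1_L3w_norm W = Inf {L1_norm W1 + L3w_norm W2 | W1 W2. L1_L3w_decomp W W1 W2}"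


section \<open>The Sobolev space of order one\<close>

definition partial_deriv :: "3 \<Rightarrow> (real^3 \<Rightarrow> real) \<Rightarrow> real^3 \<Rightarrow> real" where
  "partial_deriv i \<phi> x = frechet_derivative \<phi> (at x) (axis i 1)"

primrec Ck :: "nat \<Rightarrow> (real^3 \<Rightarrow> real) \<Rightarrow> bool" where
  "Ck 0 \<phi> \<longleftrightarrow> continuous_on UNIV \<phi>"
| "Ck (Suc n) \<phi> \<longleftrightarrow> \<phi> differentiable_on UNIV \<and> (\<forall>i. Ck n (partial_deriv i \<phi>))"

definition test_function :: "(real^3 \<Rightarrow> real) \<Rightarrow> bool" where
  "test_function \<phi> \<longleftrightarrow> (\<forall>n. Ck n \<phi>) \<and> compact (closure {x. \<phi> x \<noteq> 0})"

definition weak_gradient :: "(real^3 \<Rightarrow> complex) \<Rightarrow> (real^3 \<Rightarrow> complex^3) \<Rightarrow> bool" where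
  "weak_gradient u G \<longleftrightarrow>
     (\<forall>K. compact K \<longrightarrow> set_integrable lebesgue K u \<and> set_integrable lebesgue K G) \<and>
     (\<forall>\<phi> i. test_function \<phi> \<longrightarrow>
        (\<integral>x. partial_deriv i \<phi> x *\<^sub>R u x \<partial>lebesgue) = - (\<integral>x. \<phi> x *\<^sub>R (G x $ i) \<partial>lebesgue))"

text \<open>A weak gradient is unique almost everywhere, so every choice gives the same integrals.\<close>

definition grad :: "(real^3 \<Rightarrow> complex) \<Rightarrow> real^3 \<Rightarrow> complex^3" where
  "grad u = (SOME G. weak_gradient u G)"

definition H1 :: "(real^3 \<Rightarrow> complex) set" where
  "H1 = {u \<in> L2. \<exists>G. weak_gradient u G \<and> G \<in> L2}"

definition H1_norm :: "(real^3 \<Rightarrow> complex) \<Rightarrow> real" where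
  "H1_norm u = sqrt ((L2_norm u)\<^sup>2 + (L2_norm (grad u))\<^sup>2)"


section \<open>Schroedinger operators\<close>

definition pos_part :: "(real^3 \<Rightarrow> real) \<Rightarrow> real^3 \<Rightarrow> real" where
  "pos_part V x = max (V x) 0"

definition neg_part :: "(real^3 \<Rightarrow> real) \<Rightarrow> real^3 \<Rightarrow> real" where
  "neg_part V x = max (- V x) 0"

definition form_domain :: "(real^3 \<Rightarrow> real) \<Rightarrow> (real^3 \<Rightarrow> complex) set" where
  "form_domain V = {u \<in> H1. integrable lebesgue (\<lambda>x. pos_part V x * (norm (u x))\<^sup>2)}"

definition form_norm :: "(real^3 \<Rightarrow> real) \<Rightarrow> (real^3 \<Rightarrow> complex) \<Rightarrow> real" where
  "form_norm V u = sqrt ((H1_norm u)\<^sup>2 + (L2_norm (\<lambda>x. sqrt (pos_part V x) *\<^sub>R u x))\<^sup>2)"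

definition schrodinger_form ::
    "(real^3 \<Rightarrow> real) \<Rightarrow> (real^3 \<Rightarrow> complex) \<Rightarrow> (real^3 \<Rightarrow> complex) \<Rightarrow> complex" where
  "schrodinger_form V u w =
     (\<integral>x. (\<Sum>i\<in>UNIV. cnj (grad u x $ i) * grad w x $ i) \<partial>lebesgue) +
     (\<integral>x. of_real (V x) * cnj (u x) * w x \<partial>lebesgue)"

text \<open>
  The graph of the operator associated with the form: \<open>u\<close> lies in the domain of
  \<open>H\<^sub>V = - \<Delta> + V\<close> and \<open>H\<^sub>V u = h\<close>.
\<close>

definition schrodinger_op ::
    "(real^3 \<Rightarrow> real) \<Rightarrow> (real^3 \<Rightarrow> complex) \<Rightarrow> (real^3 \<Rightarrow> complex) \<Rightarrow> bool" where
  "schrodinger_op V u h \<longleftrightarrow> u \<in> form_domain V \<and> h \<in> L2 \<and>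
     (\<forall>w\<in>form_domain V. schrodinger_form V w u = L2_inner w h)"

text \<open>
  \<open>z\<close> is in the resolvent set if \<open>H\<^sub>V - z\<close> is a bijection from the domain onto \<open>L2\<close> with bounded
  inverse. The norm bound below expresses both injectivity and boundedness of the inverse.
\<close>

definition resolvent_set :: "(real^3 \<Rightarrow> real) \<Rightarrow> complex set" where
  "resolvent_set V = {z.
     (\<forall>h\<in>L2. \<exists>u. schrodinger_op V u (\<lambda>x. h x + z * u x)) \<and>
     (\<exists>C. \<forall>u h. schrodinger_op V u h \<longrightarrow> L2_norm u \<le> C * L2_norm (\<lambda>x. h x - z * u x))}"

definition spectrum :: "(real^3 \<Rightarrow> real) \<Rightarrow> complex set" where
  "spectrum V = - resolvent_set V"

definition spectral_inf :: "(real^3 \<Rightarrow> real) \<Rightarrow> real" where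
  "spectral_inf V = Inf (Re ` spectrum V)"

definition eigenfunction :: "(real^3 \<Rightarrow> real) \<Rightarrow> real \<Rightarrow> (real^3 \<Rightarrow> complex) \<Rightarrow> bool" where
  "eigenfunction V E u \<longleftrightarrow> schrodinger_op V u (\<lambda>x. of_real E * u x) \<and>
     \<not> (AE x in lebesgue. u x = 0)"

definition simple_eigenvalue :: "(real^3 \<Rightarrow> real) \<Rightarrow> real \<Rightarrow> bool" where
  "simple_eigenvalue V E \<longleftrightarrow> (\<exists>u. eigenfunction V E u) \<and>
     (\<forall>u w. eigenfunction V E u \<longrightarrow> eigenfunction V E w \<longrightarrow>
        (\<exists>c. AE x in lebesgue. w x = c * u x))"


section \<open>Hypotheses\<close>

definition hypothesis_A :: "(real^3 \<Rightarrow> real) \<Rightarrow> bool" where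
  "hypothesis_A V \<longleftrightarrow> V \<in> borel_measurable lebesgue \<and>
     (\<exists>a b. 0 \<le> a \<and> a < 1 \<and> (\<forall>u\<in>H1.
        integrable lebesgue (\<lambda>x. neg_part V x * (norm (u x))\<^sup>2) \<and>
        (\<integral>x. neg_part V x * (norm (u x))\<^sup>2 \<partial>lebesgue)
          \<le> a * (L2_norm (grad u))\<^sup>2 + b * (L2_norm u)\<^sup>2)) \<and>
     (\<exists>V1 V2. (AE x in lebesgue. V x = V1 x + V2 x) \<and>
        V1 \<in> Lp_loc 1 \<and> (\<forall>x. 0 \<le> V1 x) \<and>
        V2 \<in> Lp_loc (3/2) \<and> (V2 \<longlongrightarrow> 0) at_infinity \<and>
        spectral_inf V < spectral_inf V1)"

definition positive_ground_state :: "(real^3 \<Rightarrow> real) \<Rightarrow> (real^3 \<Rightarrow> real) \<Rightarrow> bool" where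
  "positive_ground_state V \<psi> \<longleftrightarrow>
     eigenfunction V (spectral_inf V) (\<lambda>x. of_real (\<psi> x)) \<and>
     (AE x in lebesgue. 0 \<le> \<psi> x) \<and> L2_norm \<psi> = 1"

definition hypothesis_B :: "(real^3 \<Rightarrow> real) \<Rightarrow> (real^3 \<Rightarrow> real) \<Rightarrow> bool" where
  "hypothesis_B V uV \<longleftrightarrow>
     simple_eigenvalue V (spectral_inf V) \<and>
     complex_of_real (spectral_inf V) isolated_in spectrum V \<and>
     positive_ground_state V uV \<and>
     (\<forall>\<psi>. positive_ground_state V \<psi> \<longrightarrow> (AE x in lebesgue. \<psi> x = uV x))"

definition hypothesis_C :: "(real^3 \<Rightarrow> real) \<Rightarrow> bool" where
  "hypothesis_C W \<longleftrightarrow> (\<exists>W1 W2. L1_L3w_decomp W W1 W2)"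


section \<open>Energy functional and minimizers\<close>

definition coupling_W ::
    "(real^3 \<Rightarrow> real) \<Rightarrow> (real^3 \<Rightarrow> real) \<Rightarrow> real \<Rightarrow> real^3 \<Rightarrow> real" where
  "coupling_W \<omega> v g k = g\<^sup>2 * inverse (\<omega> k) * (v k)\<^sup>2"

definition particle_states :: "(real^3 \<Rightarrow> real) \<Rightarrow> (real^3 \<Rightarrow> complex) set" where
  "particle_states V = {u \<in> form_domain V. L2_norm u = 1}"

definition field_space :: "(real^3 \<Rightarrow> real) \<Rightarrow> (real^3 \<Rightarrow> complex) set" where
  "field_space \<omega> = {f \<in> borel_measurable lebesgue. (\<lambda>k. sqrt (\<omega> k) *\<^sub>R f k) \<in> L2}"

definition field_norm :: "(real^3 \<Rightarrow> real) \<Rightarrow> (real^3 \<Rightarrow> complex) \<Rightarrow> real" where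
  "field_norm \<omega> f = L2_norm (\<lambda>k. sqrt (\<omega> k) *\<^sub>R f k)"

definition product_norm ::
    "(real^3 \<Rightarrow> real) \<Rightarrow> (real^3 \<Rightarrow> real) \<Rightarrow> (real^3 \<Rightarrow> complex) \<Rightarrow> (real^3 \<Rightarrow> complex) \<Rightarrow> real" where
  "product_norm V \<omega> u f = sqrt ((form_norm V u)\<^sup>2 + (field_norm \<omega> f)\<^sup>2)"

definition energy ::
    "(real^3 \<Rightarrow> real) \<Rightarrow> (real^3 \<Rightarrow> real) \<Rightarrow> (real^3 \<Rightarrow> real) \<Rightarrow> real \<Rightarrow>
     (real^3 \<Rightarrow> complex) \<Rightarrow> (real^3 \<Rightarrow> complex) \<Rightarrow> real" where
  "energy V \<omega> v g u f =
     (\<integral>x. (norm (grad u x))\<^sup>2 \<partial>lebesgue) +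
     (\<integral>x. V x * (norm (u x))\<^sup>2 \<partial>lebesgue) +
     (\<integral>k. \<omega> k * (norm (f k))\<^sup>2 \<partial>lebesgue) +
     2 * g * Re (\<integral>k. of_real (v k) * f k *
        (\<integral>x. exp (\<i> * of_real (k \<bullet> x)) * of_real ((norm (u x))\<^sup>2) \<partial>lebesgue) \<partial>lebesgue)"

definition cutoff :: "real \<Rightarrow> (real^3 \<Rightarrow> real) \<Rightarrow> real^3 \<Rightarrow> real" where
  "cutoff \<Lambda> v k = v k * indicator {k. norm k \<le> \<Lambda>} k"

definition minimizer ::
    "(real^3 \<Rightarrow> real) \<Rightarrow> (real^3 \<Rightarrow> real) \<Rightarrow> (real^3 \<Rightarrow> real) \<Rightarrow> real \<Rightarrow>
     (real^3 \<Rightarrow> complex) \<Rightarrow> (real^3 \<Rightarrow> complex) \<Rightarrow> bool" where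
  "minimizer V \<omega> v g u f \<longleftrightarrow> u \<in> particle_states V \<and> f \<in> field_space \<omega> \<and>
     (\<forall>u'\<in>particle_states V. \<forall>f'\<in>field_space \<omega>. energy V \<omega> v g u f \<le> energy V \<omega> v g u' f')"

definition positive_overlap :: "(real^3 \<Rightarrow> complex) \<Rightarrow> (real^3 \<Rightarrow> real) \<Rightarrow> bool" where
  "positive_overlap u \<psi> \<longleftrightarrow>
     Im (L2_inner u (\<lambda>x. of_real (\<psi> x))) = 0 \<and> 0 < Re (L2_inner u (\<lambda>x. of_real (\<psi> x)))"

text \<open>
  The energy is invariant under \<open>u \<mapsto> c u\<close> with \<open>\<bar>c\<bar> = 1\<close>, so minimizers can be unique only
  among those normalized by \<open>\<langle>u, u\<^sub>V\<rangle> > 0\<close>.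
\<close>

definition unique_minimizer ::
    "(real^3 \<Rightarrow> real) \<Rightarrow> (real^3 \<Rightarrow> real) \<Rightarrow> (real^3 \<Rightarrow> real) \<Rightarrow> (real^3 \<Rightarrow> real) \<Rightarrow> real \<Rightarrow>
     (real^3 \<Rightarrow> complex) \<Rightarrow> (real^3 \<Rightarrow> complex) \<Rightarrow> bool" where
  "unique_minimizer V uV \<omega> v g u f \<longleftrightarrow>
     minimizer V \<omega> v g u f \<and> positive_overlap u uV \<and>
     (\<forall>u' f'. minimizer V \<omega> v g u' f' \<and> positive_overlap u' uV \<longrightarrow>
        (AE x in lebesgue. u' x = u x) \<and> (AE k in lebesgue. f' k = f k))"

end

(*
  Minimizing over the field leaves the functional J u = <u, H u> - |psi (u, u)|^2 of the particle
  alone, where psi (u, u) is the Fourier transform of the density |u|^2 times a weight of square |W|.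
  Splitting W into its L^1 and weak L^3 parts and integrating over the level sets of the latter,
  |psi (u, w)|^2 <= C |W| |u|^2 |w|^2 in H^1 by Bessel's inequality and the embedding of H^1 in L^4.

  For small W, low energy states are close to the ground state. The spectral gap makes the form of
  H strictly convex there, up to the normalization constraint, and the quartic term is a small
  perturbation. The parallelogram identity then bounds |u1 - u2|^2 by J u1 + J u2 - 2 inf J: minimizing
  sequences are Cauchy and minimizers are unique. A minimizer for the cutoff exceeds the infimum of J
  by at most the mass of psi (u, u) outside the ball of radius Lambda, which gives the convergence.

  The spectral theorem is not needed: the gap follows from the resolvent set directly, since the
  form is bounded below by c if H - z is boundedly invertible for all real z < c.
*)

theory Submission
  imports Defs "HOL-Probability.Probability" "HOL-Library.Function_Algebras"
    "HOL-Computational_Algebra.Polynomial"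
begin

text \<open>Two difficulties shape the estimates. On general functions the quartic term grows like
  the fourth power of the H^1 norm, which would not keep the functional bounded below. On unit
  vectors, however, the length scale left free in the Sobolev inequality and the height at which the
  weak L^3 part is split can both be taken proportional to the inverse of the H^1 norm; the growth
  becomes quadratic and is absorbed by the form of H. Secondly, the unit sphere is not convex, and
  the gap says nothing along the ground state. The midpoint m of two unit vectors is orthogonal to
  half their difference d: renormalizing m costs only its small excess energy times |d|^2, and since
  m is close to the ground state, d is nearly orthogonal to it, so the gap controls d.

  All forms are real bilinear; imaginary parts are recovered by inserting a factor i. The bottom of
  the spectrum is an infimum of real parts of complex numbers, so resolvents are constructed in a
  whole half-plane. In the real setting the imaginary part of z is a skew term, hence the skew
  version of Lax-Milgram.\<close>

section \<open>Quadratic forms on real vector spaces\<close>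

text \<open>Source of all inequalities of Cauchy-Schwarz type below, including the variational ones,
  where the polynomial is the increment of a functional along a line. A leading coefficient that is
  zero or a priori negative is covered.\<close>

lemma discriminant_bound:
  fixes a b c :: real
  assumes "\<And>t. 0 \<le> a * t\<^sup>2 + 2 * b * t + c"
  shows "b\<^sup>2 \<le> a * c"
proof (cases "a = 0")
  case True
  have "b = 0"
  proof (rule ccontr)
    assume "b \<noteq> 0"
    have "0 \<le> a * (- (c + 1) / (2 * b))\<^sup>2 + 2 * b * (- (c + 1) / (2 * b)) + c"
      by (rule assms)
    with True \<open>b \<noteq> 0\<close> show False by simp
  qed
  with True show ?thesis by simp
next
  case False
  have c: "0 \<le> c" using assms[of 0] by simp
  have "0 < a"
  proof (rule ccontr)
    assume "\<not> 0 < a"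
    with False have a: "a < 0" by simp
    \<comment> \<open>Since \<open>t \<ge> 1\<close>, the lower-order terms are at most
      \<open>(\<bar>2 * b\<bar> + c) * t\<close>; this \<open>t\<close> makes the polynomial at most
      \<open>t * (a - 1)\<close>, which is negative.\<close>
    define t where "t = (\<bar>2 * b\<bar> + c + 1) / (- a) + 1"
    have t: "1 \<le> t" using a c by (simp add: t_def field_simps)
    have "a * t\<^sup>2 + 2 * b * t + c \<le> a * t\<^sup>2 + \<bar>2 * b\<bar> * t + c * t"
    proof -
      have "2 * b * t \<le> \<bar>2 * b\<bar> * t" using t by (intro mult_right_mono) auto
      moreover have "c * 1 \<le> c * t" using c t by (intro mult_left_mono)
      ultimately show ?thesis by simp
    qed
    also have "\<dots> = t * (a * t + \<bar>2 * b\<bar> + c)" by (simp add: power2_eq_square algebra_simps)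
    also have "a * t + \<bar>2 * b\<bar> + c = a - 1" using a by (simp add: t_def field_simps)
    also have "t * (a - 1) < 0" using t a by (intro mult_pos_neg) auto
    finally show False using assms[of t] by simp
  qed
  have "0 \<le> a * (- b / a)\<^sup>2 + 2 * b * (- b / a) + c" by (rule assms)
  also have "\<dots> = c - b\<^sup>2 / a" using \<open>0 < a\<close> by (simp add: field_simps power2_eq_square)
  finally show ?thesis using \<open>0 < a\<close> by (simp add: field_simps)
qed

text \<open>A form on a subspace rather than a type with an inner product: the same functions carry
  several forms at once (\<open>rip\<close>, \<open>fip\<close>, \<open>sform\<close>,
  \<open>qf\<close>) on different subspaces. Functions equal almost everywhere are not identified,
  so definiteness cannot be demanded.\<close>

locale sym_form =
  fixes S :: "'a::real_vector set" and B :: "'a \<Rightarrow> 'a \<Rightarrow> real"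
  assumes subsp: "subspace S"
    and add_left: "\<lbrakk>x \<in> S; y \<in> S; z \<in> S\<rbrakk> \<Longrightarrow> B (x + y) z = B x z + B y z"
    and scale_left: "\<lbrakk>x \<in> S; z \<in> S\<rbrakk> \<Longrightarrow> B (c *\<^sub>R x) z = c * B x z"
    and sym: "\<lbrakk>x \<in> S; z \<in> S\<rbrakk> \<Longrightarrow> B x z = B z x"
begin

lemma in_add [simp, intro]: "\<lbrakk>x \<in> S; y \<in> S\<rbrakk> \<Longrightarrow> x + y \<in> S"
  using subsp by (rule subspace_add)

lemma in_scale [simp, intro]: "x \<in> S \<Longrightarrow> c *\<^sub>R x \<in> S"
  using subsp by (rule subspace_scale)

lemma in_diff [simp, intro]: "\<lbrakk>x \<in> S; y \<in> S\<rbrakk> \<Longrightarrow> x - y \<in> S"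
  using subsp by (rule subspace_diff)

lemma in_zero [simp, intro]: "0 \<in> S"
  using subsp by (rule subspace_0)

lemma add_right: "\<lbrakk>x \<in> S; y \<in> S; z \<in> S\<rbrakk> \<Longrightarrow> B z (x + y) = B z x + B z y"
  using add_left[of x y z] by (simp add: sym)

lemma scale_right: "\<lbrakk>x \<in> S; z \<in> S\<rbrakk> \<Longrightarrow> B z (c *\<^sub>R x) = c * B z x"
  using scale_left[of x z c] by (simp add: sym)

lemma diff_left: "\<lbrakk>x \<in> S; y \<in> S; z \<in> S\<rbrakk> \<Longrightarrow> B (x - y) z = B x z - B y z"
  using add_left[of "x" "(-1) *\<^sub>R y" z] scale_left[of y z "-1"] in_scale[of y "-1"] by simp

lemma diff_right: "\<lbrakk>x \<in> S; y \<in> S; z \<in> S\<rbrakk> \<Longrightarrow> B z (x - y) = B z x - B z y"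
  using diff_left[of x y z] by (simp add: sym)

lemmas bilin = add_left add_right scale_left scale_right diff_left diff_right

end

locale psd_form = sym_form +
  assumes nonneg: "x \<in> S \<Longrightarrow> 0 \<le> B x x"
begin

lemma cauchy_schwarz:
  assumes "x \<in> S" "y \<in> S"
  shows "(B x y)\<^sup>2 \<le> B x x * B y y"
proof -
  have "(B x y)\<^sup>2 \<le> B y y * B x x"
  proof (rule discriminant_bound)
    fix t :: real
    have "0 \<le> B (x + t *\<^sub>R y) (x + t *\<^sub>R y)" using assms by (intro nonneg) auto
    also have "\<dots> = B y y * t\<^sup>2 + 2 * B x y * t + B x x"
      using assms by (simp add: bilin sym[of y x] power2_eq_square algebra_simps)
    finally show "0 \<le> B y y * t\<^sup>2 + 2 * B x y * t + B x x" .
  qed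
  thus ?thesis by (simp add: mult.commute)
qed

lemma cauchy_schwarz_abs:
  assumes "x \<in> S" "y \<in> S"
  shows "\<bar>B x y\<bar> \<le> sqrt (B x x) * sqrt (B y y)"
  using real_sqrt_le_mono[OF cauchy_schwarz[OF assms]] by (simp add: real_sqrt_mult)

lemma add_sq_le: "\<lbrakk>x \<in> S; y \<in> S\<rbrakk> \<Longrightarrow> B (x + y) (x + y) \<le> 2 * B x x + 2 * B y y"
  using nonneg[of "x - y"] by (simp add: bilin sym[of y x])

lemma diff_sq_le: "\<lbrakk>x \<in> S; y \<in> S\<rbrakk> \<Longrightarrow> B (x - y) (x - y) \<le> 2 * B x x + 2 * B y y"
  using nonneg[of "x + y"] by (simp add: bilin sym[of y x])

definition cauchy_seq :: "(nat \<Rightarrow> 'a) \<Rightarrow> bool" where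
  "cauchy_seq X \<longleftrightarrow> (\<forall>n. X n \<in> S) \<and>
     (\<forall>e>0. \<exists>N. \<forall>m\<ge>N. \<forall>n\<ge>N. B (X m - X n) (X m - X n) < e)"

text \<open>Limits are taken in the seminorm of \<open>B\<close> and are unique only up to its
  kernel, which for the function spaces below consists of the functions vanishing almost
  everywhere.\<close>

definition complete_form :: bool where
  "complete_form \<longleftrightarrow> (\<forall>X. cauchy_seq X \<longrightarrow> (\<exists>x\<in>S. (\<lambda>n. B (X n - x) (X n - x)) \<longlonglongrightarrow> 0))"

lemma cauchy_seqI:
  assumes "\<And>n. X n \<in> S" "\<And>m n. B (X m - X n) (X m - X n) \<le> e m + e n" "e \<longlonglongrightarrow> 0"
  shows "cauchy_seq X"
  unfolding cauchy_seq_def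
proof (intro conjI allI impI)
  fix d :: real assume "0 < d"
  with assms(3) have "eventually (\<lambda>n. \<bar>e n\<bar> < d / 2) sequentially"
    by (auto simp: tendsto_iff dist_real_def dest!: spec[of _ "d/2"])
  then obtain N where N: "\<And>n. n \<ge> N \<Longrightarrow> \<bar>e n\<bar> < d / 2" by (auto simp: eventually_sequentially)
  show "\<exists>N. \<forall>m\<ge>N. \<forall>n\<ge>N. B (X m - X n) (X m - X n) < d"
  proof (intro exI allI impI)
    fix m n assume "m \<ge> N" "n \<ge> N"
    with N[of m] N[of n] assms(2)[of m n] show "B (X m - X n) (X m - X n) < d" by linarith
  qed
qed (use assms in auto)

lemma tendsto_form:
  assumes "(\<lambda>n. B (X n - x) (X n - x)) \<longlonglongrightarrow> 0" "\<And>n. X n \<in> S" "x \<in> S" "w \<in> S"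
  shows "(\<lambda>n. B (X n) w) \<longlonglongrightarrow> B x w"
proof -
  have "(\<lambda>n. B (X n - x) w) \<longlonglongrightarrow> 0"
  proof (rule Lim_null_comparison)
    show "\<forall>\<^sub>F n in sequentially. norm (B (X n - x) w) \<le> sqrt (B (X n - x) (X n - x)) * sqrt (B w w)"
      using assms cauchy_schwarz_abs by auto
    show "(\<lambda>n. sqrt (B (X n - x) (X n - x)) * sqrt (B w w)) \<longlonglongrightarrow> 0"
      using tendsto_mult[OF tendsto_real_sqrt[OF assms(1)] tendsto_const[of "sqrt (B w w)"]] by simp
  qed
  hence "(\<lambda>n. B (X n) w - B x w) \<longlonglongrightarrow> 0" using assms by (simp add: bilin)
  thus ?thesis by (simp add: LIM_zero_iff)
qed

lemma tendsto_form_diag: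
  assumes "(\<lambda>n. B (X n - x) (X n - x)) \<longlonglongrightarrow> 0" "\<And>n. X n \<in> S" "x \<in> S"
  shows "(\<lambda>n. B (X n) (X n)) \<longlonglongrightarrow> B x x"
proof -
  have "(\<lambda>n. B (X n - x) (X n - x) + 2 * B (X n) x - B x x) \<longlonglongrightarrow> 0 + 2 * B x x - B x x"
    by (intro tendsto_intros assms tendsto_form)
  moreover have "B (X n - x) (X n - x) + 2 * B (X n) x - B x x = B (X n) (X n)" for n
    using assms(2)[of n] assms(3) by (simp add: bilin sym[of x "X n"])
  ultimately show ?thesis by simp
qed

text \<open>The representing vector minimizes \<open>B x x - 2 * l x\<close>. This functional is
  bounded below by \<open>- C\<close>, its minimizing sequences are Cauchy by the parallelogram
  identity, and completeness provides the limit. The equation is derived for the approximate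
  minimizers with an error tending to zero and only then passed to the limit.\<close>

theorem riesz:
  assumes complete: complete_form
    and l_add: "\<And>x y. \<lbrakk>x \<in> S; y \<in> S\<rbrakk> \<Longrightarrow> l (x + y) = l x + l y"
    and l_scale: "\<And>c x. x \<in> S \<Longrightarrow> l (c *\<^sub>R x) = c * l x"
    and l_bound: "\<And>x. x \<in> S \<Longrightarrow> (l x)\<^sup>2 \<le> C * B x x" and "0 \<le> C"
  shows "\<exists>u\<in>S. \<forall>w\<in>S. B w u = l w"
proof -
  define J where "J = (\<lambda>x. B x x - 2 * l x)"
  have lower: "- C \<le> J x" if "x \<in> S" for x
  proof -
    have "(2 * l x)\<^sup>2 \<le> 4 * (C * B x x)" using l_bound[OF that] by (simp add: power_mult_distrib)
    also have "\<dots> \<le> (C + B x x)\<^sup>2"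
      using zero_le_power2[of "C - B x x"] by (simp add: power2_eq_square algebra_simps)
    finally have "\<bar>2 * l x\<bar> \<le> \<bar>C + B x x\<bar>" by (simp add: abs_le_square_iff)
    thus ?thesis using nonneg[OF that] \<open>0 \<le> C\<close> by (simp add: J_def)
  qed
  define I where "I = (INF x\<in>S. J x)"
  have bdd: "bdd_below (J ` S)" using lower by (intro bdd_belowI[of _ "- C"]) auto
  have I_le: "I \<le> J x" if "x \<in> S" for x
    unfolding I_def using that bdd by (rule cINF_lower[rotated])
  have "\<exists>x\<in>S. J x < I + 1 / real (Suc n)" for n
  proof -
    have "I < I + 1 / real (Suc n)" by simp
    then obtain y where "y \<in> J ` S" "y < I + 1 / real (Suc n)"
      unfolding I_def using cInf_lessD[of "J ` S"] in_zero by blast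
    thus ?thesis by blast
  qed
  then obtain X where X: "\<And>n. X n \<in> S" "\<And>n. J (X n) < I + 1 / real (Suc n)" by metis
  have J_mid: "B (x - y) (x - y) \<le> 2 * (J x - I) + 2 * (J y - I)" if "x \<in> S" "y \<in> S" for x y
  proof -
    have "J ((1/2) *\<^sub>R (x + y)) = (J x + J y) / 2 - B (x - y) (x - y) / 4"
      using that by (simp add: J_def bilin l_add l_scale sym[of y x] field_simps)
    moreover have "I \<le> J ((1/2) *\<^sub>R (x + y))" using that by (intro I_le) auto
    ultimately show ?thesis by (simp add: field_simps)
  qed
  have "cauchy_seq X"
  proof (rule cauchy_seqI)
    show "B (X m - X n) (X m - X n) \<le> 2 * (1 / real (Suc m)) + 2 * (1 / real (Suc n))" for m n
    proof -
      have "2 * (J (X k) - I) \<le> 2 * (1 / real (Suc k))" for k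
        using less_imp_le[OF X(2)[of k]] by (simp only: mult_le_cancel_left_pos[OF zero_less_numeral] diff_le_eq add.commute)
      from this[of m] this[of n] J_mid[OF X(1)[of m] X(1)[of n]] show ?thesis by linarith
    qed
    show "(\<lambda>n. 2 * (1 / real (Suc n))) \<longlonglongrightarrow> 0"
      using tendsto_mult[OF tendsto_const LIMSEQ_inverse_real_of_nat, of 2] by (simp add: inverse_eq_divide)
  qed (rule X)
  with complete obtain x where x: "x \<in> S" "(\<lambda>n. B (X n - x) (X n - x)) \<longlonglongrightarrow> 0"
    unfolding complete_form_def by blast
  have "B x w = l w" if w: "w \<in> S" for w
  proof -
    have bd: "(B (X n) w - l w)\<^sup>2 \<le> B w w * (1 / real (Suc n))" for n
    proof -
      \<comment> \<open>An almost minimal \<open>X n\<close> almost solves the equation: the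
        increment of \<open>J\<close> along \<open>w\<close> above the infimum is a nonnegative
        quadratic polynomial, and its discriminant bounds the defect
        \<open>B (X n) w - l w\<close>.\<close>
      have "(B (X n) w - l w)\<^sup>2 \<le> B w w * (J (X n) - I)"
      proof (rule discriminant_bound)
        fix t :: real
        have "I \<le> J (X n + t *\<^sub>R w)" using w X(1)[of n] by (intro I_le) auto
        also have "\<dots> = B w w * t\<^sup>2 + 2 * (B (X n) w - l w) * t + J (X n)"
          using w X(1)[of n] by (simp add: J_def bilin l_add l_scale sym[of w "X n"] power2_eq_square algebra_simps)
        finally show "0 \<le> B w w * t\<^sup>2 + 2 * (B (X n) w - l w) * t + (J (X n) - I)" by simp
      qed
      also have "\<dots> \<le> B w w * (1 / real (Suc n))"
        using X(2)[of n] nonneg[OF w] by (intro mult_left_mono) auto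
      finally show ?thesis .
    qed
    have "(\<lambda>n. B (X n) w - l w) \<longlonglongrightarrow> B x w - l w"
      by (intro tendsto_diff tendsto_const tendsto_form[OF x(2) X(1) x(1) w])
    hence "(\<lambda>n. (B (X n) w - l w)\<^sup>2) \<longlonglongrightarrow> (B x w - l w)\<^sup>2" by (rule tendsto_power)
    moreover have "(\<lambda>n. B w w * (1 / real (Suc n))) \<longlonglongrightarrow> B w w * 0"
      using LIMSEQ_inverse_real_of_nat by (intro tendsto_intros) (simp add: inverse_eq_divide)
    ultimately have "(B x w - l w)\<^sup>2 \<le> B w w * 0"
      using bd by (intro LIMSEQ_le) auto
    thus ?thesis by simp
  qed
  thus ?thesis using x(1) sym by (intro bexI[of _ x]) auto
qed

lemma complete_form_equiv:
  assumes complete: complete_form and B': "psd_form S B'"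
    and lower: "\<And>x. x \<in> S \<Longrightarrow> B x x \<le> m * B' x x" and m: "0 < m"
    and upper: "\<And>x. x \<in> S \<Longrightarrow> B' x x \<le> M * B x x"
  shows "psd_form.complete_form S B'"
proof -
  interpret B': psd_form S B' by (rule B')
  show ?thesis
    unfolding B'.complete_form_def
  proof (intro allI impI)
    fix X assume X: "B'.cauchy_seq X"
    hence XS: "X n \<in> S" for n by (simp add: B'.cauchy_seq_def)
    have "cauchy_seq X"
      unfolding cauchy_seq_def
    proof (intro conjI allI impI XS)
      fix e :: real assume "0 < e"
      hence "0 < e / m" using m by simp
      then obtain N where N: "\<And>i j. \<lbrakk>N \<le> i; N \<le> j\<rbrakk> \<Longrightarrow> B' (X i - X j) (X i - X j) < e / m"
        using X unfolding B'.cauchy_seq_def by blast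
      have "B (X i - X j) (X i - X j) < e" if "N \<le> i" "N \<le> j" for i j
        using lower[OF in_diff[OF XS XS], of i j] N[OF that] m by (simp add: field_simps)
      thus "\<exists>N. \<forall>i\<ge>N. \<forall>j\<ge>N. B (X i - X j) (X i - X j) < e" by blast
    qed
    with complete obtain x where x: "x \<in> S" "(\<lambda>n. B (X n - x) (X n - x)) \<longlonglongrightarrow> 0"
      unfolding complete_form_def by blast
    have "(\<lambda>n. B' (X n - x) (X n - x)) \<longlonglongrightarrow> 0"
    proof (rule tendsto_sandwich[OF _ _ tendsto_const])
      show "(\<lambda>n. M * B (X n - x) (X n - x)) \<longlonglongrightarrow> 0"
        using tendsto_mult[OF tendsto_const x(2), of M] by simp
      show "\<forall>\<^sub>F n in sequentially. B' (X n - x) (X n - x) \<le> M * B (X n - x) (X n - x)"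
        using upper[OF in_diff[OF XS x(1)]] by simp
      show "\<forall>\<^sub>F n in sequentially. 0 \<le> B' (X n - x) (X n - x)"
        using B'.nonneg[OF in_diff[OF XS x(1)]] by simp
    qed
    with x(1) show "\<exists>x\<in>S. (\<lambda>n. B' (X n - x) (X n - x)) \<longlonglongrightarrow> 0" by blast
  qed
qed

text \<open>
  Lax--Milgram for a skew perturbation \<open>j\<close>: if \<open>j w u = B w (K u)\<close>, then \<open>1 + K\<close> is inverted by
  \<open>(1 - K) (1 - K\<^sup>2)\<inverse>\<close>, and \<open>B w v - B w (K\<^sup>2 v) = B w v + B (K w) (K v)\<close> is again an inner product.
\<close>

theorem riesz_skew:
  assumes complete: complete_form
    and j_add: "\<And>x y w. \<lbrakk>x \<in> S; y \<in> S; w \<in> S\<rbrakk> \<Longrightarrow> j (x + y) w = j x w + j y w"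
    and j_scale: "\<And>c x w. \<lbrakk>x \<in> S; w \<in> S\<rbrakk> \<Longrightarrow> j (c *\<^sub>R x) w = c * j x w"
    and j_skew: "\<And>x w. \<lbrakk>x \<in> S; w \<in> S\<rbrakk> \<Longrightarrow> j x w = - j w x"
    and j_bound: "\<And>x w. \<lbrakk>x \<in> S; w \<in> S\<rbrakk> \<Longrightarrow> (j x w)\<^sup>2 \<le> D * B x x * B w w" and D: "0 \<le> D"
    and l_add: "\<And>x y. \<lbrakk>x \<in> S; y \<in> S\<rbrakk> \<Longrightarrow> l (x + y) = l x + l y"
    and l_scale: "\<And>c x. x \<in> S \<Longrightarrow> l (c *\<^sub>R x) = c * l x"
    and l_bound: "\<And>x. x \<in> S \<Longrightarrow> (l x)\<^sup>2 \<le> C * B x x" and C: "0 \<le> C"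
  shows "\<exists>u\<in>S. \<forall>w\<in>S. B w u + j w u = l w"
proof -
  have "\<exists>k\<in>S. \<forall>w\<in>S. B w k = j w u" if "u \<in> S" for u
  proof (rule riesz[OF complete])
    show "0 \<le> D * B u u" using D nonneg[OF that] by simp
    show "(j x u)\<^sup>2 \<le> D * B u u * B x x" if "x \<in> S" for x
      using j_bound[OF that \<open>u \<in> S\<close>] by (simp add: mult_ac)
  qed (use that j_add j_scale in auto)
  then obtain K where K: "\<And>u. u \<in> S \<Longrightarrow> K u \<in> S" "\<And>u w. \<lbrakk>u \<in> S; w \<in> S\<rbrakk> \<Longrightarrow> B w (K u) = j w u"
    by metis
  have K_skew: "B (K w) u = - B w (K u)" if "u \<in> S" "w \<in> S" for u w
    using that K j_skew[of w u] by (simp add: sym[of "K w" u])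
  define B' where "B' = (\<lambda>w u. B w u + B (K w) (K u))"
  have B'_alt: "B' w u = B w u - B w (K (K u))" if "u \<in> S" "w \<in> S" for u w
    using that K(1) K_skew by (simp add: B'_def)
  have B'_sq: "B' x x \<le> (1 + D) * B x x" if "x \<in> S" for x
  proof -
    \<comment> \<open>The bound on \<open>j\<close> at the pair \<open>K x\<close>, \<open>x\<close>
      controls the square of \<open>B (K x) (K x)\<close>; dividing once by this quantity shows that
      \<open>K\<close> is bounded, with squared norm at most \<open>D\<close>.\<close>
    have "(B (K x) (K x))\<^sup>2 \<le> D * B (K x) (K x) * B x x"
      using j_bound[OF K(1)[OF that] that] K that by simp
    hence "B (K x) (K x) * B (K x) (K x) \<le> B (K x) (K x) * (D * B x x)"
      by (simp add: power2_eq_square mult_ac)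
    moreover have "0 \<le> B (K x) (K x)" "0 \<le> D * B x x" using K(1) that nonneg D by auto
    ultimately have "B (K x) (K x) \<le> D * B x x"
      by (cases "B (K x) (K x) = 0") (auto simp: mult_le_cancel_left)
    thus ?thesis by (simp add: B'_def algebra_simps)
  qed
  interpret B': psd_form S B'
  proof
    show "subspace S" by (rule subsp)
    fix x y z :: 'a and c :: real assume xz: "x \<in> S" "z \<in> S"
    show "B' (c *\<^sub>R x) z = c * B' x z"
      using xz K(1) by (simp add: B'_alt bilin algebra_simps)
    show "B' x z = B' z x" using xz K by (simp add: B'_def sym)
    assume "y \<in> S"
    with xz K(1) show "B' (x + y) z = B' x z + B' y z" by (simp add: B'_alt bilin)
  next
    show "0 \<le> B' x x" if "x \<in> S" for x using that K(1) nonneg by (simp add: B'_def)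
  qed
  have "B'.complete_form"
  proof (rule complete_form_equiv[OF complete B'.psd_form_axioms _ zero_less_one])
    show "B x x \<le> 1 * B' x x" if "x \<in> S" for x using that K(1) nonneg by (simp add: B'_def)
  qed (rule B'_sq)
  moreover have "(l x)\<^sup>2 \<le> C * B' x x" if "x \<in> S" for x
  proof -
    have "C * B x x \<le> C * B' x x" using that K(1) nonneg C by (intro mult_left_mono) (auto simp: B'_def)
    with l_bound[OF that] show ?thesis by linarith
  qed
  ultimately have "\<exists>v\<in>S. \<forall>w\<in>S. B' w v = l w"
    using l_add l_scale C by (intro B'.riesz) auto
  then obtain v where v: "v \<in> S" "\<And>w. w \<in> S \<Longrightarrow> B' w v = l w" by blast
  show ?thesis
  proof (intro bexI ballI)
    fix w assume w: "w \<in> S"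
    have "B w (v - K v) + j w (v - K v) = B w (v - K v) + B w (K (v - K v))"
      using w v K by simp
    also have "B w (K (v - K v)) = - B (K w) (v - K v)" using w v K K_skew by simp
    also have "B w (v - K v) + - B (K w) (v - K v) = B' w v"
      using w v K by (simp add: bilin B'_def K_skew[of v w] del: K(2))
    finally show "B w (v - K v) + j w (v - K v) = l w" using v(2)[OF w] by simp
  qed (use v K in auto)
qed

end

section \<open>Closed forms, their operators and the spectral gap\<close>

text \<open>
  The operator of a closed form \<open>a\<close> on \<open>Q\<close> that is bounded below, as the graph of all pairs
  \<open>(u, h)\<close> with \<open>a w u = r w h\<close> for all \<open>w\<close>. Neither density of \<open>Q\<close> nor uniqueness of \<open>h\<close>
  is needed.
\<close>

locale closed_form = r: psd_form L r + a: sym_form Q a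
  for L :: "'a::real_vector set" and r and Q and a +
  fixes c :: real
  assumes Q_sub: "Q \<subseteq> L"
    and coercive: "u \<in> Q \<Longrightarrow> r u u \<le> a u u + c * r u u"
    and complete_ac: "psd_form.complete_form Q (\<lambda>u w. a u w + c * r u w)"
begin

lemma Q_L [simp, intro]: "u \<in> Q \<Longrightarrow> u \<in> L" using Q_sub by auto

lemma sym_form_shift: "sym_form Q (\<lambda>u w. a u w + t * r u w)"
  by unfold_locales
     (auto simp: a.subsp a.bilin r.bilin a.sym r.sym algebra_simps)

lemma psd_form_shift:
  assumes "\<And>u. u \<in> Q \<Longrightarrow> 0 \<le> a u u + t * r u u"
  shows "psd_form Q (\<lambda>u w. a u w + t * r u w)"
  using sym_form_shift assms by (auto simp: psd_form_def psd_form_axioms_def)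

sublocale ac: psd_form Q "\<lambda>u w. a u w + c * r u w"
  by (rule psd_form_shift) (metis coercive r.nonneg order_trans Q_L)

definition graph :: "'a \<Rightarrow> 'a \<Rightarrow> bool" where
  "graph u h \<longleftrightarrow> u \<in> Q \<and> h \<in> L \<and> (\<forall>w\<in>Q. a w u = r w h)"

text \<open>The real number \<open>s\<close> belongs to the resolvent set of the operator. The bound
  is stated for squared norms and contains injectivity up to the kernel of \<open>r\<close>.\<close>

definition regular :: "real \<Rightarrow> bool" where
  "regular s \<longleftrightarrow> (\<forall>h\<in>L. \<exists>u. graph u (h + s *\<^sub>R u)) \<and>
     (\<exists>C. \<forall>u h. graph u h \<longrightarrow> r u u \<le> C * r (h - s *\<^sub>R u) (h - s *\<^sub>R u))"

lemma graph_sym: "\<lbrakk>graph u h; graph w k\<rbrakk> \<Longrightarrow> r u k = r w h"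
  unfolding graph_def by (metis a.sym r.sym Q_L)

lemma coercive_lower: "u \<in> Q \<Longrightarrow> (1 - c) * r u u \<le> a u u"
  using coercive[of u] by (simp add: algebra_simps)

lemma regular_obtains:
  assumes "regular s" "h \<in> L"
  obtains u where "u \<in> Q" "graph u (h + s *\<^sub>R u)"
    "\<And>w. w \<in> Q \<Longrightarrow> a w u - s * r w u = r w h"
proof -
  from assms obtain u where u: "graph u (h + s *\<^sub>R u)" unfolding regular_def by blast
  hence "u \<in> Q" by (simp add: graph_def)
  moreover have "a w u - s * r w u = r w h" if "w \<in> Q" for w
    using u that assms(2) \<open>u \<in> Q\<close> by (auto simp: graph_def r.bilin)
  ultimately show ?thesis using u that by blast
qed

text \<open>\<open>J\<close> plays multiplication by the imaginary unit, so this is the surjectivity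
  of \<open>H - z\<close> for \<open>z = x + i y\<close>. The real part is absorbed by coercivity;
  the term with \<open>y\<close> is skew, so Lax-Milgram puts no restriction on its size.\<close>

theorem solve_skew:
  assumes x: "x \<le> - c" and h: "h \<in> L"
    and J: "\<And>u. u \<in> Q \<Longrightarrow> J u \<in> Q" "\<And>u w. \<lbrakk>u \<in> Q; w \<in> Q\<rbrakk> \<Longrightarrow> J (u + w) = J u + J w"
      "\<And>t u. u \<in> Q \<Longrightarrow> J (t *\<^sub>R u) = t *\<^sub>R J u"
      "\<And>u w. \<lbrakk>u \<in> Q; w \<in> Q\<rbrakk> \<Longrightarrow> r (J u) w = - r u (J w)"
      "\<And>u. u \<in> Q \<Longrightarrow> r (J u) (J u) = r u u"
  shows "\<exists>u\<in>Q. \<forall>w\<in>Q. a w u - x * r w u - y * r w (J u) = r w h"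
proof -
  let ?B = "\<lambda>u w. a u w + (- x) * r u w"
  have lower: "a u u + c * r u u \<le> ?B u u" if "u \<in> Q" for u
    using mult_right_mono[of c "-x" "r u u"] x r.nonneg[of u] that by simp
  interpret B: psd_form Q ?B
    by (rule psd_form_shift) (use lower ac.nonneg order_trans in blast)
  have r_le: "r u u \<le> ?B u u" if "u \<in> Q" for u
    using lower[OF that] coercive[OF that] by simp
  have "B.complete_form"
  proof (rule ac.complete_form_equiv[OF complete_ac B.psd_form_axioms _ zero_less_one])
    show "a u u + c * r u u \<le> 1 * ?B u u" if "u \<in> Q" for u using lower[OF that] by simp
    fix u assume u: "u \<in> Q"
    have "(- x - c) * r u u \<le> (- x - c) * (a u u + c * r u u)"
      using x coercive[OF u] by (intro mult_left_mono) auto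
    thus "?B u u \<le> (1 + (- x - c)) * (a u u + c * r u u)" by (simp add: algebra_simps)
  qed
  hence "\<exists>u\<in>Q. \<forall>w\<in>Q. ?B w u + - y * r w (J u) = r w h"
  proof (rule B.riesz_skew[where j = "\<lambda>w u. - y * r w (J u)"])
    fix u w assume uw: "u \<in> Q" "w \<in> Q"
    show "- y * r u (J w) = - (- y * r w (J u))"
      using J(1)[OF uw(1)] J(1)[OF uw(2)] J(4)[OF uw] uw by (simp add: r.sym[of "J u" w])
    have "(- y * r u (J w))\<^sup>2 = y\<^sup>2 * (r u (J w))\<^sup>2" by (simp add: power_mult_distrib)
    also have "\<dots> \<le> y\<^sup>2 * (r u u * r w w)"
      using r.cauchy_schwarz[of u "J w"] uw J(1,5) by (intro mult_left_mono) auto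
    also have "\<dots> \<le> y\<^sup>2 * (?B u u * ?B w w)"
      by (rule mult_left_mono[OF mult_mono[OF r_le[OF uw(1)] r_le[OF uw(2)] B.nonneg[OF uw(1)]
            r.nonneg[OF Q_L[OF uw(2)]]] zero_le_power2])
    finally show "(- y * r u (J w))\<^sup>2 \<le> y\<^sup>2 * ?B u u * ?B w w" by (simp add: mult_ac)
    show "(r u h)\<^sup>2 \<le> r h h * ?B u u"
      using r.cauchy_schwarz[of u h] uw h
        mult_left_mono[OF r_le[OF uw(1)] r.nonneg[OF h]] by (simp add: mult_ac)
  qed (use h J r.nonneg[OF h] in \<open>auto simp: r.bilin algebra_simps\<close>)
  thus ?thesis by simp
qed

text \<open>Otherwise the infimum \<open>m\<close> of the Rayleigh quotients lies below \<mu> and is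
  therefore regular. The form \<open>a - m r\<close> is nonnegative; its Cauchy-Schwarz inequality
  for \<open>w\<close> and the solution \<open>y\<close> of \<open>(H - m) y = w\<close> bounds
  \<open>r w w\<close> by a constant times \<open>a w w - m * r w w\<close> on unit vectors.
  Quotients close to \<open>m\<close> contradict this.\<close>

lemma form_ge_if_regular:
  assumes reg: "\<And>x. x < \<mu> \<Longrightarrow> regular x" and u: "u \<in> Q"
  shows "\<mu> * r u u \<le> a u u"
proof (rule ccontr)
  assume neg: "\<not> ?thesis"
  hence pos: "0 < r u u"
    using coercive_lower[OF u] r.nonneg[of u] u by (cases "r u u = 0") auto
  define R where "R = {t. \<exists>w\<in>Q. 0 < r w w \<and> t = a w w / r w w}"
  have bdd: "bdd_below R"
    unfolding R_def by (rule bdd_belowI[of _ "1 - c"]) (auto simp: field_simps dest!: coercive_lower)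
  have "a u u / r u u \<in> R" using u pos by (auto simp: R_def)
  define m where "m = Inf R"
  have "m \<le> a u u / r u u" unfolding m_def using \<open>_ \<in> R\<close> bdd by (rule cInf_lower)
  also have "\<dots> < \<mu>" using neg pos by (simp add: field_simps)
  finally have m: "regular m" by (rule reg)
  have nonneg: "0 \<le> a w w + (- m) * r w w" if "w \<in> Q" for w
  proof (cases "r w w = 0")
    case True
    thus ?thesis using coercive_lower[OF that] by simp
  next
    case False
    hence p: "0 < r w w" using r.nonneg[of w] that by simp
    hence "a w w / r w w \<in> R" using that by (auto simp: R_def)
    hence "m \<le> a w w / r w w" unfolding m_def using bdd by (rule cInf_lower)
    thus ?thesis using p by (simp add: field_simps)
  qed
  interpret B: psd_form Q "\<lambda>u w. a u w + (- m) * r u w" by (rule psd_form_shift) (rule nonneg)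
  obtain C where C: "\<And>u h. graph u h \<Longrightarrow> r u u \<le> C * r (h - m *\<^sub>R u) (h - m *\<^sub>R u)"
    using m unfolding regular_def by blast
  define C' where "C' = max C 1"
  have main: "r w w \<le> (a w w - m * r w w) * sqrt C'" if w: "w \<in> Q" "r w w = 1" for w
  proof -
    obtain y where y: "y \<in> Q" "graph y (w + m *\<^sub>R y)" "\<And>v. v \<in> Q \<Longrightarrow> a v y - m * r v y = r v w"
      using regular_obtains[OF m, of w] w by blast
    have "r y y \<le> C * r w w" using C[OF y(2)] by simp
    also have "\<dots> \<le> C'" using w by (simp add: C'_def)
    finally have ryy: "r y y \<le> C'" .
    have "1 = (a w y + (- m) * r w y)\<^sup>2" using y(3)[OF w(1)] w(2) by simp
    also have "\<dots> \<le> (a w w + (- m) * r w w) * (a y y + (- m) * r y y)"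
      by (rule B.cauchy_schwarz[OF w(1) y(1)])
    also have "a y y + (- m) * r y y = r y w" using y(3)[OF y(1)] by simp
    also have "(a w w + (- m) * r w w) * r y w \<le> (a w w + (- m) * r w w) * sqrt C'"
    proof (rule mult_left_mono[OF _ nonneg[OF w(1)]])
      have "r y w \<le> sqrt (r y y) * sqrt (r w w)"
        using r.cauchy_schwarz_abs[of y w] y(1) w(1) by auto
      also have "\<dots> \<le> sqrt C'" using ryy w by simp
      finally show "r y w \<le> sqrt C'" .
    qed
    finally show ?thesis using w by simp
  qed
  have C'_pos: "0 < sqrt C'" by (simp add: C'_def)
  have "m < m + 1 / (2 * sqrt C')" using C'_pos by simp
  then obtain t where "t \<in> R" "t < m + 1 / (2 * sqrt C')"
    unfolding m_def using cInf_lessD[of R] \<open>_ \<in> R\<close> by blast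
  then obtain w where w: "w \<in> Q" "0 < r w w" "a w w / r w w < m + 1 / (2 * sqrt C')"
    by (auto simp: R_def)
  define v where "v = (1 / sqrt (r w w)) *\<^sub>R w"
  have v: "v \<in> Q" "r v v = 1" "a v v = a w w / r w w"
    using w by (auto simp: v_def r.bilin a.bilin real_sqrt_mult_self[symmetric] simp del: real_sqrt_mult_self)
       (auto simp: field_simps)
  have "(a v v - m) * sqrt C' < 1 / (2 * sqrt C') * sqrt C'"
    using w(3) C'_pos v(3) by (intro mult_strict_right_mono) auto
  also have "\<dots> = 1 / 2" using C'_pos by simp
  finally show False using main[OF v(1,2)] v(2) by simp
qed

lemma graph_add: "\<lbrakk>graph u h; graph w k\<rbrakk> \<Longrightarrow> graph (u + w) (h + k)"
  unfolding graph_def by (auto simp: a.bilin r.bilin)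

lemma graph_scale: "graph u h \<Longrightarrow> graph (t *\<^sub>R u) (t *\<^sub>R h)"
  unfolding graph_def by (auto simp: a.bilin r.bilin)

text \<open>
  Spectral mapping by hand: if \<open>- c < 0\<close> were the infimum of \<open>(H - d) H\<close>, then
  \<open>(H - d) H + c = (H - s) (H - t)\<close> with \<open>0 < s \<le> t < d\<close> would be boundedly invertible,
  which is impossible for a nonnegative form at its infimum.
\<close>

lemma gap_graph:
  assumes d: "0 < d" and reg: "\<And>s. \<lbrakk>0 < s; s < d\<rbrakk> \<Longrightarrow> regular s" and uh: "graph u h"
  shows "d * r u h \<le> r h h"
proof (rule ccontr)
  assume neg: "\<not> ?thesis"
  \<comment> \<open>The quadratic form of \<open>(H - d) H\<close>, written on the graph:
    \<open>b (u, h)\<close> is the inner product of \<open>h - d u\<close> and \<open>h\<close>,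
    with \<open>h\<close> standing for \<open>H u\<close>.\<close>
  define b where "b = (\<lambda>(u, h). r h h - d * r u h)"
  have uL: "v \<in> L" "k \<in> L" if "graph v k" for v k using that by (auto simp: graph_def)
  \<comment> \<open>The polynomial \<open>x * (x - d)\<close> has minimum \<open>- d^2 / 4\<close>
    at \<open>x = d / 2\<close>; for operators this is the square completed with
    \<open>k - (d / 2) *\<^sub>R v\<close>.\<close>
  have b_lower: "- (d\<^sup>2 / 4) * r v v \<le> b (v, k)" if "graph v k" for v k
    using r.nonneg[of "k - (d / 2) *\<^sub>R v"] uL[OF that]
    by (simp add: b_def r.bilin r.sym[of k v] power2_eq_square field_simps)
  have pos: "0 < r u u"
    using neg b_lower[OF uh] r.nonneg[OF uL(1)[OF uh]] by (cases "r u u = 0") (auto simp: b_def)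
  define R where "R = {t. \<exists>v k. graph v k \<and> 0 < r v v \<and> t = b (v, k) / r v v}"
  have R_lower: "- (d\<^sup>2 / 4) \<le> t" if "t \<in> R" for t
    using that unfolding R_def by (auto simp: field_simps dest!: b_lower)
  hence bdd: "bdd_below R" by (rule bdd_belowI)
  have R: "b (u, h) / r u u \<in> R" using uh pos by (auto simp: R_def)
  define m where "m = Inf R"
  have "m \<le> b (u, h) / r u u" unfolding m_def using R bdd by (rule cInf_lower)
  also have "\<dots> < 0" using neg pos by (simp add: b_def field_simps)
  finally have m_neg: "m < 0" .
  have m_ge: "- (d\<^sup>2 / 4) \<le> m"
    unfolding m_def using R R_lower by (intro cInf_greatest) auto
  have b_nonneg: "0 \<le> b (v, k) - m * r v v" if "graph v k" for v k
  proof (cases "r v v = 0")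
    case True
    thus ?thesis using b_lower[OF that] by simp
  next
    case False
    hence p: "0 < r v v" using r.nonneg[OF uL(1)[OF that]] by simp
    hence "b (v, k) / r v v \<in> R" using that by (auto simp: R_def)
    hence "m \<le> b (v, k) / r v v" unfolding m_def using bdd by (rule cInf_lower)
    thus ?thesis using p by (simp add: field_simps)
  qed
  define D where "D = sqrt (d\<^sup>2 / 4 + m)"
  have D: "0 \<le> D" "D\<^sup>2 = d\<^sup>2 / 4 + m" using m_ge by (auto simp: D_def)
  have "D\<^sup>2 < (d / 2)\<^sup>2" using m_neg D by (simp add: power_divide)
  hence "D < d / 2" by (rule power2_less_imp_less) (use d in simp)
  \<comment> \<open>\<open>s\<close> and \<open>t\<close> are the roots of
    \<open>x * (x - d) = m\<close>. They lie strictly between 0 and \<open>d\<close> because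
    \<open>m\<close> is negative and at least \<open>- d^2 / 4\<close>.\<close>
  define s where "s = d / 2 - D"
  define t where "t = d / 2 + D"
  have st: "0 < s" "s < d" "0 < t" "t < d" using D(1) \<open>D < d / 2\<close> d by (auto simp: s_def t_def)
  have st_sum: "s + t = d" by (simp add: s_def t_def)
  have st_prod: "s * t = - m" using D(2) by (simp add: s_def t_def power2_eq_square field_simps)
  note reg_s = reg[OF st(1,2)] and reg_t = reg[OF st(3,4)]
  obtain C1 where C1: "\<And>u h. graph u h \<Longrightarrow> r u u \<le> C1 * r (h - s *\<^sub>R u) (h - s *\<^sub>R u)"
    using reg_s unfolding regular_def by blast
  obtain C2 where C2: "\<And>u h. graph u h \<Longrightarrow> r u u \<le> C2 * r (h - t *\<^sub>R u) (h - t *\<^sub>R u)"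
    using reg_t unfolding regular_def by blast
  define C where "C = \<bar>C2\<bar> * \<bar>C1\<bar> + 1"
  have main: "r u u \<le> (b (u, h) - m * r u u) * sqrt C" if uh: "graph u h" "0 < r u u" for u h
  proof -
    note L = uL[OF uh(1)]
    \<comment> \<open>Two resolvents in succession: \<open>(H - s) y = u\<close> and
      \<open>(H - t) w = y\<close>, so \<open>w\<close> solves
      \<open>((H - d) H - m) w = u\<close>.\<close>
    obtain y where y: "y \<in> Q" "graph y (u + s *\<^sub>R y)"
      using regular_obtains[OF reg_s L(1)] by blast
    have yL: "y \<in> L" using y(1) by blast
    obtain w where w: "w \<in> Q" "graph w (y + t *\<^sub>R w)"
      using regular_obtains[OF reg_t yL] by blast
    have wL: "w \<in> L" using w(1) by blast
    have "r w w \<le> C2 * r y y" using C2[OF w(2)] by simp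
    also have "\<dots> \<le> \<bar>C2\<bar> * r y y" using r.nonneg[OF yL] by (intro mult_right_mono) auto
    also have "\<dots> \<le> \<bar>C2\<bar> * (\<bar>C1\<bar> * r u u)"
    proof (rule mult_left_mono)
      have "r y y \<le> C1 * r u u" using C1[OF y(2)] by simp
      also have "\<dots> \<le> \<bar>C1\<bar> * r u u" using uh(2) by (intro mult_right_mono) auto
      finally show "r y y \<le> \<bar>C1\<bar> * r u u" .
    qed simp
    also have "\<dots> \<le> C * r u u" using uh(2) by (simp add: C_def algebra_simps)
    finally have rww: "r w w \<le> C * r u u" .
    define k where "k = y + t *\<^sub>R w"
    have k: "k \<in> L" "graph w k" using w yL wL by (auto simp: k_def)
    have S1: "r u k = r w h" by (rule graph_sym[OF uh(1) k(2)])
    have S2: "r u u + s * r u y = r y h"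
      using graph_sym[OF uh(1) y(2)] L yL by (simp add: r.bilin)
    have S3: "r w u + s * r w y = r y k"
      using graph_sym[OF k(2) y(2)] L wL yL by (simp add: r.bilin)
    have yk: "y = k - t *\<^sub>R w" by (simp add: k_def)
    \<comment> \<open>\<open>cross\<close> and \<open>diag\<close> evaluate the polarized form of
      \<open>(H - d) H - m\<close> at \<open>(u, w)\<close> and at \<open>(w, w)\<close>. By the
      choice of \<open>w\<close> both become inner products with \<open>u\<close>, and
      Cauchy-Schwarz for this nonnegative form can be applied.\<close>
    have cross: "r h k - d * r u k - m * r u w = r u u"
    proof -
      have "r h y - s * r u y = r h k - t * r h w - s * (r u k - t * r u w)"
        using L k wL by (simp add: yk r.bilin)
      also have "r h w = r u k" using S1 L wL by (simp add: r.sym)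
      also have "r h k - t * r u k - s * (r u k - t * r u w)
          = r h k - (s + t) * r u k + (s * t) * r u w" by (simp add: algebra_simps)
      finally show ?thesis using S2 L yL st_sum st_prod by (simp add: r.sym[of h y])
    qed
    have diag: "b (w, k) - m * r w w = r w u"
    proof -
      have "r k y - s * r w y = r k k - t * r k w - s * (r w k - t * r w w)"
        using k wL by (simp add: yk r.bilin)
      also have "\<dots> = r k k - (s + t) * r w k + (s * t) * r w w"
        using k wL by (simp add: r.sym[of k w] algebra_simps)
      finally show ?thesis using S3 k yL st_sum st_prod by (simp add: b_def r.sym[of k y])
    qed
    have "(r u u)\<^sup>2 \<le> (r w u) * (b (u, h) - m * r u u)"
    proof (rule discriminant_bound)
      fix x :: real
      have "0 \<le> b (u + x *\<^sub>R w, h + x *\<^sub>R k) - m * r (u + x *\<^sub>R w) (u + x *\<^sub>R w)"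
        by (intro b_nonneg graph_add graph_scale uh k)
      also have "\<dots> = (b (w, k) - m * r w w) * x\<^sup>2 + 2 * (r h k - d * r u k - m * r u w) * x
          + (b (u, h) - m * r u u)"
        using L k wL S1 by (simp add: b_def r.bilin r.sym[of k h] r.sym[of w u] power2_eq_square algebra_simps)
      finally show "0 \<le> r w u * x\<^sup>2 + 2 * r u u * x + (b (u, h) - m * r u u)"
        by (simp add: cross diag)
    qed
    also have "\<dots> \<le> (sqrt C * r u u) * (b (u, h) - m * r u u)"
    proof (rule mult_right_mono[OF _ b_nonneg[OF uh(1)]])
      have "r w u \<le> sqrt (r w w) * sqrt (r u u)"
        using r.cauchy_schwarz_abs[OF wL L(1)] by auto
      also have "\<dots> \<le> sqrt (C * r u u) * sqrt (r u u)"
        using rww uh by (intro mult_right_mono) auto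
      also have "\<dots> = sqrt C * r u u" using uh(2) by (simp add: real_sqrt_mult)
      finally show "r w u \<le> sqrt C * r u u" .
    qed
    finally show ?thesis using uh(2) by (simp add: power2_eq_square mult_ac)
  qed
  have C: "0 < sqrt C" by (simp add: C_def add_nonneg_pos)
  have "m < m + 1 / (2 * sqrt C)" using C by simp
  then obtain x where "x \<in> R" "x < m + 1 / (2 * sqrt C)"
    unfolding m_def using cInf_lessD[of R] R by blast
  then obtain v k where v: "graph v k" "0 < r v v" "b (v, k) / r v v < m + 1 / (2 * sqrt C)"
    by (auto simp: R_def)
  have "(b (v, k) - m * r v v) * sqrt C < (r v v / (2 * sqrt C)) * sqrt C"
    using v(2,3) C by (intro mult_strict_right_mono) (auto simp: field_simps)
  also have "\<dots> = r v v / 2" using C by simp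
  finally show False using main[OF v(1,2)] v(2) by simp
qed

text \<open>With \<open>y n\<close> the solution of \<open>(H + e n) y = h\<close>, the vectors
  \<open>u n = e n *\<^sub>R y n\<close> approximate the projection of \<open>h\<close> to the
  kernel of \<open>H\<close>. The operator inequality \<open>gap_graph\<close> makes them Cauchy in
  the form norm; the limit lies in the kernel, is orthogonal to \<open>h\<close> and vanishes in
  norm. Hence \<open>r (u n) h\<close> is of order \<open>e n\<close> and \<open>r (y n) h\<close>
  stays bounded. Cauchy-Schwarz for \<open>a + e n r\<close> at \<open>h\<close> and
  \<open>y n\<close> then bounds \<open>r h h\<close> by \<open>a h h\<close>.\<close>

lemma gap_form_zero:
  assumes d: "0 < d" and reg: "\<And>s. s < 0 \<Longrightarrow> regular s" "\<And>s. \<lbrakk>0 < s; s < d\<rbrakk> \<Longrightarrow> regular s"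
    and h: "h \<in> Q" and orth: "\<And>k. graph k 0 \<Longrightarrow> r k h = 0"
  shows "d / 2 * r h h \<le> a h h"
proof -
  have a_nonneg: "0 \<le> a w w" if "w \<in> Q" for w
    using form_ge_if_regular[of 0 w, OF reg(1) that] by simp
  interpret a: psd_form Q a using a.sym_form_axioms a_nonneg by (simp add: psd_form_def psd_form_axioms_def)
  have hL: "h \<in> L" using h by blast
  define K where "K = r h h / d"
  have K: "0 \<le> K" using d r.nonneg[OF hL] by (simp add: K_def)
  define e where "e = (\<lambda>n. 1 / real (Suc n))"
  have e: "0 < e n" "e n \<le> 1" for n by (auto simp: e_def)
  have e_lim: "e \<longlonglongrightarrow> 0" using LIMSEQ_inverse_real_of_nat by (simp add: e_def inverse_eq_divide)
  have "\<exists>y. y \<in> Q \<and> graph y (h + (- e n) *\<^sub>R y)" for n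
    using regular_obtains[OF reg(1) hL, of "- e n"] e(1)[of n] by (metis neg_less_0_iff_less)
  then obtain y where y: "\<And>n. y n \<in> Q" "\<And>n. graph (y n) (h + (- e n) *\<^sub>R y n)" by metis
  define u where "u = (\<lambda>n. e n *\<^sub>R y n)"
  have uQ: "u n \<in> Q" for n using y(1) by (simp add: u_def)
  have uL: "u n \<in> L" for n using uQ by blast
  have gr: "graph (y n) (h - u n)" for n using y(2)[of n] by (simp add: u_def)
  have ay: "a w (y n) = r w h - r w (u n)" if "w \<in> Q" for w n
    using gr[of n] that hL uL[of n] by (auto simp: graph_def r.bilin)
  have au: "a w (u n) = e n * (r w h - r w (u n))" if "w \<in> Q" for w n
    using ay[OF that, of n] y(1)[of n] that by (simp add: u_def a.bilin)
  have uh: "0 \<le> r (u n) h - r (u n) (u n)" for n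
    using a_nonneg[OF uQ[of n]] au[OF uQ[of n], of n] e(1)[of n] by (simp add: zero_le_mult_iff)
  have gapu: "r (u n) h - r (u n) (u n) \<le> e n * K" for n
  proof -
    have "d * r (y n) (h - u n) \<le> r (h - u n) (h - u n)" by (rule gap_graph[OF d reg(2) gr])
    also have "\<dots> = r h h - 2 * r (u n) h + r (u n) (u n)"
      using hL uL[of n] by (simp add: r.bilin r.sym[of h "u n"])
    also have "\<dots> \<le> r h h" using uh[of n] r.nonneg[OF uL[of n]] by linarith
    finally have "r (y n) (h - u n) \<le> K" using d by (simp add: K_def field_simps)
    hence "e n * r (y n) (h - u n) \<le> e n * K" using e(1)[of n] by (intro mult_left_mono) auto
    moreover have "e n * r (y n) (h - u n) = r (u n) (h - u n)"
      using hL uL[of n] y(1)[of n] by (simp add: u_def r.scale_left Q_L)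
    ultimately show ?thesis using hL uL[of n] by (simp add: r.bilin)
  qed
  have auu: "a (u n) (u n) \<le> (e n)\<^sup>2 * K" for n
    using mult_left_mono[OF gapu[of n], of "e n"] e(1)[of n] au[OF uQ[of n], of n]
    by (simp add: power2_eq_square)
  have cross: "r (u m) h - r (u m) (u n) \<le> e m * K" for m n
  proof -
    have "\<bar>a (u m) (u n)\<bar> \<le> sqrt (a (u m) (u m)) * sqrt (a (u n) (u n))"
      by (rule a.cauchy_schwarz_abs) (rule uQ)+
    also have "\<dots> \<le> sqrt ((e m)\<^sup>2 * K) * sqrt ((e n)\<^sup>2 * K)"
      using auu a_nonneg uQ K by (intro mult_mono) auto
    also have "\<dots> = e n * (e m * K)" using e(1)[of m] e(1)[of n] K by (simp add: real_sqrt_mult)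
    finally have "e n * (r (u m) h - r (u m) (u n)) \<le> e n * (e m * K)"
      using au[OF uQ[of m], of n] by simp
    thus ?thesis using e(1)[of n] by (simp add: mult_le_cancel_left_pos)
  qed
  \<comment> \<open>\<open>uh\<close> says that \<open>r (u k) (u k)\<close> is at most
    \<open>r (u k) h\<close>; together with the two instances of \<open>cross\<close> this bounds
    the squared distance.\<close>
  have r_diff: "r (u m - u n) (u m - u n) \<le> (e m + e n) * K" for m n
    using cross[of m n] cross[of n m] uh[of m] uh[of n] uL[of m] uL[of n]
    by (simp add: r.bilin r.sym[of "u n" "u m"] algebra_simps)
  have "ac.cauchy_seq u"
  proof (rule ac.cauchy_seqI[OF uQ])
    fix m n
    have D: "u m - u n \<in> Q" using uQ by blast
    have "a (u m - u n) (u m - u n) \<le> 2 * ((e m)\<^sup>2 * K) + 2 * ((e n)\<^sup>2 * K)"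
      using a.diff_sq_le[OF uQ[of m] uQ[of n]] auu[of m] auu[of n] by linarith
    also have "\<dots> \<le> 2 * (e m * K) + 2 * (e n * K)"
      using e K by (intro add_mono mult_left_mono mult_right_mono) (auto simp: power2_eq_square mult_left_le)
    finally have A: "a (u m - u n) (u m - u n) \<le> 2 * (e m * K) + 2 * (e n * K)" .
    have "c * r (u m - u n) (u m - u n) \<le> \<bar>c\<bar> * r (u m - u n) (u m - u n)"
      using r.nonneg D by (intro mult_right_mono) auto
    also have "\<dots> \<le> \<bar>c\<bar> * ((e m + e n) * K)" using r_diff by (intro mult_left_mono) auto
    finally show "a (u m - u n) (u m - u n) + c * r (u m - u n) (u m - u n)
        \<le> (2 + \<bar>c\<bar>) * K * e m + (2 + \<bar>c\<bar>) * K * e n" using A by (simp add: algebra_simps)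
    show "(\<lambda>n. (2 + \<bar>c\<bar>) * K * e n) \<longlonglongrightarrow> 0"
      using tendsto_mult[OF tendsto_const e_lim, of "(2 + \<bar>c\<bar>) * K"] by simp
  qed
  then obtain p where p: "p \<in> Q"
    "(\<lambda>n. a (u n - p) (u n - p) + c * r (u n - p) (u n - p)) \<longlonglongrightarrow> 0"
    using complete_ac unfolding ac.complete_form_def by blast
  have pL: "p \<in> L" using p by blast
  have r_lim: "(\<lambda>n. r (u n - p) (u n - p)) \<longlonglongrightarrow> 0"
  proof (rule tendsto_sandwich[OF _ _ tendsto_const p(2)])
    show "\<forall>\<^sub>F n in sequentially. 0 \<le> r (u n - p) (u n - p)" using r.nonneg uL pL by auto
    show "\<forall>\<^sub>F n in sequentially. r (u n - p) (u n - p)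
        \<le> a (u n - p) (u n - p) + c * r (u n - p) (u n - p)" using coercive uQ p(1) by auto
  qed
  have rw_lim: "(\<lambda>n. r (u n) w) \<longlonglongrightarrow> r p w" if "w \<in> L" for w
    by (rule r.tendsto_form[OF r_lim uL pL that])
  have a_p: "a p w = 0" if w: "w \<in> Q" for w
  proof -
    have "(\<lambda>n. (a (u n) w + c * r (u n) w) - c * r (u n) w) \<longlonglongrightarrow> (a p w + c * r p w) - c * r p w"
      using w by (intro tendsto_diff tendsto_mult tendsto_const rw_lim ac.tendsto_form[OF p(2) uQ p(1)]) auto
    hence "(\<lambda>n. a (u n) w) \<longlonglongrightarrow> a p w" by simp
    moreover have "(\<lambda>n. a (u n) w) \<longlonglongrightarrow> 0"
    proof (rule Lim_null_comparison)
      show "\<forall>\<^sub>F n in sequentially. norm (a (u n) w) \<le> e n * (sqrt K * sqrt (a w w))"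
      proof (rule always_eventually, rule allI)
        fix n
        have "\<bar>a (u n) w\<bar> \<le> sqrt (a (u n) (u n)) * sqrt (a w w)" by (rule a.cauchy_schwarz_abs[OF uQ w])
        also have "\<dots> \<le> sqrt ((e n)\<^sup>2 * K) * sqrt (a w w)"
          using auu[of n] a_nonneg[OF w] by (intro mult_right_mono) auto
        finally show "norm (a (u n) w) \<le> e n * (sqrt K * sqrt (a w w))"
          using e(1)[of n] by (simp add: real_sqrt_mult)
      qed
      show "(\<lambda>n. e n * (sqrt K * sqrt (a w w))) \<longlonglongrightarrow> 0"
        using tendsto_mult[OF e_lim tendsto_const] by simp
    qed
    ultimately show ?thesis by (rule LIMSEQ_unique)
  qed
  have gp: "graph p 0"
    using p(1) a_p a.sym r.in_zero r.scale_right[OF r.in_zero, of _ 0] by (auto simp: graph_def)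
  \<comment> \<open>Every \<open>u n\<close> is orthogonal to the kernel element \<open>p\<close>,
    since \<open>H (y n) = h - u n\<close> is orthogonal to the kernel and so is \<open>h\<close>.
    As \<open>p\<close> is the limit of the \<open>u n\<close>, it has norm zero.\<close>
  have rpu: "r (u n) p = 0" for n
  proof -
    have "r p h - r p (u n) = 0" using ay[OF p(1), of n] a_p[OF y(1)[of n]] by simp
    thus ?thesis using orth[OF gp] uL[of n] pL by (simp add: r.sym)
  qed
  have rpp: "r p p = 0" using rw_lim[OF pL] rpu by (simp add: LIMSEQ_const_iff)
  have ru: "r (u m) (u m) \<le> e m * K" for m
  proof -
    have "(\<lambda>n. r (u m) (u m) - 2 * r (u n) (u m) + r (u n) (u n)) \<longlonglongrightarrow>
        r (u m) (u m) - 2 * r p (u m) + r p p"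
      by (intro tendsto_intros rw_lim[OF uL] r.tendsto_form_diag[OF r_lim uL pL])
    moreover have "r (u m) (u m) - 2 * r (u n) (u m) + r (u n) (u n) \<le> (e m + e n) * K" for n
      using r_diff[of m n] uL[of m] uL[of n] by (simp add: r.bilin r.sym[of "u m" "u n"])
    moreover have "(\<lambda>n. (e m + e n) * K) \<longlonglongrightarrow> (e m + 0) * K" by (intro tendsto_intros e_lim)
    ultimately have "r (u m) (u m) - 2 * r p (u m) + r p p \<le> (e m + 0) * K"
      by (intro LIMSEQ_le) auto
    thus ?thesis using rpu[of m] rpp uL[of m] pL by (simp add: r.sym)
  qed
  \<comment> \<open>One contribution \<open>e n * K\<close> comes from the gap inequality and one
    from the norm of \<open>u n\<close>. This doubling is the reason why the form inequality has
    \<open>d / 2\<close> where the operator inequality has \<open>d\<close>.\<close>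
  have ruh: "r (u n) h \<le> 2 * (e n * K)" for n using ru[of n] gapu[of n] by linarith
  have ryh: "r (y n) h \<le> 2 * K" for n
  proof -
    have "e n * r (y n) h \<le> e n * (2 * K)" using ruh[of n] y(1)[of n] hL by (simp add: u_def r.scale_left Q_L mult_ac)
    thus ?thesis using e(1)[of n] by (simp add: mult_le_cancel_left_pos)
  qed
  have key: "(r h h)\<^sup>2 \<le> (a h h + e n * r h h) * (2 * K)" for n
  proof -
    interpret B: psd_form Q "\<lambda>u w. a u w + e n * r u w"
      by (rule psd_form_shift) (use a_nonneg r.nonneg e(1)[of n] in auto)
    have eq: "a w (y n) + e n * r w (y n) = r w h" if "w \<in> Q" for w
      using ay[OF that, of n] that y(1)[of n] by (simp add: u_def r.scale_right Q_L)
    have "(r h h)\<^sup>2 = (a h (y n) + e n * r h (y n))\<^sup>2" using eq[OF h] by simp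
    also have "\<dots> \<le> (a h h + e n * r h h) * (a (y n) (y n) + e n * r (y n) (y n))"
      by (rule B.cauchy_schwarz[OF h y(1)])
    also have "\<dots> \<le> (a h h + e n * r h h) * (2 * K)"
      using eq[OF y(1)[of n]] ryh[of n] B.nonneg[OF h] by (intro mult_left_mono) auto
    finally show ?thesis .
  qed
  have "(\<lambda>n. (a h h + e n * r h h) * (2 * K)) \<longlonglongrightarrow> (a h h + 0 * r h h) * (2 * K)"
    by (intro tendsto_intros e_lim)
  hence "(r h h)\<^sup>2 \<le> (a h h + 0 * r h h) * (2 * K)" using key by (intro LIMSEQ_le_const) auto
  hence "(r h h)\<^sup>2 \<le> a h h * 2 * r h h / d" by (simp add: K_def)
  hence "r h h * (d * r h h) \<le> r h h * (2 * a h h)" using d by (simp add: field_simps power2_eq_square)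
  thus ?thesis using r.nonneg[OF hL] a_nonneg[OF h]
    by (cases "r h h = 0") (auto simp: mult_le_cancel_left)
qed

text \<open>Translation of the spectrum: the form \<open>a - \<mu> r\<close> is closed with constant
  \<open>c + \<mu>\<close>, its graph and its regular points are those of \<open>a\<close> shifted
  by \<mu>, and the eigenvectors for \<mu> become the kernel.\<close>

theorem gap_form:
  assumes d: "0 < d" and reg: "\<And>s. s < \<mu> \<Longrightarrow> regular s" "\<And>s. \<lbrakk>\<mu> < s; s < \<mu> + d\<rbrakk> \<Longrightarrow> regular s"
    and h: "h \<in> Q" and orth: "\<And>k. graph k (\<mu> *\<^sub>R k) \<Longrightarrow> r k h = 0"
  shows "(\<mu> + d / 2) * r h h \<le> a h h"
proof -
  let ?a = "\<lambda>u w. a u w + (- \<mu>) * r u w"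
  interpret A: closed_form L r Q ?a "c + \<mu>"
  proof (unfold closed_form_def, intro conjI)
    show "psd_form L r" by unfold_locales
    show "sym_form Q ?a" by (rule sym_form_shift)
    show "closed_form_axioms L r Q ?a (c + \<mu>)"
      by unfold_locales (use Q_sub coercive complete_ac in \<open>auto simp: algebra_simps\<close>)
  qed
  have graph_iff: "A.graph u k \<longleftrightarrow> graph u (k + \<mu> *\<^sub>R u)" for u k
  proof -
    have "k \<in> L \<longleftrightarrow> k + \<mu> *\<^sub>R u \<in> L" if "u \<in> Q"
      using that r.in_add[of k "\<mu> *\<^sub>R u"] r.in_diff[of "k + \<mu> *\<^sub>R u" "\<mu> *\<^sub>R u"] by auto
    thus ?thesis unfolding A.graph_def graph_def by (auto simp: r.bilin Q_L algebra_simps)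
  qed
  have reg': "A.regular s" if "regular (s + \<mu>)" for s
  proof -
    from that have 1: "\<forall>h\<in>L. \<exists>u. graph u (h + (s + \<mu>) *\<^sub>R u)" by (simp add: regular_def)
    from that obtain C where C: "\<And>u h. graph u h \<Longrightarrow> r u u \<le> C * r (h - (s + \<mu>) *\<^sub>R u) (h - (s + \<mu>) *\<^sub>R u)"
      unfolding regular_def by blast
    have "r u u \<le> C * r (h - s *\<^sub>R u) (h - s *\<^sub>R u)" if "A.graph u h" for u h
      using C[OF that[unfolded graph_iff]] by (simp add: algebra_simps)
    with 1 show ?thesis unfolding A.regular_def graph_iff by (auto simp: algebra_simps)
  qed
  have "d / 2 * r h h \<le> ?a h h"
  proof (rule A.gap_form_zero[OF d _ _ h])
    show "A.regular s" if "s < 0" for s using that by (intro reg' reg) auto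
    show "A.regular s" if "0 < s" "s < d" for s using that by (intro reg' reg(2)) auto
    show "r k h = 0" if "A.graph k 0" for k
      using orth[of k] that[unfolded graph_iff] by simp
  qed
  thus ?thesis by (simp add: algebra_simps)
qed

end

text \<open>Together with the pointwise addition of functions this turns \<open>L2\<close> and
  \<open>form_domain V\<close> into subspaces of a real vector space, so that the abstract forms
  apply to functions directly.\<close>

instantiation "fun" :: (type, real_vector) real_vector
begin

definition "scaleR_fun c f = (\<lambda>x. c *\<^sub>R f x)"

instance
  by standard (simp_all add: scaleR_fun_def fun_eq_iff algebra_simps)

end

lemma scaleR_fun_apply [simp]: "(c *\<^sub>R f) x = c *\<^sub>R f x"
  by (simp add: scaleR_fun_def)

section \<open>Square-integrable functions\<close>

lemma L2_measurable [measurable_dest]: "u \<in> L2 \<Longrightarrow> u \<in> borel_measurable lebesgue"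
  by (simp add: L2_def)

lemma L2_integrable_sq: "u \<in> L2 \<Longrightarrow> integrable lebesgue (\<lambda>x. (norm (u x))\<^sup>2)"
  by (simp add: L2_def)

lemma L2_if_bounded:
  assumes "u \<in> borel_measurable lebesgue" "integrable lebesgue w"
    and "AE x in lebesgue. (norm (u x))\<^sup>2 \<le> w x"
  shows "u \<in> L2"
proof -
  have "integrable lebesgue (\<lambda>x. (norm (u x))\<^sup>2)"
  proof (rule Bochner_Integration.integrable_bound[OF assms(2)])
    show "(\<lambda>x. (norm (u x))\<^sup>2) \<in> borel_measurable lebesgue" using assms(1) by measurable
    show "AE x in lebesgue. norm ((norm (u x))\<^sup>2) \<le> norm (w x)"
      using assms(3) by eventually_elim auto
  qed
  with assms(1) show ?thesis by (simp add: L2_def)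
qed

lemma norm_add_sq_le: "(norm (a + b))\<^sup>2 \<le> 2 * (norm a)\<^sup>2 + 2 * (norm b)\<^sup>2"
proof -
  have "(norm (a + b))\<^sup>2 \<le> (norm a + norm b)\<^sup>2" by (intro power_mono norm_triangle_ineq) auto
  also have "\<dots> \<le> 2 * (norm a)\<^sup>2 + 2 * (norm b)\<^sup>2"
    using zero_le_power2[of "norm a - norm b"] by (simp add: power2_eq_square algebra_simps)
  finally show ?thesis .
qed

lemma L2_add [intro]:
  assumes "u \<in> L2" "w \<in> L2"
  shows "(\<lambda>x. u x + w x) \<in> L2"
proof (rule L2_if_bounded)
  show "integrable lebesgue (\<lambda>x. 2 * (norm (u x))\<^sup>2 + 2 * (norm (w x))\<^sup>2)"
    using assms by (intro Bochner_Integration.integrable_add integrable_mult_right L2_integrable_sq)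
qed (use assms norm_add_sq_le in auto)

lemma L2_linear:
  assumes "u \<in> L2" "f \<in> borel_measurable borel" "\<And>y. norm (f y) \<le> C * norm y"
  shows "(\<lambda>x. f (u x)) \<in> L2"
proof (rule L2_if_bounded)
  show "integrable lebesgue (\<lambda>x. C\<^sup>2 * (norm (u x))\<^sup>2)"
    using assms by (intro integrable_mult_right L2_integrable_sq)
  have "(norm (f (u x)))\<^sup>2 \<le> (C * norm (u x))\<^sup>2" for x
    by (intro power_mono assms(3)) auto
  thus "AE x in lebesgue. (norm (f (u x)))\<^sup>2 \<le> C\<^sup>2 * (norm (u x))\<^sup>2"
    by (simp add: power_mult_distrib)
  show "(\<lambda>x. f (u x)) \<in> borel_measurable lebesgue"
    using assms(1,2) by measurable
qed

lemma L2_scaleR [intro]: "u \<in> L2 \<Longrightarrow> (\<lambda>x. c *\<^sub>R u x) \<in> L2"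
  by (rule L2_linear[where C = "\<bar>c\<bar>"]) auto

lemma L2_mult [intro]: "u \<in> L2 \<Longrightarrow> (\<lambda>x. c * u x) \<in> L2"
  for c :: "'a::{banach, second_countable_topology, real_normed_algebra}"
  by (rule L2_linear[where C = "norm c"]) (auto intro: norm_mult_ineq)

lemma L2_zero [simp, intro]: "(\<lambda>x. 0) \<in> L2"
  by (simp add: L2_def)

lemma L2_uminus [intro]: "u \<in> L2 \<Longrightarrow> (\<lambda>x. - u x) \<in> L2"
  using L2_scaleR[of u "-1"] by simp

lemma L2_diff [intro]: "u \<in> L2 \<Longrightarrow> w \<in> L2 \<Longrightarrow> (\<lambda>x. u x - w x) \<in> L2"
  using L2_add[OF _ L2_uminus, of u w] by simp

lemma L2_cong_AE:
  assumes "u \<in> L2" "w \<in> borel_measurable lebesgue" "AE x in lebesgue. u x = w x"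
  shows "w \<in> L2"
  using assms by (intro L2_if_bounded[OF _ L2_integrable_sq[OF assms(1)]]) auto

lemma integrable_mult_L2:
  fixes f :: "real^3 \<Rightarrow> 'b::{banach, second_countable_topology}"
  assumes "u \<in> L2" "w \<in> L2" "f \<in> borel_measurable lebesgue"
    and "AE x in lebesgue. norm (f x) \<le> norm (u x) * norm (w x)"
  shows "integrable lebesgue f"
proof (rule Bochner_Integration.integrable_bound)
  show "integrable lebesgue (\<lambda>x. (norm (u x))\<^sup>2 + (norm (w x))\<^sup>2)"
    using assms by (intro Bochner_Integration.integrable_add L2_integrable_sq)
  have "norm (u x) * norm (w x) \<le> (norm (u x))\<^sup>2 + (norm (w x))\<^sup>2" for x
    using sum_squares_bound[of "norm (u x)" "norm (w x)"]
      mult_nonneg_nonneg[OF norm_ge_zero[of "u x"] norm_ge_zero[of "w x"]] by linarith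
  with assms(4) show "AE x in lebesgue. norm (f x) \<le> norm ((norm (u x))\<^sup>2 + (norm (w x))\<^sup>2)"
    by (auto elim!: eventually_mono intro: order_trans)
qed fact

lemma L2_norm_sq: "(L2_norm u)\<^sup>2 = (\<integral>x. (norm (u x))\<^sup>2 \<partial>lebesgue)"
  unfolding L2_norm_def by (rule real_sqrt_pow2) (auto intro: Bochner_Integration.integral_nonneg)

lemma L2_norm_nonneg [simp]: "0 \<le> L2_norm u"
  unfolding L2_norm_def by (rule real_sqrt_ge_zero) (auto intro: Bochner_Integration.integral_nonneg)

lemma nn_integral_sq_L2: "u \<in> L2 \<Longrightarrow> (\<integral>\<^sup>+x. ennreal ((norm (u x))\<^sup>2) \<partial>lebesgue) = ennreal ((L2_norm u)\<^sup>2)"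
  unfolding L2_norm_sq by (rule nn_integral_eq_integral) (auto simp: L2_integrable_sq)

lemma L2_if_nn_integral:
  assumes "u \<in> borel_measurable lebesgue" "(\<integral>\<^sup>+x. ennreal ((norm (u x))\<^sup>2) \<partial>lebesgue) < \<infinity>"
  shows "u \<in> L2"
  using assms by (auto simp: L2_def integrable_iff_bounded)

lemma L2_norm_cong_AE:
  assumes "u \<in> borel_measurable lebesgue" "w \<in> borel_measurable lebesgue" "AE x in lebesgue. u x = w x"
  shows "L2_norm u = L2_norm w"
proof -
  have "(\<integral>x. (norm (u x))\<^sup>2 \<partial>lebesgue) = (\<integral>x. (norm (w x))\<^sup>2 \<partial>lebesgue)"
    using assms by (intro integral_cong_AE) auto
  thus ?thesis by (simp add: L2_norm_def)
qed

lemma L2_norm_eq_0_iff: "u \<in> L2 \<Longrightarrow> L2_norm u = 0 \<longleftrightarrow> (AE x in lebesgue. u x = 0)"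
  unfolding L2_norm_def by (subst real_sqrt_eq_0_iff, subst integral_nonneg_eq_0_iff_AE)
    (auto simp: L2_integrable_sq)

text \<open>For complex values this is the real part of \<open>L2_inner\<close>. It also serves for
  gradients, whose values lie in \<open>complex^3\<close>. It is symmetric and real bilinear, hence
  an instance of the abstract forms.\<close>

definition rip :: "(real^3 \<Rightarrow> 'a::euclidean_space) \<Rightarrow> (real^3 \<Rightarrow> 'a) \<Rightarrow> real" where
  "rip u w = (\<integral>x. u x \<bullet> w x \<partial>lebesgue)"

lemma integrable_inner_L2:
  fixes u w :: "real^3 \<Rightarrow> 'a::euclidean_space"
  assumes "u \<in> L2" "w \<in> L2"
  shows "integrable lebesgue (\<lambda>x. u x \<bullet> w x)"
  using assms by (intro integrable_mult_L2[OF assms]) (auto simp: Cauchy_Schwarz_ineq2)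

lemma rip_self: "rip u u = (L2_norm u)\<^sup>2"
  by (simp add: rip_def L2_norm_sq power2_norm_eq_inner)

interpretation L2: psd_form "L2 :: (real^3 \<Rightarrow> 'a::euclidean_space) set" rip
proof
  show "subspace (L2 :: (real^3 \<Rightarrow> 'a) set)"
    by (auto simp: subspace_def plus_fun_def zero_fun_def scaleR_fun_def)
  fix u w z :: "real^3 \<Rightarrow> 'a" and c :: real
  assume uz: "u \<in> L2" "z \<in> L2"
  show "rip (c *\<^sub>R u) z = c * rip u z" by (simp add: rip_def)
  show "rip u z = rip z u" by (simp add: rip_def inner_commute)
  assume "w \<in> L2"
  with uz show "rip (u + w) z = rip u z + rip w z"
    by (simp add: rip_def inner_add_left integrable_inner_L2)
next
  show "0 \<le> rip u u" for u :: "real^3 \<Rightarrow> 'a" by (simp add: rip_self)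
qed

lemma abs_rip_le:
  fixes u w :: "real^3 \<Rightarrow> 'a::euclidean_space"
  assumes "u \<in> L2" "w \<in> L2"
  shows "\<bar>rip u w\<bar> \<le> L2_norm u * L2_norm w"
  using L2.cauchy_schwarz_abs[OF assms] by (simp add: rip_self)

lemma integral_norm_mult_le:
  fixes u w :: "real^3 \<Rightarrow> 'a::{banach, second_countable_topology}"
  assumes "u \<in> L2" "w \<in> L2"
  shows "(\<integral>x. norm (u x) * norm (w x) \<partial>lebesgue) \<le> L2_norm u * L2_norm w"
proof -
  have N: "(\<lambda>x. norm (u x)) \<in> L2" "(\<lambda>x. norm (w x)) \<in> L2"
    using L2_linear[OF assms(1), of norm 1] L2_linear[OF assms(2), of norm 1] by auto
  have "rip (\<lambda>x. norm (u x)) (\<lambda>x. norm (w x)) \<le> L2_norm (\<lambda>x. norm (u x)) * L2_norm (\<lambda>x. norm (w x))"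
    using abs_rip_le[OF N] by simp
  thus ?thesis by (simp add: rip_def L2_norm_def)
qed

text \<open>A fast subsequence converges almost everywhere because the sum of its weighted squared
  increments has finite integral; Fatou's lemma then turns the Cauchy property into convergence of
  the whole sequence in norm.\<close>

theorem L2_complete:
  fixes X :: "nat \<Rightarrow> real^3 \<Rightarrow> 'a::{banach, second_countable_topology}"
  assumes X: "\<And>n. X n \<in> L2"
    and cauchy: "\<And>e. 0 < e \<Longrightarrow> \<exists>N. \<forall>m\<ge>N. \<forall>n\<ge>N. (L2_norm (\<lambda>x. X m x - X n x))\<^sup>2 < e"
  shows "\<exists>u\<in>L2. (\<lambda>n. (L2_norm (\<lambda>x. X n x - u x))\<^sup>2) \<longlonglongrightarrow> 0"
proof -
  have Xm [measurable]: "X n \<in> borel_measurable lebesgue" for n using X by (rule L2_measurable)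
  have "\<exists>N. \<forall>m\<ge>N. \<forall>n\<ge>N. (L2_norm (\<lambda>x. X m x - X n x))\<^sup>2 < (1/8)^k" for k
    by (rule cauchy) simp
  then obtain N where N: "\<And>k m n. \<lbrakk>N k \<le> m; N k \<le> n\<rbrakk> \<Longrightarrow> (L2_norm (\<lambda>x. X m x - X n x))\<^sup>2 < (1/8)^k"
    by metis
  \<comment> \<open>Partial sums, so that \<open>s k\<close> exceeds \<open>N j\<close> for every
    \<open>j \<le> k\<close> and not only for \<open>j = k\<close>; the Fatou estimate below relies
    on this.\<close>
  define s where "s = (\<lambda>k. \<Sum>i\<le>k. N i)"
  have s: "N k \<le> s k" "N k \<le> s (Suc k)" for k
  proof -
    show "N k \<le> s k" unfolding s_def by (rule member_le_sum) auto
    thus "N k \<le> s (Suc k)" by (simp add: s_def)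
  qed
  define Y where "Y = (\<lambda>k. X (s k))"
  have Ym [measurable]: "Y k \<in> borel_measurable lebesgue" for k by (simp add: Y_def)
  define D where "D = (\<lambda>k x. (norm (Y (Suc k) x - Y k x))\<^sup>2)"
  \<comment> \<open>The weight \<open>2^k\<close> is still summable against the decay
    \<open>(1/8)^k\<close>, and it forces \<open>D k x \<le> C / 2^k\<close> wherever the sum is
    finite. The increments themselves are then dominated by a geometric series with ratio
    \<open>sqrt (1/2)\<close>.\<close>
  have D_int: "(\<integral>\<^sup>+x. ennreal (2^k * D k x) \<partial>lebesgue) \<le> ennreal ((1/4)^k)" for k
  proof -
    have "(\<integral>\<^sup>+x. ennreal (2^k * D k x) \<partial>lebesgue) = ennreal (2^k) * (\<integral>\<^sup>+x. ennreal (D k x) \<partial>lebesgue)"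
      by (subst nn_integral_cmult[symmetric]) (auto simp: ennreal_mult D_def)
    also have "\<dots> = ennreal (2^k) * ennreal ((L2_norm (\<lambda>x. Y (Suc k) x - Y k x))\<^sup>2)"
      unfolding D_def Y_def by (simp only: nn_integral_sq_L2[OF L2_diff[OF X X]])
    also have "\<dots> \<le> ennreal (2^k) * ennreal ((1/8)^k)"
      using N[OF s(2) s(1), of k] by (intro mult_left_mono ennreal_leI) (auto simp: Y_def)
    also have "\<dots> = ennreal ((1/4)^k)"
      by (simp add: ennreal_mult[symmetric] power_mult_distrib[symmetric])
    finally show ?thesis .
  qed
  have "(\<integral>\<^sup>+x. (\<Sum>k. ennreal (2^k * D k x)) \<partial>lebesgue) = (\<Sum>k. \<integral>\<^sup>+x. ennreal (2^k * D k x) \<partial>lebesgue)"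
    by (rule nn_integral_suminf) (auto simp: D_def)
  also have "\<dots> \<le> (\<Sum>k. ennreal ((1/4)^k))" by (intro suminf_le D_int) auto
  also have "\<dots> = ennreal (\<Sum>k. (1/4)^k)" by (rule suminf_ennreal2) (auto intro: summable_geometric)
  also have "\<dots> < \<infinity>" by simp
  finally have fin: "(\<integral>\<^sup>+x. (\<Sum>k. ennreal (2^k * D k x)) \<partial>lebesgue) \<noteq> \<infinity>" by simp
  have "AE x in lebesgue. (\<Sum>k. ennreal (2^k * D k x)) \<noteq> \<infinity>"
    by (rule nn_integral_PInf_AE[OF _ fin]) (auto simp: D_def)
  hence conv: "AE x in lebesgue. convergent (\<lambda>k. Y k x)"
  proof eventually_elim
    fix x assume "(\<Sum>k. ennreal (2^k * D k x)) \<noteq> \<infinity>"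
    then obtain C where C: "(\<Sum>k. ennreal (2^k * D k x)) = ennreal C" "0 \<le> C"
      by (cases "\<Sum>k. ennreal (2^k * D k x)") auto
    have D_le: "2^k * D k x \<le> C" for k
    proof -
      have "ennreal (2^k * D k x) \<le> ennreal C"
        unfolding C(1)[symmetric] using sum_le_suminf[of "\<lambda>k. ennreal (2^k * D k x)" "{k}"] by simp
      thus ?thesis using C(2) by (simp add: D_def)
    qed
    have Dle: "norm (Y (Suc k) x - Y k x) \<le> sqrt C * (sqrt (1/2))^k" for k
    proof -
      have "(norm (Y (Suc k) x - Y k x))\<^sup>2 \<le> C * (1/2)^k"
        using D_le[of k] by (simp add: D_def field_simps)
      hence "norm (Y (Suc k) x - Y k x) \<le> sqrt (C * (1/2)^k)" by (intro real_le_rsqrt)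
      thus ?thesis by (simp add: real_sqrt_mult real_sqrt_power)
    qed
    have "summable (\<lambda>k. Y (Suc k) x - Y k x)"
    proof (rule summable_comparison_test')
      have "norm (sqrt (1/2)) < 1" by (simp add: real_sqrt_divide)
      thus "summable (\<lambda>k. sqrt C * (sqrt (1/2))^k)" by (intro summable_mult summable_geometric)
    qed (rule Dle)
    hence "convergent (\<lambda>n. \<Sum>k<n. Y (Suc k) x - Y k x)" by (simp add: summable_iff_convergent)
    hence "convergent (\<lambda>n. Y n x - Y 0 x)"
      by (simp add: sum_lessThan_telescope[of "\<lambda>k. Y k x"])
    from convergent_add[OF this convergent_const[of "Y 0 x"]]
    show "convergent (\<lambda>k. Y k x)" by simp
  qed
  define u where "u = (\<lambda>x. lim (\<lambda>k. Y k x))"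
  have um [measurable]: "u \<in> borel_measurable lebesgue" unfolding u_def by measurable
  have Yu: "AE x in lebesgue. (\<lambda>k. Y k x) \<longlonglongrightarrow> u x"
    using conv by eventually_elim (simp add: u_def convergent_LIMSEQ_iff)
  have fatou: "(\<integral>\<^sup>+x. ennreal ((norm (X n x - u x))\<^sup>2) \<partial>lebesgue) \<le> ennreal ((1/8)^j)" if "N j \<le> n" for n j
  proof -
    have "(\<integral>\<^sup>+x. ennreal ((norm (X n x - u x))\<^sup>2) \<partial>lebesgue)
        = (\<integral>\<^sup>+x. liminf (\<lambda>k. ennreal ((norm (X n x - Y k x))\<^sup>2)) \<partial>lebesgue)"
    proof (rule nn_integral_cong_AE, use Yu in eventually_elim)
      fix x assume "(\<lambda>k. Y k x) \<longlonglongrightarrow> u x"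
      hence "(\<lambda>k. ennreal ((norm (X n x - Y k x))\<^sup>2)) \<longlonglongrightarrow> ennreal ((norm (X n x - u x))\<^sup>2)"
        by (intro tendsto_intros)
      from lim_imp_Liminf[OF sequentially_bot this]
      show "ennreal ((norm (X n x - u x))\<^sup>2) = liminf (\<lambda>k. ennreal ((norm (X n x - Y k x))\<^sup>2))"
        by (rule sym)
    qed
    also have "\<dots> \<le> liminf (\<lambda>k. \<integral>\<^sup>+x. ennreal ((norm (X n x - Y k x))\<^sup>2) \<partial>lebesgue)"
      by (rule nn_integral_liminf) measurable
    also have "\<dots> \<le> ennreal ((1/8)^j)"
    proof (rule Liminf_le)
      show "\<forall>\<^sub>F k in sequentially. (\<integral>\<^sup>+x. ennreal ((norm (X n x - Y k x))\<^sup>2) \<partial>lebesgue) \<le> ennreal ((1/8)^j)"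
      proof (rule eventually_sequentiallyI[of j])
        fix k assume "j \<le> k"
        hence "N j \<le> s k" unfolding s_def by (intro member_le_sum) auto
        hence "(L2_norm (\<lambda>x. X n x - Y k x))\<^sup>2 < (1/8)^j" unfolding Y_def using that by (intro N)
        hence "ennreal ((L2_norm (\<lambda>x. X n x - Y k x))\<^sup>2) \<le> ennreal ((1/8)^j)"
          by (intro ennreal_leI less_imp_le)
        moreover have "(\<lambda>x. X n x - Y k x) \<in> L2" unfolding Y_def by (rule L2_diff[OF X X])
        ultimately show "(\<integral>\<^sup>+x. ennreal ((norm (X n x - Y k x))\<^sup>2) \<partial>lebesgue) \<le> ennreal ((1/8)^j)"
          by (simp only: nn_integral_sq_L2)
      qed
    qed simp
    finally show ?thesis .
  qed
  have diff_L2: "(\<lambda>x. X n x - u x) \<in> L2" if "N 0 \<le> n" for n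
    by (rule L2_if_nn_integral, measurable) (rule le_less_trans[OF fatou[OF that]], simp)
  have "(\<lambda>x. X (N 0) x - (X (N 0) x - u x)) \<in> L2" by (intro L2_diff X diff_L2) simp
  hence u: "u \<in> L2" by simp
  have le: "(L2_norm (\<lambda>x. X n x - u x))\<^sup>2 \<le> (1/8)^j" if "N j \<le> n" for n j
    using fatou[OF that] nn_integral_sq_L2[OF L2_diff[OF X[of n] u]] by simp
  have "(\<lambda>n. (L2_norm (\<lambda>x. X n x - u x))\<^sup>2) \<longlonglongrightarrow> 0"
  proof (rule LIMSEQ_I)
    fix e :: real assume "0 < e"
    then obtain j where "(1/8::real)^j < e" using real_arch_pow_inv[of e "1/8"] by auto
    hence "norm ((L2_norm (\<lambda>x. X n x - u x))\<^sup>2 - 0) < e" if "N j \<le> n" for n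
      using le[OF that] by simp
    thus "\<exists>no. \<forall>n\<ge>no. norm ((L2_norm (\<lambda>x. X n x - u x))\<^sup>2 - 0) < e" by blast
  qed
  with u show ?thesis by blast
qed

section \<open>Test functions\<close>

lemma partial_deriv_eq:
  assumes "(\<phi> has_derivative D) (at x)"
  shows "partial_deriv i \<phi> x = D (axis i 1)"
  using frechet_derivative_at[OF assms] by (simp add: partial_deriv_def)

lemma has_derivative_partial:
  assumes "\<phi> differentiable (at x)"
  shows "(\<phi> has_derivative (\<lambda>h. \<Sum>i\<in>UNIV. h $ i * partial_deriv i \<phi> x)) (at x)"
proof -
  let ?D = "frechet_derivative \<phi> (at x)"
  have D: "(\<phi> has_derivative ?D) (at x)" using assms by (simp add: frechet_derivative_works)
  interpret linear ?D by (rule has_derivative_linear[OF D])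
  have "?D h = (\<Sum>i\<in>UNIV. h $ i * partial_deriv i \<phi> x)" for h
  proof -
    have "h = (\<Sum>i\<in>UNIV. (h $ i) *\<^sub>R axis i 1)" by (simp add: vec_eq_iff axis_def if_distrib cong: if_cong)
    hence "?D h = ?D (\<Sum>i\<in>UNIV. (h $ i) *\<^sub>R axis i 1)" by simp
    thus ?thesis by (simp add: sum scale partial_deriv_def)
  qed
  hence "?D = (\<lambda>h. \<Sum>i\<in>UNIV. h $ i * partial_deriv i \<phi> x)" by (rule ext)
  with D show ?thesis by simp
qed

lemma Ck_continuous: "Ck n \<phi> \<Longrightarrow> continuous_on UNIV \<phi>"
  by (cases n) (auto intro: differentiable_imp_continuous_on)

lemma Ck_Suc_imp: "Ck (Suc n) \<phi> \<Longrightarrow> Ck n \<phi>"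
proof (induction n arbitrary: \<phi>)
  case 0
  thus ?case using Ck_continuous[of "Suc 0" \<phi>] by simp
next
  case (Suc n)
  from Suc.prems have d: "\<phi> differentiable_on UNIV" "\<And>i. Ck (Suc n) (partial_deriv i \<phi>)"
    by (simp_all only: Ck.simps(2)[of "Suc n"])
  show ?case unfolding Ck.simps(2) using d Suc.IH by blast
qed

lemma Ck_const [simp]: "Ck n (\<lambda>x. c)"
proof (induction n arbitrary: c)
  case (Suc n)
  have "partial_deriv i (\<lambda>x. c) = (\<lambda>x. 0)" for i
    by (rule ext, rule partial_deriv_eq) (rule has_derivative_const)
  with Suc show ?case by (simp add: differentiable_on_def)
qed simp

lemma Ck_add:
  assumes "Ck n \<phi>" "Ck n \<psi>"
  shows "Ck n (\<lambda>x. \<phi> x + \<psi> x)"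
  using assms
proof (induction n arbitrary: \<phi> \<psi>)
  case (Suc n)
  from Suc.prems have d: "\<phi> differentiable at x" "\<psi> differentiable at x" for x
    by (auto simp: differentiable_on_def)
  have "partial_deriv i (\<lambda>x. \<phi> x + \<psi> x) = (\<lambda>x. partial_deriv i \<phi> x + partial_deriv i \<psi> x)" for i
    by (rule ext, rule trans[OF partial_deriv_eq[OF has_derivative_add[OF d[unfolded frechet_derivative_works]]]])
       (simp add: partial_deriv_def)
  with Suc show ?case by (auto simp: differentiable_on_def intro!: differentiable_add)
qed (auto intro: continuous_intros)

lemma Ck_mult:
  assumes "Ck n \<phi>" "Ck n \<psi>"
  shows "Ck n (\<lambda>x. \<phi> x * \<psi> x)"
  using assms
proof (induction n arbitrary: \<phi> \<psi>)
  case (Suc n)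
  from Suc.prems have d: "\<phi> differentiable at x" "\<psi> differentiable at x" for x
    by (auto simp: differentiable_on_def)
  have "partial_deriv i (\<lambda>x. \<phi> x * \<psi> x) = (\<lambda>x. \<phi> x * partial_deriv i \<psi> x + partial_deriv i \<phi> x * \<psi> x)" for i
    by (rule ext, rule trans[OF partial_deriv_eq[OF has_derivative_mult[OF d[unfolded frechet_derivative_works]]]])
       (simp add: partial_deriv_def)
  moreover have "Ck n (\<lambda>x. \<phi> x * partial_deriv i \<psi> x + partial_deriv i \<phi> x * \<psi> x)" for i
    using Suc.prems Ck_Suc_imp[OF Suc.prems(1)] Ck_Suc_imp[OF Suc.prems(2)]
    by (intro Ck_add Suc.IH) auto
  ultimately show ?case using d by (auto simp: differentiable_on_def)
qed (auto intro: continuous_intros)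

lemma Ck_prod:
  assumes "finite I" "\<And>i. i \<in> I \<Longrightarrow> Ck n (f i)"
  shows "Ck n (\<lambda>x. \<Prod>i\<in>I. f i x)"
  using assms by (induction I) (auto intro: Ck_mult)

subsection \<open>Bump functions\<close>

text \<open>Polynomials in \<open>1 / x\<close> times \<open>exp (- c / x)\<close>, extended by
  zero: a family closed under differentiation and containing the standard smooth step, so that one
  derivative formula yields all orders.\<close>

definition eta :: "real \<Rightarrow> real poly \<Rightarrow> real \<Rightarrow> real" where
  "eta c p x = (if 0 < x then poly p (1 / x) * exp (- c / x) else 0)"

lemma poly_exp_tendsto_0:
  fixes c :: real
  assumes "0 < c"
  shows "((\<lambda>y. poly p y * exp (- c * y)) \<longlongrightarrow> 0) at_top"
proof -
  have "((\<lambda>y. coeff p i * (1 / c)^i * ((c * y)^i / exp (c * y))) \<longlongrightarrow> coeff p i * (1 / c)^i * 0) at_top" for i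
  proof (intro tendsto_mult tendsto_const)
    have "filterlim (\<lambda>y. c * y) at_top at_top"
      using assms by (intro filterlim_tendsto_pos_mult_at_top[OF tendsto_const] filterlim_ident)
    from filterlim_compose[OF tendsto_power_div_exp_0[of i] this]
    show "((\<lambda>y. (c * y)^i / exp (c * y)) \<longlongrightarrow> 0) at_top" .
  qed
  hence "((\<lambda>y. \<Sum>i\<le>degree p. coeff p i * (1 / c)^i * ((c * y)^i / exp (c * y))) \<longlongrightarrow>
      (\<Sum>i\<le>degree p. coeff p i * (1 / c)^i * 0)) at_top" by (intro tendsto_sum)
  moreover have "(\<Sum>i\<le>degree p. coeff p i * (1 / c)^i * ((c * y)^i / exp (c * y))) = poly p y * exp (- c * y)" for y
    unfolding poly_altdef sum_distrib_right using assms
    by (intro sum.cong refl) (simp add: power_mult_distrib power_divide exp_minus field_simps)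
  ultimately show ?thesis by simp
qed

lemma eta_tendsto_0:
  assumes "0 < c"
  shows "(eta c p \<longlongrightarrow> 0) (at 0)"
proof -
  have "((\<lambda>x. poly p (inverse x) * exp (- c * inverse x)) \<longlongrightarrow> 0) (at_right 0)"
    by (rule filterlim_compose[OF poly_exp_tendsto_0[OF assms] filterlim_inverse_at_top_right])
  moreover have "\<forall>\<^sub>F x in at_right 0. poly p (inverse x) * exp (- c * inverse x) = eta c p x"
    unfolding eventually_at_filter by (auto simp: eta_def divide_inverse)
  ultimately have "(eta c p \<longlongrightarrow> 0) (at_right 0)" by (rule Lim_transform_eventually)
  moreover have "(eta c p \<longlongrightarrow> 0) (at_left 0)"
    by (rule Lim_transform_eventually[OF tendsto_const])
       (auto simp: eventually_at_filter eta_def)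
  ultimately show ?thesis by (simp add: filterlim_split_at)
qed

text \<open>In the variable \<open>y = 1 / x\<close> the derivative by \<open>x\<close> is
  \<open>- y^2\<close> times the derivative by \<open>y\<close>, and the exponential contributes
  \<open>- c\<close>; the signs combine to \<open>y^2 * (c p - p')\<close>.\<close>

definition eta_step :: "real \<Rightarrow> real poly \<Rightarrow> real poly" where
  "eta_step c p = [:0, 0, 1:] * (smult c p - pderiv p)"

lemma eta_has_derivative:
  assumes "0 < c"
  shows "(eta c p has_real_derivative eta c (eta_step c p) x) (at x)"
proof -
  consider "0 < x" | "x < 0" | "x = 0" by linarith
  thus ?thesis
  proof cases
    case 1
    have "((\<lambda>x. poly p (1 / x) * exp (- c / x)) has_real_derivative eta c (eta_step c p) x) (at x)"
      using 1 by (auto intro!: derivative_eq_intros DERIV_chain'[OF _ poly_DERIV]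
          simp: eta_def eta_step_def field_simps power2_eq_square)
    moreover have "\<forall>\<^sub>F y in nhds x. poly p (1 / y) * exp (- c / y) = eta c p y"
      using eventually_nhds_in_open[of "{0<..}" x] 1 by (auto elim!: eventually_mono simp: eta_def)
    ultimately show ?thesis by (rule DERIV_cong_ev[THEN iffD1, OF refl _ refl, rotated])
  next
    case 2
    have "((\<lambda>x. 0) has_real_derivative eta c (eta_step c p) x) (at x)"
      using 2 by (simp add: eta_def)
    moreover have "\<forall>\<^sub>F y in nhds x. 0 = eta c p y"
      using eventually_nhds_in_open[of "{..<0}" x] 2 by (auto elim!: eventually_mono simp: eta_def)
    ultimately show ?thesis by (rule DERIV_cong_ev[THEN iffD1, OF refl _ refl, rotated])
  next
    case 3
    \<comment> \<open>At the origin the difference quotient is again of the form \<open>eta\<close>,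
      with \<open>p\<close> multiplied by the variable, and tends to zero like every member of the
      family.\<close>
    have "((\<lambda>h. (eta c p (0 + h) - eta c p 0) / h) \<longlongrightarrow> 0) (at 0)"
    proof (rule Lim_transform_eventually[OF eta_tendsto_0[OF assms, of "[:0, 1:] * p"]])
      show "\<forall>\<^sub>F h in at 0. eta c ([:0, 1:] * p) h = (eta c p (0 + h) - eta c p 0) / h"
        by (auto simp: eventually_at_filter eta_def field_simps)
    qed
    moreover have "eta c (eta_step c p) x = 0" using 3 by (simp add: eta_def)
    ultimately show ?thesis using 3 by (simp only: DERIV_def)
  qed
qed

lemma Ck_eta:
  assumes "0 < c"
  shows "Ck n (\<lambda>x. eta c p (s * x $ i + t))"
proof (induction n arbitrary: p)
  case 0
  have "continuous_on UNIV (eta c p)"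
    using eta_has_derivative[OF assms] by (intro continuous_at_imp_continuous_on ballI DERIV_isCont) blast
  hence "continuous_on UNIV (\<lambda>x::real^3. eta c p (s * x $ i + t))"
    by (rule continuous_on_compose2) (auto intro!: continuous_intros)
  thus ?case by simp
next
  case (Suc n)
  have D: "((\<lambda>x::real^3. eta c p (s * x $ i + t)) has_derivative
      (\<lambda>h. eta c (eta_step c p) (s * x $ i + t) * (s * h $ i))) (at x)" for x
  proof -
    have 1: "((\<lambda>x::real^3. s * x $ i + t) has_derivative (\<lambda>h. s * h $ i)) (at x)"
      by (auto intro!: derivative_eq_intros bounded_linear_imp_has_derivative[OF bounded_linear_vec_nth])
    have 2: "(eta c p has_derivative (\<lambda>h. eta c (eta_step c p) (s * x $ i + t) * h)) (at (s * x $ i + t))"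
      using eta_has_derivative[OF assms] by (simp add: has_field_derivative_def)
    show ?thesis using has_derivative_compose[OF 1 2] .
  qed
  have "partial_deriv j (\<lambda>x. eta c p (s * x $ i + t)) =
      (\<lambda>x. (s * axis j 1 $ i) * eta c (eta_step c p) (s * x $ i + t))" for j
    by (rule ext, subst partial_deriv_eq[OF D]) (simp add: mult_ac)
  moreover have "Ck n (\<lambda>x. (s * axis j 1 $ i) * eta c (eta_step c p) (s * x $ i + t))" for j :: 3
    by (intro Ck_mult Ck_const Suc)
  ultimately show ?case using D by (auto simp: differentiable_on_def differentiable_def)
qed

text \<open>The parameter \<open>c\<close> sets the steepness: each factor is
  \<open>exp (- c / y)\<close> for positive \<open>y\<close>, so as \<open>c\<close> tends to 0 the
  bumps converge to the indicator of the open box.\<close>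

definition bump :: "real \<Rightarrow> real^3 \<Rightarrow> real^3 \<Rightarrow> real^3 \<Rightarrow> real" where
  "bump c a b x = (\<Prod>i\<in>UNIV. eta c 1 (x $ i - a $ i) * eta c 1 (b $ i - x $ i))"

lemma bump_nonneg: "0 \<le> bump c a b x"
  unfolding bump_def by (intro prod_nonneg) (auto simp: eta_def)

lemma eta_le_1: "0 < c \<Longrightarrow> eta c 1 y \<le> 1"
  by (simp add: eta_def)

lemma eta_nonneg: "0 \<le> eta c 1 y"
  by (simp add: eta_def)

lemma bump_le_1: "0 < c \<Longrightarrow> bump c a b x \<le> 1"
  unfolding bump_def by (intro prod_le_1 conjI mult_le_one mult_nonneg_nonneg eta_le_1 eta_nonneg) auto

lemma bump_outside:
  assumes "x \<notin> box a b"
  shows "bump c a b x = 0"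
proof -
  obtain i where "\<not> (a $ i < x $ i \<and> x $ i < b $ i)" using assms by (auto simp: mem_box_cart)
  hence "eta c 1 (x $ i - a $ i) * eta c 1 (b $ i - x $ i) = 0" by (auto simp: eta_def)
  thus ?thesis unfolding bump_def by (intro prod_zero) auto
qed

lemma bump_tendsto: "(\<lambda>n. bump (1 / real (Suc n)) a b x) \<longlonglongrightarrow> indicator (box a b) x"
proof (cases "x \<in> box a b")
  case False
  thus ?thesis by (simp add: bump_outside)
next
  case True
  have "(\<lambda>n. eta (1 / real (Suc n)) 1 y) \<longlonglongrightarrow> 1" if "0 < y" for y
  proof -
    have "(\<lambda>n. exp (- (1 / real (Suc n)) / y)) \<longlonglongrightarrow> exp (- 0 / y)"
      using LIMSEQ_inverse_real_of_nat that by (intro tendsto_intros) (auto simp: inverse_eq_divide)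
    thus ?thesis using that by (simp add: eta_def)
  qed
  hence "(\<lambda>n. bump (1 / real (Suc n)) a b x) \<longlonglongrightarrow> (\<Prod>i\<in>(UNIV::3 set). 1 * 1)"
    unfolding bump_def using True by (intro tendsto_prod tendsto_mult) (auto simp: mem_box_cart)
  thus ?thesis using True by simp
qed

lemma test_function_bump:
  assumes "0 < c"
  shows "test_function (bump c a b)"
  unfolding test_function_def
proof (intro conjI allI)
  fix n
  have "Ck n (\<lambda>x. eta c 1 (1 * x $ i + - a $ i) * eta c 1 (- 1 * x $ i + b $ i))" for i
    by (intro Ck_mult Ck_eta assms)
  hence "Ck n (\<lambda>x. \<Prod>i\<in>UNIV. eta c 1 (1 * x $ i + - a $ i) * eta c 1 (- 1 * x $ i + b $ i))"
    by (intro Ck_prod) auto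
  thus "Ck n (bump c a b)" by (simp add: bump_def[abs_def])
next
  have "{x. bump c a b x \<noteq> 0} \<subseteq> cbox a b" using bump_outside box_subset_cbox[of a b] by blast
  hence "closure {x. bump c a b x \<noteq> 0} \<subseteq> cbox a b" by (intro closure_minimal closed_cbox)
  hence "bounded (closure {x. bump c a b x \<noteq> 0})" using bounded_cbox bounded_subset by blast
  thus "compact (closure {x. bump c a b x \<noteq> 0})" by (simp add: compact_eq_bounded_closed)
qed

subsection \<open>The fundamental lemma of the calculus of variations\<close>

lemma enn2real_eq_imp: "\<lbrakk>enn2real p = enn2real q; p \<noteq> \<infinity>; q \<noteq> \<infinity>\<rbrakk> \<Longrightarrow> p = q"
  by (cases p; cases q) auto

text \<open>\<open>ennreal\<close> truncates negative values, so the two densities are the positive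
  and the negative part of \<open>f\<close>. The measures agree on boxes, a generator stable under
  intersections with a finite exhausting sequence; hence they are equal, and so are their
  densities.\<close>

lemma AE_zero_if_box_integrals_zero:
  fixes f :: "real^3 \<Rightarrow> real"
  assumes f [measurable]: "f \<in> borel_measurable borel"
    and int: "\<And>a b. set_integrable lborel (box a b) f"
    and zero: "\<And>a b. (\<integral>x\<in>box a b. f x \<partial>lborel) = 0"
  shows "AE x in lborel. f x = 0"
proof -
  let ?M = "density lborel (\<lambda>x. ennreal (f x))" and ?N = "density lborel (\<lambda>x. ennreal (- f x))"
  have fin: "emeasure ?M (box a b) \<noteq> \<infinity> \<and> emeasure ?M (box a b) = emeasure ?N (box a b)" for a b
  proof -
    let ?g = "\<lambda>x. indicator (box a b) x *\<^sub>R f x"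
    have i: "integrable lborel ?g" using int[of a b] by (simp add: set_integrable_def)
    have M: "emeasure ?M (box a b) = (\<integral>\<^sup>+x. ennreal (?g x) \<partial>lborel)"
      by (subst emeasure_density) (auto intro!: nn_integral_cong split: split_indicator)
    have N: "emeasure ?N (box a b) = (\<integral>\<^sup>+x. ennreal (- ?g x) \<partial>lborel)"
      by (subst emeasure_density) (auto intro!: nn_integral_cong split: split_indicator)
    have fin: "(\<integral>\<^sup>+x. ennreal (?g x) \<partial>lborel) \<noteq> \<infinity>" "(\<integral>\<^sup>+x. ennreal (- ?g x) \<partial>lborel) \<noteq> \<infinity>"
      using i by (auto simp: real_integrable_def)
    have "0 = enn2real (\<integral>\<^sup>+x. ennreal (?g x) \<partial>lborel) - enn2real (\<integral>\<^sup>+x. ennreal (- ?g x) \<partial>lborel)"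
      using zero[of a b] real_lebesgue_integral_def[OF i] by (simp add: set_lebesgue_integral_def)
    hence "enn2real (\<integral>\<^sup>+x. ennreal (?g x) \<partial>lborel) = enn2real (\<integral>\<^sup>+x. ennreal (- ?g x) \<partial>lborel)"
      by linarith
    hence "(\<integral>\<^sup>+x. ennreal (?g x) \<partial>lborel) = (\<integral>\<^sup>+x. ennreal (- ?g x) \<partial>lborel)"
      using fin by (intro enn2real_eq_imp) auto
    with M N fin show ?thesis by simp
  qed
  have "?M = ?N"
  proof (rule measure_eqI_generator_eq[where \<Omega> = UNIV and E = "range (\<lambda>(a, b). box a b)"
        and A = "\<lambda>n. box (- (real n *\<^sub>R One)) (real n *\<^sub>R One)"])
    show "Int_stable (range (\<lambda>(a, b::real^3). box a b))"
      by (auto simp: Int_stable_def box_Int_box)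
    show "sets ?M = sigma_sets UNIV (range (\<lambda>(a, b). box a b))"
      "sets ?N = sigma_sets UNIV (range (\<lambda>(a, b). box a b))"
      by (simp_all add: borel_eq_box)
    show "(\<Union>n. box (- (real n *\<^sub>R One)) (real n *\<^sub>R One)) = (UNIV :: (real^3) set)"
      by (rule UN_box_eq_UNIV)
    show "emeasure ?M X = emeasure ?N X" if "X \<in> range (\<lambda>(a, b). box a b)" for X
    proof -
      from that obtain a b where "X = box a b" by force
      thus ?thesis using fin[of a b] by blast
    qed
    show "range (\<lambda>n. box (- (real n *\<^sub>R One)) (real n *\<^sub>R One)) \<subseteq> range (\<lambda>(a, b::real^3). box a b)"
      by force
    show "emeasure ?M (box (- (real n *\<^sub>R One)) (real n *\<^sub>R One)) \<noteq> \<infinity>" for n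
      using fin by blast
  qed simp
  hence "AE x in lborel. ennreal (f x) = ennreal (- f x)"
    by (intro sigma_finite_measure.density_unique[OF sigma_finite_lborel]) auto
  thus ?thesis
  proof eventually_elim
    fix x assume "ennreal (f x) = ennreal (- f x)"
    thus "f x = 0" by (cases "0 \<le> f x") (auto simp: ennreal_neg ennreal_eq_0_iff dest: sym)
  qed
qed

text \<open>Bumps are test functions that converge to indicators of boxes and are dominated by them,
  so the integral of \<open>f\<close> over every box vanishes. The measure argument is carried out
  for a Borel representative.\<close>

lemma fundamental_lemma_real:
  fixes f :: "real^3 \<Rightarrow> real"
  assumes int: "\<And>K. compact K \<Longrightarrow> set_integrable lebesgue K f"
    and zero: "\<And>\<phi>. test_function \<phi> \<Longrightarrow> (\<integral>x. \<phi> x * f x \<partial>lebesgue) = 0"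
  shows "AE x in lebesgue. f x = 0"
proof -
  have f: "f \<in> borel_measurable lebesgue"
  proof (rule borel_measurable_LIMSEQ_real)
    show "(\<lambda>n. indicator (cball 0 (real n)) x *\<^sub>R f x) \<longlonglongrightarrow> f x" for x
    proof (rule tendsto_eventually)
      obtain N where "norm x \<le> real N" using real_arch_simple by blast
      thus "\<forall>\<^sub>F n in sequentially. indicator (cball 0 (real n)) x *\<^sub>R f x = f x"
        by (intro eventually_sequentiallyI[of N]) (auto simp: indicator_def)
    qed
    show "(\<lambda>x. indicator (cball 0 (real n)) x *\<^sub>R f x) \<in> borel_measurable lebesgue" for n
      using int[of "cball 0 (real n)"] by (auto simp: set_integrable_def)
  qed
  have box_int: "integrable lebesgue (\<lambda>x. indicator (box a b) x *\<^sub>R f x)" for a b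
    using set_integrable_subset[OF int[of "cbox a b"], of "box a b"] box_subset_cbox[of a b]
    by (auto simp: set_integrable_def)
  have box_zero: "(\<integral>x. indicator (box a b) x *\<^sub>R f x \<partial>lebesgue) = 0" for a b
  proof -
    have "(\<lambda>n. \<integral>x. bump (1 / real (Suc n)) a b x * f x \<partial>lebesgue) \<longlonglongrightarrow>
        (\<integral>x. indicator (box a b) x *\<^sub>R f x \<partial>lebesgue)"
    proof (rule integral_dominated_convergence[where w = "\<lambda>x. norm (indicator (box a b) x *\<^sub>R f x)"])
      show "(\<lambda>x. indicator (box a b) x *\<^sub>R f x) \<in> borel_measurable lebesgue"
        using box_int by (rule borel_measurable_integrable)
      show "(\<lambda>x. bump (1 / real (Suc n)) a b x * f x) \<in> borel_measurable lebesgue" for n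
      proof -
        have "continuous_on UNIV (bump (1 / real (Suc n)) a b)"
          using test_function_bump[of "1 / real (Suc n)" a b] by (auto simp: test_function_def intro: Ck_continuous)
        hence "bump (1 / real (Suc n)) a b \<in> borel_measurable lebesgue"
          by (intro measurable_completion) (simp add: borel_measurable_continuous_onI)
        with f show ?thesis by measurable
      qed
      show "integrable lebesgue (\<lambda>x. norm (indicator (box a b) x *\<^sub>R f x))" using box_int by (rule integrable_norm)
      show "AE x in lebesgue. (\<lambda>n. bump (1 / real (Suc n)) a b x * f x) \<longlonglongrightarrow> indicator (box a b) x *\<^sub>R f x"
        unfolding real_scaleR_def by (intro AE_I2 tendsto_mult bump_tendsto tendsto_const)
      show "AE x in lebesgue. norm (bump (1 / real (Suc n)) a b x * f x) \<le> norm (indicator (box a b) x *\<^sub>R f x)" for n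
      proof (rule AE_I2)
        fix x
        have "bump (1 / real (Suc n)) a b x \<le> indicator (box a b) x"
          using bump_le_1[of "1 / real (Suc n)" a b x] bump_outside[of x a b] by (auto split: split_indicator)
        thus "norm (bump (1 / real (Suc n)) a b x * f x) \<le> norm (indicator (box a b) x *\<^sub>R f x)"
          using bump_nonneg by (auto simp: abs_mult intro!: mult_right_mono)
      qed
    qed
    moreover have "(\<integral>x. bump (1 / real (Suc n)) a b x * f x \<partial>lebesgue) = 0" for n
      by (intro zero test_function_bump) simp
    ultimately show ?thesis by (simp add: LIMSEQ_const_iff)
  qed
  obtain f' where f': "f' \<in> borel_measurable lborel" "AE x in lborel. f x = f' x"
    using completion_ex_borel_measurable_real[OF f] by blast
  hence f'm [measurable]: "f' \<in> borel_measurable borel" by simp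
  have ae: "AE x in lebesgue. f x = f' x" using f'(2) by (rule AE_completion)
  have "AE x in lborel. f' x = 0"
  proof (rule AE_zero_if_box_integrals_zero)
    fix a b
    have m: "(\<lambda>x. indicator (box a b) x *\<^sub>R f' x) \<in> borel_measurable lborel" by measurable
    have ae': "AE x in lebesgue. indicator (box a b) x *\<^sub>R f x = indicator (box a b) x *\<^sub>R f' x"
      using ae by eventually_elim simp
    have "integrable lebesgue (\<lambda>x. indicator (box a b) x *\<^sub>R f' x)"
      by (rule integrable_cong_AE_imp[OF box_int[of a b]])
         (use measurable_completion[OF m] ae' in \<open>auto elim: eventually_mono\<close>)
    thus "set_integrable lborel (box a b) f'"
      unfolding set_integrable_def using integrable_completion[OF m] by simp
    have "(\<integral>x. indicator (box a b) x *\<^sub>R f' x \<partial>lborel) = (\<integral>x. indicator (box a b) x *\<^sub>R f' x \<partial>lebesgue)"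
      by (rule integral_completion[OF m, symmetric])
    also have "\<dots> = (\<integral>x. indicator (box a b) x *\<^sub>R f x \<partial>lebesgue)"
      by (rule integral_cong_AE) (use measurable_completion[OF m] box_int ae' in \<open>auto elim: eventually_mono\<close>)
    finally show "(\<integral>x\<in>box a b. f' x \<partial>lborel) = 0" by (simp only: set_lebesgue_integral_def box_zero)
  qed measurable
  hence "AE x in lebesgue. f' x = 0" by (rule AE_completion)
  with ae show ?thesis by eventually_elim simp
qed

section \<open>Weak gradients and the form domain\<close>

lemma test_function_bounds:
  assumes "test_function \<phi>"
  obtains K B where "compact K" "0 \<le> B"
    "\<And>x. x \<notin> K \<Longrightarrow> \<phi> x = 0" "\<And>i x. x \<notin> K \<Longrightarrow> partial_deriv i \<phi> x = 0"
    "\<And>x. \<bar>\<phi> x\<bar> \<le> B" "\<And>i x. \<bar>partial_deriv i \<phi> x\<bar> \<le> B"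
    "continuous_on UNIV \<phi>" "\<And>i. continuous_on UNIV (partial_deriv i \<phi>)" "\<And>x. \<phi> differentiable (at x)"
proof -
  define K where "K = closure {x. \<phi> x \<noteq> 0}"
  have K: "compact K" using assms by (simp add: test_function_def K_def)
  have C: "Ck n \<phi>" for n using assms by (simp add: test_function_def)
  have zero: "\<phi> x = 0" if "x \<notin> K" for x using that closure_subset[of "{x. \<phi> x \<noteq> 0}"] by (auto simp: K_def)
  have cont: "continuous_on UNIV \<phi>" by (rule Ck_continuous[OF C])
  have cont': "continuous_on UNIV (partial_deriv i \<phi>)" for i using C[of "Suc 0"] by simp
  have diff: "\<phi> differentiable (at x)" for x using C[of "Suc 0"] by (simp add: differentiable_on_def)
  have zero': "partial_deriv i \<phi> x = 0" if "x \<notin> K" for i x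
  proof -
    have "(\<phi> has_derivative (\<lambda>h. 0)) (at x)"
    proof (rule has_derivative_transform_within_open)
      show "((\<lambda>x. 0) has_derivative (\<lambda>h. 0)) (at x)" by simp
      show "open (- K)" using K by (simp add: compact_imp_closed open_Compl)
    qed (use that zero in auto)
    thus ?thesis by (subst partial_deriv_eq) auto
  qed
  have bdd: "\<exists>B\<ge>0. \<forall>x. \<bar>f x\<bar> \<le> B" if f: "continuous_on UNIV f" "\<And>x. x \<notin> K \<Longrightarrow> f x = 0" for f :: "real^3 \<Rightarrow> real"
  proof -
    have "bounded (f ` K)" using f(1) K by (intro compact_imp_bounded compact_continuous_image) (auto intro: continuous_on_subset)
    then obtain B where "\<And>x. x \<in> K \<Longrightarrow> norm (f x) \<le> B" by (auto simp: bounded_iff)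
    hence "\<bar>f x\<bar> \<le> max B 0" for x using f(2)[of x] by (cases "x \<in> K") (auto simp: le_max_iff_disj)
    thus ?thesis by (intro exI[of _ "max B 0"]) auto
  qed
  obtain B0 where B0: "0 \<le> B0" "\<And>x. \<bar>\<phi> x\<bar> \<le> B0" using bdd[OF cont zero] by blast
  have "\<exists>B\<ge>0. \<forall>x. \<bar>partial_deriv i \<phi> x\<bar> \<le> B" for i by (rule bdd[OF cont' zero'])
  then obtain B1 where B1: "\<And>i. 0 \<le> B1 i" "\<And>i x. \<bar>partial_deriv i \<phi> x\<bar> \<le> B1 i" by metis
  define B where "B = B0 + (\<Sum>i\<in>UNIV. B1 i)"
  have sum: "0 \<le> (\<Sum>i\<in>UNIV. B1 i)" "B1 i \<le> (\<Sum>i\<in>UNIV. B1 i)" for i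
    using B1 by (auto intro!: sum_nonneg member_le_sum)
  have "\<bar>\<phi> x\<bar> \<le> B" for x using B0(2)[of x] sum(1) by (simp add: B_def)
  moreover have "\<bar>partial_deriv i \<phi> x\<bar> \<le> B" for i x using B1(2)[of i x] sum(2)[of i] B0(1) by (simp add: B_def)
  ultimately show ?thesis using B0(1) sum(1) by (intro that[OF K, of B]) (auto simp: B_def zero zero' cont cont' diff)
qed

lemma continuous_lebesgue_measurable:
  fixes f :: "real^3 \<Rightarrow> 'a::{second_countable_topology, real_normed_vector}"
  shows "continuous_on UNIV f \<Longrightarrow> f \<in> borel_measurable lebesgue"
  by (rule measurable_completion) (simp add: borel_measurable_continuous_onI)

lemma integrable_compact_mult:
  fixes u :: "real^3 \<Rightarrow> 'a::{banach, second_countable_topology}"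
  assumes u: "set_integrable lebesgue K u" and f: "continuous_on UNIV f" "\<And>x. \<bar>f x\<bar> \<le> B" "\<And>x. x \<notin> K \<Longrightarrow> f x = 0"
  shows "integrable lebesgue (\<lambda>x. f x *\<^sub>R u x)"
proof (rule Bochner_Integration.integrable_bound)
  let ?v = "\<lambda>x. indicator K x *\<^sub>R u x"
  have v: "integrable lebesgue ?v" using u by (simp add: set_integrable_def)
  thus "integrable lebesgue (\<lambda>x. B * norm (?v x))" by (intro integrable_mult_right integrable_norm)
  have eq: "f x *\<^sub>R u x = f x *\<^sub>R ?v x" for x using f(3)[of x] by (cases "x \<in> K") auto
  show "(\<lambda>x. f x *\<^sub>R u x) \<in> borel_measurable lebesgue"
    unfolding eq using v continuous_lebesgue_measurable[OF f(1)] by measurable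
  show "AE x in lebesgue. norm (f x *\<^sub>R u x) \<le> norm (B * norm (?v x))"
  proof (rule AE_I2)
    fix x
    have "norm (f x *\<^sub>R u x) \<le> B * norm (?v x)"
      unfolding eq norm_scaleR using f(2)[of x] by (intro mult_right_mono) auto
    thus "norm (f x *\<^sub>R u x) \<le> norm (B * norm (?v x))" by simp
  qed
qed

lemma fundamental_lemma_complex:
  fixes f :: "real^3 \<Rightarrow> complex"
  assumes int: "\<And>K. compact K \<Longrightarrow> set_integrable lebesgue K f"
    and zero: "\<And>\<phi>. test_function \<phi> \<Longrightarrow> (\<integral>x. \<phi> x *\<^sub>R f x \<partial>lebesgue) = 0"
  shows "AE x in lebesgue. f x = 0"
proof -
  have int\<phi>: "integrable lebesgue (\<lambda>x. \<phi> x *\<^sub>R f x)" if \<phi>: "test_function \<phi>" for \<phi>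
  proof -
    obtain K B where "compact K" "\<And>x. x \<notin> K \<Longrightarrow> \<phi> x = 0" "\<And>x. \<bar>\<phi> x\<bar> \<le> B" "continuous_on UNIV \<phi>"
      by (rule test_function_bounds[OF \<phi>]) blast
    thus ?thesis using integrable_compact_mult[OF int] by blast
  qed
  have proj: "AE x in lebesgue. T (f x) = 0" if T: "bounded_linear T" for T :: "complex \<Rightarrow> real"
  proof (rule fundamental_lemma_real)
    interpret T: bounded_linear T by (rule T)
    show "set_integrable lebesgue K (\<lambda>x. T (f x))" if "compact K" for K
      using integrable_bounded_linear[OF T int[OF that, unfolded set_integrable_def]]
      by (simp add: set_integrable_def T.scaleR)
    show "(\<integral>x. \<phi> x * T (f x) \<partial>lebesgue) = 0" if "test_function \<phi>" for \<phi>
      using integral_bounded_linear[OF T int\<phi>[OF that]] zero[OF that] by (simp add: T.scaleR T.zero)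
  qed
  from proj[OF bounded_linear_Re] proj[OF bounded_linear_Im] show ?thesis
    by eventually_elim (simp add: complex_eq_iff)
qed

lemma L2_indicator_compact: "compact K \<Longrightarrow> (indicator K :: real^3 \<Rightarrow> real) \<in> L2"
proof (rule L2_if_nn_integral)
  assume K: "compact K"
  hence m: "K \<in> sets lborel" by (simp add: borel_compact)
  show "indicator K \<in> borel_measurable lebesgue" using m by (intro measurable_completion) simp
  have "(\<integral>\<^sup>+x. ennreal ((norm (indicator K x :: real))\<^sup>2) \<partial>lebesgue) = (\<integral>\<^sup>+x. indicator K x \<partial>lborel)"
    by (subst nn_integral_completion, intro nn_integral_cong) (auto split: split_indicator)
  also have "\<dots> = emeasure lborel K" using m by simp
  also have "\<dots> < \<infinity>" using emeasure_bounded_finite[OF compact_imp_bounded[OF K]] by simp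
  finally show "(\<integral>\<^sup>+x. ennreal ((norm (indicator K x :: real))\<^sup>2) \<partial>lebesgue) < \<infinity>" .
qed

lemma L2_set_integrable:
  fixes u :: "real^3 \<Rightarrow> 'a::{banach, second_countable_topology}"
  assumes "u \<in> L2" "compact K"
  shows "set_integrable lebesgue K u"
  unfolding set_integrable_def
proof (rule integrable_mult_L2[OF assms(1) L2_indicator_compact[OF assms(2)]])
  show "(\<lambda>x. indicat_real K x *\<^sub>R u x) \<in> borel_measurable lebesgue"
    using assms(1) L2_measurable[OF L2_indicator_compact[OF assms(2)]] by measurable
qed (auto split: split_indicator)

lemma L2_test_function:
  assumes "test_function \<phi>"
  shows "\<phi> \<in> L2" "partial_deriv i \<phi> \<in> L2"
proof -
  obtain K B where K: "compact K" "0 \<le> B"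
    "\<And>x. x \<notin> K \<Longrightarrow> \<phi> x = 0" "\<And>i x. x \<notin> K \<Longrightarrow> partial_deriv i \<phi> x = 0"
    "\<And>x. \<bar>\<phi> x\<bar> \<le> B" "\<And>i x. \<bar>partial_deriv i \<phi> x\<bar> \<le> B"
    "continuous_on UNIV \<phi>" "\<And>i. continuous_on UNIV (partial_deriv i \<phi>)"
    by (rule test_function_bounds[OF assms]) blast
  have "f \<in> L2" if f: "continuous_on UNIV f" "\<And>x. \<bar>f x\<bar> \<le> B" "\<And>x. x \<notin> K \<Longrightarrow> f x = 0" for f :: "real^3 \<Rightarrow> real"
  proof (rule L2_if_bounded[OF continuous_lebesgue_measurable[OF f(1)]])
    show "integrable lebesgue (\<lambda>x. B\<^sup>2 * (norm (indicator K x :: real))\<^sup>2)"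
      by (intro integrable_mult_right L2_integrable_sq L2_indicator_compact K)
    show "AE x in lebesgue. (norm (f x))\<^sup>2 \<le> B\<^sup>2 * (norm (indicator K x :: real))\<^sup>2"
    proof (rule AE_I2)
      fix x
      have "\<bar>f x\<bar>\<^sup>2 \<le> B\<^sup>2" using f(2)[of x] by (intro power_mono) auto
      thus "(norm (f x))\<^sup>2 \<le> B\<^sup>2 * (norm (indicator K x :: real))\<^sup>2" using f(3)[of x] by (cases "x \<in> K") auto
    qed
  qed
  with K show "\<phi> \<in> L2" "partial_deriv i \<phi> \<in> L2" by blast+
qed

lemma weak_gradientD:
  assumes "weak_gradient u G" "test_function \<phi>"
  shows "(\<integral>x. partial_deriv i \<phi> x *\<^sub>R u x \<partial>lebesgue) = - (\<integral>x. \<phi> x *\<^sub>R (G x $ i) \<partial>lebesgue)"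
    and "integrable lebesgue (\<lambda>x. partial_deriv i \<phi> x *\<^sub>R u x)"
    and "integrable lebesgue (\<lambda>x. \<phi> x *\<^sub>R (G x $ i))"
proof -
  obtain K B where K: "compact K" "0 \<le> B"
    "\<And>x. x \<notin> K \<Longrightarrow> \<phi> x = 0" "\<And>i x. x \<notin> K \<Longrightarrow> partial_deriv i \<phi> x = 0"
    "\<And>x. \<bar>\<phi> x\<bar> \<le> B" "\<And>i x. \<bar>partial_deriv i \<phi> x\<bar> \<le> B"
    "continuous_on UNIV \<phi>" "\<And>i. continuous_on UNIV (partial_deriv i \<phi>)"
    by (rule test_function_bounds[OF assms(2)]) blast
  show "(\<integral>x. partial_deriv i \<phi> x *\<^sub>R u x \<partial>lebesgue) = - (\<integral>x. \<phi> x *\<^sub>R (G x $ i) \<partial>lebesgue)"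
    using assms by (simp add: weak_gradient_def)
  have loc: "set_integrable lebesgue K u" "set_integrable lebesgue K G"
    using assms(1) K(1) by (auto simp: weak_gradient_def)
  show "integrable lebesgue (\<lambda>x. partial_deriv i \<phi> x *\<^sub>R u x)"
    by (rule integrable_compact_mult[OF loc(1) K(8,6,4)])
  have "integrable lebesgue (\<lambda>x. (\<phi> x *\<^sub>R G x) $ i)"
    by (rule integrable_bounded_linear[OF bounded_linear_vec_nth integrable_compact_mult[OF loc(2) K(7,5,3)]])
  thus "integrable lebesgue (\<lambda>x. \<phi> x *\<^sub>R (G x $ i))" by simp
qed

lemma weak_gradient_unique:
  assumes "weak_gradient u G" "weak_gradient u G'"
  shows "AE x in lebesgue. G x = G' x"
proof -
  have "AE x in lebesgue. G x $ i - G' x $ i = 0" for i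
  proof (rule fundamental_lemma_complex)
    show "set_integrable lebesgue K (\<lambda>x. G x $ i - G' x $ i)" if "compact K" for K
    proof -
      have "set_integrable lebesgue K (\<lambda>x. H x $ i)" if "weak_gradient u H" for H
      proof -
        have "set_integrable lebesgue K H" using that \<open>compact K\<close> by (simp add: weak_gradient_def)
        from integrable_bounded_linear[OF bounded_linear_vec_nth this[unfolded set_integrable_def], of i]
        show ?thesis by (simp add: set_integrable_def)
      qed
      with assms show ?thesis by (intro set_integral_diff) auto
    qed
    show "(\<integral>x. \<phi> x *\<^sub>R (G x $ i - G' x $ i) \<partial>lebesgue) = 0" if "test_function \<phi>" for \<phi>
      using weak_gradientD[OF assms(1) that, of i] weak_gradientD[OF assms(2) that, of i]
      by (simp add: scaleR_diff_right)
  qed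
  hence "AE x in lebesgue. \<forall>i. G x $ i - G' x $ i = 0" by (subst AE_all_countable) auto
  thus ?thesis by eventually_elim (simp add: vec_eq_iff)
qed

lemma weak_gradient_add:
  assumes "weak_gradient u G" "weak_gradient w H"
  shows "weak_gradient (\<lambda>x. u x + w x) (\<lambda>x. G x + H x)"
  unfolding weak_gradient_def
proof (intro conjI allI impI)
  fix K :: "(real^3) set" assume "compact K"
  thus "set_integrable lebesgue K (\<lambda>x. u x + w x)" "set_integrable lebesgue K (\<lambda>x. G x + H x)"
    using assms by (auto simp: weak_gradient_def intro!: set_integral_add)
next
  fix \<phi> and i :: 3 assume "test_function \<phi>"
  from weak_gradientD[OF assms(1) this, of i] weak_gradientD[OF assms(2) this, of i]
  show "(\<integral>x. partial_deriv i \<phi> x *\<^sub>R (u x + w x) \<partial>lebesgue) = - (\<integral>x. \<phi> x *\<^sub>R ((G x + H x) $ i) \<partial>lebesgue)"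
    by (simp add: scaleR_add_right)
qed

lemma bounded_linear_vector_scalar: "bounded_linear (\<lambda>v::complex^3. c *s v)"
  unfolding linear_conv_bounded_linear[symmetric]
  by (auto intro!: linearI simp: vec_eq_iff algebra_simps)

lemma weak_gradient_mult:
  assumes "weak_gradient u G"
  shows "weak_gradient (\<lambda>x. c * u x) (\<lambda>x. c *s G x)"
  unfolding weak_gradient_def
proof (intro conjI allI impI)
  fix K :: "(real^3) set" assume "compact K"
  hence i: "set_integrable lebesgue K u" "set_integrable lebesgue K G"
    using assms by (auto simp: weak_gradient_def)
  show "set_integrable lebesgue K (\<lambda>x. c * u x)" by (rule set_integrable_mult_right) (rule i)
  interpret bounded_linear "\<lambda>v::complex^3. c *s v" by (rule bounded_linear_vector_scalar)
  from integrable_bounded_linear[OF bounded_linear_vector_scalar i(2)[unfolded set_integrable_def], of c]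
  show "set_integrable lebesgue K (\<lambda>x. c *s G x)" by (simp add: set_integrable_def scaleR)
next
  fix \<phi> and i :: 3 assume \<phi>: "test_function \<phi>"
  have "(\<integral>x. partial_deriv i \<phi> x *\<^sub>R (c * u x) \<partial>lebesgue) = c * (\<integral>x. partial_deriv i \<phi> x *\<^sub>R u x \<partial>lebesgue)"
    by (subst integral_mult_right_zero[symmetric]) (simp add: mult_scaleR_right)
  also have "\<dots> = - (c * (\<integral>x. \<phi> x *\<^sub>R (G x $ i) \<partial>lebesgue))" using weak_gradientD(1)[OF assms \<phi>, of i] by simp
  also have "c * (\<integral>x. \<phi> x *\<^sub>R (G x $ i) \<partial>lebesgue) = (\<integral>x. \<phi> x *\<^sub>R ((c *s G x) $ i) \<partial>lebesgue)"
    by (subst integral_mult_right_zero[symmetric]) (simp add: mult_scaleR_right)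
  finally show "(\<integral>x. partial_deriv i \<phi> x *\<^sub>R (c * u x) \<partial>lebesgue) = - (\<integral>x. \<phi> x *\<^sub>R ((c *s G x) $ i) \<partial>lebesgue)" .
qed

lemma weak_gradient_measurable:
  assumes "weak_gradient u G"
  shows "G \<in> borel_measurable lebesgue"
proof (rule borel_measurable_LIMSEQ_metric)
  show "(\<lambda>n. indicator (cball 0 (real n)) x *\<^sub>R G x) \<longlonglongrightarrow> G x" for x
  proof (rule tendsto_eventually)
    obtain N where "norm x \<le> real N" using real_arch_simple by blast
    thus "\<forall>\<^sub>F n in sequentially. indicator (cball 0 (real n)) x *\<^sub>R G x = G x"
      by (intro eventually_sequentiallyI[of N]) (auto simp: indicator_def)
  qed
  show "(\<lambda>x. indicator (cball 0 (real n)) x *\<^sub>R G x) \<in> borel_measurable lebesgue" for n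
    using assms by (auto simp: weak_gradient_def set_integrable_def dest!: spec[of _ "cball 0 (real n)"])
qed

lemma H1_I:
  assumes "u \<in> L2" "G \<in> L2" "weak_gradient u G"
  shows "u \<in> H1" "AE x in lebesgue. grad u x = G x"
proof -
  show "u \<in> H1" using assms by (auto simp: H1_def)
  have "weak_gradient u (grad u)" unfolding grad_def using someI[of "weak_gradient u", OF assms(3)] by simp
  thus "AE x in lebesgue. grad u x = G x" using assms(3) by (rule weak_gradient_unique)
qed

lemma H1_D:
  assumes "u \<in> H1"
  shows "u \<in> L2" "weak_gradient u (grad u)" "grad u \<in> L2"
proof -
  obtain G where G: "u \<in> L2" "weak_gradient u G" "G \<in> L2" using assms by (auto simp: H1_def)
  show "u \<in> L2" by (rule G)
  show wg: "weak_gradient u (grad u)" unfolding grad_def using someI[of "weak_gradient u", OF G(2)] by simp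
  show "grad u \<in> L2"
    by (rule L2_cong_AE[OF G(3) weak_gradient_measurable[OF wg] weak_gradient_unique[OF G(2) wg]])
qed

lemma H1_add:
  assumes "u \<in> H1" "w \<in> H1"
  shows "(\<lambda>x. u x + w x) \<in> H1" "AE x in lebesgue. grad (\<lambda>x. u x + w x) x = grad u x + grad w x"
proof -
  note U = H1_D[OF assms(1)] and W = H1_D[OF assms(2)]
  show "(\<lambda>x. u x + w x) \<in> H1" "AE x in lebesgue. grad (\<lambda>x. u x + w x) x = grad u x + grad w x"
    using H1_I[OF L2_add[OF U(1) W(1)] L2_add[OF U(3) W(3)] weak_gradient_add[OF U(2) W(2)]] .
qed

lemma norm_vector_scalar: "norm (c *s (v::complex^3)) = norm c * norm v"
  by (simp add: norm_vec_def norm_mult L2_set_right_distrib)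

lemma H1_mult:
  assumes "u \<in> H1"
  shows "(\<lambda>x. c * u x) \<in> H1" "AE x in lebesgue. grad (\<lambda>x. c * u x) x = c *s grad u x"
proof -
  have "(\<lambda>x. c *s grad u x) \<in> L2"
    by (rule L2_linear[OF H1_D(3)[OF assms], where C = "norm c"])
       (auto simp: norm_vector_scalar intro: borel_measurable_continuous_onI linear_continuous_on bounded_linear_vector_scalar)
  from H1_I[OF L2_mult[OF H1_D(1)[OF assms], of c] this weak_gradient_mult[OF H1_D(2)[OF assms]]]
  show "(\<lambda>x. c * u x) \<in> H1" "AE x in lebesgue. grad (\<lambda>x. c * u x) x = c *s grad u x" .
qed

lemma tendsto_integral_L2:
  fixes u :: "real^3 \<Rightarrow> 'a::euclidean_space"
  assumes f: "f \<in> L2" and u: "\<And>n. X n \<in> L2" "u \<in> L2" "(\<lambda>n. (L2_norm (\<lambda>x. X n x - u x))\<^sup>2) \<longlonglongrightarrow> 0"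
  shows "(\<lambda>n. \<integral>x. f x *\<^sub>R X n x \<partial>lebesgue) \<longlonglongrightarrow> (\<integral>x. f x *\<^sub>R u x \<partial>lebesgue)"
proof -
  have int: "integrable lebesgue (\<lambda>x. f x *\<^sub>R w x)" if "w \<in> L2" for w :: "real^3 \<Rightarrow> 'a"
    using f that by (intro integrable_mult_L2[OF f that]) auto
  have "(\<lambda>n. (\<integral>x. f x *\<^sub>R X n x \<partial>lebesgue) - (\<integral>x. f x *\<^sub>R u x \<partial>lebesgue)) \<longlonglongrightarrow> 0"
  proof (rule Lim_null_comparison)
    have "norm ((\<integral>x. f x *\<^sub>R X n x \<partial>lebesgue) - (\<integral>x. f x *\<^sub>R u x \<partial>lebesgue))
        \<le> L2_norm f * sqrt ((L2_norm (\<lambda>x. X n x - u x))\<^sup>2)" for n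
    proof -
      have D: "(\<lambda>x. X n x - u x) \<in> L2" using u by blast
      have "(\<integral>x. f x *\<^sub>R X n x \<partial>lebesgue) - (\<integral>x. f x *\<^sub>R u x \<partial>lebesgue) = (\<integral>x. f x *\<^sub>R (X n x - u x) \<partial>lebesgue)"
        using int[OF u(1)[of n]] int[OF u(2)] by (simp add: scaleR_diff_right)
      also have "norm \<dots> \<le> (\<integral>x. norm (f x *\<^sub>R (X n x - u x)) \<partial>lebesgue)" by (rule integral_norm_bound)
      also have "\<dots> = rip (\<lambda>x. \<bar>f x\<bar>) (\<lambda>x. norm (X n x - u x))" by (simp add: rip_def)
      also have "\<dots> \<le> L2_norm (\<lambda>x. \<bar>f x\<bar>) * L2_norm (\<lambda>x. norm (X n x - u x))"
        using abs_rip_le[OF L2_linear[OF f, of norm 1] L2_linear[OF D, of norm 1]] by simp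
      finally show ?thesis by (simp add: L2_norm_def)
    qed
    thus "\<forall>\<^sub>F n in sequentially. norm ((\<integral>x. f x *\<^sub>R X n x \<partial>lebesgue) - (\<integral>x. f x *\<^sub>R u x \<partial>lebesgue))
        \<le> L2_norm f * sqrt ((L2_norm (\<lambda>x. X n x - u x))\<^sup>2)" by simp
    show "(\<lambda>n. L2_norm f * sqrt ((L2_norm (\<lambda>x. X n x - u x))\<^sup>2)) \<longlonglongrightarrow> 0"
      using tendsto_mult[OF tendsto_const tendsto_real_sqrt[OF u(3)], of "L2_norm f"] by simp
  qed
  thus ?thesis by (simp add: LIM_zero_iff)
qed

lemma L2_norm_nth_le:
  fixes G :: "real^3 \<Rightarrow> complex^3"
  assumes "G \<in> L2"
  shows "(\<lambda>x. G x $ i) \<in> L2" "(L2_norm (\<lambda>x. G x $ i))\<^sup>2 \<le> (L2_norm G)\<^sup>2"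
proof -
  show L: "(\<lambda>x. G x $ i) \<in> L2"
    by (rule L2_linear[OF assms, where C = 1])
       (auto simp: Finite_Cartesian_Product.norm_nth_le
         intro: borel_measurable_continuous_onI linear_continuous_on bounded_linear_vec_nth)
  show "(L2_norm (\<lambda>x. G x $ i))\<^sup>2 \<le> (L2_norm G)\<^sup>2"
    unfolding L2_norm_sq
    by (intro integral_mono L2_integrable_sq L assms power_mono Finite_Cartesian_Product.norm_nth_le norm_ge_zero)
qed

text \<open>The gradient is a closed operator: test functions and their derivatives lie in
  \<open>L2\<close>, so both sides of the integration by parts are continuous along the two
  sequences.\<close>

lemma weak_gradient_limit:
  assumes X: "\<And>n. X n \<in> H1" and u: "u \<in> L2" "G \<in> L2"
    and lim: "(\<lambda>n. (L2_norm (\<lambda>x. X n x - u x))\<^sup>2) \<longlonglongrightarrow> 0" "(\<lambda>n. (L2_norm (\<lambda>x. grad (X n) x - G x))\<^sup>2) \<longlonglongrightarrow> 0"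
  shows "weak_gradient u G"
  unfolding weak_gradient_def
proof (intro conjI allI impI)
  fix \<phi> and i :: 3 assume \<phi>: "test_function \<phi>"
  have 1: "(\<lambda>n. \<integral>x. partial_deriv i \<phi> x *\<^sub>R X n x \<partial>lebesgue) \<longlonglongrightarrow> (\<integral>x. partial_deriv i \<phi> x *\<^sub>R u x \<partial>lebesgue)"
    by (rule tendsto_integral_L2[OF L2_test_function(2)[OF \<phi>] H1_D(1)[OF X] u(1) lim(1)])
  have "(\<lambda>n. (L2_norm (\<lambda>x. grad (X n) x $ i - G x $ i))\<^sup>2) \<longlonglongrightarrow> 0"
  proof (rule tendsto_sandwich[OF _ _ tendsto_const lim(2)])
    show "\<forall>\<^sub>F n in sequentially. (L2_norm (\<lambda>x. grad (X n) x $ i - G x $ i))\<^sup>2 \<le> (L2_norm (\<lambda>x. grad (X n) x - G x))\<^sup>2"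
      using L2_norm_nth_le(2)[OF L2_diff[OF H1_D(3)[OF X] u(2)], where i = i] by simp
  qed simp
  hence 2: "(\<lambda>n. \<integral>x. \<phi> x *\<^sub>R (grad (X n) x $ i) \<partial>lebesgue) \<longlonglongrightarrow> (\<integral>x. \<phi> x *\<^sub>R (G x $ i) \<partial>lebesgue)"
    by (intro tendsto_integral_L2 L2_test_function \<phi> L2_norm_nth_le u H1_D(3) X)
  have "(\<integral>x. partial_deriv i \<phi> x *\<^sub>R X n x \<partial>lebesgue) = - (\<integral>x. \<phi> x *\<^sub>R (grad (X n) x $ i) \<partial>lebesgue)" for n
    by (rule weak_gradientD(1)[OF H1_D(2)[OF X] \<phi>])
  with 1 have "(\<lambda>n. - (\<integral>x. \<phi> x *\<^sub>R (grad (X n) x $ i) \<partial>lebesgue)) \<longlonglongrightarrow> (\<integral>x. partial_deriv i \<phi> x *\<^sub>R u x \<partial>lebesgue)" by simp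
  thus "(\<integral>x. partial_deriv i \<phi> x *\<^sub>R u x \<partial>lebesgue) = - (\<integral>x. \<phi> x *\<^sub>R (G x $ i) \<partial>lebesgue)"
    using tendsto_minus[OF 2] by (rule LIMSEQ_unique)
qed (use u in \<open>auto intro: L2_set_integrable\<close>)

lemma L2_tendsto_AE_subseq:
  assumes "\<And>n. X n \<in> L2" "u \<in> L2" "(\<lambda>n. (L2_norm (\<lambda>x. X n x - u x))\<^sup>2) \<longlonglongrightarrow> 0"
  obtains r :: "nat \<Rightarrow> nat" where "strict_mono r" "AE x in lebesgue. (\<lambda>n. X (r n) x) \<longlonglongrightarrow> u x"
proof -
  have "\<exists>r::nat\<Rightarrow>nat. strict_mono r \<and> (AE x in lebesgue. (\<lambda>n. (norm (X (r n) x - u x))\<^sup>2) \<longlonglongrightarrow> 0)"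
    using assms L2_integrable_sq[OF L2_diff[OF assms(1,2)]]
    by (intro tendsto_L1_AE_subseq) (auto simp: L2_norm_sq)
  then obtain r :: "nat \<Rightarrow> nat" where r: "strict_mono r" "AE x in lebesgue. (\<lambda>n. (norm (X (r n) x - u x))\<^sup>2) \<longlonglongrightarrow> 0"
    by blast
  have "AE x in lebesgue. (\<lambda>n. X (r n) x) \<longlonglongrightarrow> u x"
    using r(2)
  proof eventually_elim
    fix x assume "(\<lambda>n. (norm (X (r n) x - u x))\<^sup>2) \<longlonglongrightarrow> 0"
    from tendsto_real_sqrt[OF this] have "(\<lambda>n. norm (X (r n) x - u x)) \<longlonglongrightarrow> 0" by simp
    thus "(\<lambda>n. X (r n) x) \<longlonglongrightarrow> u x" by (simp add: tendsto_norm_zero_iff LIM_zero_iff)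
  qed
  with r(1) show ?thesis by (rule that)
qed

text \<open>Multiplication by \<open>s\<close>, possibly unbounded, is a closed operator: along a
  common subsequence both sequences converge almost everywhere, and there the limits can be compared
  pointwise.\<close>

lemma L2_limit_mult:
  fixes u :: "real^3 \<Rightarrow> complex"
  assumes X: "\<And>n. X n \<in> L2" "u \<in> L2" "(\<lambda>n. (L2_norm (\<lambda>x. X n x - u x))\<^sup>2) \<longlonglongrightarrow> 0"
    and Y: "\<And>n. (\<lambda>x. s x *\<^sub>R X n x) \<in> L2" "F \<in> L2" "(\<lambda>n. (L2_norm (\<lambda>x. s x *\<^sub>R X n x - F x))\<^sup>2) \<longlonglongrightarrow> 0"
  shows "AE x in lebesgue. F x = s x *\<^sub>R u x"
proof -
  obtain r :: "nat \<Rightarrow> nat" where r: "strict_mono r" "AE x in lebesgue. (\<lambda>n. X (r n) x) \<longlonglongrightarrow> u x"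
    by (rule L2_tendsto_AE_subseq[OF X])
  have "(\<lambda>n. (L2_norm (\<lambda>x. s x *\<^sub>R X (r n) x - F x))\<^sup>2) \<longlonglongrightarrow> 0"
    using LIMSEQ_subseq_LIMSEQ[OF Y(3) r(1)] by (simp add: o_def)
  then obtain q :: "nat \<Rightarrow> nat" where q: "strict_mono q" "AE x in lebesgue. (\<lambda>n. s x *\<^sub>R X (r (q n)) x) \<longlonglongrightarrow> F x"
    by (rule L2_tendsto_AE_subseq[of "\<lambda>n x. s x *\<^sub>R X (r n) x", OF Y(1,2)])
  from r(2) q(2) show ?thesis
  proof eventually_elim
    fix x assume 1: "(\<lambda>n. X (r n) x) \<longlonglongrightarrow> u x" and 2: "(\<lambda>n. s x *\<^sub>R X (r (q n)) x) \<longlonglongrightarrow> F x"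
    have "(\<lambda>n. s x *\<^sub>R X (r (q n)) x) \<longlonglongrightarrow> s x *\<^sub>R u x"
      using LIMSEQ_subseq_LIMSEQ[OF 1 q(1)] by (intro tendsto_intros) (simp add: o_def)
    with 2 show "F x = s x *\<^sub>R u x" by (rule LIMSEQ_unique)
  qed
qed

section \<open>The form domain as a complete space\<close>

abbreviation wt :: "(real^3 \<Rightarrow> real) \<Rightarrow> real^3 \<Rightarrow> real" where
  "wt V x \<equiv> sqrt (pos_part V x)"

text \<open>The real inner product whose diagonal is the square of \<open>form_norm\<close>. It is
  the reference form for completeness and the norm in which minimizing sequences converge.\<close>

definition fip :: "(real^3 \<Rightarrow> real) \<Rightarrow> (real^3 \<Rightarrow> complex) \<Rightarrow> (real^3 \<Rightarrow> complex) \<Rightarrow> real" where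
  "fip V u w = rip u w + rip (grad u) (grad w) + rip (\<lambda>x. wt V x *\<^sub>R u x) (\<lambda>x. wt V x *\<^sub>R w x)"

lemma pos_part_nonneg [simp]: "0 \<le> pos_part V x" and neg_part_nonneg [simp]: "0 \<le> neg_part V x"
  by (auto simp: pos_part_def neg_part_def)

lemma pos_part_measurable [measurable]: "V \<in> borel_measurable lebesgue \<Longrightarrow> pos_part V \<in> borel_measurable lebesgue"
  unfolding pos_part_def[abs_def] by measurable

lemma neg_part_measurable [measurable]: "V \<in> borel_measurable lebesgue \<Longrightarrow> neg_part V \<in> borel_measurable lebesgue"
  unfolding neg_part_def[abs_def] by measurable

lemma fip_self: "fip V u u = (form_norm V u)\<^sup>2"
  by (simp add: fip_def form_norm_def H1_norm_def rip_self)

lemma rip_cong_AE: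
  assumes "AE x in lebesgue. u x = u' x" "AE x in lebesgue. w x = w' x"
    "u \<in> borel_measurable lebesgue" "u' \<in> borel_measurable lebesgue"
    "w \<in> borel_measurable lebesgue" "w' \<in> borel_measurable lebesgue"
  shows "rip u w = rip u' w'"
  unfolding rip_def
  by (rule integral_cong_AE) (use assms in \<open>auto elim: eventually_elim2\<close>)

lemma of_real_vector_scalar: "complex_of_real c *s v = c *\<^sub>R v"
  by (simp add: vec_eq_iff scaleR_conv_of_real[where 'a = complex])

lemma cnj_measurable [measurable]: "cnj \<in> borel_measurable borel"
  by (intro borel_measurable_continuous_onI continuous_intros)

lemma vec_nth_measurable [measurable]: "(\<lambda>v::complex^3. v $ i) \<in> borel_measurable borel"
  by (intro borel_measurable_continuous_onI linear_continuous_on bounded_linear_vec_nth)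

lemma H1_zero: "(\<lambda>x. 0) \<in> H1"
proof (rule H1_I)
  show "weak_gradient (\<lambda>x. 0) (\<lambda>x. 0)" by (simp add: weak_gradient_def set_integrable_def)
qed auto

lemma Re_L2_inner: 
  assumes "u \<in> L2" "w \<in> L2"
  shows "Re (L2_inner u w) = rip u w"
proof -
  note [measurable] = L2_measurable[OF assms(1)] L2_measurable[OF assms(2)]
  have "(\<lambda>x. cnj (u x) * w x) \<in> borel_measurable lebesgue" by measurable
  hence "integrable lebesgue (\<lambda>x. cnj (u x) * w x)"
    by (intro integrable_mult_L2[OF assms]) (auto simp: norm_mult)
  hence "Re (L2_inner u w) = (\<integral>x. Re (cnj (u x) * w x) \<partial>lebesgue)"
    unfolding L2_inner_def by (rule integral_Re[symmetric])
  thus ?thesis by (simp add: rip_def inner_complex_def)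
qed

lemma L2_inner_mult_left: "L2_inner (\<lambda>x. c * u x) w = cnj c * L2_inner u w"
  unfolding L2_inner_def by (subst integral_mult_right_zero[symmetric]) (simp add: mult_ac)

lemma L2_inner_mult_right: "L2_inner u (\<lambda>x. c * w x) = c * L2_inner u w"
  unfolding L2_inner_def by (subst integral_mult_right_zero[symmetric]) (simp add: mult_ac)

lemma L2_inner_cnj: "L2_inner w u = cnj (L2_inner u w)"
  using Bochner_Integration.integral_cnj[of lebesgue "\<lambda>x. cnj (u x) * w x"] by (simp add: L2_inner_def mult.commute)

lemma form_domain_D:
  assumes "V \<in> borel_measurable lebesgue" "u \<in> form_domain V"
  shows "u \<in> H1" "(\<lambda>x. wt V x *\<^sub>R u x) \<in> L2" "u \<in> L2" "grad u \<in> L2"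
proof -
  show u: "u \<in> H1" using assms(2) by (simp add: form_domain_def)
  show "u \<in> L2" "grad u \<in> L2" by (rule H1_D[OF u])+
  note [measurable] = L2_measurable[OF \<open>u \<in> L2\<close>]
  note assms(1)[measurable]
  show "(\<lambda>x. wt V x *\<^sub>R u x) \<in> L2"
    using assms(2) by (auto simp: L2_def form_domain_def power_mult_distrib)
qed

lemma form_domain_I:
  assumes "u \<in> H1" "(\<lambda>x. wt V x *\<^sub>R u x) \<in> L2"
  shows "u \<in> form_domain V"
  using assms L2_integrable_sq[OF assms(2)] by (auto simp: form_domain_def power_mult_distrib)

context
  fixes V :: "real^3 \<Rightarrow> real"
  assumes V [measurable]: "V \<in> borel_measurable lebesgue"
begin

lemma form_domain_add:
  assumes "u \<in> form_domain V" "w \<in> form_domain V"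
  shows "(\<lambda>x. u x + w x) \<in> form_domain V"
  using form_domain_D[OF V assms(1)] form_domain_D[OF V assms(2)]
    L2_add[of "\<lambda>x. wt V x *\<^sub>R u x" "\<lambda>x. wt V x *\<^sub>R w x"]
  by (intro form_domain_I H1_add) (auto simp: scaleR_add_right)

lemma form_domain_mult:
  assumes "u \<in> form_domain V"
  shows "(\<lambda>x. c * u x) \<in> form_domain V"
  using form_domain_D[OF V assms] L2_mult[of "\<lambda>x. wt V x *\<^sub>R u x" c]
  by (intro form_domain_I H1_mult) (auto simp: mult_scaleR_right)

lemma form_domain_scaleR: "u \<in> form_domain V \<Longrightarrow> (\<lambda>x. c *\<^sub>R u x) \<in> form_domain V"
  using form_domain_mult[of u "of_real c"] by (simp add: scaleR_conv_of_real)

lemma subspace_form_domain: "subspace (form_domain V)"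
  unfolding subspace_def
proof (intro conjI ballI allI)
  show "0 \<in> form_domain V" using H1_zero by (intro form_domain_I) (auto simp: zero_fun_def)
qed (auto simp: plus_fun_def scaleR_fun_def form_domain_add form_domain_scaleR)

lemma grad_add_AE: "\<lbrakk>u \<in> form_domain V; w \<in> form_domain V\<rbrakk> \<Longrightarrow>
    AE x in lebesgue. grad (u + w) x = (grad u + grad w) x"
  using H1_add(2) form_domain_D(1)[OF V] by (simp add: plus_fun_def)

lemma grad_scale_AE: "u \<in> form_domain V \<Longrightarrow> AE x in lebesgue. grad (c *\<^sub>R u) x = (c *\<^sub>R grad u) x"
  using H1_mult(2)[of u "of_real c"] form_domain_D(1)[OF V]
  by (simp add: scaleR_fun_def scaleR_conv_of_real of_real_vector_scalar)

lemma rip_grad_add: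
  assumes "u \<in> form_domain V" "w \<in> form_domain V" "z \<in> form_domain V"
  shows "rip (grad (u + w)) (grad z) = rip (grad u) (grad z) + rip (grad w) (grad z)"
proof -
  have uw: "u + w \<in> form_domain V" using assms subspace_form_domain by (intro subspace_add)
  note D = form_domain_D(4)[OF V]
  have "rip (grad (u + w)) (grad z) = rip (grad u + grad w) (grad z)"
    using grad_add_AE[OF assms(1,2)] D[OF uw] D[OF assms(1)] D[OF assms(2)] D[OF assms(3)]
      L2_measurable[OF L2.in_add[OF D[OF assms(1)] D[OF assms(2)]]]
    by (intro rip_cong_AE) auto
  thus ?thesis using D assms by (simp add: L2.bilin)
qed

lemma rip_grad_scale:
  assumes "u \<in> form_domain V" "z \<in> form_domain V"
  shows "rip (grad (c *\<^sub>R u)) (grad z) = c * rip (grad u) (grad z)"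
proof -
  have uw: "c *\<^sub>R u \<in> form_domain V" using assms subspace_form_domain by (intro subspace_scale)
  note D = form_domain_D(4)[OF V]
  have "rip (grad (c *\<^sub>R u)) (grad z) = rip (c *\<^sub>R grad u) (grad z)"
    using grad_scale_AE[OF assms(1)] D[OF uw] D[OF assms(1)] D[OF assms(2)]
      L2_measurable[OF L2.in_scale[OF D[OF assms(1)], of c]]
    by (intro rip_cong_AE) auto
  thus ?thesis using D assms by (simp add: L2.bilin)
qed

lemma psd_form_fip: "psd_form (form_domain V) (fip V)"
proof
  show "subspace (form_domain V)" by (rule subspace_form_domain)
  fix u w z and c :: real
  assume uz: "u \<in> form_domain V" "z \<in> form_domain V"
  note D = form_domain_D[OF V]
  have eq: "(\<lambda>x. wt V x *\<^sub>R (c *\<^sub>R u) x) = c *\<^sub>R (\<lambda>x. wt V x *\<^sub>R u x)" by (simp add: fun_eq_iff)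
  show "fip V (c *\<^sub>R u) z = c * fip V u z"
    using uz D[OF uz(1)] D[OF uz(2)] unfolding fip_def eq
    by (simp only: rip_grad_scale L2.scale_left) (simp add: algebra_simps)
  show "fip V u z = fip V z u" by (simp add: fip_def rip_def inner_commute)
  assume w: "w \<in> form_domain V"
  have eq: "(\<lambda>x. wt V x *\<^sub>R (u + w) x) = (\<lambda>x. wt V x *\<^sub>R u x) + (\<lambda>x. wt V x *\<^sub>R w x)"
    by (simp add: fun_eq_iff scaleR_add_right)
  show "fip V (u + w) z = fip V u z + fip V w z"
    using uz w D[OF uz(1)] D[OF uz(2)] D[OF w] unfolding fip_def eq
    by (simp only: rip_grad_add L2.add_left)
next
  show "0 \<le> fip V u u" for u by (simp add: fip_self)
qed

interpretation F: psd_form "form_domain V" "fip V" by (rule psd_form_fip)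

lemma norm_grad_diff:
  assumes "u \<in> form_domain V" "w \<in> form_domain V"
  shows "L2_norm (grad (u - w)) = L2_norm (\<lambda>x. grad u x - grad w x)"
proof -
  have "AE x in lebesgue. grad (u + (-1) *\<^sub>R w) x = grad u x - grad w x"
    using grad_add_AE[OF assms(1) F.in_scale[OF assms(2)], of "-1"] grad_scale_AE[OF assms(2), of "-1"]
    by eventually_elim simp
  moreover have "u + (-1) *\<^sub>R w = u - w" by simp
  ultimately have "AE x in lebesgue. grad (u - w) x = grad u x - grad w x" by simp
  moreover have "u - w \<in> form_domain V" using assms by auto
  ultimately show ?thesis
    using form_domain_D(4)[OF V] assms L2_diff[of "grad u" "grad w"] by (intro L2_norm_cong_AE) auto
qed

lemma fip_diff:
  assumes "u \<in> form_domain V" "w \<in> form_domain V"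
  shows "fip V (u - w) (u - w) = (L2_norm (\<lambda>x. u x - w x))\<^sup>2 + (L2_norm (\<lambda>x. grad u x - grad w x))\<^sup>2
    + (L2_norm (\<lambda>x. wt V x *\<^sub>R u x - wt V x *\<^sub>R w x))\<^sup>2"
  using norm_grad_diff[OF assms] by (simp add: fip_def rip_self fun_diff_def scaleR_diff_right)

text \<open>The functions, their gradients and their products with the root of the positive part
  converge separately in \<open>L2\<close>. Closedness of the gradient and of multiplication
  identifies the second and third limit with those of the first.\<close>

theorem complete_fip: "F.complete_form"
  unfolding F.complete_form_def
proof (intro allI impI)
  fix X assume X: "F.cauchy_seq X"
  hence XQ: "X n \<in> form_domain V" for n by (simp add: F.cauchy_seq_def)
  note D = form_domain_D[OF V XQ]
  have cauchy: "\<exists>N. \<forall>m\<ge>N. \<forall>n\<ge>N. fip V (X m - X n) (X m - X n) < e" if "0 < e" for e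
    using X that unfolding F.cauchy_seq_def by blast
  have transfer: "\<exists>N. \<forall>m\<ge>N. \<forall>n\<ge>N. f m n < e" if "0 < e" "\<And>m n. f m n \<le> fip V (X m - X n) (X m - X n)"
    for f :: "nat \<Rightarrow> nat \<Rightarrow> real" and e
    using cauchy[OF that(1)] that(2) by (meson le_less_trans)
  have "\<exists>u\<in>L2. (\<lambda>n. (L2_norm (\<lambda>x. X n x - u x))\<^sup>2) \<longlonglongrightarrow> 0"
    by (rule L2_complete[OF D(3)], rule transfer) (auto simp: fip_diff XQ)
  then obtain u where u: "u \<in> L2" "(\<lambda>n. (L2_norm (\<lambda>x. X n x - u x))\<^sup>2) \<longlonglongrightarrow> 0" by blast
  have "\<exists>G\<in>L2. (\<lambda>n. (L2_norm (\<lambda>x. grad (X n) x - G x))\<^sup>2) \<longlonglongrightarrow> 0"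
    by (rule L2_complete[OF D(4)], rule transfer) (auto simp: fip_diff XQ)
  then obtain G where G: "G \<in> L2" "(\<lambda>n. (L2_norm (\<lambda>x. grad (X n) x - G x))\<^sup>2) \<longlonglongrightarrow> 0" by blast
  have "\<exists>F\<in>L2. (\<lambda>n. (L2_norm (\<lambda>x. wt V x *\<^sub>R X n x - F x))\<^sup>2) \<longlonglongrightarrow> 0"
    by (rule L2_complete[OF D(2)], rule transfer) (auto simp: fip_diff XQ)
  then obtain F where F: "F \<in> L2" "(\<lambda>n. (L2_norm (\<lambda>x. wt V x *\<^sub>R X n x - F x))\<^sup>2) \<longlonglongrightarrow> 0" by blast
  have wg: "weak_gradient u G" by (rule weak_gradient_limit[OF D(1) u(1) G(1) u(2) G(2)])
  note H = H1_I[OF u(1) G(1) wg]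
  have Fu: "AE x in lebesgue. F x = wt V x *\<^sub>R u x" by (rule L2_limit_mult[OF D(3) u D(2) F])
  note um [measurable] = L2_measurable[OF u(1)]
  have wu: "(\<lambda>x. wt V x *\<^sub>R u x) \<in> L2" by (rule L2_cong_AE[OF F(1) _ Fu]) measurable
  have uQ: "u \<in> form_domain V" by (rule form_domain_I[OF H(1) wu])
  have eqG: "L2_norm (\<lambda>x. grad (X n) x - grad u x) = L2_norm (\<lambda>x. grad (X n) x - G x)" for n
    using H(2) D(4)[of n] G(1) H1_D(3)[OF H(1)] by (intro L2_norm_cong_AE) auto
  have eqF: "L2_norm (\<lambda>x. wt V x *\<^sub>R X n x - wt V x *\<^sub>R u x) = L2_norm (\<lambda>x. wt V x *\<^sub>R X n x - F x)" for n
    using Fu D(2)[of n] F(1) wu by (intro L2_norm_cong_AE) auto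
  have "(\<lambda>n. fip V (X n - u) (X n - u)) \<longlonglongrightarrow> 0 + 0 + 0"
    unfolding fip_diff[OF XQ uQ] eqG eqF by (intro tendsto_add u G F)
  with uQ show "\<exists>u\<in>form_domain V. (\<lambda>n. fip V (X n - u) (X n - u)) \<longlonglongrightarrow> 0" by auto
qed

end

section \<open>The spectral gap\<close>

text \<open>The real part of \<open>schrodinger_form\<close>. The potential enters through one
  integral; \<open>sform_eq\<close> splits it into the positive and negative parts.\<close>

definition sform :: "(real^3 \<Rightarrow> real) \<Rightarrow> (real^3 \<Rightarrow> complex) \<Rightarrow> (real^3 \<Rightarrow> complex) \<Rightarrow> real" where
  "sform V u w = rip (grad u) (grad w) + (\<integral>x. V x * (u x \<bullet> w x) \<partial>lebesgue)"

lemma hypothesis_A_D: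
  assumes "hypothesis_A V"
  obtains a b where "V \<in> borel_measurable lebesgue" "0 \<le> a" "a < 1" "0 \<le> b"
    "\<And>u. u \<in> H1 \<Longrightarrow> integrable lebesgue (\<lambda>x. neg_part V x * (norm (u x))\<^sup>2)"
    "\<And>u. u \<in> H1 \<Longrightarrow> (\<integral>x. neg_part V x * (norm (u x))\<^sup>2 \<partial>lebesgue)
          \<le> a * (L2_norm (grad u))\<^sup>2 + b * (L2_norm u)\<^sup>2"
proof -
  from assms obtain a b where ab: "0 \<le> a" "a < 1" "\<And>u. u \<in> H1 \<Longrightarrow>
        integrable lebesgue (\<lambda>x. neg_part V x * (norm (u x))\<^sup>2) \<and>
        (\<integral>x. neg_part V x * (norm (u x))\<^sup>2 \<partial>lebesgue) \<le> a * (L2_norm (grad u))\<^sup>2 + b * (L2_norm u)\<^sup>2"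
    unfolding hypothesis_A_def by blast
  show ?thesis
  \<comment> \<open>Enlarging \<open>b\<close> preserves the form bound; the absolute value makes
    the constant nonnegative.\<close>
  proof (rule that[of a "\<bar>b\<bar>"])
    fix u assume u: "u \<in> H1"
    have "b * (L2_norm u)\<^sup>2 \<le> \<bar>b\<bar> * (L2_norm u)\<^sup>2" by (intro mult_right_mono) auto
    with ab(3)[OF u] show "(\<integral>x. neg_part V x * (norm (u x))\<^sup>2 \<partial>lebesgue)
          \<le> a * (L2_norm (grad u))\<^sup>2 + \<bar>b\<bar> * (L2_norm u)\<^sup>2" by linarith
  qed (use assms ab in \<open>auto simp: hypothesis_A_def\<close>)
qed

lemma V_split: "V x = pos_part V x - neg_part V x"
  by (simp add: pos_part_def neg_part_def)

context
  fixes V :: "real^3 \<Rightarrow> real"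
  assumes A: "hypothesis_A V"
begin

lemma V_measurable: "V \<in> borel_measurable lebesgue"
  using A by (simp add: hypothesis_A_def)

interpretation F: psd_form "form_domain V" "fip V" by (rule psd_form_fip[OF V_measurable])

lemma neg_L2:
  assumes "u \<in> form_domain V"
  shows "(\<lambda>x. sqrt (neg_part V x) *\<^sub>R u x) \<in> L2"
proof -
  have u: "u \<in> H1" "u \<in> L2" using form_domain_D[OF V_measurable assms] by auto
  note [measurable] = V_measurable L2_measurable[OF u(2)]
  obtain a b where "integrable lebesgue (\<lambda>x. neg_part V x * (norm (u x))\<^sup>2)"
    using u(1) by (rule_tac hypothesis_A_D[OF A]) blast
  thus ?thesis by (auto simp: L2_def power_mult_distrib)
qed

lemma sform_eq:
  assumes "u \<in> form_domain V" "w \<in> form_domain V"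
  shows "integrable lebesgue (\<lambda>x. V x * (u x \<bullet> w x))"
    and "sform V u w = rip (grad u) (grad w) + rip (\<lambda>x. wt V x *\<^sub>R u x) (\<lambda>x. wt V x *\<^sub>R w x)
      - rip (\<lambda>x. sqrt (neg_part V x) *\<^sub>R u x) (\<lambda>x. sqrt (neg_part V x) *\<^sub>R w x)"
proof -
  let ?P = "\<lambda>u x. wt V x *\<^sub>R u x" and ?N = "\<lambda>u x. sqrt (neg_part V x) *\<^sub>R u x"
  have eq: "V x * (u x \<bullet> w x) = ?P u x \<bullet> ?P w x - ?N u x \<bullet> ?N w x" for x
    by (subst V_split) (simp add: mult.assoc[symmetric] algebra_simps)
  have i: "integrable lebesgue (\<lambda>x. ?P u x \<bullet> ?P w x)" "integrable lebesgue (\<lambda>x. ?N u x \<bullet> ?N w x)"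
    using integrable_inner_L2[OF form_domain_D(2)[OF V_measurable assms(1)] form_domain_D(2)[OF V_measurable assms(2)]]
      integrable_inner_L2[OF neg_L2[OF assms(1)] neg_L2[OF assms(2)]] .
  show "integrable lebesgue (\<lambda>x. V x * (u x \<bullet> w x))" unfolding eq using i by (rule Bochner_Integration.integrable_diff)
  show "sform V u w = rip (grad u) (grad w) + rip (?P u) (?P w) - rip (?N u) (?N w)"
    unfolding sform_def eq rip_def using i by simp
qed

lemma sym_form_sform: "sym_form (form_domain V) (sform V)"
proof
  show "subspace (form_domain V)" by (rule F.subsp)
  fix u w z and c :: real
  assume uz: "u \<in> form_domain V" "z \<in> form_domain V"
  show "sform V (c *\<^sub>R u) z = c * sform V u z"
    using rip_grad_scale[OF V_measurable uz, of c] by (simp add: sform_def algebra_simps)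
  show "sform V u z = sform V z u" by (simp add: sform_def rip_def inner_commute)
  assume w: "w \<in> form_domain V"
  show "sform V (u + w) z = sform V u z + sform V w z"
    using rip_grad_add[OF V_measurable uz(1) w uz(2)] sform_eq(1)[OF uz] sform_eq(1)[OF w uz(2)]
    by (simp add: sform_def algebra_simps)
qed

lemma sform_bounds:
  obtains a c where "0 < a" "0 \<le> c"
    "\<And>u. u \<in> form_domain V \<Longrightarrow> a * fip V u u \<le> sform V u u + c * rip u u"
    "\<And>u. u \<in> form_domain V \<Longrightarrow> rip u u \<le> sform V u u + c * rip u u"
    "\<And>u. u \<in> form_domain V \<Longrightarrow> sform V u u \<le> fip V u u"
proof -
  obtain a b where ab: "0 \<le> a" "a < 1" "0 \<le> b" "\<And>u. u \<in> H1 \<Longrightarrow>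
    (\<integral>x. neg_part V x * (norm (u x))\<^sup>2 \<partial>lebesgue) \<le> a * (L2_norm (grad u))\<^sup>2 + b * (L2_norm u)\<^sup>2"
    by (rule hypothesis_A_D[OF A]) blast
  have eq: "sform V u u = (L2_norm (grad u))\<^sup>2 + (L2_norm (\<lambda>x. wt V x *\<^sub>R u x))\<^sup>2
      - (\<integral>x. neg_part V x * (norm (u x))\<^sup>2 \<partial>lebesgue)" if "u \<in> form_domain V" for u
    by (simp add: sform_eq(2)[OF that that] rip_self L2_norm_sq power_mult_distrib)
  have fipeq: "fip V u u = (L2_norm u)\<^sup>2 + (L2_norm (grad u))\<^sup>2 + (L2_norm (\<lambda>x. wt V x *\<^sub>R u x))\<^sup>2" for u
    by (simp add: fip_def rip_self)
  show ?thesis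
  \<comment> \<open>Because \<open>a < 1\<close>, the fraction \<open>1 - a\<close> of the gradient
    term survives subtraction of the negative part. The shift \<open>1 + b\<close> compensates
    \<open>b\<close> and leaves one full copy of \<open>rip u u\<close>.\<close>
  proof (rule that[of "1 - a" "1 + b"])
    fix u assume u: "u \<in> form_domain V"
    have le: "(\<integral>x. neg_part V x * (norm (u x))\<^sup>2 \<partial>lebesgue) \<le> a * (L2_norm (grad u))\<^sup>2 + b * (L2_norm u)\<^sup>2"
      by (rule ab(4)) (rule form_domain_D[OF V_measurable u])
    have p: "0 \<le> a * (L2_norm (\<lambda>x. wt V x *\<^sub>R u x))\<^sup>2" "0 \<le> a * (L2_norm u)\<^sup>2"
      "0 \<le> (1 - a) * (L2_norm (grad u))\<^sup>2" "0 \<le> b * (L2_norm u)\<^sup>2" using ab by auto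
    have n: "0 \<le> (\<integral>x. neg_part V x * (norm (u x))\<^sup>2 \<partial>lebesgue)" by (intro Bochner_Integration.integral_nonneg) simp
    show "(1 - a) * fip V u u \<le> sform V u u + (1 + b) * rip u u"
      using le p by (simp add: eq[OF u] fipeq rip_self algebra_simps)
    show "rip u u \<le> sform V u u + (1 + b) * rip u u"
      using le p zero_le_power2[of "L2_norm (\<lambda>x. wt V x *\<^sub>R u x)"]
      unfolding eq[OF u] rip_self distrib_right left_diff_distrib mult_1 by linarith
    show "sform V u u \<le> fip V u u"
      using n zero_le_power2[of "L2_norm u"] unfolding eq[OF u] fipeq by linarith
  qed (use ab in auto)
qed

text \<open>The form is antilinear in its first argument, so replacing \<open>u\<close> by
  \<open>\<i> * u\<close> multiplies it by \<open>- \<i>\<close> and moves the imaginary part into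
  the real part.\<close>

lemma schrodinger_form_Re_Im:
  assumes u: "u \<in> form_domain V" and w: "w \<in> form_domain V"
  shows "Re (schrodinger_form V u w) = sform V u w"
    and "Im (schrodinger_form V u w) = sform V (\<lambda>x. \<i> * u x) w"
proof -
  note Du = form_domain_D[OF V_measurable u] and Dw = form_domain_D[OF V_measurable w]
  note [measurable] = L2_measurable[OF Du(3)] L2_measurable[OF Du(4)] L2_measurable[OF Dw(3)] L2_measurable[OF Dw(4)]
  let ?g = "\<lambda>x. \<Sum>i\<in>UNIV. cnj (grad u x $ i) * grad w x $ i"
  let ?v = "\<lambda>x. of_real (V x) * cnj (u x) * w x"
  have ig: "integrable lebesgue ?g"
  proof (rule Bochner_Integration.integrable_sum)
    fix i :: 3
    have "(\<lambda>x. cnj (grad u x $ i) * grad w x $ i) \<in> borel_measurable lebesgue" by measurable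
    thus "integrable lebesgue (\<lambda>x. cnj (grad u x $ i) * grad w x $ i)"
      by (intro integrable_mult_L2[OF L2_norm_nth_le(1)[OF Du(4), of i] L2_norm_nth_le(1)[OF Dw(4), of i]])
         (auto simp: norm_mult)
  qed
  have iv: "integrable lebesgue ?v"
  proof -
    have iu: "(\<lambda>x. \<i> * u x) \<in> form_domain V" by (rule form_domain_mult[OF V_measurable u])
    have "integrable lebesgue (\<lambda>x. complex_of_real (V x * (u x \<bullet> w x)) + \<i> * complex_of_real (V x * ((\<i> * u x) \<bullet> w x)))"
      by (intro Bochner_Integration.integrable_add integrable_mult_right integrable_of_real sform_eq(1) u w iu)
    also have "(\<lambda>x. complex_of_real (V x * (u x \<bullet> w x)) + \<i> * complex_of_real (V x * ((\<i> * u x) \<bullet> w x))) = ?v"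
      by (simp add: fun_eq_iff complex_eq_iff inner_complex_def algebra_simps)
    finally show ?thesis .
  qed
  have S: "schrodinger_form V u w = (\<integral>x. ?g x \<partial>lebesgue) + (\<integral>x. ?v x \<partial>lebesgue)"
    by (simp add: schrodinger_form_def)
  have "Re (\<integral>x. ?g x \<partial>lebesgue) = (\<integral>x. Re (?g x) \<partial>lebesgue)" using ig by (rule integral_Re[symmetric])
  moreover have "Re (\<integral>x. ?v x \<partial>lebesgue) = (\<integral>x. Re (?v x) \<partial>lebesgue)" using iv by (rule integral_Re[symmetric])
  ultimately show "Re (schrodinger_form V u w) = sform V u w"
    by (simp add: S sform_def rip_def inner_vec_def inner_complex_def algebra_simps)
  have "rip (grad (\<lambda>x. \<i> * u x)) (grad w) = rip (\<lambda>x. \<i> *s grad u x) (grad w)"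
  proof (rule rip_cong_AE)
    show "grad (\<lambda>x. \<i> * u x) \<in> borel_measurable lebesgue"
      by (rule L2_measurable[OF form_domain_D(4)[OF V_measurable form_domain_mult[OF V_measurable u]]])
    show "(\<lambda>x. \<i> *s grad u x) \<in> borel_measurable lebesgue"
      by (rule measurable_compose[OF _ borel_measurable_continuous_onI[OF linear_continuous_on[OF bounded_linear_vector_scalar]]]) measurable
  qed (use H1_mult(2)[OF Du(1)] in auto)
  also have "\<dots> = Im (\<integral>x. ?g x \<partial>lebesgue)"
  proof -
    have "Im (\<integral>x. ?g x \<partial>lebesgue) = (\<integral>x. Im (?g x) \<partial>lebesgue)" using ig by (rule integral_Im[symmetric])
    thus ?thesis by (simp add: rip_def inner_vec_def inner_complex_def algebra_simps)
  qed
  finally have "rip (grad (\<lambda>x. \<i> * u x)) (grad w) = Im (\<integral>x. ?g x \<partial>lebesgue)" .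
  moreover have "Im (\<integral>x. ?v x \<partial>lebesgue) = (\<integral>x. Im (?v x) \<partial>lebesgue)" using iv by (rule integral_Im[symmetric])
  ultimately show "Im (schrodinger_form V u w) = sform V (\<lambda>x. \<i> * u x) w"
    by (simp add: S sform_def inner_complex_def algebra_simps)
qed

text \<open>Testing the real identity with \<open>\<i> * w\<close> in place of \<open>w\<close>
  recovers the imaginary parts. Thus the complex operator is the graph attached to the real
  form.\<close>

lemma schrodinger_op_iff:
  "schrodinger_op V u h \<longleftrightarrow> u \<in> form_domain V \<and> h \<in> L2 \<and> (\<forall>w\<in>form_domain V. sform V w u = rip w h)"
proof -
  have "(\<forall>w\<in>form_domain V. schrodinger_form V w u = L2_inner w h) \<longleftrightarrow> (\<forall>w\<in>form_domain V. sform V w u = rip w h)"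
    if u: "u \<in> form_domain V" and h: "h \<in> L2"
  proof (intro iffI ballI)
    fix w assume w: "w \<in> form_domain V"
    note wL = form_domain_D(3)[OF V_measurable w]
    {
      assume "\<forall>w\<in>form_domain V. schrodinger_form V w u = L2_inner w h"
      thus "sform V w u = rip w h"
        using w schrodinger_form_Re_Im(1)[OF w u] Re_L2_inner[OF wL h] by simp
    }
    assume *: "\<forall>w\<in>form_domain V. sform V w u = rip w h"
    have iw: "(\<lambda>x. \<i> * w x) \<in> form_domain V" by (rule form_domain_mult[OF V_measurable w])
    have "Im (L2_inner w h) = Re (L2_inner (\<lambda>x. \<i> * w x) h)" by (simp add: L2_inner_mult_left)
    also have "\<dots> = rip (\<lambda>x. \<i> * w x) h" by (rule Re_L2_inner[OF L2_mult[OF wL] h])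
    also have "\<dots> = Im (schrodinger_form V w u)"
      using * iw schrodinger_form_Re_Im(2)[OF w u] by simp
    finally show "schrodinger_form V w u = L2_inner w h"
      using * w schrodinger_form_Re_Im(1)[OF w u] Re_L2_inner[OF wL h] by (simp add: complex_eq_iff)
  qed
  thus ?thesis unfolding schrodinger_op_def by blast
qed

end

lemma closed_form_sform:
  assumes A: "hypothesis_A V"
  obtains c where "0 \<le> c" "closed_form L2 rip (form_domain V) (sform V) c"
proof -
  obtain a c where ac: "0 < a" "0 \<le> c"
    "\<And>u. u \<in> form_domain V \<Longrightarrow> a * fip V u u \<le> sform V u u + c * rip u u"
    "\<And>u. u \<in> form_domain V \<Longrightarrow> rip u u \<le> sform V u u + c * rip u u"
    "\<And>u. u \<in> form_domain V \<Longrightarrow> sform V u u \<le> fip V u u"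
    by (rule sform_bounds[OF A]) blast
  note V = V_measurable[OF A]
  interpret F: psd_form "form_domain V" "fip V" by (rule psd_form_fip[OF V])
  interpret S: sym_form "form_domain V" "sform V" by (rule sym_form_sform[OF A])
  have sub: "form_domain V \<subseteq> L2" using form_domain_D(3)[OF V] by blast
  let ?B = "\<lambda>u w. sform V u w + c * rip u w"
  have psd: "psd_form (form_domain V) ?B"
  proof
    show "subspace (form_domain V)" by (rule S.subsp)
    fix u w z and t :: real
    assume uz: "u \<in> form_domain V" "z \<in> form_domain V"
    hence L: "u \<in> L2" "z \<in> L2" using sub by auto
    show "?B (t *\<^sub>R u) z = t * ?B u z"
      unfolding S.scale_left[OF uz] L2.scale_left[OF L] by (simp add: algebra_simps)
    show "?B u z = ?B z u" unfolding S.sym[OF uz] L2.sym[OF L] ..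
    assume w: "w \<in> form_domain V"
    hence Lw: "w \<in> L2" using sub by auto
    show "?B (u + w) z = ?B u z + ?B w z"
      unfolding S.add_left[OF uz(1) w uz(2)] L2.add_left[OF L(1) Lw L(2)] by (simp add: algebra_simps)
  next
    show "0 \<le> ?B u u" if "u \<in> form_domain V" for u
      using ac(4)[OF that] L2.nonneg[of u] sub that by (auto intro: order_trans)
  qed
  have rf: "rip u u \<le> fip V u u" for u by (simp add: fip_def rip_self)
  have "psd_form.complete_form (form_domain V) ?B"
  proof (rule F.complete_form_equiv[OF complete_fip[OF V] psd])
    show "fip V u u \<le> (1 / a) * ?B u u" if "u \<in> form_domain V" for u
      using ac(3)[OF that] ac(1) by (simp add: field_simps)
    show "?B u u \<le> (1 + c) * fip V u u" if "u \<in> form_domain V" for u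
      using ac(5)[OF that] mult_left_mono[OF rf ac(2), of u] by (simp add: algebra_simps)
  qed (use ac in simp)
  hence "closed_form L2 rip (form_domain V) (sform V) c"
    unfolding closed_form_def closed_form_axioms_def
    using L2.psd_form_axioms S.sym_form_axioms sub ac(4) by blast
  with ac(2) show ?thesis by (rule that)
qed

context
  fixes V :: "real^3 \<Rightarrow> real" and c :: real
  assumes A: "hypothesis_A V" and C: "closed_form L2 rip (form_domain V) (sform V) c"
begin

interpretation C: closed_form L2 rip "form_domain V" "sform V" c by (rule C)

lemma graph_iff: "C.graph u h \<longleftrightarrow> schrodinger_op V u h"
  unfolding C.graph_def schrodinger_op_iff[OF A] by blast

lemma real_shift: "h + s *\<^sub>R u = (\<lambda>x. h x + complex_of_real s * u x)"
  "h - s *\<^sub>R u = (\<lambda>x. h x - complex_of_real s * u x)"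
  by (simp_all add: fun_eq_iff scaleR_conv_of_real)

lemma regular_if_resolvent:
  assumes "complex_of_real s \<in> resolvent_set V"
  shows "C.regular s"
proof -
  obtain K where K: "\<And>u h. schrodinger_op V u h \<Longrightarrow> L2_norm u \<le> K * L2_norm (\<lambda>x. h x - of_real s * u x)"
    using assms unfolding resolvent_set_def by blast
  have "rip u u \<le> K\<^sup>2 * rip (h - s *\<^sub>R u) (h - s *\<^sub>R u)" if "schrodinger_op V u h" for u h
  proof -
    have "(L2_norm u)\<^sup>2 \<le> (K * L2_norm (\<lambda>x. h x - of_real s * u x))\<^sup>2"
      by (intro power_mono K that) simp
    thus ?thesis by (simp add: rip_self real_shift power_mult_distrib)
  qed
  moreover have "\<forall>h\<in>L2. \<exists>u. schrodinger_op V u (h + s *\<^sub>R u)"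
    using assms unfolding resolvent_set_def real_shift by blast
  ultimately show ?thesis unfolding C.regular_def graph_iff by blast
qed

lemma rip_i_mult: "u \<in> L2 \<Longrightarrow> rip u (\<lambda>x. \<i> * u x) = 0"
  by (simp add: rip_def inner_complex_def mult.commute)

text \<open>\<open>spectral_inf\<close> is an infimum of real parts, so a lower bound is required
  for all points of the spectrum, nonreal ones included; this half-plane supplies it. Existence is
  the skew Lax-Milgram argument, and the bound on the inverse comes from testing the equation with
  \<open>u\<close> itself.\<close>

lemma resolvent_left:
  assumes z: "Re z \<le> - c"
  shows "z \<in> resolvent_set V"
  unfolding resolvent_set_def
proof (intro CollectI conjI ballI)
  note D = form_domain_D[OF V_measurable[OF A]]
  fix h :: "real^3 \<Rightarrow> complex" assume h: "h \<in> L2"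
  have "\<exists>u\<in>form_domain V. \<forall>w\<in>form_domain V.
      sform V w u - Re z * rip w u - Im z * rip w (\<lambda>x. \<i> * u x) = rip w h"
  proof (rule C.solve_skew[OF z h])
    show "(\<lambda>x. \<i> * u x) \<in> form_domain V" if "u \<in> form_domain V" for u
      by (rule form_domain_mult[OF V_measurable[OF A] that])
    show "rip (\<lambda>x. \<i> * u x) w = - rip u (\<lambda>x. \<i> * w x)" for u w
      unfolding rip_def Bochner_Integration.integral_minus[symmetric]
      by (rule Bochner_Integration.integral_cong) (auto simp: inner_complex_def algebra_simps)
  qed (simp_all add: rip_def inner_complex_def fun_eq_iff algebra_simps)
  then obtain u where u: "u \<in> form_domain V"
    "\<And>w. w \<in> form_domain V \<Longrightarrow> sform V w u - Re z * rip w u - Im z * rip w (\<lambda>x. \<i> * u x) = rip w h"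
    by blast
  have iu: "(\<lambda>x. \<i> * u x) \<in> L2" using D(3)[OF u(1)] by (rule L2_mult)
  have zu: "(\<lambda>x. h x + z * u x) = h + Re z *\<^sub>R u + Im z *\<^sub>R (\<lambda>x. \<i> * u x)"
    by (simp add: fun_eq_iff complex_eq_iff)
  have "(\<lambda>x. h x + z * u x) \<in> L2" by (intro L2_add h L2_mult D(3) u(1))
  moreover have "sform V w u = rip w (\<lambda>x. h x + z * u x)" if w: "w \<in> form_domain V" for w
    unfolding zu using u(2)[OF w] D(3)[OF w] D(3)[OF u(1)] h iu by (simp add: L2.bilin)
  ultimately have "schrodinger_op V u (\<lambda>x. h x + z * u x)"
    unfolding schrodinger_op_iff[OF A] using u(1) by blast
  thus "\<exists>u. schrodinger_op V u (\<lambda>x. h x + z * u x)" by blast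
next
  note D = form_domain_D[OF V_measurable[OF A]]
  have "L2_norm u \<le> 1 * L2_norm (\<lambda>x. h x - z * u x)" if "schrodinger_op V u h" for u h
  proof -
  from that have u: "u \<in> form_domain V" "h \<in> L2" "sform V u u = rip u h"
    unfolding schrodinger_op_iff[OF A] by blast+
  note uL = D(3)[OF u(1)]
  have iu: "(\<lambda>x. \<i> * u x) \<in> L2" using uL by (rule L2_mult)
  let ?k = "\<lambda>x. h x - z * u x"
  have kL: "?k \<in> L2" by (intro L2_diff u L2_mult uL)
  have zu: "?k = h - Re z *\<^sub>R u - Im z *\<^sub>R (\<lambda>x. \<i> * u x)" by (simp add: fun_eq_iff complex_eq_iff)
  \<comment> \<open>The contribution of \<open>Im z\<close> drops out because \<open>u\<close> and
    \<open>\<i> * u\<close> are orthogonal for \<open>rip\<close>.\<close>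
  have "rip u ?k = sform V u u - Re z * rip u u"
    unfolding zu using uL u(2,3) iu rip_i_mult[OF uL] by (simp add: L2.bilin)
  hence "sform V u u + c * rip u u \<le> rip u ?k"
    using mult_right_mono[OF z, of "rip u u"] L2.nonneg[OF uL] by simp
  hence "rip u u \<le> rip u ?k" using C.coercive[OF u(1)] by simp
  also have "\<dots> \<le> L2_norm u * L2_norm ?k" using abs_rip_le[OF uL kL] by simp
  finally have "L2_norm u * L2_norm u \<le> L2_norm u * L2_norm ?k" by (simp add: rip_self power2_eq_square)
  thus "L2_norm u \<le> 1 * L2_norm ?k"
    using L2_norm_nonneg[of u] by (cases "L2_norm u = 0") (auto simp: mult_le_cancel_left)
  qed
  thus "\<exists>C. \<forall>u h. schrodinger_op V u h \<longrightarrow> L2_norm u \<le> C * L2_norm (\<lambda>x. h x - z * u x)" by blast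
qed

text \<open>A spectral point \<open>s\<close> would bound the infimum from above. This inference
  requires the set of real parts to be bounded below, since otherwise \<open>Inf\<close> carries no
  information.\<close>

lemma resolvent_below:
  assumes "s < spectral_inf V"
  shows "complex_of_real s \<in> resolvent_set V"
proof (rule ccontr)
  assume "complex_of_real s \<notin> resolvent_set V"
  hence "s \<in> Re ` spectrum V" unfolding spectrum_def by force
  moreover have "bdd_below (Re ` spectrum V)"
  proof (rule bdd_belowI)
    fix t assume "t \<in> Re ` spectrum V"
    then obtain z where "z \<notin> resolvent_set V" "t = Re z" unfolding spectrum_def by blast
    with resolvent_left[of z] show "- c \<le> t" by linarith
  qed
  ultimately have "spectral_inf V \<le> s" unfolding spectral_inf_def by (rule cInf_lower)
  with assms show False by simp
qed

end

text \<open>Isolation makes every real point within distance \<open>d\<close> above the bottom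
  regular, and simplicity reduces orthogonality to all eigenfunctions to orthogonality to
  \<open>uV\<close>. The gap \<gamma> is \<open>d / 2\<close>, as inherited from the abstract
  theorem.\<close>

theorem spectral_gap:
  assumes A: "hypothesis_A V" and B: "hypothesis_B V uV"
  obtains \<gamma> where "0 < \<gamma>"
    "\<And>u. u \<in> form_domain V \<Longrightarrow> spectral_inf V * rip u u \<le> sform V u u"
    "\<And>w. \<lbrakk>w \<in> form_domain V; L2_inner (\<lambda>x. of_real (uV x)) w = 0\<rbrakk> \<Longrightarrow>
      (spectral_inf V + \<gamma>) * rip w w \<le> sform V w w"
proof -
  obtain c where c: "closed_form L2 rip (form_domain V) (sform V) c"
    by (rule closed_form_sform[OF A]) blast
  interpret C: closed_form L2 rip "form_domain V" "sform V" c by (rule c)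
  define \<mu> where "\<mu> = spectral_inf V"
  have reg1: "C.regular s" if "s < \<mu>" for s
    using regular_if_resolvent[OF A c resolvent_below[OF A c]] that by (simp add: \<mu>_def)
  have "complex_of_real \<mu> isolated_in spectrum V" using B by (simp add: hypothesis_B_def \<mu>_def)
  then obtain T where T: "open T" "T \<inter> spectrum V = {complex_of_real \<mu>}" unfolding isolated_in_def by blast
  then obtain d where d: "0 < d" "ball (complex_of_real \<mu>) d \<subseteq> T"
    using openE[of T "complex_of_real \<mu>"] by blast
  have reg2: "C.regular s" if "\<mu> < s" "s < \<mu> + d" for s
  proof (rule regular_if_resolvent[OF A c])
    have "dist (complex_of_real \<mu>) (complex_of_real s) = \<bar>\<mu> - s\<bar>"
      unfolding dist_norm of_real_diff[symmetric] norm_of_real ..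
    hence "complex_of_real s \<in> T" using d(2) that by auto
    moreover have "complex_of_real s \<noteq> complex_of_real \<mu>" using that by simp
    ultimately have "complex_of_real s \<notin> spectrum V" using T(2) by blast
    thus "complex_of_real s \<in> resolvent_set V" by (simp add: spectrum_def)
  qed
  let ?\<psi> = "\<lambda>x. complex_of_real (uV x)"
  have ef: "eigenfunction V \<mu> ?\<psi>" using B by (simp add: hypothesis_B_def positive_ground_state_def \<mu>_def)
  hence \<psi>L: "?\<psi> \<in> L2" using form_domain_D(3)[OF V_measurable[OF A]]
    by (auto simp: eigenfunction_def schrodinger_op_def)
  show ?thesis
  proof (rule that[of "d / 2"])
    show "0 < d / 2" using d by simp
    show "spectral_inf V * rip u u \<le> sform V u u" if "u \<in> form_domain V" for u
      using C.form_ge_if_regular[OF reg1 that] by (simp add: \<mu>_def)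
    show "(spectral_inf V + d / 2) * rip w w \<le> sform V w w"
      if w: "w \<in> form_domain V" and orth: "L2_inner ?\<psi> w = 0" for w
      unfolding \<mu>_def[symmetric]
    proof (rule C.gap_form[OF d(1) reg1 reg2 w])
      fix k assume "C.graph k (\<mu> *\<^sub>R k)"
      hence k: "schrodinger_op V k (\<lambda>x. of_real \<mu> * k x)"
        by (simp add: graph_iff[OF A c] scaleR_fun_def scaleR_conv_of_real)
      hence kL: "k \<in> L2" using form_domain_D(3)[OF V_measurable[OF A]] by (auto simp: schrodinger_op_def)
      have wL: "w \<in> L2" by (rule form_domain_D(3)[OF V_measurable[OF A] w])
      have "\<exists>z. AE x in lebesgue. k x = z * ?\<psi> x"
      proof (cases "AE x in lebesgue. k x = 0")
        case True
        thus ?thesis by (intro exI[of _ 0]) simp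
      next
        case False
        with k have "eigenfunction V \<mu> k" by (simp add: eigenfunction_def)
        with ef B show ?thesis by (auto simp: hypothesis_B_def simple_eigenvalue_def \<mu>_def)
      qed
      then obtain z where z: "AE x in lebesgue. k x = z * ?\<psi> x" by blast
      have "rip k w = rip (\<lambda>x. z * ?\<psi> x) w"
        using z kL wL \<psi>L L2_mult[OF \<psi>L, of z] by (intro rip_cong_AE) auto
      also have "\<dots> = Re (cnj z * L2_inner ?\<psi> w)"
        using Re_L2_inner[OF L2_mult[OF \<psi>L] wL, of z] by (simp add: L2_inner_mult_left)
      finally show "rip k w = 0" using orth by simp
    qed
  qed
qed

section \<open>The Sobolev inequality\<close>

text \<open>Translations, joint measurability and Fubini are argued for Borel functions on the Borel
  measure; this lemma, applied coordinate by coordinate, provides the passage.\<close>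

lemma lebesgue_borel_representative:
  fixes f :: "real^3 \<Rightarrow> 'a::euclidean_space"
  assumes "f \<in> borel_measurable lebesgue"
  obtains g where "g \<in> borel_measurable borel" "AE x in lebesgue. f x = g x"
proof -
  have "\<exists>g\<in>borel_measurable lborel. AE x in lborel. f x \<bullet> b = g x" for b
    using assms by (intro completion_ex_borel_measurable_real) auto
  then obtain g where g: "\<And>b. g b \<in> borel_measurable lborel" "\<And>b. AE x in lborel. f x \<bullet> b = g b x"
    by metis
  have [measurable]: "g b \<in> borel_measurable borel" for b using g(1)[of b] by simp
  show ?thesis
  proof (rule that)
    show "(\<lambda>x. \<Sum>b\<in>Basis. g b x *\<^sub>R b) \<in> borel_measurable borel" by measurable
    have "AE x in lborel. \<forall>b\<in>Basis. f x \<bullet> b = g b x" using g(2) by (simp add: AE_finite_all)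
    hence "AE x in lborel. f x = (\<Sum>b\<in>Basis. g b x *\<^sub>R b)"
      by eventually_elim (metis (no_types, lifting) euclidean_representation sum.cong)
    thus "AE x in lebesgue. f x = (\<Sum>b\<in>Basis. g b x *\<^sub>R b)" by (rule AE_completion)
  qed
qed

lemma partial_deriv_translate:
  assumes "\<And>x. \<phi> differentiable (at x)"
  shows "partial_deriv i (\<lambda>x. \<phi> (x - c)) = (\<lambda>x. partial_deriv i \<phi> (x - c))"
    and "(\<lambda>x. \<phi> (x - c)) differentiable (at x)"
proof -
  have D: "((\<lambda>x. \<phi> (x - c)) has_derivative frechet_derivative \<phi> (at (x - c))) (at x)" for x
  proof -
    have 1: "((\<lambda>x. x - c) has_derivative (\<lambda>h. h)) (at x)" by (auto intro!: derivative_eq_intros)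
    have 2: "(\<phi> has_derivative frechet_derivative \<phi> (at (x - c))) (at (x - c))"
      using assms by (simp add: frechet_derivative_works)
    show ?thesis using has_derivative_compose[OF 1 2] .
  qed
  show "partial_deriv i (\<lambda>x. \<phi> (x - c)) = (\<lambda>x. partial_deriv i \<phi> (x - c))"
    by (rule ext, subst partial_deriv_eq[OF D]) (simp add: partial_deriv_def)
  show "(\<lambda>x. \<phi> (x - c)) differentiable (at x)" using D by (rule differentiableI)
qed

lemma Ck_translate: "Ck n \<phi> \<Longrightarrow> Ck n (\<lambda>x. \<phi> (x - c))"
proof (induction n arbitrary: \<phi>)
  case 0
  hence "continuous_on UNIV \<phi>" by simp
  hence "continuous_on UNIV (\<lambda>x. \<phi> (x - c))" by (rule continuous_on_compose2) (auto intro!: continuous_intros)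
  thus ?case by simp
next
  case (Suc n)
  hence "\<And>x. \<phi> differentiable (at x)" by (simp add: differentiable_on_def)
  with partial_deriv_translate[of \<phi>] Suc show ?case by (auto simp: differentiable_on_def)
qed

lemma test_function_translate:
  assumes "test_function \<phi>"
  shows "test_function (\<lambda>x. \<phi> (x - c))"
proof -
  have "{x. \<phi> (x - c) \<noteq> 0} = (+) c ` {x. \<phi> x \<noteq> 0}"
    by (auto simp: image_iff) (rule_tac x = "x - c" in exI, simp)
  hence "closure {x. \<phi> (x - c) \<noteq> 0} = (+) c ` closure {x. \<phi> x \<noteq> 0}" by (simp add: closure_translation)
  thus ?thesis using assms Ck_translate by (auto simp: test_function_def intro!: compact_translation)
qed

lemma nn_integral_affine_lborel:
  fixes f :: "real^3 \<Rightarrow> ennreal"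
  assumes [measurable]: "f \<in> borel_measurable borel" and s: "s \<noteq> 0"
  shows "(\<integral>\<^sup>+x. f x \<partial>lborel) = ennreal (\<bar>s\<bar>^3) * (\<integral>\<^sup>+x. f (t + s *\<^sub>R x) \<partial>lborel)"
  by (subst lborel_affine[OF s, of t], subst nn_integral_density)
     (auto simp: nn_integral_distr nn_integral_cmult ennreal_power)

lemma nn_integral_translate:
  fixes f :: "real^3 \<Rightarrow> ennreal"
  assumes "f \<in> borel_measurable borel"
  shows "(\<integral>\<^sup>+x. f (x + c) \<partial>lborel) = (\<integral>\<^sup>+x. f x \<partial>lborel)"
  using nn_integral_affine_lborel[OF assms, of 1 c] by (simp add: add.commute)

lemma integral_translate:
  fixes f :: "real^3 \<Rightarrow> 'b::{banach, second_countable_topology}"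
  assumes [measurable]: "f \<in> borel_measurable borel"
  shows "(\<integral>x. f (x + c) \<partial>lborel) = (\<integral>x. f x \<partial>lborel)"
proof -
  have "(\<integral>x. f x \<partial>lborel) = (\<integral>x. f x \<partial>distr lborel borel ((+) c))" by (simp add: lborel_distr_plus)
  also have "\<dots> = (\<integral>x. f (c + x) \<partial>lborel)" by (rule integral_distr) auto
  finally show ?thesis by (simp add: add.commute)
qed

lemma L2_translate:
  fixes f :: "real^3 \<Rightarrow> 'b::{banach, second_countable_topology}"
  assumes [measurable]: "f \<in> borel_measurable borel" and f: "f \<in> L2"
  shows "(\<lambda>x. f (x + c)) \<in> L2" "L2_norm (\<lambda>x. f (x + c)) = L2_norm f"
proof -
  have m: "(\<lambda>x. f (x + c)) \<in> borel_measurable lebesgue" by (rule measurable_completion) measurable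
  have eq: "(\<integral>\<^sup>+x. ennreal ((norm (f (x + c)))\<^sup>2) \<partial>lebesgue) = ennreal ((L2_norm f)\<^sup>2)"
    using nn_integral_translate[of "\<lambda>x. ennreal ((norm (f x))\<^sup>2)" c] nn_integral_sq_L2[OF f]
    by (simp add: nn_integral_completion)
  show L: "(\<lambda>x. f (x + c)) \<in> L2" by (rule L2_if_nn_integral[OF m]) (simp add: eq)
  have "(L2_norm (\<lambda>x. f (x + c)))\<^sup>2 = (L2_norm f)\<^sup>2" using nn_integral_sq_L2[OF L] eq by simp
  thus "L2_norm (\<lambda>x. f (x + c)) = L2_norm f" by (simp add: power2_eq_iff_nonneg)
qed

lemma nn_integral_mult_L2:
  fixes f :: "real^3 \<Rightarrow> 'b::{banach, second_countable_topology}"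
    and g :: "real^3 \<Rightarrow> 'c::{banach, second_countable_topology}"
  assumes "f \<in> L2" "g \<in> L2"
  shows "(\<integral>\<^sup>+x. ennreal (norm (f x) * norm (g x)) \<partial>lebesgue) \<le> ennreal (L2_norm f * L2_norm g)"
proof -
  have L: "(\<lambda>x. norm (f x)) \<in> L2" "(\<lambda>x. norm (g x)) \<in> L2"
    using L2_linear[OF assms(1), of norm 1] L2_linear[OF assms(2), of norm 1] by auto
  have "(\<integral>\<^sup>+x. ennreal (norm (f x) * norm (g x)) \<partial>lebesgue) = ennreal (rip (\<lambda>x. norm (f x)) (\<lambda>x. norm (g x)))"
    unfolding rip_def using integrable_inner_L2[OF L] by (subst nn_integral_eq_integral) auto
  also have "\<dots> \<le> ennreal (L2_norm (\<lambda>x. norm (f x)) * L2_norm (\<lambda>x. norm (g x)))"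
    using abs_rip_le[OF L] by (intro ennreal_leI) simp
  finally show ?thesis by (simp add: L2_norm_def)
qed

lemma Fubini_unit_interval:
  fixes f :: "real \<Rightarrow> real^3 \<Rightarrow> complex"
  assumes f [measurable]: "case_prod f \<in> borel_measurable (borel \<Otimes>\<^sub>M borel)"
    and bd: "\<And>t. t \<in> {0..1} \<Longrightarrow> (\<integral>\<^sup>+x. norm (f t x) \<partial>lborel) \<le> ennreal C"
  shows "(\<integral>x. (\<integral>t. indicator {0..1} t *\<^sub>R f t x \<partial>lborel) \<partial>lborel) =
      (\<integral>t. indicator {0..1} t *\<^sub>R (\<integral>x. f t x \<partial>lborel) \<partial>lborel)"
    and "integrable lborel (\<lambda>x. \<integral>t. indicator {0..1} t *\<^sub>R f t x \<partial>lborel)"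
proof -
  let ?g = "\<lambda>t x. indicator {0..1::real} t *\<^sub>R f t x"
  have m [measurable]: "case_prod ?g \<in> borel_measurable (lborel \<Otimes>\<^sub>M lborel)"
  proof -
    have "(\<lambda>p. indicator {0..1::real} (fst p) *\<^sub>R f (fst p) (snd p)) \<in> borel_measurable (borel \<Otimes>\<^sub>M borel)"
      by measurable
    thus ?thesis by (simp add: case_prod_beta')
  qed
  have int: "integrable (lborel \<Otimes>\<^sub>M lborel) (case_prod ?g)"
  proof (subst integrable_iff_bounded, intro conjI m)
    have "(\<integral>\<^sup>+p. ennreal (norm (case_prod ?g p)) \<partial>(lborel \<Otimes>\<^sub>M lborel))
        = (\<integral>\<^sup>+t. \<integral>\<^sup>+x. ennreal (norm (?g t x)) \<partial>lborel \<partial>lborel)"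
      by (subst lborel.nn_integral_fst[symmetric]) auto
    also have "\<dots> \<le> (\<integral>\<^sup>+t. ennreal C * indicator {0..1::real} t \<partial>lborel)"
    proof (rule nn_integral_mono)
      fix t :: real
      show "(\<integral>\<^sup>+x. ennreal (norm (?g t x)) \<partial>lborel) \<le> ennreal C * indicator {0..1::real} t"
        using bd[of t] by (cases "t \<in> {0..1}") auto
    qed
    also have "\<dots> = ennreal C" by (subst nn_integral_cmult_indicator) auto
    also have "\<dots> < \<infinity>" by simp
    finally show "(\<integral>\<^sup>+p. ennreal (norm (case_prod ?g p)) \<partial>(lborel \<Otimes>\<^sub>M lborel)) < \<infinity>" .
  qed
  show "(\<integral>x. (\<integral>t. ?g t x \<partial>lborel) \<partial>lborel) = (\<integral>t. indicator {0..1} t *\<^sub>R (\<integral>x. f t x \<partial>lborel) \<partial>lborel)"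
    using lborel_pair.Fubini_integral[OF int] by simp
  show "integrable lborel (\<lambda>x. \<integral>t. ?g t x \<partial>lborel)"
    using lborel_pair.integrable_snd[OF int] .
qed

text \<open>The derivative in direction \<open>c\<close> of a function with gradient
  \<open>G\<close>, bilinear and without conjugation.\<close>

definition dgrad :: "real^3 \<Rightarrow> (real^3 \<Rightarrow> complex^3) \<Rightarrow> real^3 \<Rightarrow> complex" where
  "dgrad c G x = (\<Sum>i\<in>UNIV. (c $ i) *\<^sub>R (G x $ i))"

lemma dgrad_measurable [measurable]:
  assumes [measurable]: "G \<in> borel_measurable M"
  shows "dgrad c G \<in> borel_measurable M"
  unfolding dgrad_def[abs_def] by measurable

lemma norm_dgrad_le: "norm (dgrad c G x) \<le> 3 * norm c * norm (G x)"
proof -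
  have "norm (dgrad c G x) \<le> (\<Sum>i\<in>(UNIV::3 set). norm c * norm (G x))"
    unfolding dgrad_def
  proof (rule sum_norm_le)
    fix i :: 3
    have "norm ((c $ i) *\<^sub>R (G x $ i)) = norm (c $ i) * norm (G x $ i)" by simp
    also have "\<dots> \<le> norm c * norm (G x)"
      by (intro mult_mono Finite_Cartesian_Product.norm_nth_le) auto
    finally show "norm ((c $ i) *\<^sub>R (G x $ i)) \<le> norm c * norm (G x)" .
  qed
  thus ?thesis by simp
qed

lemma L2_dgrad:
  assumes "G \<in> L2"
  shows "dgrad c G \<in> L2"
proof (rule L2_if_bounded)
  show "integrable lebesgue (\<lambda>x. (3 * norm c)\<^sup>2 * (norm (G x))\<^sup>2)"
    by (intro integrable_mult_right L2_integrable_sq assms)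
  show "AE x in lebesgue. (norm (dgrad c G x))\<^sup>2 \<le> (3 * norm c)\<^sup>2 * (norm (G x))\<^sup>2"
    unfolding power_mult_distrib[symmetric] by (intro AE_I2 power_mono norm_dgrad_le) auto
  show "dgrad c G \<in> borel_measurable lebesgue" using L2_measurable[OF assms] by measurable
qed

text \<open>
  The path \<open>t \<mapsto> x + t\<^sup>4 c\<close> is parametrized such that its speed compensates the
  \<open>t\<^sup>-\<^sup>3\<close> in the volume of the cube \<open>x + t [0,1]\<^sup>3\<close>: then Jensen's inequality suffices
  in the Sobolev estimate.
\<close>

lemma shift_formula:
  assumes wg: "weak_gradient u G" and L: "u \<in> L2" "G \<in> L2"
    and [measurable]: "u \<in> borel_measurable borel" "G \<in> borel_measurable borel"
  shows "AE x in lebesgue. u (x + c) - u x =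
    (\<integral>t. indicator {0..1} t *\<^sub>R ((4 * t^3) *\<^sub>R dgrad c G (x + t^4 *\<^sub>R c)) \<partial>lborel)"
proof -
  let ?I = "\<lambda>x. \<integral>t. indicator {0..1} t *\<^sub>R ((4 * t^3) *\<^sub>R dgrad c G (x + t^4 *\<^sub>R c)) \<partial>lborel"
  define D where "D = dgrad c G"
  have Dm [measurable]: "D \<in> borel_measurable borel" unfolding D_def by measurable
  have DL: "D \<in> L2" unfolding D_def by (rule L2_dgrad[OF L(2)])
  have DLt: "(\<lambda>x. D (x + d)) \<in> L2" "L2_norm (\<lambda>x. D (x + d)) = L2_norm D" for d
    by (rule L2_translate[OF Dm DL])+
  have mD: "(\<lambda>(t, x). (4 * t^3) *\<^sub>R (f x *\<^sub>R D (x + t^4 *\<^sub>R c))) \<in> borel_measurable (borel \<Otimes>\<^sub>M borel)"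
    if [measurable]: "f \<in> borel_measurable borel" for f :: "real^3 \<Rightarrow> real" by measurable
  have bdD: "(\<integral>\<^sup>+x. norm ((4 * t^3) *\<^sub>R (f x *\<^sub>R D (x + t^4 *\<^sub>R c))) \<partial>lborel) \<le> ennreal (4 * (L2_norm f * L2_norm D))"
    if t: "t \<in> {0..1}" and f: "f \<in> L2" and fm [measurable]: "f \<in> borel_measurable borel" for t and f :: "real^3 \<Rightarrow> real"
  proof -
    have t3: "t^3 \<le> 1" using t by (simp add: power_le_one)
    have "(\<integral>\<^sup>+x. norm ((4 * t^3) *\<^sub>R (f x *\<^sub>R D (x + t^4 *\<^sub>R c))) \<partial>lborel)
        \<le> (\<integral>\<^sup>+x. ennreal 4 * ennreal (norm (f x) * norm (D (x + t^4 *\<^sub>R c))) \<partial>lborel)"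
    proof (rule nn_integral_mono)
      fix x
      have "4 * t^3 * (norm (f x) * norm (D (x + t^4 *\<^sub>R c))) \<le> 4 * (norm (f x) * norm (D (x + t^4 *\<^sub>R c)))"
        using t3 t by (intro mult_right_mono) auto
      thus "ennreal (norm ((4 * t^3) *\<^sub>R (f x *\<^sub>R D (x + t^4 *\<^sub>R c)))) \<le> ennreal 4 * ennreal (norm (f x) * norm (D (x + t^4 *\<^sub>R c)))"
        using t by (subst ennreal_mult[symmetric]) (auto intro!: ennreal_leI simp: abs_mult mult_ac)
    qed
    also have "\<dots> = ennreal 4 * (\<integral>\<^sup>+x. ennreal (norm (f x) * norm (D (x + t^4 *\<^sub>R c))) \<partial>lebesgue)"
      by (subst nn_integral_completion, rule nn_integral_cmult) measurable
    also have "\<dots> \<le> ennreal 4 * ennreal (L2_norm f * L2_norm D)"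
      using nn_integral_mult_L2[OF f DLt(1), of "t^4 *\<^sub>R c"] unfolding DLt(2) by (intro mult_left_mono) auto
    also have "\<dots> = ennreal (4 * (L2_norm f * L2_norm D))" by (rule ennreal_mult[symmetric]) auto
    finally show ?thesis .
  qed
  note fub = Fubini_unit_interval[OF mD bdD]
  have pull: "(\<integral>t. indicator {0..1} t *\<^sub>R ((4 * t^3) *\<^sub>R (a *\<^sub>R X t)) \<partial>lborel) =
      a *\<^sub>R (\<integral>t. indicator {0..1} t *\<^sub>R ((4 * t^3) *\<^sub>R X t) \<partial>lborel)" for a :: real and X :: "real \<Rightarrow> complex"
  proof -
    have "(\<lambda>t. indicator {0..1} t *\<^sub>R ((4 * t^3) *\<^sub>R (a *\<^sub>R X t))) =
        (\<lambda>t. a *\<^sub>R (indicator {0..1} t *\<^sub>R ((4 * t^3) *\<^sub>R X t)))"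
      by (simp add: fun_eq_iff mult_ac)
    thus ?thesis by (simp only: integral_scaleR_right)
  qed
  have Im [measurable]: "?I \<in> borel_measurable borel" unfolding D_def[symmetric] by measurable
  have "AE x in lebesgue. (u (x + c) - u x) - ?I x = 0"
  proof (rule fundamental_lemma_complex)
    fix K :: "(real^3) set" assume K: "compact K"
    have Km [measurable]: "(indicator K :: real^3 \<Rightarrow> real) \<in> borel_measurable borel" using K by (intro borel_measurable_indicator) (simp add: borel_compact)
    have "integrable lborel (\<lambda>x. \<integral>t. indicator {0..1} t *\<^sub>R ((4 * t^3) *\<^sub>R (indicator K x *\<^sub>R D (x + t^4 *\<^sub>R c))) \<partial>lborel)"
      by (rule fub(2)[OF Km _ L2_indicator_compact[OF K] Km])
    also have "(\<lambda>x. \<integral>t. indicator {0..1} t *\<^sub>R ((4 * t^3) *\<^sub>R (indicator K x *\<^sub>R D (x + t^4 *\<^sub>R c))) \<partial>lborel) =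
       (\<lambda>x. indicator K x *\<^sub>R ?I x)"
      unfolding D_def[symmetric] by (simp only: pull)
    finally have i: "integrable lborel (\<lambda>x. indicator K x *\<^sub>R ?I x)" .
    have "set_integrable lebesgue K ?I"
      unfolding set_integrable_def by (subst integrable_completion) (use i in measurable)
    moreover have "set_integrable lebesgue K (\<lambda>x. u (x + c))" "set_integrable lebesgue K u"
      using L L2_translate(1)[OF _ L(1), of c] K by (auto intro: L2_set_integrable)
    ultimately show "set_integrable lebesgue K (\<lambda>x. (u (x + c) - u x) - ?I x)" by (intro set_integral_diff)
  next
    \<comment> \<open>Duality: the translation is moved from \<open>u\<close> to the smooth \<phi>,
      where the fundamental theorem of calculus applies along the path, and the weak gradient then
      moves the derivative back to \<open>u\<close>. Fubini exchanges the path parameter with the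
      space variable in both directions.\<close>
    fix \<phi> assume \<phi>: "test_function \<phi>"
    obtain K B where KB: "compact K" "0 \<le> B" "\<And>x. x \<notin> K \<Longrightarrow> \<phi> x = 0" "\<And>i x. x \<notin> K \<Longrightarrow> partial_deriv i \<phi> x = 0"
      "\<And>x. \<bar>\<phi> x\<bar> \<le> B" "\<And>i x. \<bar>partial_deriv i \<phi> x\<bar> \<le> B"
      "continuous_on UNIV \<phi>" "\<And>i. continuous_on UNIV (partial_deriv i \<phi>)" "\<And>x. \<phi> differentiable (at x)"
      by (rule test_function_bounds[OF \<phi>]) blast
    have \<phi>m [measurable]: "\<phi> \<in> borel_measurable borel" using KB(7) by (rule borel_measurable_continuous_onI)
    have pm [measurable]: "partial_deriv i \<phi> \<in> borel_measurable borel" for i using KB(8) by (rule borel_measurable_continuous_onI)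
    define \<psi> where "\<psi> = (\<lambda>x. \<Sum>i\<in>UNIV. c $ i * partial_deriv i \<phi> x)"
    have \<psi>m [measurable]: "\<psi> \<in> borel_measurable borel" unfolding \<psi>_def by measurable
    have \<psi>c: "continuous_on UNIV \<psi>" unfolding \<psi>_def by (intro continuous_intros KB(8))
    have \<psi>L: "\<psi> \<in> L2"
    proof -
      have "(\<lambda>x. \<Sum>i\<in>I. c $ i * partial_deriv i \<phi> x) \<in> L2" if "finite I" for I :: "3 set"
        using that by induction (auto intro!: L2_add L2_mult L2_test_function(2)[OF \<phi>])
      thus ?thesis unfolding \<psi>_def by simp
    qed
    have ftc: "\<phi> (x - c) - \<phi> x = - (\<integral>t. indicator {0..1} t *\<^sub>R (4 * t^3 * \<psi> (x - t^4 *\<^sub>R c)) \<partial>lborel)" for x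
    proof -
      have "(\<integral>t. indicator {0..1} t *\<^sub>R (- (4 * t^3 * \<psi> (x - t^4 *\<^sub>R c))) \<partial>lborel) = \<phi> (x - 1^4 *\<^sub>R c) - \<phi> (x - 0^4 *\<^sub>R c)"
      proof (rule integral_FTC_Icc)
        show "(0::real) \<le> 1" by simp
        show "continuous_on {0..1} (\<lambda>t. - (4 * t^3 * \<psi> (x - t^4 *\<^sub>R c)))"
          by (intro continuous_intros continuous_on_compose2[OF \<psi>c]) auto
        fix t :: real assume "0 \<le> t" "t \<le> 1"
        have 1: "((\<lambda>t. x - t^4 *\<^sub>R c) has_derivative (\<lambda>h. - ((h * (4 * t^3)) *\<^sub>R c))) (at t within {0..1})"
          by (auto intro!: derivative_eq_intros simp: algebra_simps)
        have 2: "(\<phi> has_derivative (\<lambda>h. \<Sum>i\<in>UNIV. h $ i * partial_deriv i \<phi> (x - t^4 *\<^sub>R c))) (at (x - t^4 *\<^sub>R c))"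
          by (rule has_derivative_partial[OF KB(9)])
        have "((\<lambda>t. \<phi> (x - t^4 *\<^sub>R c)) has_derivative
            (\<lambda>h. \<Sum>i\<in>UNIV. (- ((h * (4 * t^3)) *\<^sub>R c)) $ i * partial_deriv i \<phi> (x - t^4 *\<^sub>R c))) (at t within {0..1})"
          using has_derivative_compose[OF 1 2] .
        also have "(\<lambda>h. \<Sum>i\<in>UNIV. (- ((h * (4 * t^3)) *\<^sub>R c)) $ i * partial_deriv i \<phi> (x - t^4 *\<^sub>R c)) =
            (\<lambda>h. h *\<^sub>R (- (4 * t^3 * \<psi> (x - t^4 *\<^sub>R c))))"
          by (simp add: \<psi>_def fun_eq_iff sum_negf sum_distrib_left mult_ac)
        finally show "((\<lambda>t. \<phi> (x - t^4 *\<^sub>R c)) has_vector_derivative - (4 * t^3 * \<psi> (x - t^4 *\<^sub>R c))) (at t within {0..1})"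
          by (simp add: has_vector_derivative_def)
      qed
      thus ?thesis by simp
    qed
    have weak: "(\<integral>x. \<psi> (x - d) *\<^sub>R u x \<partial>lborel) = - (\<integral>x. \<phi> x *\<^sub>R D (x + d) \<partial>lborel)" for d
    proof -
      have T: "test_function (\<lambda>x. \<phi> (x - d))" by (rule test_function_translate[OF \<phi>])
      note w = weak_gradientD[OF wg T, unfolded partial_deriv_translate(1)[OF KB(9)]]
      have "(\<integral>x. \<psi> (x - d) *\<^sub>R u x \<partial>lborel) = (\<integral>x. \<psi> (x - d) *\<^sub>R u x \<partial>lebesgue)"
        by (rule integral_completion[symmetric]) measurable
      also have "\<dots> = (\<integral>x. (\<Sum>i\<in>UNIV. (c $ i) *\<^sub>R (partial_deriv i \<phi> (x - d) *\<^sub>R u x)) \<partial>lebesgue)"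
        by (simp add: \<psi>_def scaleR_sum_left)
      also have "\<dots> = (\<Sum>i\<in>UNIV. (c $ i) *\<^sub>R (- (\<integral>x. \<phi> (x - d) *\<^sub>R (G x $ i) \<partial>lebesgue)))"
        by (subst Bochner_Integration.integral_sum) (auto simp: w(2) w(1)[symmetric] simp del: scaleR_scaleR)
      also have "\<dots> = - (\<integral>x. (\<Sum>i\<in>UNIV. (c $ i) *\<^sub>R (\<phi> (x - d) *\<^sub>R (G x $ i))) \<partial>lebesgue)"
        by (subst Bochner_Integration.integral_sum) (auto simp: w(3) sum_negf simp del: scaleR_scaleR)
      also have "(\<lambda>x. \<Sum>i\<in>UNIV. (c $ i) *\<^sub>R (\<phi> (x - d) *\<^sub>R (G x $ i))) = (\<lambda>x. \<phi> (x - d) *\<^sub>R D x)"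
        by (simp add: D_def dgrad_def scaleR_sum_right mult.commute)
      also have "(\<integral>x. \<phi> (x - d) *\<^sub>R D x \<partial>lebesgue) = (\<integral>x. \<phi> (x - d) *\<^sub>R D x \<partial>lborel)"
        by (rule integral_completion) measurable
      also have "\<dots> = (\<integral>x. \<phi> (x + d - d) *\<^sub>R D (x + d) \<partial>lborel)"
        by (rule integral_translate[symmetric]) measurable
      finally show ?thesis by simp
    qed
    have \<phi>L: "\<phi> \<in> L2" by (rule L2_test_function[OF \<phi>])
    have intL: "integrable lborel (\<lambda>x. f x *\<^sub>R w x)"
      if "f \<in> L2" "w \<in> L2" and [measurable]: "f \<in> borel_measurable borel" "w \<in> borel_measurable borel"
      for f :: "real^3 \<Rightarrow> real" and w :: "real^3 \<Rightarrow> complex"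
    proof -
      have m: "(\<lambda>x. f x *\<^sub>R w x) \<in> borel_measurable lborel" by measurable
      have "integrable lebesgue (\<lambda>x. f x *\<^sub>R w x)"
        by (rule integrable_mult_L2[OF that(1,2) measurable_completion[OF m]]) simp
      thus ?thesis using integrable_completion[OF m] by simp
    qed
    have uc: "(\<lambda>x. u (x + c)) \<in> L2" using L2_translate(1)[OF _ L(1)] by simp
    have \<phi>c: "(\<lambda>x. \<phi> (x - d)) \<in> L2" for d by (rule L2_test_function[OF test_function_translate[OF \<phi>]])
    have i1: "integrable lborel (\<lambda>x. \<phi> x *\<^sub>R u (x + c))" by (rule intL[OF \<phi>L uc]) measurable
    have i2: "integrable lborel (\<lambda>x. \<phi> x *\<^sub>R u x)" by (rule intL[OF \<phi>L L(1)]) measurable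
    have i3: "integrable lborel (\<lambda>x. \<phi> (x - c) *\<^sub>R u x)" by (rule intL[OF \<phi>c L(1)]) measurable
    have "(\<integral>x. \<phi> x *\<^sub>R u (x + c) \<partial>lborel) = (\<integral>x. \<phi> (x - c) *\<^sub>R u x \<partial>lborel)"
      using integral_translate[of "\<lambda>x. \<phi> (x - c) *\<^sub>R u x" c] by simp
    hence "(\<integral>x. \<phi> x *\<^sub>R u (x + c) \<partial>lborel) - (\<integral>x. \<phi> x *\<^sub>R u x \<partial>lborel) = (\<integral>x. (\<phi> (x - c) - \<phi> x) *\<^sub>R u x \<partial>lborel)"
      using i2 i3 by (simp add: scaleR_diff_left)
    also have "\<dots> = - (\<integral>x. (\<integral>t. indicator {0..1} t *\<^sub>R ((4 * t^3) *\<^sub>R (\<psi> (x - t^4 *\<^sub>R c) *\<^sub>R u x)) \<partial>lborel) \<partial>lborel)"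
    proof -
      have "(\<phi> (x - c) - \<phi> x) *\<^sub>R u x = - (\<integral>t. indicator {0..1} t *\<^sub>R ((4 * t^3) *\<^sub>R (\<psi> (x - t^4 *\<^sub>R c) *\<^sub>R u x)) \<partial>lborel)" for x
      proof -
        have "(\<integral>t. indicator {0..1} t *\<^sub>R ((4 * t^3) *\<^sub>R (\<psi> (x - t^4 *\<^sub>R c) *\<^sub>R u x)) \<partial>lborel)
            = (\<integral>t. (indicator {0..1} t *\<^sub>R (4 * t^3 * \<psi> (x - t^4 *\<^sub>R c))) *\<^sub>R u x \<partial>lborel)"
          by (simp add: mult.assoc)
        also have "\<dots> = (\<integral>t. indicator {0..1} t *\<^sub>R (4 * t^3 * \<psi> (x - t^4 *\<^sub>R c)) \<partial>lborel) *\<^sub>R u x"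
        proof (rule integral_scaleR_left)
          assume "u x \<noteq> 0"
          have "continuous_on {0..1} (\<lambda>t. 4 * t^3 * \<psi> (x - t^4 *\<^sub>R c))"
            by (intro continuous_intros continuous_on_compose2[OF \<psi>c]) auto
          thus "integrable lborel (\<lambda>t. indicator {0..1} t *\<^sub>R (4 * t^3 * \<psi> (x - t^4 *\<^sub>R c)))"
            by (intro borel_integrable_compact) auto
        qed
        finally show ?thesis unfolding ftc by simp
      qed
      thus ?thesis by simp
    qed
    also have "(\<integral>x. (\<integral>t. indicator {0..1} t *\<^sub>R ((4 * t^3) *\<^sub>R (\<psi> (x - t^4 *\<^sub>R c) *\<^sub>R u x)) \<partial>lborel) \<partial>lborel)
        = (\<integral>t. indicator {0..1} t *\<^sub>R (\<integral>x. (4 * t^3) *\<^sub>R (\<psi> (x - t^4 *\<^sub>R c) *\<^sub>R u x) \<partial>lborel) \<partial>lborel)"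
    proof (rule Fubini_unit_interval(1))
      show "(\<lambda>(t, x). (4 * t^3) *\<^sub>R (\<psi> (x - t^4 *\<^sub>R c) *\<^sub>R u x)) \<in> borel_measurable (borel \<Otimes>\<^sub>M borel)" by measurable
      fix t :: real assume t: "t \<in> {0..1}"
      have t3: "t^3 \<le> 1" using t by (simp add: power_le_one)
      have \<psi>t: "(\<lambda>x. \<psi> (x - t^4 *\<^sub>R c)) \<in> L2" "L2_norm (\<lambda>x. \<psi> (x - t^4 *\<^sub>R c)) = L2_norm \<psi>"
        using L2_translate[OF \<psi>m \<psi>L, of "- (t^4 *\<^sub>R c)"] by simp_all
      have "(\<integral>\<^sup>+x. norm ((4 * t^3) *\<^sub>R (\<psi> (x - t^4 *\<^sub>R c) *\<^sub>R u x)) \<partial>lborel)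
        \<le> (\<integral>\<^sup>+x. ennreal 4 * ennreal (norm (\<psi> (x - t^4 *\<^sub>R c)) * norm (u x)) \<partial>lborel)"
      proof (rule nn_integral_mono)
        fix x
        have "4 * t^3 * (norm (\<psi> (x - t^4 *\<^sub>R c)) * norm (u x)) \<le> 4 * (norm (\<psi> (x - t^4 *\<^sub>R c)) * norm (u x))"
          using t3 t by (intro mult_right_mono) auto
        thus "ennreal (norm ((4 * t^3) *\<^sub>R (\<psi> (x - t^4 *\<^sub>R c) *\<^sub>R u x))) \<le> ennreal 4 * ennreal (norm (\<psi> (x - t^4 *\<^sub>R c)) * norm (u x))"
          using t by (subst ennreal_mult[symmetric]) (auto intro!: ennreal_leI simp: abs_mult mult_ac)
      qed
      also have "\<dots> = ennreal 4 * (\<integral>\<^sup>+x. ennreal (norm (\<psi> (x - t^4 *\<^sub>R c)) * norm (u x)) \<partial>lebesgue)"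
        by (subst nn_integral_completion, rule nn_integral_cmult) measurable
      also have "\<dots> \<le> ennreal 4 * ennreal (L2_norm \<psi> * L2_norm u)"
        using nn_integral_mult_L2[OF \<psi>t(1) L(1)] unfolding \<psi>t(2) by (intro mult_left_mono) auto
      also have "\<dots> = ennreal (4 * (L2_norm \<psi> * L2_norm u))" by (rule ennreal_mult[symmetric]) auto
      finally show "(\<integral>\<^sup>+x. norm ((4 * t^3) *\<^sub>R (\<psi> (x - t^4 *\<^sub>R c) *\<^sub>R u x)) \<partial>lborel) \<le> ennreal (4 * (L2_norm \<psi> * L2_norm u))" .
    qed
    also have "- \<dots> = (\<integral>t. indicator {0..1} t *\<^sub>R (\<integral>x. (4 * t^3) *\<^sub>R (\<phi> x *\<^sub>R D (x + t^4 *\<^sub>R c)) \<partial>lborel) \<partial>lborel)"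
      by (simp add: weak del: scaleR_scaleR)
    also have "\<dots> = (\<integral>x. (\<integral>t. indicator {0..1} t *\<^sub>R ((4 * t^3) *\<^sub>R (\<phi> x *\<^sub>R D (x + t^4 *\<^sub>R c))) \<partial>lborel) \<partial>lborel)"
      by (rule fub(1)[OF \<phi>m _ \<phi>L \<phi>m, symmetric])
    also have eqI: "(\<lambda>x. \<integral>t. indicator {0..1} t *\<^sub>R ((4 * t^3) *\<^sub>R (\<phi> x *\<^sub>R D (x + t^4 *\<^sub>R c))) \<partial>lborel) = (\<lambda>x. \<phi> x *\<^sub>R ?I x)"
      unfolding D_def[symmetric] by (simp only: pull)
    finally have main: "(\<integral>x. \<phi> x *\<^sub>R u (x + c) \<partial>lborel) - (\<integral>x. \<phi> x *\<^sub>R u x \<partial>lborel) = (\<integral>x. \<phi> x *\<^sub>R ?I x \<partial>lborel)" .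
    have i4: "integrable lborel (\<lambda>x. \<phi> x *\<^sub>R ?I x)"
      using fub(2)[OF \<phi>m _ \<phi>L \<phi>m] unfolding eqI .
    have "(\<integral>x. \<phi> x *\<^sub>R ((u (x + c) - u x) - ?I x) \<partial>lebesgue) = (\<integral>x. \<phi> x *\<^sub>R ((u (x + c) - u x) - ?I x) \<partial>lborel)"
      by (rule integral_completion) measurable
    also have "\<dots> = 0" using main i1 i2 i4 by (simp add: scaleR_diff_right)
    finally show "(\<integral>x. \<phi> x *\<^sub>R ((u (x + c) - u x) - ?I x) \<partial>lebesgue) = 0" .
  qed
  thus ?thesis by eventually_elim simp
qed

section \<open>Averages over cubes and the embedding into L4\<close>

lemma jensen_sq:
  assumes [measurable]: "f \<in> borel_measurable M" "A \<in> sets M" and A: "emeasure M A = 1"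
  shows "(\<integral>\<^sup>+x. f x * indicator A x \<partial>M)^2 \<le> (\<integral>\<^sup>+x. (f x)^2 * indicator A x \<partial>M)"
proof -
  have "(\<integral>\<^sup>+x. f x * indicator A x \<partial>M)^2 = (\<integral>\<^sup>+x. (f x * indicator A x) * indicator A x \<partial>M)^2"
    by (intro arg_cong[of _ _ "\<lambda>y. y^2"] nn_integral_cong) (auto split: split_indicator)
  also have "\<dots> \<le> (\<integral>\<^sup>+x. (f x * indicator A x)^2 \<partial>M) * (\<integral>\<^sup>+x. (indicator A x)^2 \<partial>M)"
    by (rule Cauchy_Schwarz_nn_integral) auto
  also have "(\<integral>\<^sup>+x. (indicator A x)^2 \<partial>M) = (\<integral>\<^sup>+x. indicator A x \<partial>M)"
    by (intro nn_integral_cong) (auto split: split_indicator)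
  also have "\<dots> = 1" using A by simp
  also have "(\<integral>\<^sup>+x. (f x * indicator A x)^2 \<partial>M) = (\<integral>\<^sup>+x. (f x)^2 * indicator A x \<partial>M)"
    by (intro nn_integral_cong) (auto split: split_indicator)
  finally show ?thesis by simp
qed

lemma jensen_power4:
  assumes [measurable]: "f \<in> borel_measurable M" "A \<in> sets M" and A: "emeasure M A = 1"
  shows "(\<integral>\<^sup>+x. f x * indicator A x \<partial>M)^4 \<le> (\<integral>\<^sup>+x. (f x)^4 * indicator A x \<partial>M)"
proof -
  have "(\<integral>\<^sup>+x. f x * indicator A x \<partial>M)^4 = ((\<integral>\<^sup>+x. f x * indicator A x \<partial>M)^2)^2"
    by (simp flip: power_mult)
  also have "\<dots> \<le> (\<integral>\<^sup>+x. (f x)^2 * indicator A x \<partial>M)^2"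
    by (intro power_mono_ennreal jensen_sq assms)
  also have "\<dots> \<le> (\<integral>\<^sup>+x. ((f x)^2)^2 * indicator A x \<partial>M)"
    by (intro jensen_sq A) auto
  finally show ?thesis by (simp flip: power_mult)
qed

lemma power4_add_le: "(a + b)^4 \<le> 8 * (a^4 + b^4 :: ennreal)"
proof (cases a; cases b)
  fix x y :: real assume xy: "0 \<le> x" "0 \<le> y" "a = ennreal x" "b = ennreal y"
  have sq: "(p + q)\<^sup>2 \<le> 2 * (p\<^sup>2 + q\<^sup>2)" for p q :: real
    using zero_le_power2[of "p - q"] by (simp add: power2_eq_square algebra_simps)
  have "(x + y)^4 = ((x + y)\<^sup>2)\<^sup>2" by (simp flip: power_mult)
  also have "\<dots> \<le> (2 * (x\<^sup>2 + y\<^sup>2))\<^sup>2" by (intro power_mono sq) auto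
  also have "\<dots> = 4 * (x\<^sup>2 + y\<^sup>2)\<^sup>2" by (simp only: power_mult_distrib) simp
  also have "\<dots> \<le> 4 * (2 * ((x\<^sup>2)\<^sup>2 + (y\<^sup>2)\<^sup>2))" by (intro mult_left_mono sq) auto
  finally have "(x + y)^4 \<le> 8 * (x^4 + y^4)" by (simp flip: power_mult)
  hence "ennreal ((x + y)^4) \<le> ennreal (8 * (x^4 + y^4))" by (rule ennreal_leI)
  moreover have "(a + b)^4 = ennreal ((x + y)^4)"
    by (simp only: xy(3,4) ennreal_plus[OF xy(1,2), symmetric] ennreal_power add_nonneg_nonneg xy(1,2))
  moreover have "8 * (a^4 + b^4) = ennreal (8 * (x^4 + y^4))"
    using xy by (simp add: ennreal_mult ennreal_power)
  ultimately show ?thesis by simp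
qed (simp_all add: ennreal_mult_eq_top_iff)

abbreviation unit_cube :: "(real^3) set" where
  "unit_cube \<equiv> cbox 0 One"

lemma emeasure_unit_cube: "emeasure lborel unit_cube = 1"
  by (subst emeasure_lborel_cbox) auto

lemma norm_unit_cube: "c \<in> unit_cube \<Longrightarrow> norm c \<le> 3"
proof -
  assume "c \<in> unit_cube"
  hence "0 \<le> c $ i \<and> c $ i \<le> 1" for i
  proof -
    have "axis i 1 \<in> (Basis :: (real^3) set)" by (simp add: axis_in_Basis_iff)
    hence "(0 :: real^3) \<bullet> axis i 1 \<le> c \<bullet> axis i 1 \<and> c \<bullet> axis i 1 \<le> One \<bullet> axis i (1::real)"
      using \<open>c \<in> unit_cube\<close> unfolding mem_box by blast
    moreover have "One \<bullet> axis i (1::real) = (\<Sum>b\<in>(Basis :: (real^3) set). if b = axis i 1 then 1 else 0)"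
      unfolding inner_sum_left using \<open>axis i 1 \<in> Basis\<close> by (intro sum.cong refl) (rule inner_Basis)
    moreover have "\<dots> = 1" using \<open>axis i 1 \<in> Basis\<close> by simp
    moreover have "c \<bullet> axis i 1 = c $ i" by (simp add: inner_axis)
    ultimately show ?thesis by simp
  qed
  hence "(\<Sum>i\<in>UNIV. \<bar>c $ i\<bar>) \<le> (\<Sum>i\<in>(UNIV::3 set). 1)" by (intro sum_mono) auto
  thus "norm c \<le> 3" using norm_le_l1_cart[of c] by simp
qed

text \<open>By Jensen the fourth power of the average is at most the square of the average
  \<open>?B\<close> of the squares. One factor \<open>?B\<close> is bounded pointwise, by the full
  square integral divided by the volume \<open>r^3\<close> of the cube; the other is integrated,
  where translation invariance makes it cost nothing.\<close>

lemma cube_average_L4: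
  fixes g :: "real^3 \<Rightarrow> 'a::{banach, second_countable_topology}"
  assumes [measurable]: "g \<in> borel_measurable borel" and g: "g \<in> L2" and r: "0 < r"
  shows "(\<integral>\<^sup>+x. (\<integral>\<^sup>+c. ennreal (norm (g (x + r *\<^sub>R c))) * indicator unit_cube c \<partial>lborel)^4 \<partial>lborel)
    \<le> ennreal ((L2_norm g)^4 / r^3)"
proof -
  let ?A = "\<lambda>x. \<integral>\<^sup>+c. ennreal (norm (g (x + r *\<^sub>R c))) * indicator unit_cube c \<partial>lborel"
  let ?B = "\<lambda>x. \<integral>\<^sup>+c. ennreal ((norm (g (x + r *\<^sub>R c)))\<^sup>2) * indicator unit_cube c \<partial>lborel"
  have g2: "(\<integral>\<^sup>+x. ennreal ((norm (g x))\<^sup>2) \<partial>lborel) = ennreal ((L2_norm g)\<^sup>2)"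
    using nn_integral_sq_L2[OF g] by (simp add: nn_integral_completion)
  have A2: "(?A x)\<^sup>2 \<le> ?B x" for x
  proof -
    have "(?A x)\<^sup>2 \<le> (\<integral>\<^sup>+c. (ennreal (norm (g (x + r *\<^sub>R c))))\<^sup>2 * indicator unit_cube c \<partial>lborel)"
      by (rule jensen_sq) (auto simp: emeasure_unit_cube)
    thus ?thesis by (simp add: ennreal_power)
  qed
  have B_le: "?B x \<le> ennreal ((L2_norm g)\<^sup>2 / r^3)" for x
  proof -
    have "?B x \<le> (\<integral>\<^sup>+c. ennreal ((norm (g (x + r *\<^sub>R c)))\<^sup>2) \<partial>lborel)"
      by (intro nn_integral_mono) (auto split: split_indicator)
    also have "\<dots> = ennreal (1 / r^3) * (ennreal (\<bar>r\<bar>^3) * (\<integral>\<^sup>+c. ennreal ((norm (g (x + r *\<^sub>R c)))\<^sup>2) \<partial>lborel))"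
      using r by (simp add: mult.assoc[symmetric] ennreal_mult[symmetric])
    also have "\<dots> = ennreal (1 / r^3) * ennreal ((L2_norm g)\<^sup>2)"
      using r by (subst nn_integral_affine_lborel[symmetric]) (auto simp: g2)
    finally show ?thesis using r by (simp add: ennreal_mult[symmetric])
  qed
  have "(\<integral>\<^sup>+x. ?B x \<partial>lborel) = (\<integral>\<^sup>+c. \<integral>\<^sup>+x. ennreal ((norm (g (x + r *\<^sub>R c)))\<^sup>2) * indicator unit_cube c \<partial>lborel \<partial>lborel)"
    by (rule lborel_pair.Fubini') measurable
  also have "\<dots> = (\<integral>\<^sup>+c. ennreal ((L2_norm g)\<^sup>2) * indicator unit_cube c \<partial>lborel)"
    by (intro nn_integral_cong, subst nn_integral_multc)
       (auto simp: nn_integral_translate[of "\<lambda>x. ennreal ((norm (g x))\<^sup>2)"] g2)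
  also have "\<dots> = ennreal ((L2_norm g)\<^sup>2)"
    by (subst nn_integral_cmult_indicator) (auto simp: emeasure_unit_cube)
  finally have B_int: "(\<integral>\<^sup>+x. ?B x \<partial>lborel) = ennreal ((L2_norm g)\<^sup>2)" .
  have "(\<integral>\<^sup>+x. (?A x)^4 \<partial>lborel) \<le> (\<integral>\<^sup>+x. ennreal ((L2_norm g)\<^sup>2 / r^3) * ?B x \<partial>lborel)"
  proof (rule nn_integral_mono)
    fix x
    have "(?A x)^4 = (?A x)\<^sup>2 * (?A x)\<^sup>2" by (simp flip: power_add)
    also have "\<dots> \<le> ennreal ((L2_norm g)\<^sup>2 / r^3) * ?B x"
      by (intro mult_mono order_trans[OF A2 B_le] A2) auto
    finally show "(?A x)^4 \<le> ennreal ((L2_norm g)\<^sup>2 / r^3) * ?B x" .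
  qed
  also have "\<dots> = ennreal ((L2_norm g)\<^sup>2 / r^3) * ennreal ((L2_norm g)\<^sup>2)"
    by (subst nn_integral_cmult) (auto simp: B_int)
  also have "\<dots> = ennreal ((L2_norm g)^4 / r^3)"
    using r by (simp add: ennreal_mult[symmetric] flip: power_add)
  finally show ?thesis .
qed

lemma norm_integral_le_nn_integral:
  fixes f :: "'a \<Rightarrow> 'b::{banach, second_countable_topology}"
  shows "ennreal (norm (integral\<^sup>L M f)) \<le> (\<integral>\<^sup>+x. ennreal (norm (f x)) \<partial>M)"
  by (cases "integrable M f") (auto simp: integral_norm_bound_ennreal not_integrable_integral_eq)

text \<open>The shift formula for the vectors \<open>s *\<^sub>R c\<close> is averaged over
  \<open>c\<close> in the unit cube. For fixed \<open>t\<close> the inner integral in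
  \<open>T\<close> is then the average of the gradient over a cube of side \<open>t^4 * s\<close>,
  which shrinks to a point as \<open>t\<close> tends to 0.\<close>

lemma sobolev_pointwise:
  assumes wg: "weak_gradient u G" and L: "u \<in> L2" "G \<in> L2"
    and [measurable]: "u \<in> borel_measurable borel" "G \<in> borel_measurable borel" and s: "0 < s"
  defines "A \<equiv> \<lambda>x. \<integral>\<^sup>+c. ennreal (norm (u (x + s *\<^sub>R c))) * indicator unit_cube c \<partial>lborel"
    and "T \<equiv> \<lambda>x. \<integral>\<^sup>+t. (ennreal (4 * t^3) *
        (\<integral>\<^sup>+c. ennreal (norm (G (x + (t^4 * s) *\<^sub>R c))) * indicator unit_cube c \<partial>lborel)) * indicator {0..1} t \<partial>lborel"
  shows "AE x in lborel. ennreal (norm (u x)) \<le> A x + ennreal (9 * s) * T x"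
proof -
  define H where "H = (\<lambda>x c. \<integral>\<^sup>+t. (ennreal (4 * t^3) * ennreal (norm (G (x + (t^4 * s) *\<^sub>R c)))) * indicator {0..1} t \<partial>lborel)"
  have Hm [measurable]: "case_prod H \<in> borel_measurable (borel \<Otimes>\<^sub>M borel)"
    unfolding H_def case_prod_beta' by measurable
  have step: "AE x in lborel. c \<in> unit_cube \<longrightarrow>
      ennreal (norm (u x)) \<le> ennreal (norm (u (x + s *\<^sub>R c))) + ennreal (9 * s) * H x c" for c
  proof (cases "c \<in> unit_cube")
    case True
    have "AE x in lebesgue. u (x + s *\<^sub>R c) - u x =
      (\<integral>t. indicator {0..1} t *\<^sub>R ((4 * t^3) *\<^sub>R dgrad (s *\<^sub>R c) G (x + t^4 *\<^sub>R (s *\<^sub>R c))) \<partial>lborel)"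
      by (rule shift_formula[OF wg L]) measurable
    hence "AE x in lborel. u (x + s *\<^sub>R c) - u x =
      (\<integral>t. indicator {0..1} t *\<^sub>R ((4 * t^3) *\<^sub>R dgrad (s *\<^sub>R c) G (x + t^4 *\<^sub>R (s *\<^sub>R c))) \<partial>lborel)"
      by (simp only: AE_completion_iff)
    thus ?thesis
    proof eventually_elim
      fix x assume eq: "u (x + s *\<^sub>R c) - u x =
        (\<integral>t. indicator {0..1} t *\<^sub>R ((4 * t^3) *\<^sub>R dgrad (s *\<^sub>R c) G (x + t^4 *\<^sub>R (s *\<^sub>R c))) \<partial>lborel)"
      have "ennreal (norm (u (x + s *\<^sub>R c) - u x)) \<le>
          (\<integral>\<^sup>+t. ennreal (norm (indicator {0..1} t *\<^sub>R ((4 * t^3) *\<^sub>R dgrad (s *\<^sub>R c) G (x + t^4 *\<^sub>R (s *\<^sub>R c))))) \<partial>lborel)"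
        unfolding eq by (rule norm_integral_le_nn_integral)
      also have "\<dots> \<le> (\<integral>\<^sup>+t. ennreal (9 * s) * ((ennreal (4 * t^3) * ennreal (norm (G (x + (t^4 * s) *\<^sub>R c)))) * indicator {0..1} t) \<partial>lborel)"
      proof (rule nn_integral_mono)
        fix t :: real
        show "ennreal (norm (indicator {0..1} t *\<^sub>R ((4 * t^3) *\<^sub>R dgrad (s *\<^sub>R c) G (x + t^4 *\<^sub>R (s *\<^sub>R c)))))
          \<le> ennreal (9 * s) * ((ennreal (4 * t^3) * ennreal (norm (G (x + (t^4 * s) *\<^sub>R c)))) * indicator {0..1} t)"
        proof (cases "t \<in> {0..1}")
          case t: True
          define y where "y = x + (t^4 * s) *\<^sub>R c"
          have "norm (dgrad (s *\<^sub>R c) G y) \<le> 3 * norm (s *\<^sub>R c) * norm (G y)" by (rule norm_dgrad_le)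
          also have "\<dots> = (3 * s) * norm c * norm (G y)" using s by simp
          \<comment> \<open>One factor 3 comes from the three components of the directional
            derivative, the other bounds the length of vectors in the unit cube.\<close>
          also have "\<dots> \<le> (3 * s) * 3 * norm (G y)"
            using norm_unit_cube[OF True] s by (intro mult_right_mono mult_left_mono) auto
          finally have "norm (dgrad (s *\<^sub>R c) G y) \<le> 9 * s * norm (G y)" by simp
          hence "(4 * t^3) * norm (dgrad (s *\<^sub>R c) G y) \<le> (4 * t^3) * (9 * s * norm (G y))"
            using t by (intro mult_left_mono) auto
          hence "ennreal ((4 * t^3) * norm (dgrad (s *\<^sub>R c) G y)) \<le> ennreal (9 * s * ((4 * t^3) * norm (G y)))"
            by (intro ennreal_leI) (simp add: mult_ac)
          also have "\<dots> = ennreal (9 * s) * (ennreal (4 * t^3) * ennreal (norm (G y)))"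
            using t s ennreal_mult[of "9 * s" "(4 * t^3) * norm (G y)"] ennreal_mult[of "4 * t^3" "norm (G y)"]
            by (simp del: ennreal_mult)
          finally show ?thesis using t by (simp add: y_def)
        qed simp
      qed
      also have "\<dots> = ennreal (9 * s) * H x c" unfolding H_def by (rule nn_integral_cmult) measurable
      finally have D: "ennreal (norm (u (x + s *\<^sub>R c) - u x)) \<le> ennreal (9 * s) * H x c" .
      have "norm (u x) \<le> norm (u (x + s *\<^sub>R c)) + norm (u (x + s *\<^sub>R c) - u x)"
        using norm_triangle_ineq4[of "u (x + s *\<^sub>R c)" "u (x + s *\<^sub>R c) - u x"] by simp
      hence "ennreal (norm (u x)) \<le> ennreal (norm (u (x + s *\<^sub>R c))) + ennreal (norm (u (x + s *\<^sub>R c) - u x))"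
        by (simp add: ennreal_plus[symmetric] del: ennreal_plus)
      also have "\<dots> \<le> ennreal (norm (u (x + s *\<^sub>R c))) + ennreal (9 * s) * H x c"
        using D by (rule add_left_mono)
      finally show "c \<in> unit_cube \<longrightarrow> ennreal (norm (u x)) \<le> ennreal (norm (u (x + s *\<^sub>R c))) + ennreal (9 * s) * H x c" by simp
    qed
  qed simp
  let ?P = "\<lambda>x c. c \<in> unit_cube \<longrightarrow>
      ennreal (norm (u x)) \<le> ennreal (norm (u (x + s *\<^sub>R c))) + ennreal (9 * s) * H x c"
  \<comment> \<open>For each \<open>c\<close> the estimate fails only on a null set of
    \<open>x\<close> that depends on \<open>c\<close>. Exchanging the order gives, for almost every
    \<open>x\<close>, an estimate valid for almost every \<open>c\<close>, which can be integrated
    over the cube.\<close>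
  have "AE c in lborel. AE x in lborel. ?P x c" using step by simp
  moreover have "{p\<in>space (lborel \<Otimes>\<^sub>M lborel). ?P (fst p) (snd p)} \<in> sets (lborel \<Otimes>\<^sub>M lborel)"
  proof -
    have [measurable]: "(\<lambda>p. H (fst p) (snd p)) \<in> borel_measurable (lborel \<Otimes>\<^sub>M lborel)"
      using Hm by (simp add: case_prod_beta' cong: measurable_cong_sets)
    show ?thesis by measurable
  qed
  ultimately have "AE x in lborel. AE c in lborel. ?P x c"
    by (subst lborel_pair.AE_commute) auto
  thus ?thesis
  proof eventually_elim
    fix x assume ae: "AE c in lborel. ?P x c"
    have [measurable]: "H x \<in> borel_measurable borel" unfolding H_def by measurable
    have "ennreal (norm (u x)) = (\<integral>\<^sup>+c. ennreal (norm (u x)) * indicator unit_cube c \<partial>lborel)"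
      by (subst nn_integral_cmult_indicator) (auto simp: emeasure_unit_cube)
    also have "\<dots> \<le> (\<integral>\<^sup>+c. ennreal (norm (u (x + s *\<^sub>R c))) * indicator unit_cube c
        + ennreal (9 * s) * (H x c * indicator unit_cube c) \<partial>lborel)"
      by (rule nn_integral_mono_AE, use ae in eventually_elim) (auto split: split_indicator)
    also have "\<dots> = A x + ennreal (9 * s) * (\<integral>\<^sup>+c. H x c * indicator unit_cube c \<partial>lborel)"
      unfolding A_def by (subst nn_integral_add) (auto simp: nn_integral_cmult)
    also have "(\<integral>\<^sup>+c. H x c * indicator unit_cube c \<partial>lborel) =
        (\<integral>\<^sup>+c. \<integral>\<^sup>+t. (ennreal (4 * t^3) * ennreal (norm (G (x + (t^4 * s) *\<^sub>R c)))) * indicator {0..1} t * indicator unit_cube c \<partial>lborel \<partial>lborel)"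
      unfolding H_def by (intro nn_integral_cong nn_integral_multc[symmetric]) measurable
    also have "\<dots> = (\<integral>\<^sup>+t. \<integral>\<^sup>+c. (ennreal (4 * t^3) * ennreal (norm (G (x + (t^4 * s) *\<^sub>R c)))) * indicator {0..1} t * indicator unit_cube c \<partial>lborel \<partial>lborel)"
      by (rule lborel_pair.Fubini') measurable
    also have "\<dots> = T x" unfolding T_def
    proof (rule nn_integral_cong)
      fix t :: real
      have "(\<integral>\<^sup>+c. (ennreal (4 * t^3) * ennreal (norm (G (x + (t^4 * s) *\<^sub>R c)))) * indicator {0..1} t * indicator unit_cube c \<partial>lborel)
        = (\<integral>\<^sup>+c. (ennreal (4 * t^3) * indicator {0..1} t) * (ennreal (norm (G (x + (t^4 * s) *\<^sub>R c))) * indicator unit_cube c) \<partial>lborel)"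
        by (intro nn_integral_cong) (simp add: mult_ac)
      also have "\<dots> = (ennreal (4 * t^3) * indicator {0..1} t) * (\<integral>\<^sup>+c. ennreal (norm (G (x + (t^4 * s) *\<^sub>R c))) * indicator unit_cube c \<partial>lborel)"
        by (rule nn_integral_cmult) measurable
      finally show "(\<integral>\<^sup>+c. (ennreal (4 * t^3) * ennreal (norm (G (x + (t^4 * s) *\<^sub>R c)))) * indicator {0..1} t * indicator unit_cube c \<partial>lborel)
        = ennreal (4 * t^3) * (\<integral>\<^sup>+c. ennreal (norm (G (x + (t^4 * s) *\<^sub>R c))) * indicator unit_cube c \<partial>lborel) * indicator {0..1} t"
        by (simp add: mult_ac)
    qed
    finally show "ennreal (norm (u x)) \<le> A x + ennreal (9 * s) * T x" .
  qed
qed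

text \<open>The two cube averages are estimated separately. For the gradient term Jensen's
  inequality moves the fourth power inside the integral over \<open>t\<close>, where each cube
  average is known.\<close>

lemma sobolev_L4_borel:
  assumes wg: "weak_gradient u G" and L: "u \<in> L2" "G \<in> L2"
    and [measurable]: "u \<in> borel_measurable borel" "G \<in> borel_measurable borel" and s: "0 < s"
  shows "(\<integral>\<^sup>+x. ennreal ((norm (u x))^4) \<partial>lborel)
    \<le> ennreal (8 * ((L2_norm u)^4 / s^3) + 8 * 9^4 * 256 * (s * (L2_norm G)^4))"
proof -
  define A where "A = (\<lambda>x. \<integral>\<^sup>+c. ennreal (norm (u (x + s *\<^sub>R c))) * indicator unit_cube c \<partial>lborel)"
  define P where "P = (\<lambda>t x. \<integral>\<^sup>+c. ennreal (norm (G (x + (t^4 * s) *\<^sub>R c))) * indicator unit_cube c \<partial>lborel)"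
  define T where "T = (\<lambda>x. \<integral>\<^sup>+t. (ennreal (4 * t^3) * P t x) * indicator {0..1} t \<partial>lborel)"
  have Am [measurable]: "A \<in> borel_measurable borel" unfolding A_def by measurable
  have Pm [measurable]: "case_prod P \<in> borel_measurable (borel \<Otimes>\<^sub>M borel)" unfolding P_def case_prod_beta' by measurable
  have Pm1 [measurable]: "(\<lambda>t. P t x) \<in> borel_measurable borel" for x unfolding P_def by measurable
  have Pm2 [measurable]: "P t \<in> borel_measurable borel" for t unfolding P_def by measurable
  have Pm3 [measurable]: "(\<lambda>p. P (snd p) (fst p)) \<in> borel_measurable (lborel \<Otimes>\<^sub>M lborel)"
    unfolding P_def by measurable
  have Tm [measurable]: "T \<in> borel_measurable borel"
    unfolding T_def P_def by measurable
  have pw: "AE x in lborel. ennreal (norm (u x)) \<le> A x + ennreal (9 * s) * T x"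
    unfolding A_def T_def P_def by (rule sobolev_pointwise[OF wg L _ _ s]) measurable
  have e1: "8 * ennreal p = ennreal (8 * p)" if "0 \<le> p" for p using that by (simp add: ennreal_mult)
  have e2: "8 * ennreal p * ennreal q = ennreal (8 * p * q)" if "0 \<le> p" "0 \<le> q" for p q
    using that by (simp add: ennreal_mult)
  have A4: "(\<integral>\<^sup>+x. (A x)^4 \<partial>lborel) \<le> ennreal ((L2_norm u)^4 / s^3)"
    unfolding A_def by (rule cube_average_L4[OF _ L(1) s]) measurable
  have "(\<integral>\<^sup>+x. (T x)^4 \<partial>lborel) \<le> (\<integral>\<^sup>+x. \<integral>\<^sup>+t. (ennreal (4 * t^3) * P t x)^4 * indicator {0..1} t \<partial>lborel \<partial>lborel)"
    unfolding T_def by (intro nn_integral_mono jensen_power4) auto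
  also have "\<dots> = (\<integral>\<^sup>+t. \<integral>\<^sup>+x. (ennreal (4 * t^3) * P t x)^4 * indicator {0..1} t \<partial>lborel \<partial>lborel)"
    by (rule lborel_pair.Fubini'[symmetric]) measurable
  also have "\<dots> \<le> (\<integral>\<^sup>+t. ennreal (256 * (L2_norm G)^4 / s^3) * indicator {0..1::real} t \<partial>lborel)"
  proof (rule nn_integral_mono)
    fix t :: real
    show "(\<integral>\<^sup>+x. (ennreal (4 * t^3) * P t x)^4 * indicator {0..1} t \<partial>lborel) \<le> ennreal (256 * (L2_norm G)^4 / s^3) * indicator {0..1} t"
    proof (cases "0 < t \<and> t \<le> 1")
      case True
      have "(\<integral>\<^sup>+x. (ennreal (4 * t^3) * P t x)^4 * indicator {0..1} t \<partial>lborel) = (\<integral>\<^sup>+x. ennreal ((4 * t^3)^4) * (P t x)^4 \<partial>lborel)"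
        using True by (intro nn_integral_cong) (simp add: power_mult_distrib ennreal_power)
      also have "\<dots> = ennreal ((4 * t^3)^4) * (\<integral>\<^sup>+x. (P t x)^4 \<partial>lborel)" by (rule nn_integral_cmult) measurable
      also have "\<dots> \<le> ennreal ((4 * t^3)^4) * ennreal ((L2_norm G)^4 / (t^4 * s)^3)"
        unfolding P_def using True s by (intro mult_left_mono cube_average_L4 L) auto
      also have "\<dots> = ennreal ((4 * t^3)^4 * ((L2_norm G)^4 / (t^4 * s)^3))"
        using True s by (subst ennreal_mult) auto
      \<comment> \<open>The powers of \<open>t\<close> cancel exactly, \<open>t^12\<close> from the
        speed against \<open>t^12\<close> from the volume of the cube. The integrand is constant on
        the unit interval, and 256 is \<open>4^4\<close>.\<close>
      also have "(4 * t^3)^4 * ((L2_norm G)^4 / (t^4 * s)^3) = 256 * (L2_norm G)^4 / s^3"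
        using True by (simp add: power_mult_distrib field_simps flip: power_mult)
      finally show ?thesis using True by simp
    next
      case False
      hence "t = 0 \<or> t \<notin> {0..1}" by auto
      thus ?thesis by auto
    qed
  qed
  also have "\<dots> = ennreal (256 * (L2_norm G)^4 / s^3)" by (subst nn_integral_cmult_indicator) auto
  finally have T4: "(\<integral>\<^sup>+x. (T x)^4 \<partial>lborel) \<le> ennreal (256 * (L2_norm G)^4 / s^3)" .
  have "(\<integral>\<^sup>+x. ennreal ((norm (u x))^4) \<partial>lborel) \<le> (\<integral>\<^sup>+x. 8 * (A x)^4 + 8 * ennreal ((9 * s)^4) * (T x)^4 \<partial>lborel)"
  proof (rule nn_integral_mono_AE, use pw in eventually_elim)
    fix x assume "ennreal (norm (u x)) \<le> A x + ennreal (9 * s) * T x"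
    hence "(ennreal (norm (u x)))^4 \<le> (A x + ennreal (9 * s) * T x)^4" by (rule power_mono_ennreal)
    also have "\<dots> \<le> 8 * ((A x)^4 + (ennreal (9 * s) * T x)^4)" by (rule power4_add_le)
    also have "\<dots> = 8 * (A x)^4 + 8 * ennreal ((9 * s)^4) * (T x)^4"
      using s by (subst power_mult_distrib, subst ennreal_power) (auto simp: distrib_left mult.assoc)
    finally show "ennreal ((norm (u x))^4) \<le> 8 * (A x)^4 + 8 * ennreal ((9 * s)^4) * (T x)^4" by (simp add: ennreal_power)
  qed
  also have "\<dots> = 8 * (\<integral>\<^sup>+x. (A x)^4 \<partial>lborel) + 8 * ennreal ((9 * s)^4) * (\<integral>\<^sup>+x. (T x)^4 \<partial>lborel)"
    by (subst nn_integral_add) (auto simp: nn_integral_cmult)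
  also have "\<dots> \<le> 8 * ennreal ((L2_norm u)^4 / s^3) + 8 * ennreal ((9 * s)^4) * ennreal (256 * (L2_norm G)^4 / s^3)"
    by (intro add_mono mult_left_mono A4 T4) auto
  also have "\<dots> = ennreal (8 * ((L2_norm u)^4 / s^3)) + ennreal (8 * (9 * s)^4 * (256 * (L2_norm G)^4 / s^3))"
    using e1[of "(L2_norm u)^4 / s^3"] e2[of "(9 * s)^4" "256 * (L2_norm G)^4 / s^3"] s by simp
  also have "\<dots> = ennreal (8 * ((L2_norm u)^4 / s^3) + 8 * (9 * s)^4 * (256 * (L2_norm G)^4 / s^3))"
    using s by (subst ennreal_plus) auto
  also have "8 * (9 * s)^4 * (256 * (L2_norm G)^4 / s^3) = 8 * 9^4 * 256 * (s * (L2_norm G)^4)"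
    using s by (simp add: power_mult_distrib field_simps power4_eq_xxxx power3_eq_cube)
  finally show ?thesis .
qed

text \<open>The length \<open>s\<close> stays free: with \<open>s = 1\<close> the bound is in terms
  of the \<open>H1\<close> norm, while on unit vectors a small \<open>s\<close> trades the gradient
  against the fixed \<open>L2\<close> norm.\<close>

theorem sobolev_L4:
  assumes u: "u \<in> H1" and s: "0 < s"
  shows "(\<integral>\<^sup>+x. ennreal ((norm (u x))^4) \<partial>lebesgue)
    \<le> ennreal (8 * 9^4 * 256 * ((L2_norm u)^4 / s^3 + s * (L2_norm (grad u))^4))"
proof -
  note D = H1_D[OF u]
  obtain u' where u': "u' \<in> borel_measurable borel" "AE x in lebesgue. u x = u' x"
    by (rule lebesgue_borel_representative[OF L2_measurable[OF D(1)]])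
  obtain G' where G': "G' \<in> borel_measurable borel" "AE x in lebesgue. grad u x = G' x"
    by (rule lebesgue_borel_representative[OF L2_measurable[OF D(3)]])
  note [measurable] = u'(1) G'(1)
  have m: "u' \<in> borel_measurable lebesgue" "G' \<in> borel_measurable lebesgue"
    using u'(1) G'(1) by (auto intro: measurable_completion)
  have L: "u' \<in> L2" "G' \<in> L2" using L2_cong_AE[OF D(1) m(1) u'(2)] L2_cong_AE[OF D(3) m(2) G'(2)] .
  have norms: "L2_norm u' = L2_norm u" "L2_norm G' = L2_norm (grad u)"
    using L2_norm_cong_AE[OF L2_measurable[OF D(1)] m(1) u'(2)] L2_norm_cong_AE[OF L2_measurable[OF D(3)] m(2) G'(2)]
    by simp_all
  have wg: "weak_gradient u' G'"
    unfolding weak_gradient_def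
  proof (intro conjI allI impI)
    fix \<phi> and i :: 3 assume \<phi>: "test_function \<phi>"
    have [measurable]: "\<phi> \<in> borel_measurable lebesgue" "partial_deriv i \<phi> \<in> borel_measurable lebesgue"
      using L2_test_function[OF \<phi>] by (auto intro: L2_measurable)
    note [measurable] = L2_measurable[OF D(1)] L2_measurable[OF D(3)] m
    have "(\<integral>x. partial_deriv i \<phi> x *\<^sub>R u' x \<partial>lebesgue) = (\<integral>x. partial_deriv i \<phi> x *\<^sub>R u x \<partial>lebesgue)"
      using u'(2) by (intro integral_cong_AE) (auto elim: eventually_mono)
    also have "\<dots> = - (\<integral>x. \<phi> x *\<^sub>R (grad u x $ i) \<partial>lebesgue)" by (rule weak_gradientD(1)[OF D(2) \<phi>])
    also have "(\<integral>x. \<phi> x *\<^sub>R (grad u x $ i) \<partial>lebesgue) = (\<integral>x. \<phi> x *\<^sub>R (G' x $ i) \<partial>lebesgue)"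
      using G'(2) by (intro integral_cong_AE) (auto elim: eventually_mono)
    finally show "(\<integral>x. partial_deriv i \<phi> x *\<^sub>R u' x \<partial>lebesgue) = - (\<integral>x. \<phi> x *\<^sub>R (G' x $ i) \<partial>lebesgue)" .
  qed (use L in \<open>auto intro: L2_set_integrable\<close>)
  have "(\<integral>\<^sup>+x. ennreal ((norm (u x))^4) \<partial>lebesgue) = (\<integral>\<^sup>+x. ennreal ((norm (u' x))^4) \<partial>lebesgue)"
    using u'(2) by (intro nn_integral_cong_AE) (auto elim: eventually_mono)
  also have "\<dots> = (\<integral>\<^sup>+x. ennreal ((norm (u' x))^4) \<partial>lborel)" by (rule nn_integral_completion)
  also have "\<dots> \<le> ennreal (8 * ((L2_norm u')^4 / s^3) + 8 * 9^4 * 256 * (s * (L2_norm G')^4))"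
    by (rule sobolev_L4_borel[OF wg L u'(1) G'(1) s])
  also have "\<dots> \<le> ennreal (8 * 9^4 * 256 * ((L2_norm u)^4 / s^3 + s * (L2_norm (grad u))^4))"
  proof (intro ennreal_leI)
    have "0 \<le> (L2_norm u)^4 / s^3" using s by simp
    thus "8 * ((L2_norm u')^4 / s^3) + 8 * 9^4 * 256 * (s * (L2_norm G')^4)
        \<le> 8 * 9^4 * 256 * ((L2_norm u)^4 / s^3 + s * (L2_norm (grad u))^4)"
      unfolding norms distrib_left by (intro add_right_mono mult_right_mono) simp_all
  qed
  finally show ?thesis .
qed

section \<open>Fourier transforms and the coupling\<close>

text \<open>Sign and normalization are those of the coupling term in the energy: positive exponent
  and no power of \<open>2 * pi\<close>. Hence the factor \<open>(2 * pi)^3\<close> in the Bessel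
  inequality.\<close>

definition ft :: "(real^3 \<Rightarrow> complex) \<Rightarrow> real^3 \<Rightarrow> complex" where
  "ft \<rho> k = (\<integral>x. exp (\<i> * of_real (k \<bullet> x)) * \<rho> x \<partial>lebesgue)"

lemma exp_measurable [measurable]: "(exp :: complex \<Rightarrow> complex) \<in> borel_measurable borel"
  by (intro borel_measurable_continuous_onI continuous_intros)

lemma ft_cong_AE:
  assumes "AE x in lebesgue. \<rho> x = \<sigma> x" "\<rho> \<in> borel_measurable lebesgue" "\<sigma> \<in> borel_measurable lebesgue"
  shows "ft \<rho> k = ft \<sigma> k"
proof -
  have [measurable]: "(\<lambda>x. exp (\<i> * complex_of_real (k \<bullet> x))) \<in> borel_measurable lebesgue"
    by (rule measurable_completion) measurable
  note [measurable] = assms(2,3)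
  show ?thesis unfolding ft_def using assms(1) by (intro integral_cong_AE) (auto elim: eventually_mono)
qed

lemma ft_borel:
  assumes [measurable]: "\<rho> \<in> borel_measurable borel"
  shows "ft \<rho> k = (\<integral>x. exp (\<i> * of_real (k \<bullet> x)) * \<rho> x \<partial>lborel)"
  unfolding ft_def by (rule integral_completion) measurable

lemma ft_measurable:
  assumes "\<rho> \<in> borel_measurable lebesgue"
  shows "ft \<rho> \<in> borel_measurable borel"
proof -
  obtain \<sigma> where \<sigma>: "\<sigma> \<in> borel_measurable borel" "AE x in lebesgue. \<rho> x = \<sigma> x"
    by (rule lebesgue_borel_representative[OF assms])
  note [measurable] = \<sigma>(1)
  have m: "\<sigma> \<in> borel_measurable lebesgue" by (rule measurable_completion) measurable
  have "ft \<rho> = (\<lambda>k. \<integral>x. exp (\<i> * of_real (k \<bullet> x)) * \<sigma> x \<partial>lborel)"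
    using ft_cong_AE[OF \<sigma>(2) assms m] ft_borel[OF \<sigma>(1)] by auto
  thus ?thesis by simp
qed

lemma ft_measurable_lebesgue [measurable]:
  "\<rho> \<in> borel_measurable lebesgue \<Longrightarrow> ft \<rho> \<in> borel_measurable lebesgue"
  by (rule measurable_completion) (simp add: ft_measurable)

lemma integrable_ft:
  assumes "integrable lebesgue \<rho>"
  shows "integrable lebesgue (\<lambda>x. exp (\<i> * of_real (k \<bullet> x)) * \<rho> x)"
proof (rule Bochner_Integration.integrable_bound[OF assms])
  have [measurable]: "(\<lambda>x. exp (\<i> * complex_of_real (k \<bullet> x))) \<in> borel_measurable lebesgue"
    by (rule measurable_completion) measurable
  note [measurable] = borel_measurable_integrable[OF assms]
  show "(\<lambda>x. exp (\<i> * of_real (k \<bullet> x)) * \<rho> x) \<in> borel_measurable lebesgue" by measurable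
qed (simp add: norm_mult)

lemma norm_ft_le: "norm (ft \<rho> k) \<le> (\<integral>x. norm (\<rho> x) \<partial>lebesgue)"
  using integral_norm_bound[of lebesgue "\<lambda>x. exp (\<i> * of_real (k \<bullet> x)) * \<rho> x"]
  by (simp add: ft_def norm_mult)

lemma ft_add:
  assumes "integrable lebesgue \<rho>" "integrable lebesgue \<sigma>"
  shows "ft (\<lambda>x. \<rho> x + \<sigma> x) k = ft \<rho> k + ft \<sigma> k"
  using integrable_ft[OF assms(1), of k] integrable_ft[OF assms(2), of k]
  by (simp add: ft_def distrib_left)

lemma ft_mult: "ft (\<lambda>x. c * \<rho> x) k = c * ft \<rho> k"
  unfolding ft_def by (subst integral_mult_right_zero[symmetric]) (simp add: mult_ac)

subsection \<open>Bessel's inequality\<close>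

lemma lborel_integral_prod:
  fixes f :: "'a::euclidean_space \<Rightarrow> real \<Rightarrow> complex"
  assumes int: "\<And>b. b \<in> Basis \<Longrightarrow> integrable lborel (f b)"
  shows "(\<integral>k. (\<Prod>b\<in>Basis. f b (k \<bullet> b)) \<partial>lborel) = (\<Prod>b\<in>Basis. \<integral>t. f b t \<partial>lborel)"
proof -
  interpret product_sigma_finite "\<lambda>_::'a. lborel :: real measure" ..
  have [measurable]: "f b \<in> borel_measurable borel" if "b \<in> Basis" for b
    using int[OF that] by simp
  have "(\<integral>k. (\<Prod>b\<in>Basis. f b (k \<bullet> b)) \<partial>lborel) =
      (\<integral>t. (\<Prod>b\<in>Basis. f b ((\<Sum>i\<in>Basis. t i *\<^sub>R i) \<bullet> b)) \<partial>(\<Pi>\<^sub>M b\<in>Basis. lborel))"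
    by (subst lborel_eq, subst integral_distr) auto
  also have "\<dots> = (\<integral>t. (\<Prod>b\<in>Basis. f b (t b)) \<partial>(\<Pi>\<^sub>M b\<in>Basis. lborel))"
    by (intro Bochner_Integration.integral_cong refl prod.cong) (simp add: inner_sum_left inner_Basis if_distrib cong: if_cong)
  also have "\<dots> = (\<Prod>b\<in>Basis. \<integral>t. f b t \<partial>lborel)" by (rule product_integral_prod) (auto intro: int)
  finally show ?thesis .
qed

text \<open>Normalized to be 1 at the origin instead of having unit mass: it is used as a cutoff in
  Fourier space that tends to 1 as the width \<open>n\<close> grows.\<close>

definition gauss :: "real \<Rightarrow> real \<Rightarrow> real" where
  "gauss n t = exp (- ((t / n)\<^sup>2 / 2))"

lemma gauss_measurable [measurable]: "gauss n \<in> borel_measurable borel"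
  unfolding gauss_def[abs_def] by measurable

lemma gauss_nonneg [simp]: "0 \<le> gauss n t" and gauss_0 [simp]: "gauss n 0 = 1"
  by (simp_all add: gauss_def)

lemma gauss_density: "0 < n \<Longrightarrow> gauss n t = sqrt (2 * pi) * std_normal_density (t / n)"
  by (simp add: gauss_def std_normal_density_def)

lemma integrable_std_normal_char:
  "integrable lborel (\<lambda>t. complex_of_real (std_normal_density t) * exp (\<i> * of_real (s * t)))"
proof (rule Bochner_Integration.integrable_bound)
  show "integrable lborel std_normal_density" by (rule integrable_normal_density) simp
qed (auto simp: norm_mult)

lemma std_normal_char:
  "(\<integral>t. complex_of_real (std_normal_density t) * exp (\<i> * of_real (s * t)) \<partial>lborel) = of_real (exp (- (s\<^sup>2 / 2)))"
proof -
  have "char std_normal_distribution s = of_real (exp (- (s\<^sup>2 / 2)))" by (simp add: char_std_normal_distribution)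
  moreover have "char std_normal_distribution s = (\<integral>t. std_normal_density t *\<^sub>R exp (\<i> * of_real (s * t)) \<partial>lborel)"
    unfolding char_def by (subst integral_density) (auto simp: normal_density_nonneg)
  ultimately show ?thesis by (simp add: scaleR_conv_of_real)
qed

text \<open>The characteristic function of the standard normal distribution after rescaling: a
  Gaussian of width \<open>n\<close> becomes one of width \<open>1 / n\<close>.\<close>

lemma gauss_char:
  assumes n: "0 < n"
  shows "integrable lborel (\<lambda>t. complex_of_real (gauss n t) * exp (\<i> * of_real (t * s)))"
    and "(\<integral>t. complex_of_real (gauss n t) * exp (\<i> * of_real (t * s)) \<partial>lborel) =
      of_real (n * sqrt (2 * pi) * gauss (1 / n) s)"
proof -
  let ?h = "\<lambda>t. complex_of_real (std_normal_density t) * exp (\<i> * of_real ((s * n) * t))"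
  have eq: "complex_of_real (gauss n t) * exp (\<i> * of_real (t * s)) = sqrt (2 * pi) * ?h (0 + (1 / n) * t)" for t
    using n by (simp add: gauss_density mult_ac)
  have "integrable lborel (\<lambda>t. ?h (0 + (1 / n) * t))"
    using n integrable_std_normal_char[of "s * n"] by (intro lborel_integrable_real_affine) auto
  thus "integrable lborel (\<lambda>t. complex_of_real (gauss n t) * exp (\<i> * of_real (t * s)))"
    unfolding eq by (rule integrable_mult_right)
  have "(\<integral>t. ?h t \<partial>lborel) = \<bar>1 / n\<bar> *\<^sub>R (\<integral>t. ?h (0 + (1 / n) * t) \<partial>lborel)"
    using n by (intro lborel_integral_real_affine) simp
  hence "(\<integral>t. ?h (0 + (1 / n) * t) \<partial>lborel) = n * of_real (exp (- ((s * n)\<^sup>2 / 2)))"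
    using n unfolding std_normal_char by (simp add: scaleR_conv_of_real field_simps)
  thus "(\<integral>t. complex_of_real (gauss n t) * exp (\<i> * of_real (t * s)) \<partial>lborel) =
      of_real (n * sqrt (2 * pi) * gauss (1 / n) s)"
    unfolding eq by (subst integral_mult_right_zero) (simp add: gauss_def)
qed

lemma nn_integral_gauss:
  assumes n: "0 < n"
  shows "(\<integral>\<^sup>+t. ennreal (gauss n t) \<partial>lborel) = ennreal (n * sqrt (2 * pi))"
proof -
  have "integrable lborel (\<lambda>t. Re (complex_of_real (gauss n t) * exp (\<i> * of_real (t * 0))))"
    using gauss_char(1)[OF n] by (rule integrable_Re)
  hence i: "integrable lborel (gauss n)" by simp
  have "complex_of_real (\<integral>t. gauss n t \<partial>lborel) = of_real (n * sqrt (2 * pi))"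
    using gauss_char(2)[OF n, of 0] by simp
  hence "(\<integral>t. gauss n t \<partial>lborel) = n * sqrt (2 * pi)" by (simp only: of_real_eq_iff)
  thus ?thesis using i by (subst nn_integral_eq_integral) auto
qed

definition gauss3 :: "real \<Rightarrow> real^3 \<Rightarrow> real" where
  "gauss3 n k = (\<Prod>b\<in>Basis. gauss n (k \<bullet> b))"

lemma gauss3_measurable [measurable]: "gauss3 n \<in> borel_measurable borel"
  unfolding gauss3_def[abs_def] by measurable

lemma gauss3_nonneg [simp]: "0 \<le> gauss3 n k"
  unfolding gauss3_def by (intro prod_nonneg) (simp add: gauss_def)

lemma nn_integral_gauss3:
  assumes n: "0 < n"
  shows "(\<integral>\<^sup>+k. ennreal (gauss3 n k) \<partial>lborel) = ennreal ((n * sqrt (2 * pi))^3)"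
proof -
  have "(\<integral>\<^sup>+k. ennreal (gauss3 n k) \<partial>lborel) = (\<integral>\<^sup>+k. (\<Prod>b\<in>Basis. ennreal (gauss n ((k::real^3) \<bullet> b))) \<partial>lborel)"
    by (intro nn_integral_cong) (simp add: gauss3_def prod_ennreal)
  also have "\<dots> = (\<Prod>b\<in>(Basis :: (real^3) set). \<integral>\<^sup>+t. ennreal (gauss n t) \<partial>lborel)"
    by (rule nn_integral_lborel_prod) auto
  also have "\<dots> = ennreal ((n * sqrt (2 * pi))^3)"
    using n by (simp add: nn_integral_gauss ennreal_power)
  finally show ?thesis .
qed

lemma gauss3_char:
  assumes n: "0 < n"
  shows "(\<integral>k. complex_of_real (gauss3 n k) * exp (\<i> * of_real (k \<bullet> z)) \<partial>lborel) =
      of_real ((n * sqrt (2 * pi))^3 * gauss3 (1 / n) z)"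
proof -
  have eq: "complex_of_real (gauss3 n k) * exp (\<i> * of_real (k \<bullet> z)) =
      (\<Prod>b\<in>Basis. complex_of_real (gauss n (k \<bullet> b)) * exp (\<i> * of_real ((k \<bullet> b) * (z \<bullet> b))))" for k
  proof -
    have "exp (\<i> * complex_of_real (k \<bullet> z)) = exp (\<Sum>b\<in>Basis. \<i> * of_real ((k \<bullet> b) * (z \<bullet> b)))"
      by (subst euclidean_inner) (simp add: sum_distrib_left)
    thus ?thesis by (simp add: exp_sum gauss3_def prod.distrib)
  qed
  show ?thesis
    unfolding eq lborel_integral_prod[of "\<lambda>b t. complex_of_real (gauss n t) * exp (\<i> * of_real (t * (z \<bullet> b)))", OF gauss_char(1)[OF n]]
      gauss_char(2)[OF n] by (simp add: gauss3_def prod.distrib power_mult_distrib)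
qed

lemma integrable_pair_bounded:
  fixes f :: "real^3 \<Rightarrow> real^3 \<Rightarrow> complex"
  assumes [measurable]: "case_prod f \<in> borel_measurable (borel \<Otimes>\<^sub>M borel)"
    "a \<in> borel_measurable borel" "b \<in> borel_measurable borel"
    and le: "\<And>x y. norm (f x y) \<le> a x * b y" and nn: "\<And>x. 0 \<le> a x" "\<And>x. 0 \<le> b x"
    and fin: "(\<integral>\<^sup>+x. ennreal (a x) \<partial>lborel) < \<infinity>" "(\<integral>\<^sup>+y. ennreal (b y) \<partial>lborel) < \<infinity>"
  shows "integrable (lborel \<Otimes>\<^sub>M lborel) (case_prod f)"
proof (subst integrable_iff_bounded, intro conjI)
  have "(\<lambda>p. f (fst p) (snd p)) \<in> borel_measurable (lborel \<Otimes>\<^sub>M lborel)"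
    using assms(1) by (simp add: case_prod_beta' cong: measurable_cong_sets)
  thus "case_prod f \<in> borel_measurable (lborel \<Otimes>\<^sub>M lborel)" by (simp add: case_prod_beta')
  have "(\<integral>\<^sup>+p. ennreal (norm (case_prod f p)) \<partial>(lborel \<Otimes>\<^sub>M lborel)) \<le> (\<integral>\<^sup>+p. ennreal (a (fst p)) * ennreal (b (snd p)) \<partial>(lborel \<Otimes>\<^sub>M lborel))"
    using le nn by (intro nn_integral_mono) (auto simp: ennreal_mult[symmetric] intro!: ennreal_leI)
  also have "\<dots> = (\<integral>\<^sup>+x. \<integral>\<^sup>+y. ennreal (a x) * ennreal (b y) \<partial>lborel \<partial>lborel)"
    by (subst lborel.nn_integral_fst[symmetric]) auto
  also have "\<dots> = (\<integral>\<^sup>+x. ennreal (a x) \<partial>lborel) * (\<integral>\<^sup>+y. ennreal (b y) \<partial>lborel)"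
    by (simp add: nn_integral_cmult nn_integral_multc)
  also have "\<dots> < \<infinity>" using fin by (simp add: ennreal_mult_less_top)
  finally show "(\<integral>\<^sup>+p. ennreal (norm (case_prod f p)) \<partial>(lborel \<Otimes>\<^sub>M lborel)) < \<infinity>" .
qed

text \<open>
  Inserting the Gaussian weight \<open>gauss3 n\<close> turns the left-hand side into
  \<open>\<integral>\<integral> \<rho>(x) cnj \<rho>(y) \<gamma>(x - y)\<close>, where \<open>\<gamma>\<close> is positive with integral \<open>(2 \<pi>)\<^sup>3\<close>.
\<close>

lemma bessel_gauss:
  assumes [measurable]: "\<rho> \<in> borel_measurable borel" and i: "integrable lborel \<rho>" and L: "\<rho> \<in> L2" and n: "0 < n"
  shows "(\<integral>\<^sup>+k. ennreal (gauss3 n k * (norm (ft \<rho> k))\<^sup>2) \<partial>lborel) \<le> ennreal ((2 * pi)^3 * (L2_norm \<rho>)\<^sup>2)"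
proof -
  let ?e = "\<lambda>t. exp (\<i> * complex_of_real t)"
  let ?g = "\<lambda>k. complex_of_real (gauss3 n k)"
  define \<gamma> where "\<gamma> = (\<lambda>z. (n * sqrt (2 * pi))^3 * gauss3 (1 / n) z)"
  have \<gamma>m [measurable]: "\<gamma> \<in> borel_measurable borel" unfolding \<gamma>_def by measurable
  have \<gamma>0: "0 \<le> \<gamma> z" for z using n by (simp add: \<gamma>_def)
  \<comment> \<open>The factor \<open>n^3\<close> in front cancels the mass of a Gaussian of width
    \<open>1 / n\<close>, so the mass of \<gamma> does not depend on \<open>n\<close>.\<close>
  have \<gamma>_int: "(\<integral>\<^sup>+z. ennreal (\<gamma> z) \<partial>lborel) = ennreal ((2 * pi)^3)"
  proof -
    have "(\<integral>\<^sup>+z. ennreal (\<gamma> z) \<partial>lborel) = ennreal ((n * sqrt (2 * pi))^3) * (\<integral>\<^sup>+z. ennreal (gauss3 (1 / n) z) \<partial>lborel)"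
      using n by (subst nn_integral_cmult[symmetric]) (auto simp: \<gamma>_def ennreal_mult)
    also have "\<dots> = ennreal ((n * sqrt (2 * pi))^3 * ((1 / n) * sqrt (2 * pi))^3)"
      using n by (simp add: nn_integral_gauss3 ennreal_mult)
    also have "(n * sqrt (2 * pi))^3 * ((1 / n) * sqrt (2 * pi))^3 = ((n * sqrt (2 * pi)) * ((1 / n) * sqrt (2 * pi)))^3"
      by (rule power_mult_distrib[symmetric])
    also have "(n * sqrt (2 * pi)) * ((1 / n) * sqrt (2 * pi)) = 2 * pi" using n by simp
    finally show ?thesis .
  qed
  have g_fin: "(\<integral>\<^sup>+k. ennreal (gauss3 n k) \<partial>lborel) < \<infinity>" using n by (simp add: nn_integral_gauss3)
  have \<rho>_fin: "(\<integral>\<^sup>+x. ennreal (norm (\<rho> x)) \<partial>lborel) < \<infinity>" using i by (simp add: integrable_iff_bounded)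
  define M where "M = (\<integral>x. norm (\<rho> x) \<partial>lebesgue)"
  have M0: "0 \<le> M" unfolding M_def by (rule Bochner_Integration.integral_nonneg) simp
  have F [measurable]: "ft \<rho> \<in> borel_measurable borel" by (rule ft_measurable) (rule measurable_completion, measurable)
  have F_le: "norm (ft \<rho> k) \<le> M" for k unfolding M_def by (rule norm_ft_le)
  have Fsq: "of_real ((norm (ft \<rho> k))\<^sup>2) = ft \<rho> k * cnj (ft \<rho> k)" for k by (rule complex_norm_square)
  have int1: "integrable (lborel \<Otimes>\<^sub>M lborel) (\<lambda>(k, x). ?g k * cnj (ft \<rho> k) * (?e (k \<bullet> x) * \<rho> x))"
  proof (rule integrable_pair_bounded[where a = "\<lambda>k. gauss3 n k" and b = "\<lambda>x. M * norm (\<rho> x)"])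
    show "norm (?g k * cnj (ft \<rho> k) * (?e (k \<bullet> x) * \<rho> x)) \<le> gauss3 n k * (M * norm (\<rho> x))" for k x
      using F_le[of k] by (simp add: norm_mult mult.assoc mult_left_mono mult_right_mono)
    have "(\<integral>\<^sup>+x. ennreal (M * norm (\<rho> x)) \<partial>lborel) = ennreal M * (\<integral>\<^sup>+x. ennreal (norm (\<rho> x)) \<partial>lborel)"
      using M0 by (subst nn_integral_cmult[symmetric]) (auto simp: ennreal_mult)
    thus "(\<integral>\<^sup>+x. ennreal (M * norm (\<rho> x)) \<partial>lborel) < \<infinity>" using \<rho>_fin by (simp add: ennreal_mult_less_top)
  qed (use M0 g_fin in auto)
  have int2: "integrable (lborel \<Otimes>\<^sub>M lborel) (\<lambda>(k, y). ?g k * ?e (k \<bullet> x) * cnj (?e (k \<bullet> y) * \<rho> y))" for x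
    by (rule integrable_pair_bounded[where a = "\<lambda>k. gauss3 n k" and b = "\<lambda>x. norm (\<rho> x)"])
       (use g_fin \<rho>_fin in \<open>auto simp: norm_mult\<close>)
  have inner: "(\<integral>k. ?g k * ?e (k \<bullet> x) * cnj (ft \<rho> k) \<partial>lborel) = (\<integral>y. cnj (\<rho> y) * of_real (\<gamma> (x - y)) \<partial>lborel)" for x
  proof -
    have "(\<integral>k. ?g k * ?e (k \<bullet> x) * cnj (ft \<rho> k) \<partial>lborel) =
        (\<integral>k. (\<integral>y. ?g k * ?e (k \<bullet> x) * cnj (?e (k \<bullet> y) * \<rho> y) \<partial>lborel) \<partial>lborel)"
      by (subst integral_mult_right_zero) (simp add: ft_borel Bochner_Integration.integral_cnj del: complex_cnj_mult)
    also have "\<dots> = (\<integral>y. (\<integral>k. ?g k * ?e (k \<bullet> x) * cnj (?e (k \<bullet> y) * \<rho> y) \<partial>lborel) \<partial>lborel)"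
      by (rule lborel_pair.Fubini_integral[OF int2, symmetric])
    also have "\<dots> = (\<integral>y. cnj (\<rho> y) * (\<integral>k. ?g k * ?e (k \<bullet> (x - y)) \<partial>lborel) \<partial>lborel)"
    proof (rule Bochner_Integration.integral_cong[OF refl])
      fix y
      have "?g k * ?e (k \<bullet> x) * cnj (?e (k \<bullet> y) * \<rho> y) = cnj (\<rho> y) * (?g k * ?e (k \<bullet> (x - y)))" for k
      proof -
        have "?e (k \<bullet> (x - y)) = ?e (k \<bullet> x) * cnj (?e (k \<bullet> y))"
          by (simp add: inner_diff_right exp_cnj exp_add[symmetric] algebra_simps)
        thus ?thesis by (simp add: mult_ac)
      qed
      thus "(\<integral>k. ?g k * ?e (k \<bullet> x) * cnj (?e (k \<bullet> y) * \<rho> y) \<partial>lborel) = cnj (\<rho> y) * (\<integral>k. ?g k * ?e (k \<bullet> (x - y)) \<partial>lborel)"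
        by (simp only: integral_mult_right_zero)
    qed
    finally show ?thesis by (simp only: gauss3_char[OF n] \<gamma>_def)
  qed
  have "(\<integral>k. ?g k * of_real ((norm (ft \<rho> k))\<^sup>2) \<partial>lborel) = (\<integral>k. (\<integral>x. ?g k * cnj (ft \<rho> k) * (?e (k \<bullet> x) * \<rho> x) \<partial>lborel) \<partial>lborel)"
    unfolding Fsq integral_mult_right_zero ft_borel[OF assms(1), symmetric] by (simp only: mult_ac)
  also have "\<dots> = (\<integral>x. (\<integral>k. ?g k * cnj (ft \<rho> k) * (?e (k \<bullet> x) * \<rho> x) \<partial>lborel) \<partial>lborel)"
    by (rule lborel_pair.Fubini_integral[OF int1, symmetric])
  also have "\<dots> = (\<integral>x. \<rho> x * (\<integral>k. ?g k * ?e (k \<bullet> x) * cnj (ft \<rho> k) \<partial>lborel) \<partial>lborel)"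
    by (subst integral_mult_right_zero[symmetric]) (simp add: mult_ac)
  also have "\<dots> = (\<integral>x. \<rho> x * (\<integral>y. cnj (\<rho> y) * of_real (\<gamma> (x - y)) \<partial>lborel) \<partial>lborel)" by (simp only: inner)
  finally have main: "(\<integral>k. ?g k * of_real ((norm (ft \<rho> k))\<^sup>2) \<partial>lborel) = (\<integral>x. \<rho> x * (\<integral>y. cnj (\<rho> y) * of_real (\<gamma> (x - y)) \<partial>lborel) \<partial>lborel)" .
  have Sq: "(\<integral>\<^sup>+x. ennreal ((norm (\<rho> x))\<^sup>2) \<partial>lborel) = ennreal ((L2_norm \<rho>)\<^sup>2)"
    using nn_integral_sq_L2[OF L] by (simp add: nn_integral_completion)
  have \<gamma>t: "(\<integral>\<^sup>+y. ennreal (\<gamma> (x - y)) \<partial>lborel) = ennreal ((2 * pi)^3)" for x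
    using nn_integral_affine_lborel[of "\<lambda>z. ennreal (\<gamma> z)" "-1" x] \<gamma>_int by simp
  have \<gamma>t': "(\<integral>\<^sup>+x. ennreal (\<gamma> (x - y)) \<partial>lborel) = ennreal ((2 * pi)^3)" for y
    using nn_integral_translate[of "\<lambda>z. ennreal (\<gamma> z)" "- y"] \<gamma>_int by simp
  have "(\<integral>\<^sup>+k. ennreal (gauss3 n k * (norm (ft \<rho> k))\<^sup>2) \<partial>lborel) = ennreal (\<integral>k. gauss3 n k * (norm (ft \<rho> k))\<^sup>2 \<partial>lborel)"
  proof (rule nn_integral_eq_integral)
    have gi: "integrable lborel (\<lambda>k. gauss3 n k * M\<^sup>2)"
      using g_fin by (intro integrable_mult_left) (simp add: integrable_iff_bounded)
    show "integrable lborel (\<lambda>k. gauss3 n k * (norm (ft \<rho> k))\<^sup>2)"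
      by (rule Bochner_Integration.integrable_bound[OF gi])
         (use F_le in \<open>auto intro!: mult_left_mono power_mono simp: abs_mult\<close>)
  qed auto
  also have "(\<integral>k. gauss3 n k * (norm (ft \<rho> k))\<^sup>2 \<partial>lborel) = norm (\<integral>k. ?g k * of_real ((norm (ft \<rho> k))\<^sup>2) \<partial>lborel)"
  proof -
    have "(\<integral>k. ?g k * of_real ((norm (ft \<rho> k))\<^sup>2) \<partial>lborel) = of_real (\<integral>k. gauss3 n k * (norm (ft \<rho> k))\<^sup>2 \<partial>lborel)"
      by (simp only: of_real_mult[symmetric] integral_complex_of_real)
    moreover have "0 \<le> (\<integral>k. gauss3 n k * (norm (ft \<rho> k))\<^sup>2 \<partial>lborel)" by (rule Bochner_Integration.integral_nonneg) simp
    ultimately show ?thesis by simp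
  qed
  also have "ennreal \<dots> \<le> (\<integral>\<^sup>+x. ennreal (norm (\<rho> x * (\<integral>y. cnj (\<rho> y) * of_real (\<gamma> (x - y)) \<partial>lborel))) \<partial>lborel)"
    unfolding main by (rule norm_integral_le_nn_integral)
  also have "\<dots> \<le> (\<integral>\<^sup>+x. \<integral>\<^sup>+y. ennreal ((norm (\<rho> x))\<^sup>2 / 2) * ennreal (\<gamma> (x - y)) + ennreal ((norm (\<rho> y))\<^sup>2 / 2) * ennreal (\<gamma> (x - y)) \<partial>lborel \<partial>lborel)"
  proof (rule nn_integral_mono)
    fix x
    have "ennreal (norm (\<rho> x * (\<integral>y. cnj (\<rho> y) * of_real (\<gamma> (x - y)) \<partial>lborel))) =
        ennreal (norm (\<rho> x)) * ennreal (norm (\<integral>y. cnj (\<rho> y) * of_real (\<gamma> (x - y)) \<partial>lborel))"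
      by (simp add: norm_mult ennreal_mult)
    also have "\<dots> \<le> ennreal (norm (\<rho> x)) * (\<integral>\<^sup>+y. ennreal (norm (cnj (\<rho> y) * of_real (\<gamma> (x - y)))) \<partial>lborel)"
      by (intro mult_left_mono norm_integral_le_nn_integral) simp
    also have "\<dots> = (\<integral>\<^sup>+y. ennreal (norm (\<rho> x)) * ennreal (norm (cnj (\<rho> y) * of_real (\<gamma> (x - y)))) \<partial>lborel)"
      by (rule nn_integral_cmult[symmetric]) measurable
    also have "\<dots> \<le> (\<integral>\<^sup>+y. ennreal ((norm (\<rho> x))\<^sup>2 / 2) * ennreal (\<gamma> (x - y)) + ennreal ((norm (\<rho> y))\<^sup>2 / 2) * ennreal (\<gamma> (x - y)) \<partial>lborel)"
    proof (rule nn_integral_mono)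
      fix y
      \<comment> \<open>The inequality between geometric and arithmetic mean separates the
        variables; each half is then multiplied by the total mass of \<gamma>, in \<open>y\<close>
        or in \<open>x\<close>. This replaces Young's convolution inequality.\<close>
      have "norm (\<rho> x) * norm (\<rho> y) \<le> (norm (\<rho> x))\<^sup>2 / 2 + (norm (\<rho> y))\<^sup>2 / 2"
        using sum_squares_bound[of "norm (\<rho> x)" "norm (\<rho> y)"] by simp
      hence "norm (\<rho> x) * norm (\<rho> y) * \<gamma> (x - y) \<le> ((norm (\<rho> x))\<^sup>2 / 2 + (norm (\<rho> y))\<^sup>2 / 2) * \<gamma> (x - y)"
        using \<gamma>0 by (intro mult_right_mono) auto
      hence "ennreal (norm (\<rho> x) * norm (\<rho> y) * \<gamma> (x - y)) \<le> ennreal ((norm (\<rho> x))\<^sup>2 / 2 * \<gamma> (x - y) + (norm (\<rho> y))\<^sup>2 / 2 * \<gamma> (x - y))"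
        by (intro ennreal_leI) (simp add: distrib_right)
      also have "\<dots> = ennreal ((norm (\<rho> x))\<^sup>2 / 2) * ennreal (\<gamma> (x - y)) + ennreal ((norm (\<rho> y))\<^sup>2 / 2) * ennreal (\<gamma> (x - y))"
        using \<gamma>0 by (simp only: ennreal_plus ennreal_mult mult_nonneg_nonneg divide_nonneg_nonneg zero_le_power2 zero_le_numeral)
      finally show "ennreal (norm (\<rho> x)) * ennreal (norm (cnj (\<rho> y) * of_real (\<gamma> (x - y)))) \<le> \<dots>"
        using \<gamma>0[of "x - y"] by (simp add: norm_mult ennreal_mult[symmetric] mult.assoc)
    qed
    finally show "ennreal (norm (\<rho> x * (\<integral>y. cnj (\<rho> y) * of_real (\<gamma> (x - y)) \<partial>lborel))) \<le> \<dots>" .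
  qed
  also have "\<dots> = (\<integral>\<^sup>+x. ennreal ((norm (\<rho> x))\<^sup>2 / 2) * ennreal ((2 * pi)^3) \<partial>lborel) +
      (\<integral>\<^sup>+x. \<integral>\<^sup>+y. ennreal ((norm (\<rho> y))\<^sup>2 / 2) * ennreal (\<gamma> (x - y)) \<partial>lborel \<partial>lborel)"
    by (subst nn_integral_add[symmetric]) (auto intro!: nn_integral_cong simp: nn_integral_add nn_integral_cmult \<gamma>t)
  also have "(\<integral>\<^sup>+x. \<integral>\<^sup>+y. ennreal ((norm (\<rho> y))\<^sup>2 / 2) * ennreal (\<gamma> (x - y)) \<partial>lborel \<partial>lborel)
      = (\<integral>\<^sup>+y. \<integral>\<^sup>+x. ennreal ((norm (\<rho> y))\<^sup>2 / 2) * ennreal (\<gamma> (x - y)) \<partial>lborel \<partial>lborel)"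
    by (rule lborel_pair.Fubini') measurable
  also have "\<dots> = (\<integral>\<^sup>+y. ennreal ((norm (\<rho> y))\<^sup>2 / 2) * ennreal ((2 * pi)^3) \<partial>lborel)"
    by (intro nn_integral_cong) (simp add: nn_integral_cmult \<gamma>t')
  also have "(\<integral>\<^sup>+x. ennreal ((norm (\<rho> x))\<^sup>2 / 2) * ennreal ((2 * pi)^3) \<partial>lborel) + \<dots> = ennreal ((2 * pi)^3 * (L2_norm \<rho>)\<^sup>2)"
  proof -
    have "(\<integral>\<^sup>+x. ennreal ((norm (\<rho> x))\<^sup>2 / 2) * ennreal ((2 * pi)^3) \<partial>lborel) =
        (\<integral>\<^sup>+x. ennreal ((2 * pi)^3 / 2) * ennreal ((norm (\<rho> x))\<^sup>2) \<partial>lborel)"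
      by (intro nn_integral_cong) (simp add: ennreal_mult[symmetric] mult.commute)
    also have "\<dots> = ennreal ((2 * pi)^3 / 2) * ennreal ((L2_norm \<rho>)\<^sup>2)" by (subst nn_integral_cmult) (auto simp: Sq)
    also have "\<dots> = ennreal ((2 * pi)^3 / 2 * (L2_norm \<rho>)\<^sup>2)" by (rule ennreal_mult[symmetric]) auto
    finally show ?thesis by (simp add: ennreal_plus[symmetric] del: ennreal_plus)
  qed
  finally show ?thesis .
qed

text \<open>The Gaussian weights tend to 1 while the bound stays fixed, so Fatou's lemma gives the
  upper bound. Integrability of \<rho> makes the transform a pointwise integral.\<close>

theorem bessel:
  assumes i: "integrable lebesgue \<rho>" and L: "\<rho> \<in> L2"
  shows "(\<integral>\<^sup>+k. ennreal ((norm (ft \<rho> k))\<^sup>2) \<partial>lebesgue) \<le> ennreal ((2 * pi)^3 * (L2_norm \<rho>)\<^sup>2)"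
proof -
  note m = L2_measurable[OF L]
  obtain \<sigma> where \<sigma>: "\<sigma> \<in> borel_measurable borel" "AE x in lebesgue. \<rho> x = \<sigma> x"
    by (rule lebesgue_borel_representative[OF m])
  note [measurable] = \<sigma>(1)
  have \<sigma>m: "\<sigma> \<in> borel_measurable lebesgue" by (rule measurable_completion) measurable
  have eq: "ft \<rho> k = ft \<sigma> k" for k by (rule ft_cong_AE[OF \<sigma>(2) m \<sigma>m])
  have \<sigma>L: "\<sigma> \<in> L2" by (rule L2_cong_AE[OF L \<sigma>m \<sigma>(2)])
  have norm: "L2_norm \<sigma> = L2_norm \<rho>" using L2_norm_cong_AE[OF m \<sigma>m \<sigma>(2)] by simp
  have "integrable lebesgue \<sigma>" using i \<sigma>m \<sigma>(2) by (rule integrable_cong_AE_imp)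
  hence \<sigma>i: "integrable lborel \<sigma>" by (subst (asm) integrable_completion) auto
  have F [measurable]: "ft \<sigma> \<in> borel_measurable borel" by (rule ft_measurable[OF \<sigma>m])
  have lim: "(\<lambda>n. ennreal (gauss3 (real (Suc n)) k * (norm (ft \<sigma> k))\<^sup>2)) \<longlonglongrightarrow> ennreal ((norm (ft \<sigma> k))\<^sup>2)" for k
  proof -
    have "(\<lambda>n. exp (- ((t * (1 / real (Suc n)))\<^sup>2 / 2))) \<longlonglongrightarrow> exp (- ((t * 0)\<^sup>2 / 2))" for t
      using LIMSEQ_inverse_real_of_nat by (intro tendsto_intros) (auto simp: inverse_eq_divide)
    hence "(\<lambda>n. gauss (real (Suc n)) t) \<longlonglongrightarrow> 1" for t by (simp add: gauss_def)
    hence "(\<lambda>n. gauss3 (real (Suc n)) k) \<longlonglongrightarrow> (\<Prod>b\<in>(Basis :: (real^3) set). 1)"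
      unfolding gauss3_def by (intro tendsto_prod)
    hence "(\<lambda>n. gauss3 (real (Suc n)) k * (norm (ft \<sigma> k))\<^sup>2) \<longlonglongrightarrow> 1 * (norm (ft \<sigma> k))\<^sup>2"
      by (intro tendsto_mult tendsto_const) simp
    from tendsto_ennrealI[OF this] show ?thesis by simp
  qed
  have "(\<integral>\<^sup>+k. ennreal ((norm (ft \<rho> k))\<^sup>2) \<partial>lebesgue) = (\<integral>\<^sup>+k. liminf (\<lambda>n. ennreal (gauss3 (real (Suc n)) k * (norm (ft \<sigma> k))\<^sup>2)) \<partial>lborel)"
    unfolding nn_integral_completion eq
    by (intro nn_integral_cong lim_imp_Liminf[symmetric] lim sequentially_bot)
  also have "\<dots> \<le> liminf (\<lambda>n. \<integral>\<^sup>+k. ennreal (gauss3 (real (Suc n)) k * (norm (ft \<sigma> k))\<^sup>2) \<partial>lborel)"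
    by (rule nn_integral_liminf) measurable
  also have "\<dots> \<le> ennreal ((2 * pi)^3 * (L2_norm \<rho>)\<^sup>2)"
  proof (rule Liminf_le)
    show "\<forall>\<^sub>F n in sequentially. (\<integral>\<^sup>+k. ennreal (gauss3 (real (Suc n)) k * (norm (ft \<sigma> k))\<^sup>2) \<partial>lborel) \<le> ennreal ((2 * pi)^3 * (L2_norm \<rho>)\<^sup>2)"
      using bessel_gauss[OF \<sigma>(1) \<sigma>i \<sigma>L, of "real (Suc n)" for n] by (simp add: norm del: of_nat_Suc)
  qed simp
  finally show ?thesis .
qed

subsection \<open>Bounds on the coupling\<close>

lemma weak_L3_tail:
  assumes N: "L3w_norm W \<le> ennreal N" "0 < N" and t: "0 < t"
  shows "emeasure lebesgue {x. t < \<bar>W x\<bar>} \<le> ennreal (N^3 / t^3)"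
proof -
  define e where "e = emeasure lebesgue {x. t < \<bar>W x\<bar>}"
  have "ennreal t * ennreal_cbrt e \<le> L3w_norm W"
    unfolding L3w_norm_def e_def using t by (intro SUP_upper) auto
  hence le: "ennreal t * ennreal_cbrt e \<le> ennreal N" using N(1) by (rule order_trans)
  have "e \<noteq> top"
  proof
    assume "e = top"
    hence "ennreal t * ennreal_cbrt e = top" using t by (simp add: ennreal_cbrt_def ennreal_mult_eq_top_iff)
    with le show False by (simp add: top_unique)
  qed
  then obtain m where m: "e = ennreal m" "0 \<le> m" by (cases e) auto
  have "ennreal (t * root 3 m) \<le> ennreal N"
    using le m t by (simp add: ennreal_cbrt_def ennreal_mult)
  hence "t * root 3 m \<le> N" using N(2) by (simp add: ennreal_le_iff)
  hence "root 3 m \<le> N / t" using t by (simp add: field_simps)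
  hence "root 3 m ^ 3 \<le> (N / t)^3" using m by (intro power_mono) auto
  hence "m \<le> N^3 / t^3" using m by (simp add: power_divide)
  thus ?thesis using m unfolding e_def[symmetric] by (simp add: ennreal_leI)
qed

lemma ennreal_le_suminf: "f j \<le> (\<Sum>k. f k)" for f :: "nat \<Rightarrow> ennreal"
  using sum_le_suminf[of f "{j}"] by simp

text \<open>Dyadic layers: where \<open>\<bar>W x\<bar>\<close> lies between \<open>2^j * l\<close>
  and \<open>2^(j+1) * l\<close> it is at most the upper value, and the level set has measure at
  most \<open>N^3 / (2^j * l)^3\<close>. The terms decay with ratio \<open>1/4\<close>; their sum
  \<open>8/3\<close> is rounded up to 4.\<close>

lemma weak_L3_integral_tail:
  assumes [measurable]: "W \<in> borel_measurable lebesgue" and N: "L3w_norm W \<le> ennreal N" "0 < N" and l: "0 < l"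
  shows "(\<integral>\<^sup>+x. ennreal \<bar>W x\<bar> * indicator {x. l < \<bar>W x\<bar>} x \<partial>lebesgue) \<le> ennreal (4 * N^3 / l^2)"
proof -
  have "(\<integral>\<^sup>+x. ennreal \<bar>W x\<bar> * indicator {x. l < \<bar>W x\<bar>} x \<partial>lebesgue)
      \<le> (\<integral>\<^sup>+x. (\<Sum>j. ennreal (2^(Suc j) * l) * indicator {x. 2^j * l < \<bar>W x\<bar>} x) \<partial>lebesgue)"
  proof (rule nn_integral_mono)
    fix x
    show "ennreal \<bar>W x\<bar> * indicator {x. l < \<bar>W x\<bar>} x \<le> (\<Sum>j. ennreal (2^(Suc j) * l) * indicator {x. 2^j * l < \<bar>W x\<bar>} x)"
    proof (cases "l < \<bar>W x\<bar>")
      case True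
      obtain n where "\<bar>W x\<bar> / l < 2^n" using real_arch_pow[of 2 "\<bar>W x\<bar> / l"] by auto
      hence ex: "\<bar>W x\<bar> \<le> 2^n * l" using l by (simp add: field_simps)
      define m where "m = (LEAST n. \<bar>W x\<bar> \<le> 2^n * l)"
      have m: "\<bar>W x\<bar> \<le> 2^m * l" unfolding m_def using ex by (rule LeastI)
      have "m \<noteq> 0" using m True by (intro notI) simp
      then obtain j where j: "m = Suc j" by (cases m) auto
      have "\<not> \<bar>W x\<bar> \<le> 2^j * l" using not_less_Least[of j "\<lambda>n. \<bar>W x\<bar> \<le> 2^n * l"] j by (simp add: m_def)
      hence "ennreal \<bar>W x\<bar> \<le> ennreal (2^(Suc j) * l) * indicator {x. 2^j * l < \<bar>W x\<bar>} x"
        using m j by (simp add: ennreal_leI)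
      also have "\<dots> \<le> (\<Sum>j. ennreal (2^(Suc j) * l) * indicator {x. 2^j * l < \<bar>W x\<bar>} x)"
        by (rule ennreal_le_suminf)
      finally show ?thesis using True by simp
    qed simp
  qed
  also have "\<dots> = (\<Sum>j. \<integral>\<^sup>+x. ennreal (2^(Suc j) * l) * indicator {x. 2^j * l < \<bar>W x\<bar>} x \<partial>lebesgue)"
    by (rule nn_integral_suminf) measurable
  also have "\<dots> \<le> (\<Sum>j. ennreal (2 * N^3 / l^2 * (1/4)^j))"
  proof (rule suminf_le)
    fix j
    have "(\<integral>\<^sup>+x. ennreal (2^(Suc j) * l) * indicator {x. 2^j * l < \<bar>W x\<bar>} x \<partial>lebesgue)
      = ennreal (2^(Suc j) * l) * emeasure lebesgue {x. 2^j * l < \<bar>W x\<bar>}"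
    proof (rule nn_integral_cmult_indicator)
      have "{x \<in> space lebesgue. 2^j * l < \<bar>W x\<bar>} \<in> sets lebesgue" by measurable
      thus "{x. 2^j * l < \<bar>W x\<bar>} \<in> sets lebesgue" by simp
    qed
    also have "\<dots> \<le> ennreal (2^(Suc j) * l) * ennreal (N^3 / (2^j * l)^3)"
      using l by (intro mult_left_mono weak_L3_tail N) auto
    also have "\<dots> = ennreal (2^(Suc j) * l * (N^3 / (2^j * l)^3))" using l N by (intro ennreal_mult[symmetric]) auto
    also have "2^(Suc j) * l * (N^3 / (2^j * l)^3) = 2 * N^3 / l^2 * (1/4)^j"
    proof -
      have "(4::real)^j = 2^j * 2^j" by (simp add: power_mult_distrib[symmetric])
      thus ?thesis using l by (simp add: power_mult_distrib power2_eq_square power3_eq_cube field_simps)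
    qed
    finally show "(\<integral>\<^sup>+x. ennreal (2^(Suc j) * l) * indicator {x. 2^j * l < \<bar>W x\<bar>} x \<partial>lebesgue) \<le> ennreal (2 * N^3 / l^2 * (1/4)^j)" .
  qed auto
  also have "\<dots> = ennreal (\<Sum>j. 2 * N^3 / l^2 * (1/4)^j)"
    using N by (intro suminf_ennreal2 summable_mult summable_geometric) auto
  also have "(\<Sum>j. 2 * N^3 / l^2 * (1/4)^j) = 2 * N^3 / l^2 * (1 / (1 - 1/4))"
    by (subst suminf_mult) (auto simp: suminf_geometric intro: summable_geometric)
  also have "ennreal (2 * N^3 / l^2 * (1 / (1 - 1/4))) \<le> ennreal (4 * N^3 / l^2)"
    using N l by (intro ennreal_leI) (simp add: field_simps)
  finally show ?thesis .
qed

text \<open>\<open>W1\<close> is paired with the supremum \<open>H\<close> of \<open>h\<close>.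
  \<open>W2\<close> is split at the height \<open>N * s\<close>: below it the integral
  \<open>I\<close> of \<open>h\<close> is used, above it the supremum and the tail estimate.
  Measuring the height in units of \<open>N\<close> makes the bound linear in \<open>N\<close> for
  every \<open>s\<close>.\<close>

lemma decomp_integral_le:
  assumes W: "L1_L3w_decomp W W1 W2" and n: "L1_norm W1 \<le> ennreal N" "L3w_norm W2 \<le> ennreal N" "0 < N"
    and h [measurable]: "h \<in> borel_measurable lebesgue" and hb: "\<And>x. 0 \<le> h x" "\<And>x. h x \<le> H" "0 \<le> H"
    and I: "(\<integral>\<^sup>+x. ennreal (h x) \<partial>lebesgue) \<le> ennreal I" "0 \<le> I" and s: "0 < s"
  shows "(\<integral>\<^sup>+x. ennreal (\<bar>W x\<bar> * h x) \<partial>lebesgue) \<le> ennreal (N * (H + s * I + 4 * H / s^2))"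
proof -
  have [measurable]: "W1 \<in> borel_measurable lebesgue" "W2 \<in> borel_measurable lebesgue"
    using W by (auto simp: L1_L3w_decomp_def L1_def L3w_def)
  have ae: "AE x in lebesgue. W x = W1 x + W2 x" using W by (simp add: L1_L3w_decomp_def)
  let ?T = "{x. N * s < \<bar>W2 x\<bar>}"
  have "(\<integral>\<^sup>+x. ennreal (\<bar>W x\<bar> * h x) \<partial>lebesgue) \<le>
      (\<integral>\<^sup>+x. ennreal H * ennreal \<bar>W1 x\<bar> + (ennreal (N * s) * ennreal (h x) + ennreal H * (ennreal \<bar>W2 x\<bar> * indicator ?T x)) \<partial>lebesgue)"
  proof (rule nn_integral_mono_AE, use ae in eventually_elim)
    fix x assume eq: "W x = W1 x + W2 x"
    have 1: "\<bar>W x\<bar> * h x \<le> H * \<bar>W1 x\<bar> + \<bar>W2 x\<bar> * h x"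
    proof -
      have "\<bar>W x\<bar> * h x \<le> (\<bar>W1 x\<bar> + \<bar>W2 x\<bar>) * h x" unfolding eq using hb by (intro mult_right_mono) auto
      moreover have "\<bar>W1 x\<bar> * h x \<le> \<bar>W1 x\<bar> * H" using hb by (intro mult_left_mono) auto
      ultimately show ?thesis by (simp add: algebra_simps)
    qed
    have 2: "ennreal (\<bar>W2 x\<bar> * h x) \<le> ennreal (N * s) * ennreal (h x) + ennreal H * (ennreal \<bar>W2 x\<bar> * indicator ?T x)"
    proof (cases "x \<in> ?T")
      case True
      have "ennreal (\<bar>W2 x\<bar> * h x) \<le> ennreal (H * \<bar>W2 x\<bar>)"
        using mult_left_mono[OF hb(2)[of x], of "\<bar>W2 x\<bar>"] by (intro ennreal_leI) (simp add: mult.commute)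
      also have "\<dots> = ennreal H * (ennreal \<bar>W2 x\<bar> * indicator ?T x)" using True hb by (simp add: ennreal_mult)
      also have "\<dots> \<le> ennreal (N * s) * ennreal (h x) + \<dots>" by simp
      finally show ?thesis .
    next
      case False
      hence "\<bar>W2 x\<bar> * h x \<le> (N * s) * h x" using hb by (intro mult_right_mono) auto
      hence "ennreal (\<bar>W2 x\<bar> * h x) \<le> ennreal ((N * s) * h x)" by (rule ennreal_leI)
      also have "\<dots> = ennreal (N * s) * ennreal (h x)" using n s hb by (intro ennreal_mult) auto
      also have "\<dots> \<le> ennreal (N * s) * ennreal (h x) + ennreal H * (ennreal \<bar>W2 x\<bar> * indicator ?T x)" by simp
      finally show ?thesis .
    qed
    have "ennreal (\<bar>W x\<bar> * h x) \<le> ennreal (H * \<bar>W1 x\<bar> + \<bar>W2 x\<bar> * h x)" using 1 by (rule ennreal_leI)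
    also have "\<dots> = ennreal H * ennreal \<bar>W1 x\<bar> + ennreal (\<bar>W2 x\<bar> * h x)"
      using hb by (simp add: ennreal_mult)
    also have "\<dots> \<le> ennreal H * ennreal \<bar>W1 x\<bar> + (ennreal (N * s) * ennreal (h x) + ennreal H * (ennreal \<bar>W2 x\<bar> * indicator ?T x))"
      using 2 by (rule add_left_mono)
    finally show "ennreal (\<bar>W x\<bar> * h x) \<le> \<dots>" .
  qed
  also have "\<dots> = ennreal H * L1_norm W1 + (ennreal (N * s) * (\<integral>\<^sup>+x. ennreal (h x) \<partial>lebesgue) +
      ennreal H * (\<integral>\<^sup>+x. ennreal \<bar>W2 x\<bar> * indicator ?T x \<partial>lebesgue))"
    unfolding L1_norm_def by (simp add: nn_integral_add nn_integral_cmult)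
  also have "\<dots> \<le> ennreal H * ennreal N + (ennreal (N * s) * ennreal I + ennreal H * ennreal (4 * N^3 / (N * s)^2))"
    using n s by (intro add_mono mult_left_mono n I weak_L3_integral_tail) auto
  also have "\<dots> = ennreal (H * N + (N * s * I + H * (4 * N^3 / (N * s)^2)))"
  proof -
    have eq: "ennreal H * ennreal N + (ennreal p * ennreal I + ennreal H * ennreal q) = ennreal (H * N + (p * I + H * q))"
      if "0 \<le> p" "0 \<le> q" for p q using that n hb I by (simp add: ennreal_mult)
    show ?thesis using n s by (intro eq) auto
  qed
  also have "H * N + (N * s * I + H * (4 * N^3 / (N * s)^2)) = N * (H + s * I + 4 * H / s^2)"
    using n s by (simp add: field_simps power2_eq_square power3_eq_cube)
  finally show ?thesis .
qed

text \<open>The infimum over decompositions is in general not attained; some decomposition stays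
  below \<open>2 * \<epsilon>\<close>, which is the source of the factor 2.\<close>

lemma norm_integral_le:
  assumes eps: "0 < \<epsilon>" and W: "L1_L3w_norm W \<le> ennreal \<epsilon>"
    and h [measurable]: "h \<in> borel_measurable lebesgue" and hb: "\<And>x. 0 \<le> h x" "\<And>x. h x \<le> H" "0 \<le> H"
    and I: "(\<integral>\<^sup>+x. ennreal (h x) \<partial>lebesgue) \<le> ennreal I" "0 \<le> I" and s: "0 < s"
  shows "(\<integral>\<^sup>+x. ennreal (\<bar>W x\<bar> * h x) \<partial>lebesgue) \<le> ennreal (2 * \<epsilon> * (H + s * I + 4 * H / s^2))"
proof -
  have "L1_L3w_norm W < ennreal (2 * \<epsilon>)"
    using W eps by (rule_tac le_less_trans[OF W]) (simp add: ennreal_less_iff)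
  then obtain W1 W2 where d: "L1_L3w_decomp W W1 W2" "L1_norm W1 + L3w_norm W2 < ennreal (2 * \<epsilon>)"
    unfolding L1_L3w_norm_def by (auto simp: Inf_less_iff)
  have "L1_norm W1 \<le> L1_norm W1 + L3w_norm W2" "L3w_norm W2 \<le> L1_norm W1 + L3w_norm W2" by simp_all
  with d(2) have "L1_norm W1 \<le> ennreal (2 * \<epsilon>)" "L3w_norm W2 \<le> ennreal (2 * \<epsilon>)"
    using less_imp_le order_trans by blast+
  thus ?thesis by (intro decomp_integral_le[OF d(1)] assms) (use eps in auto)
qed

section \<open>The coupling in terms of Sobolev norms\<close>

definition sobC :: real where "sobC = 8 * 9^4 * 256"

lemma sobC_pos [simp]: "0 < sobC" and sobC_nonneg [simp]: "0 \<le> sobC" by (simp_all add: sobC_def)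

lemma L2_sq_H1:
  assumes u: "u \<in> H1"
  shows "(\<lambda>x. (norm (u x))\<^sup>2) \<in> L2"
    and "0 < s \<Longrightarrow> (L2_norm (\<lambda>x. (norm (u x))\<^sup>2))\<^sup>2 \<le> sobC * ((L2_norm u)^4 / s^3 + s * (L2_norm (grad u))^4)"
proof -
  note [measurable] = L2_measurable[OF H1_D(1)[OF u]]
  have eq: "(\<integral>\<^sup>+x. ennreal ((norm ((norm (u x))\<^sup>2))\<^sup>2) \<partial>lebesgue) = (\<integral>\<^sup>+x. ennreal ((norm (u x))^4) \<partial>lebesgue)"
    by (intro nn_integral_cong) (simp flip: power_mult)
  have b: "(\<integral>\<^sup>+x. ennreal ((norm ((norm (u x))\<^sup>2))\<^sup>2) \<partial>lebesgue) \<le> ennreal (sobC * ((L2_norm u)^4 / s^3 + s * (L2_norm (grad u))^4))"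
    if "0 < s" for s unfolding eq sobC_def using sobolev_L4[OF u that] .
  show L: "(\<lambda>x. (norm (u x))\<^sup>2) \<in> L2"
  proof (rule L2_if_nn_integral)
    show "(\<integral>\<^sup>+x. ennreal ((norm ((norm (u x))\<^sup>2))\<^sup>2) \<partial>lebesgue) < \<infinity>"
      using b[of 1] by (rule le_less_trans) auto
  qed measurable
  show "(L2_norm (\<lambda>x. (norm (u x))\<^sup>2))\<^sup>2 \<le> sobC * ((L2_norm u)^4 / s^3 + s * (L2_norm (grad u))^4)" if s: "0 < s"
    using b[OF s] s unfolding nn_integral_sq_L2[OF L] by (subst (asm) ennreal_le_iff) auto
qed

lemma H1_norm_sq: "(H1_norm u)\<^sup>2 = (L2_norm u)\<^sup>2 + (L2_norm (grad u))\<^sup>2"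
  by (simp add: H1_norm_def)

lemma H1_norm_nonneg [simp]: "0 \<le> H1_norm u"
  by (simp add: H1_norm_def)

lemma sum_power4_le: "(a::real)^4 + b^4 \<le> (a\<^sup>2 + b\<^sup>2)\<^sup>2"
proof -
  have "(a\<^sup>2 + b\<^sup>2)\<^sup>2 = a^4 + b^4 + 2 * (a\<^sup>2 * b\<^sup>2)" by (simp add: power2_sum flip: power_mult)
  thus ?thesis by simp
qed

definition dens :: "(real^3 \<Rightarrow> complex) \<Rightarrow> (real^3 \<Rightarrow> complex) \<Rightarrow> real^3 \<Rightarrow> complex" where
  "dens u w x = u x * cnj (w x)"

lemma dens_facts:
  assumes u: "u \<in> H1" and w: "w \<in> H1"
  shows "integrable lebesgue (dens u w)" "dens u w \<in> L2"
    and "(\<integral>x. norm (dens u w x) \<partial>lebesgue) \<le> L2_norm u * L2_norm w"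
    and "(L2_norm (dens u w))\<^sup>2 \<le> L2_norm (\<lambda>x. (norm (u x))\<^sup>2) * L2_norm (\<lambda>x. (norm (w x))\<^sup>2)"
proof -
  note uL = H1_D(1)[OF u] and wL = H1_D(1)[OF w]
  note [measurable] = L2_measurable[OF uL] L2_measurable[OF wL]
  have m [measurable]: "dens u w \<in> borel_measurable lebesgue" unfolding dens_def[abs_def] by measurable
  show "integrable lebesgue (dens u w)"
    by (rule integrable_mult_L2[OF uL wL m]) (simp add: dens_def norm_mult)
  have eq: "(norm (dens u w x))\<^sup>2 = (norm (u x))\<^sup>2 * (norm (w x))\<^sup>2" for x
    by (simp add: dens_def norm_mult power_mult_distrib)
  have "integrable lebesgue (\<lambda>x. (norm (u x))\<^sup>2 * (norm (w x))\<^sup>2)"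
    by (rule integrable_mult_L2[OF L2_sq_H1(1)[OF u] L2_sq_H1(1)[OF w]]) auto
  thus "dens u w \<in> L2" using m by (simp add: L2_def eq)
  show "(\<integral>x. norm (dens u w x) \<partial>lebesgue) \<le> L2_norm u * L2_norm w"
    using integral_norm_mult_le[OF uL wL] by (simp add: dens_def norm_mult)
  show "(L2_norm (dens u w))\<^sup>2 \<le> L2_norm (\<lambda>x. (norm (u x))\<^sup>2) * L2_norm (\<lambda>x. (norm (w x))\<^sup>2)"
    using integral_norm_mult_le[OF L2_sq_H1(1)[OF u] L2_sq_H1(1)[OF w]] by (simp add: L2_norm_sq eq)
qed

text \<open>The outer 2 is that of the near-optimal decomposition, 5 collects the supremum terms
  \<open>1 + 4\<close>, and the last summand is the Bessel constant times twice the Sobolev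
  constant. The value fits both estimates of \<open>coupling_bound\<close>.\<close>

definition coupK :: real where "coupK = 2 * (5 + 2 * (2 * pi)^3 * sobC)"

lemma coupK_pos [simp]: "0 < coupK"
  unfolding coupK_def by (intro mult_pos_pos add_pos_pos) auto

text \<open>Both estimates apply the splitting to the squared transform of the density: its supremum
  is bounded by the \<open>L2\<close> norms, its integral by Bessel and Sobolev. The bilinear
  estimate serves perturbations around a state; the quadratic one, on unit vectors, makes the
  reduced functional coercive.\<close>

theorem coupling_bound:
  assumes eps: "0 < \<epsilon>" and W: "L1_L3w_norm W \<le> ennreal \<epsilon>" and u: "u \<in> H1" and w: "w \<in> H1"
  shows "(\<integral>\<^sup>+k. ennreal (\<bar>W k\<bar> * (norm (ft (dens u w) k))\<^sup>2) \<partial>lebesgue)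
      \<le> ennreal (coupK * \<epsilon> * (H1_norm u)\<^sup>2 * (H1_norm w)\<^sup>2)"
    and "L2_norm u = 1 \<Longrightarrow> (\<integral>\<^sup>+k. ennreal (\<bar>W k\<bar> * (norm (ft (dens u u) k))\<^sup>2) \<partial>lebesgue)
      \<le> ennreal (coupK * \<epsilon> * (H1_norm u)\<^sup>2)"
proof -
  have base: "(\<integral>\<^sup>+k. ennreal (\<bar>W k\<bar> * (norm (ft (dens u w) k))\<^sup>2) \<partial>lebesgue)
      \<le> ennreal (2 * \<epsilon> * (H + s * ((2 * pi)^3 * R) + 4 * H / s^2))"
    if u: "u \<in> H1" and w: "w \<in> H1" and H: "(L2_norm u * L2_norm w)\<^sup>2 \<le> H"
      and R: "L2_norm (\<lambda>x. (norm (u x))\<^sup>2) * L2_norm (\<lambda>x. (norm (w x))\<^sup>2) \<le> R" and s: "0 < s" for u w H R s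
  proof (rule norm_integral_le[OF eps W _ _ _ _ _ _ s])
    note d = dens_facts[OF u w]
    show "(\<lambda>k. (norm (ft (dens u w) k))\<^sup>2) \<in> borel_measurable lebesgue"
      using L2_measurable[OF d(2)] by measurable
    have "(norm (ft (dens u w) k))\<^sup>2 \<le> (L2_norm u * L2_norm w)\<^sup>2" for k
      using norm_ft_le[of "dens u w" k] d(3) by (intro power_mono) auto
    thus "(norm (ft (dens u w) k))\<^sup>2 \<le> H" for k using H order_trans by blast
    show "0 \<le> H" using H zero_le_power2 order_trans by blast
    have "0 \<le> R" using R by (rule order_trans[rotated]) simp
    thus "0 \<le> (2 * pi)^3 * R" by simp
    have "(\<integral>\<^sup>+k. ennreal ((norm (ft (dens u w) k))\<^sup>2) \<partial>lebesgue) \<le> ennreal ((2 * pi)^3 * (L2_norm (dens u w))\<^sup>2)"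
      by (rule bessel[OF d(1,2)])
    also have "\<dots> \<le> ennreal ((2 * pi)^3 * R)"
      using order_trans[OF d(4) R] by (intro ennreal_leI mult_left_mono) auto
    finally show "(\<integral>\<^sup>+k. ennreal ((norm (ft (dens u w) k))\<^sup>2) \<partial>lebesgue) \<le> ennreal ((2 * pi)^3 * R)" .
  qed simp
  have L4: "(L2_norm (\<lambda>x. (norm (u x))\<^sup>2)) \<le> sqrt sobC * (H1_norm u)\<^sup>2" if u: "u \<in> H1" for u
  proof -
    have "(L2_norm (\<lambda>x. (norm (u x))\<^sup>2))\<^sup>2 \<le> sobC * ((L2_norm u)^4 / 1^3 + 1 * (L2_norm (grad u))^4)"
      by (rule L2_sq_H1(2)[OF u]) simp
    also have "\<dots> \<le> sobC * ((H1_norm u)\<^sup>2)\<^sup>2"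
      unfolding H1_norm_sq using sum_power4_le[of "L2_norm u" "L2_norm (grad u)"] by (intro mult_left_mono) (auto simp: less_imp_le)
    also have "\<dots> = (sqrt sobC * (H1_norm u)\<^sup>2)\<^sup>2" by (simp add: power_mult_distrib less_imp_le)
    finally show ?thesis by (rule power2_le_imp_le) (simp add: less_imp_le)
  qed
  have L2H: "(L2_norm u)\<^sup>2 \<le> (H1_norm u)\<^sup>2" for u :: "real^3 \<Rightarrow> complex" by (simp add: H1_norm_sq)
  show "(\<integral>\<^sup>+k. ennreal (\<bar>W k\<bar> * (norm (ft (dens u w) k))\<^sup>2) \<partial>lebesgue)
      \<le> ennreal (coupK * \<epsilon> * (H1_norm u)\<^sup>2 * (H1_norm w)\<^sup>2)"
  proof -
    define h where "h = (H1_norm u)\<^sup>2 * (H1_norm w)\<^sup>2"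
    have H: "(L2_norm u * L2_norm w)\<^sup>2 \<le> h"
      unfolding h_def power_mult_distrib by (intro mult_mono L2H) auto
    have "L2_norm (\<lambda>x. (norm (u x))\<^sup>2) * L2_norm (\<lambda>x. (norm (w x))\<^sup>2) \<le>
        (sqrt sobC * (H1_norm u)\<^sup>2) * (sqrt sobC * (H1_norm w)\<^sup>2)"
      by (intro mult_mono L4 u w) (auto simp: less_imp_le)
    also have "\<dots> = sobC * h"
    proof -
      have "(sqrt sobC * (H1_norm u)\<^sup>2) * (sqrt sobC * (H1_norm w)\<^sup>2) = (sqrt sobC * sqrt sobC) * h"
        unfolding h_def by (simp only: mult_ac)
      thus ?thesis by simp
    qed
    finally have R: "L2_norm (\<lambda>x. (norm (u x))\<^sup>2) * L2_norm (\<lambda>x. (norm (w x))\<^sup>2) \<le> sobC * h" .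
    have h0: "0 \<le> h" by (simp add: h_def)
    have "2 * \<epsilon> * (h + 1 * ((2 * pi)^3 * (sobC * h)) + 4 * h / 1^2) \<le> coupK * \<epsilon> * h"
    proof -
      define P where "P = (2 * pi)^3 * (sobC * h)"
      have "0 \<le> P" using h0 by (simp add: P_def)
      hence "2 * \<epsilon> * (h + 1 * P + 4 * h / 1^2) \<le> 2 * \<epsilon> * (5 * h + 2 * P)"
        using eps by (intro mult_left_mono) auto
      also have "\<dots> = coupK * \<epsilon> * h" by (simp add: coupK_def P_def algebra_simps)
      finally show ?thesis by (simp only: P_def)
    qed
    from order_trans[OF base[OF u w H R zero_less_one] ennreal_leI[OF this]]
    show ?thesis by (simp only: h_def mult.assoc)
  qed
  show "(\<integral>\<^sup>+k. ennreal (\<bar>W k\<bar> * (norm (ft (dens u u) k))\<^sup>2) \<partial>lebesgue) \<le> ennreal (coupK * \<epsilon> * (H1_norm u)\<^sup>2)"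
    if one: "L2_norm u = 1"
  proof -
    define q where "q = H1_norm u"
    have q1: "1 \<le> q"
    proof -
      have "1\<^sup>2 \<le> q\<^sup>2" using L2H[of u] one by (simp add: q_def)
      thus ?thesis by (rule power2_le_imp_le) (simp add: q_def)
    qed
    have G: "(L2_norm (grad u))^4 \<le> q^4"
    proof -
      have "(L2_norm (grad u))\<^sup>2 \<le> q\<^sup>2" by (simp add: q_def H1_norm_sq)
      hence "((L2_norm (grad u))\<^sup>2)\<^sup>2 \<le> (q\<^sup>2)\<^sup>2" by (rule power_mono) simp
      thus ?thesis by (simp flip: power_mult)
    qed
    \<comment> \<open>At the length scale \<open>1 / q\<close> both Sobolev terms are of order
      \<open>q^3\<close>. Splitting the weak part with the parameter \<open>1 / q\<close> as well
      brings the integral term and the tail term to order \<open>q^2\<close>.\<close>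
    have "(L2_norm (\<lambda>x. (norm (u x))\<^sup>2))\<^sup>2 \<le> sobC * ((L2_norm u)^4 / (1/q)^3 + (1/q) * (L2_norm (grad u))^4)"
      by (rule L2_sq_H1(2)[OF u]) (use q1 in simp)
    also have "\<dots> \<le> sobC * (q^3 + q^3)"
    proof (rule mult_left_mono)
      have "(1/q) * (L2_norm (grad u))^4 \<le> (1/q) * q^4" using G q1 by (intro mult_left_mono) auto
      also have "\<dots> = q^3" using q1 by (simp add: power4_eq_xxxx power3_eq_cube)
      finally show "(L2_norm u)^4 / (1/q)^3 + (1/q) * (L2_norm (grad u))^4 \<le> q^3 + q^3"
        using q1 by (simp add: one power_divide)
    qed (simp add: less_imp_le)
    finally have R: "L2_norm (\<lambda>x. (norm (u x))\<^sup>2) * L2_norm (\<lambda>x. (norm (u x))\<^sup>2) \<le> sobC * (q^3 + q^3)"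
      by (simp only: power2_eq_square)
    have H: "(L2_norm u * L2_norm u)\<^sup>2 \<le> 1" by (simp add: one)
    have "2 * \<epsilon> * (1 + (1/q) * ((2 * pi)^3 * (sobC * (q^3 + q^3))) + 4 * 1 / (1/q)^2) \<le> coupK * \<epsilon> * q\<^sup>2"
    proof -
      have "1 \<le> q\<^sup>2" using q1 by simp
      hence "1 + (1/q) * ((2 * pi)^3 * (sobC * (q^3 + q^3))) + 4 * 1 / (1/q)^2 \<le> (5 + 2 * (2 * pi)^3 * sobC) * q\<^sup>2"
        using q1 by (simp add: field_simps power2_eq_square power3_eq_cube)
      hence "2 * \<epsilon> * (1 + (1/q) * ((2 * pi)^3 * (sobC * (q^3 + q^3))) + 4 * 1 / (1/q)^2) \<le> 2 * \<epsilon> * ((5 + 2 * (2 * pi)^3 * sobC) * q\<^sup>2)"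
        using eps by (intro mult_left_mono) auto
      thus ?thesis unfolding coupK_def by (simp only: mult_ac)
    qed
    hence "ennreal (2 * \<epsilon> * (1 + (1/q) * ((2 * pi)^3 * (sobC * (q^3 + q^3))) + 4 * 1 / (1/q)^2)) \<le> ennreal (coupK * \<epsilon> * q\<^sup>2)"
      by (rule ennreal_leI)
    from order_trans[OF base[OF u u H R] this] q1 show ?thesis by (simp add: q_def)
  qed
qed

section \<open>Strict convexity near the ground state\<close>

text \<open>The form of \<open>H - \<mu>\<close>, with \<mu> the bottom of the spectrum:
  nonnegative, with the ground state in its kernel.\<close>

definition qf :: "(real^3 \<Rightarrow> real) \<Rightarrow> (real^3 \<Rightarrow> complex) \<Rightarrow> (real^3 \<Rightarrow> complex) \<Rightarrow> real" where
  "qf V u w = sform V u w - spectral_inf V * rip u w"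

lemma L2_inner_add_right:
  assumes "u \<in> L2" "w \<in> L2" "z \<in> L2"
  shows "L2_inner u (\<lambda>x. w x + z x) = L2_inner u w + L2_inner u z"
proof -
  have i: "integrable lebesgue (\<lambda>x. cnj (u x) * y x)" if "y \<in> L2" for y
  proof -
    note [measurable] = L2_measurable[OF assms(1)] L2_measurable[OF that]
    show ?thesis by (rule integrable_mult_L2[OF assms(1) that]) (measurable, simp add: norm_mult)
  qed
  show ?thesis using i[OF assms(2)] i[OF assms(3)] by (simp add: L2_inner_def distrib_left)
qed

lemma rip_mult_left: "\<lbrakk>u \<in> L2; w \<in> L2\<rbrakk> \<Longrightarrow> rip (\<lambda>x. c * u x) w = Re (cnj c * L2_inner u w)"
  using Re_L2_inner[OF L2_mult, of u w c] by (simp add: L2_inner_mult_left)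

lemma L2_norm_mult: "L2_norm (\<lambda>x. c * u x) = cmod c * L2_norm u"
  by (simp add: L2_norm_def norm_mult power_mult_distrib real_sqrt_mult)

lemma L2_inner_self: "u \<in> L2 \<Longrightarrow> L2_inner u u = of_real ((L2_norm u)\<^sup>2)"
proof -
  assume u: "u \<in> L2"
  have "L2_inner u u = (\<integral>x. of_real ((norm (u x))\<^sup>2) \<partial>lebesgue)"
    unfolding L2_inner_def by (intro Bochner_Integration.integral_cong) (simp_all only: complex_norm_square mult.commute)
  thus ?thesis by (simp only: integral_complex_of_real L2_norm_sq)
qed

text \<open>The complex projection \<open>p\<close> of \<open>u\<close> to \<psi> is a real
  combination of \<psi> and \<open>\<i> * \<psi>\<close>, and both lie in the kernel of the real
  form \<open>qf V\<close>. So \<open>u\<close> and its orthogonal part \<open>w = u - p\<close>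
  have the same value of the form, and the gap for \<open>w\<close> becomes an inequality for
  \<open>u\<close>.\<close>

theorem ground_state_constants:
  assumes A: "hypothesis_A V" and B: "hypothesis_B V uV"
  defines "\<psi> \<equiv> \<lambda>x. complex_of_real (uV x)"
  obtains \<gamma> K M where "0 < \<gamma>" "1 \<le> K" "0 < M" "psd_form (form_domain V) (qf V)"
    "\<And>u. u \<in> form_domain V \<Longrightarrow> fip V u u \<le> K * (qf V u u + rip u u)"
    "\<And>u. u \<in> form_domain V \<Longrightarrow> qf V u u \<le> M * fip V u u"
    "\<And>u. u \<in> form_domain V \<Longrightarrow> \<gamma> * (rip u u - (cmod (L2_inner \<psi> u))\<^sup>2) \<le> qf V u u"
    "\<psi> \<in> form_domain V" "L2_norm \<psi> = 1" "qf V \<psi> \<psi> = 0"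
proof -
  define \<mu> where "\<mu> = spectral_inf V"
  note V = V_measurable[OF A]
  obtain \<gamma> where g: "0 < \<gamma>" "\<And>u. u \<in> form_domain V \<Longrightarrow> \<mu> * rip u u \<le> sform V u u"
    "\<And>w. \<lbrakk>w \<in> form_domain V; L2_inner \<psi> w = 0\<rbrakk> \<Longrightarrow> (\<mu> + \<gamma>) * rip w w \<le> sform V w w"
    unfolding \<mu>_def \<psi>_def by (rule spectral_gap[OF A B]) blast
  obtain a c where ac: "0 < a" "0 \<le> c"
    "\<And>u. u \<in> form_domain V \<Longrightarrow> a * fip V u u \<le> sform V u u + c * rip u u"
    "\<And>u. u \<in> form_domain V \<Longrightarrow> sform V u u \<le> fip V u u"
    by (rule sform_bounds[OF A]) blast
  interpret S: sym_form "form_domain V" "sform V" by (rule sym_form_sform[OF A])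
  note D = form_domain_D[OF V]
  have q_nonneg: "0 \<le> qf V u u" if "u \<in> form_domain V" for u using g(2)[OF that] by (simp add: qf_def \<mu>_def)
  interpret q: psd_form "form_domain V" "qf V"
  proof
    fix u w z and t :: real
    assume uz: "u \<in> form_domain V" "z \<in> form_domain V"
    note L = D(3)[OF uz(1)] D(3)[OF uz(2)]
    show "qf V (t *\<^sub>R u) z = t * qf V u z"
      unfolding qf_def S.scale_left[OF uz] L2.scale_left[OF L] by (simp add: algebra_simps)
    show "qf V u z = qf V z u" unfolding qf_def S.sym[OF uz] L2.sym[OF L] ..
    assume w: "w \<in> form_domain V"
    show "qf V (u + w) z = qf V u z + qf V w z"
      unfolding qf_def S.add_left[OF uz(1) w uz(2)] L2.add_left[OF L(1) D(3)[OF w] L(2)] by (simp add: algebra_simps)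
  qed (use S.subsp q_nonneg in auto)
  have ef: "schrodinger_op V \<psi> (\<lambda>x. of_real \<mu> * \<psi> x)"
    using B by (simp add: hypothesis_B_def positive_ground_state_def eigenfunction_def \<mu>_def \<psi>_def)
  hence \<psi>: "\<psi> \<in> form_domain V" by (simp add: schrodinger_op_def)
  note \<psi>L = D(3)[OF \<psi>]
  have one: "L2_norm \<psi> = 1"
    using B by (simp add: hypothesis_B_def positive_ground_state_def \<psi>_def L2_norm_def)
  have sker: "schrodinger_form V w \<psi> = of_real \<mu> * L2_inner w \<psi>" if "w \<in> form_domain V" for w
    using ef that by (simp add: schrodinger_op_def L2_inner_mult_right)
  have ker: "qf V \<psi> w = 0" if w: "w \<in> form_domain V" for w
  proof -
    have "sform V w \<psi> = Re (of_real \<mu> * L2_inner w \<psi>)"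
      using schrodinger_form_Re_Im(1)[OF A w \<psi>] sker[OF w] by simp
    also have "\<dots> = \<mu> * rip w \<psi>" using Re_L2_inner[OF D(3)[OF w] \<psi>L] by simp
    finally show ?thesis using q.sym[OF \<psi> w] by (simp add: qf_def \<mu>_def)
  qed
  have i\<psi>: "(\<lambda>x. \<i> * \<psi> x) \<in> form_domain V" by (rule form_domain_mult[OF V \<psi>])
  have keri: "qf V (\<lambda>x. \<i> * \<psi> x) w = 0" if w: "w \<in> form_domain V" for w
  proof -
    have "schrodinger_form V \<psi> w = cnj (schrodinger_form V w \<psi>)"
      unfolding schrodinger_form_def complex_cnj_add Bochner_Integration.integral_cnj[symmetric]
      by (simp add: mult_ac)
    hence "schrodinger_form V \<psi> w = of_real \<mu> * L2_inner \<psi> w"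
      using sker[OF w] L2_inner_cnj[of \<psi> w] by simp
    hence "sform V (\<lambda>x. \<i> * \<psi> x) w = \<mu> * Im (L2_inner \<psi> w)"
      using schrodinger_form_Re_Im(2)[OF A \<psi> w] by simp
    moreover have "rip (\<lambda>x. \<i> * \<psi> x) w = Im (L2_inner \<psi> w)"
      using rip_mult_left[OF \<psi>L D(3)[OF w], of \<i>] by simp
    ultimately show ?thesis by (simp add: qf_def \<mu>_def)
  qed
  show ?thesis
  \<comment> \<open>The quotient alone bounds \<open>fip\<close>; the summand 1 only ensures
    \<open>1 \<le> K\<close>. Likewise \<open>1 + \<bar>\<mu>\<bar>\<close> is positive and bounds
    the shifted form from above.\<close>
  proof (rule that[of \<gamma> "(1 + \<bar>\<mu> + c\<bar>) / a + 1" "1 + \<bar>\<mu>\<bar>"])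
    fix u assume u: "u \<in> form_domain V"
    note uL = D(3)[OF u]
    have r0: "0 \<le> rip u u" by (simp add: rip_self)
    have q0: "0 \<le> qf V u u" by (rule q_nonneg[OF u])
    have rF: "rip u u \<le> fip V u u" by (simp add: fip_def rip_self)
    have "a * fip V u u \<le> qf V u u + (\<mu> + c) * rip u u" using ac(3)[OF u] by (simp add: qf_def \<mu>_def algebra_simps)
    also have "\<dots> \<le> (1 + \<bar>\<mu> + c\<bar>) * (qf V u u + rip u u)"
    proof -
      have "(\<mu> + c) * rip u u \<le> \<bar>\<mu> + c\<bar> * rip u u" using r0 by (intro mult_right_mono) auto
      moreover have "0 \<le> \<bar>\<mu> + c\<bar> * qf V u u" using q0 by simp
      ultimately show ?thesis using r0 unfolding distrib_left distrib_right by linarith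
    qed
    finally have "fip V u u \<le> (1 + \<bar>\<mu> + c\<bar>) / a * (qf V u u + rip u u)" using ac(1) by (simp add: field_simps)
    also have "\<dots> \<le> ((1 + \<bar>\<mu> + c\<bar>) / a + 1) * (qf V u u + rip u u)"
      using q0 r0 by (intro mult_right_mono) auto
    finally show "fip V u u \<le> ((1 + \<bar>\<mu> + c\<bar>) / a + 1) * (qf V u u + rip u u)" .
    have "- \<mu> * rip u u \<le> \<bar>\<mu>\<bar> * rip u u" using r0 by (intro mult_right_mono) auto
    also have "\<dots> \<le> \<bar>\<mu>\<bar> * fip V u u" using rF by (intro mult_left_mono) auto
    finally show "qf V u u \<le> (1 + \<bar>\<mu>\<bar>) * fip V u u" using ac(4)[OF u] by (simp add: qf_def \<mu>_def algebra_simps)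
    define b where "b = L2_inner \<psi> u"
    define p where "p = Re b *\<^sub>R \<psi> + Im b *\<^sub>R (\<lambda>x. \<i> * \<psi> x)"
    have p_eq: "p = (\<lambda>x. b * \<psi> x)" by (simp add: p_def fun_eq_iff complex_eq_iff)
    have pQ: "p \<in> form_domain V" unfolding p_def using \<psi> i\<psi> by blast
    have pL: "p \<in> L2" by (rule D(3)[OF pQ])
    have qp: "qf V p w = 0" if "w \<in> form_domain V" for w
      unfolding p_def using \<psi> i\<psi> that ker keri by (simp add: q.bilin)
    define w where "w = u - p"
    have wQ: "w \<in> form_domain V" unfolding w_def using u pQ by blast
    have w_eq: "w = (\<lambda>x. u x + (- b) * \<psi> x)" by (simp add: w_def p_eq fun_eq_iff)
    have "L2_inner \<psi> w = 0"
      unfolding w_eq by (subst L2_inner_add_right[OF \<psi>L uL L2_mult[OF \<psi>L]])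
        (simp only: L2_inner_mult_right L2_inner_self[OF \<psi>L] one b_def, simp)
    hence "\<gamma> * rip w w \<le> qf V w w" using g(3)[OF wQ] by (simp add: qf_def \<mu>_def algebra_simps)
    also have "qf V w w = qf V u u" unfolding w_def using u pQ qp[OF u] qp[OF pQ] q.sym[OF u pQ] by (simp add: q.bilin)
    also have "rip w w = rip u u - (cmod b)\<^sup>2"
    proof -
      have pu: "rip p u = (cmod b)\<^sup>2"
        unfolding p_eq rip_mult_left[OF \<psi>L uL] b_def[symmetric] by (simp only: cmod_power2) (simp add: power2_eq_square)
      have pp: "rip p p = (cmod b)\<^sup>2" unfolding p_eq rip_self L2_norm_mult one by simp
      show ?thesis unfolding w_def using uL pL pu pp L2.sym[OF uL pL] by (simp add: L2.bilin)
    qed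
    finally show "\<gamma> * (rip u u - (cmod (L2_inner \<psi> u))\<^sup>2) \<le> qf V u u" by (simp add: b_def)
  next
    show "qf V \<psi> \<psi> = 0" by (rule ker[OF \<psi>])
    show "1 \<le> (1 + \<bar>\<mu> + c\<bar>) / a + 1" using ac(1) by simp
  qed (use g(1) \<psi> one q.psd_form_axioms in auto)
qed

section \<open>The reduced functional of the particle\<close>

text \<open>With \<open>s = g * v / sqrt \<omega>\<close> its square integral is the quartic
  interaction, and \<open>- psi s u u\<close> is the optimal field in the coordinates
  \<open>fieldvec\<close>. The two arguments allow the density of a sum to be expanded.\<close>

definition psi :: "(real^3 \<Rightarrow> real) \<Rightarrow> (real^3 \<Rightarrow> complex) \<Rightarrow> (real^3 \<Rightarrow> complex) \<Rightarrow> real^3 \<Rightarrow> complex" where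
  "psi s u w k = s k *\<^sub>R ft (dens u w) k"

lemma psi_add_left: "\<lbrakk>u \<in> H1; u' \<in> H1; w \<in> H1\<rbrakk> \<Longrightarrow> psi s (u + u') w = psi s u w + psi s u' w"
  using ft_add[OF dens_facts(1) dens_facts(1), of u w u' w]
  by (simp add: psi_def fun_eq_iff dens_def[abs_def] distrib_right scaleR_add_right)

lemma psi_add_right: "\<lbrakk>u \<in> H1; u' \<in> H1; w \<in> H1\<rbrakk> \<Longrightarrow> psi s w (u + u') = psi s w u + psi s w u'"
  using ft_add[OF dens_facts(1) dens_facts(1), of w u w u']
  by (simp add: psi_def fun_eq_iff dens_def[abs_def] distrib_left scaleR_add_right)

lemma psi_scale: "psi s (c *\<^sub>R u) (d *\<^sub>R w) = (c * d) *\<^sub>R psi s u w"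
  using ft_mult[of "of_real (c * d)" "dens u w"]
  by (simp add: psi_def fun_eq_iff dens_def[abs_def] scaleR_conv_of_real mult_ac)

lemma psi_phase: "cmod c = 1 \<Longrightarrow> psi s (\<lambda>x. c * u x) (\<lambda>x. c * u x) = psi s u u"
proof -
  assume "cmod c = 1"
  hence "c * cnj c = 1" by (metis complex_norm_square of_real_1 one_power2)
  hence "dens (\<lambda>x. c * u x) (\<lambda>x. c * u x) = dens u u"
    by (auto simp: dens_def fun_eq_iff)
  thus ?thesis by (simp add: psi_def[abs_def])
qed

text \<open>All that the variational argument uses of the particle and of the coupling. \<kappa>
  bounds the interaction, \<eta> is the energy below which a state counts as near the ground state.
  \<open>\<eta> \<le> \<gamma> / 32\<close> fixes the overlap,
  \<open>\<kappa> * K \<le> \<eta> / 4\<close> places low states below \<eta>, and the factors 8 and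
  56 each let one error of \<open>strict_convexity\<close> consume at most half of the gain. The
  weight \<open>s\<close> is a parameter, so all cutoffs share the same constants.\<close>

locale coupled =
  fixes V :: "real^3 \<Rightarrow> real" and \<psi> :: "real^3 \<Rightarrow> complex" and \<gamma> K M \<eta> \<kappa> :: real and s :: "real^3 \<Rightarrow> real"
  assumes V_meas: "V \<in> borel_measurable lebesgue"
    and \<gamma>: "0 < \<gamma>" and K: "1 \<le> K" and M: "0 < M" and \<kappa>: "0 < \<kappa>"
    and q_psd: "psd_form (form_domain V) (qf V)"
    and fip_le: "\<And>u. u \<in> form_domain V \<Longrightarrow> fip V u u \<le> K * (qf V u u + rip u u)"
    and q_le: "\<And>u. u \<in> form_domain V \<Longrightarrow> qf V u u \<le> M * fip V u u"
    and gap: "\<And>u. u \<in> form_domain V \<Longrightarrow> \<gamma> * (rip u u - (cmod (L2_inner \<psi> u))\<^sup>2) \<le> qf V u u"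
    and \<psi>: "\<psi> \<in> form_domain V" "L2_norm \<psi> = 1" "qf V \<psi> \<psi> = 0"
    and psi_L2: "\<And>u w. \<lbrakk>u \<in> H1; w \<in> H1\<rbrakk> \<Longrightarrow> psi s u w \<in> L2"
    and psi_bound: "\<And>u w. \<lbrakk>u \<in> H1; w \<in> H1\<rbrakk> \<Longrightarrow> rip (psi s u w) (psi s u w) \<le> \<kappa> * (H1_norm u)\<^sup>2 * (H1_norm w)\<^sup>2"
    and psi_bound_unit: "\<And>u. \<lbrakk>u \<in> H1; L2_norm u = 1\<rbrakk> \<Longrightarrow> rip (psi s u u) (psi s u u) \<le> \<kappa> * (H1_norm u)\<^sup>2"
    and small: "0 < \<eta>" "\<eta> \<le> 1" "\<eta> \<le> \<gamma> / 32" "\<eta> * (8 * (K * (1 + 2 / \<gamma>))) \<le> 1"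
      "\<kappa> * K \<le> \<eta> / 4" "(\<kappa> * K) * (56 * (K * (1 + 2 / \<gamma>))) \<le> 1"
begin

sublocale F: psd_form "form_domain V" "fip V" by (rule psd_form_fip[OF V_meas])
sublocale q: psd_form "form_domain V" "qf V" by (rule q_psd)

abbreviation "Q \<equiv> form_domain V"

definition D :: "(real^3 \<Rightarrow> complex) \<Rightarrow> real" where "D u = rip (psi s u u) (psi s u u)"
definition J :: "(real^3 \<Rightarrow> complex) \<Rightarrow> real" where "J u = qf V u u - D u"

lemmas QD = form_domain_D[OF V_meas]

lemma D_nonneg: "0 \<le> D u" by (simp add: D_def rip_self)

lemma H1_le: "(H1_norm u)\<^sup>2 \<le> fip V u u" by (simp add: H1_norm_sq fip_def rip_self)

lemma rip_le: "rip u u \<le> fip V u u" by (simp add: fip_def rip_self)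

lemma psi_le: "\<lbrakk>u \<in> Q; w \<in> Q\<rbrakk> \<Longrightarrow> rip (psi s u w) (psi s u w) \<le> \<kappa> * fip V u u * fip V w w"
proof -
  assume uw: "u \<in> Q" "w \<in> Q"
  have "rip (psi s u w) (psi s u w) \<le> \<kappa> * (H1_norm u)\<^sup>2 * (H1_norm w)\<^sup>2" by (intro psi_bound QD uw)
  also have "\<dots> \<le> \<kappa> * fip V u u * fip V w w"
    using \<kappa> H1_le F.nonneg uw by (intro mult_mono) auto
  finally show ?thesis .
qed

lemma statesD: "u \<in> particle_states V \<Longrightarrow> u \<in> Q" "u \<in> particle_states V \<Longrightarrow> rip u u = 1"
  by (auto simp: particle_states_def rip_self)

lemma D_unit: "u \<in> particle_states V \<Longrightarrow> D u \<le> \<kappa> * K * (qf V u u + 1)"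
proof -
  assume u: "u \<in> particle_states V"
  hence uQ: "u \<in> Q" and "L2_norm u = 1" by (auto simp: particle_states_def)
  hence "D u \<le> \<kappa> * (H1_norm u)\<^sup>2" unfolding D_def by (intro psi_bound_unit QD)
  also have "\<dots> \<le> \<kappa> * (K * (qf V u u + 1))"
    using order_trans[OF H1_le fip_le[OF uQ]] statesD(2)[OF u] \<kappa> by (intro mult_left_mono) auto
  finally show ?thesis by simp
qed

text \<open>On unit vectors the interaction is at most \<open>\<kappa> * K * (qf V u u + 1)\<close>
  with \<open>\<kappa> * K \<le> 1/2\<close>, so at least half of \<open>qf\<close> survives in
  \<open>J\<close>.\<close>

lemma q_le_J:
  assumes u: "u \<in> particle_states V"
  shows "qf V u u \<le> 2 * J u + 2 * (\<kappa> * K)"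
proof -
  have q0: "0 \<le> qf V u u" by (rule q.nonneg[OF statesD(1)[OF u]])
  have "\<kappa> * K \<le> 1/2" using small by linarith
  hence "\<kappa> * K * qf V u u \<le> (1/2) * qf V u u" using q0 by (rule mult_right_mono)
  thus ?thesis using D_unit[OF u] by (simp add: J_def distrib_left)
qed

lemma J_lower: "u \<in> particle_states V \<Longrightarrow> - (\<kappa> * K) \<le> J u"
  using q_le_J[of u] q.nonneg[OF statesD(1)[of u]] by linarith

lemma \<psi>_state: "\<psi> \<in> particle_states V" using \<psi> by (simp add: particle_states_def)

lemma J_\<psi>: "J \<psi> \<le> 0" using \<psi>(3) D_nonneg by (simp add: J_def)

text \<open>The bound \<open>2 * J u + 2 * (\<kappa> * K)\<close> is at most
  \<open>4 * (\<kappa> * K)\<close>, hence at most \<eta>. Since the infimum of \<open>J\<close> is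
  at most 0, this leaves room for approximate minimizers.\<close>

lemma near_minimum: "\<lbrakk>u \<in> particle_states V; J u \<le> \<kappa> * K\<rbrakk> \<Longrightarrow> qf V u u \<le> \<eta>"
  using q_le_J[of u] small(5) by linarith

definition overlap :: "(real^3 \<Rightarrow> complex) \<Rightarrow> complex" where "overlap u = L2_inner \<psi> u"

lemma \<psi>L: "\<psi> \<in> L2" by (rule QD(3)[OF \<psi>(1)])

lemma Re_overlap: "u \<in> Q \<Longrightarrow> Re (overlap u) = rip \<psi> u"
  unfolding overlap_def by (rule Re_L2_inner[OF \<psi>L QD(3)])

lemma overlap_ge:
  assumes "u \<in> particle_states V" "qf V u u \<le> \<eta>"
  shows "31/32 \<le> (cmod (overlap u))\<^sup>2"
proof -
  have "\<gamma> * (1 - (cmod (overlap u))\<^sup>2) \<le> \<gamma> * (1/32)"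
    using gap[OF statesD(1)[OF assms(1)]] statesD(2)[OF assms(1)] assms(2) small(3) by (simp add: overlap_def)
  hence "1 - (cmod (overlap u))\<^sup>2 \<le> 1/32" using \<gamma> by (simp only: mult_le_cancel_left_pos)
  thus ?thesis by simp
qed

text \<open>For unit vectors with real positive overlap \<open>a\<close> the squared distance is
  \<open>2 - 2 * a\<close>, and \<open>a \<ge> a^2 \<ge> 31/32\<close> because \<open>a\<close> is
  at most 1.\<close>

lemma near_\<psi>:
  assumes u: "u \<in> particle_states V" "qf V u u \<le> \<eta>" and ov: "Im (overlap u) = 0" "0 < Re (overlap u)"
  shows "rip (u - \<psi>) (u - \<psi>) \<le> 1/16"
proof -
  note uQ = statesD(1)[OF u(1)]
  note uL = QD(3)[OF uQ]
  let ?a = "rip \<psi> u"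
  have a: "0 < ?a" "(cmod (overlap u))\<^sup>2 = ?a\<^sup>2" using ov Re_overlap[OF uQ] by (auto simp: cmod_power2)
  have "?a\<^sup>2 \<le> rip \<psi> \<psi> * rip u u" by (rule L2.cauchy_schwarz[OF \<psi>L uL])
  hence "?a\<^sup>2 \<le> 1" using statesD(2)[OF u(1)] statesD(2)[OF \<psi>_state] by simp
  hence "?a \<le> 1" by (intro power2_le_imp_le[of ?a 1]) simp_all
  hence "?a * ?a \<le> 1 * ?a" using a(1) by (intro mult_right_mono) auto
  hence "?a\<^sup>2 \<le> ?a" by (simp add: power2_eq_square)
  moreover have "31/32 \<le> ?a\<^sup>2" using overlap_ge[OF u] a(2) by simp
  moreover have "rip (u - \<psi>) (u - \<psi>) = 2 - 2 * ?a"
    using uL \<psi>L statesD(2)[OF u(1)] statesD(2)[OF \<psi>_state] by (simp add: L2.bilin L2.sym[OF uL \<psi>L])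
  ultimately show ?thesis by linarith
qed

text \<open>With \<open>u1 = m + d\<close> and \<open>u2 = m - d\<close> the parallelogram identity
  gains \<open>2 * qf V d d\<close> when the normalized midpoint \<open>v\<close> is used as a
  competitor. The near orthogonality of \<open>d\<close> to \<psi> turns this gain into a multiple
  of \<open>fip V d d\<close>, which dominates the errors from normalization and interaction. As
  \<open>e\<close> may be any lower bound of \<open>J\<close>, the estimate covers minimizing
  sequences, uniqueness and stability alike.\<close>

theorem strict_convexity:
  assumes u1: "u1 \<in> particle_states V" "qf V u1 u1 \<le> \<eta>" "Im (overlap u1) = 0" "0 < Re (overlap u1)"
    and u2: "u2 \<in> particle_states V" "qf V u2 u2 \<le> \<eta>" "Im (overlap u2) = 0" "0 < Re (overlap u2)"
    and e: "\<And>u. u \<in> particle_states V \<Longrightarrow> e \<le> J u"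
  shows "fip V (u1 - u2) (u1 - u2) \<le> 4 * (K * (1 + 2 / \<gamma>)) * (J u1 + J u2 - 2 * e)"
proof -
  define K2 where "K2 = K * (1 + 2 / \<gamma>)"
  have K2: "0 < K2" unfolding K2_def using K \<gamma> by (intro mult_pos_pos add_pos_pos divide_pos_pos) auto
  note Q1 = statesD(1)[OF u1(1)] and Q2 = statesD(1)[OF u2(1)]
  note L1 = QD(3)[OF Q1] and L2' = QD(3)[OF Q2]
  define m where "m = (1/2) *\<^sub>R (u1 + u2)"
  define d where "d = (1/2) *\<^sub>R (u1 - u2)"
  have mQ: "m \<in> Q" and dQ: "d \<in> Q" unfolding m_def d_def using Q1 Q2 by blast+
  note mL = QD(3)[OF mQ] and dL = QD(3)[OF dQ]
  have u1_eq: "u1 = m + d" and u2_eq: "u2 = m - d"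
    unfolding m_def d_def scaleR_add_right scaleR_diff_right
    by (simp_all add: scaleR_add_left[symmetric] fun_eq_iff scaleR_2[symmetric])
  have par: "B u1 u1 + B u2 u2 = 2 * B m m + 2 * B d d" if "sym_form Q B" for B
  proof -
    interpret sym_form Q B by (rule that)
    show ?thesis unfolding u1_eq u2_eq using mQ dQ by (simp add: bilin)
  qed
  have parF: "fip V u1 u1 + fip V u2 u2 = 2 * fip V m m + 2 * fip V d d" by (rule par) unfold_locales
  have parq: "qf V u1 u1 + qf V u2 u2 = 2 * qf V m m + 2 * qf V d d" by (rule par) unfold_locales
  have parr: "rip u1 u1 + rip u2 u2 = 2 * rip m m + 2 * rip d d"
    unfolding u1_eq u2_eq using mL dL by (simp add: L2.bilin)
  have r1: "rip u1 u1 = 1" "rip u2 u2 = 1" using statesD(2) u1(1) u2(1) by auto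
  have F1: "fip V u1 u1 \<le> 2 * K" "fip V u2 u2 \<le> 2 * K"
  proof -
    have "fip V u u \<le> 2 * K" if u: "u \<in> Q" "rip u u = 1" "qf V u u \<le> \<eta>" for u
    proof -
      have "fip V u u \<le> K * (qf V u u + rip u u)" by (rule fip_le[OF u(1)])
      also have "\<dots> \<le> K * 2" using u small(2) K by (intro mult_left_mono) auto
      finally show ?thesis by simp
    qed
    thus "fip V u1 u1 \<le> 2 * K" "fip V u2 u2 \<le> 2 * K" using Q1 Q2 r1 u1(2) u2(2) by auto
  qed
  have Fm: "fip V m m \<le> 2 * K" and Fd: "fip V d d \<le> 2 * K"
    using parF F1 F.nonneg[OF mQ] F.nonneg[OF dQ] by linarith+
  have n2: "rip m m = 1 - rip d d" using parr r1 by simp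
  \<comment> \<open>\<open>m\<close> and \<open>d\<close> are half the sum and half the difference
    of vectors of equal length, hence orthogonal.\<close>
  have md: "rip m d = 0"
    using r1 L1 L2' mL dL unfolding m_def d_def
    by (simp add: L2.bilin L2.sym[OF L2' L1] del: scaleR_scaleR)
  have dm: "rip d d \<le> 1/16"
  proof -
    have "rip (u1 - u2) (u1 - u2) \<le> 2 * rip (u1 - \<psi>) (u1 - \<psi>) + 2 * rip (u2 - \<psi>) (u2 - \<psi>)"
      using L2.diff_sq_le[of "u1 - \<psi>" "u2 - \<psi>"] L1 L2' \<psi>L by auto
    also have "\<dots> \<le> 1/4" using near_\<psi>[OF u1] near_\<psi>[OF u2] by simp
    finally have "rip (u1 - u2) (u1 - u2) \<le> 1/4" .
    moreover have "rip d d = rip (u1 - u2) (u1 - u2) / 4"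
      unfolding d_def using L2.in_diff[OF L1 L2'] by (simp add: L2.scale_left L2.scale_right L2.in_scale)
    ultimately show ?thesis by simp
  qed
  have m\<psi>: "rip (\<psi> - m) (\<psi> - m) \<le> 1/16"
  proof -
    have eq: "\<psi> - m = (1/2) *\<^sub>R (\<psi> - u1) + (1/2) *\<^sub>R (\<psi> - u2)"
      by (simp add: m_def fun_eq_iff field_simps scaleR_conv_of_real)
    have D1: "\<psi> - u1 \<in> L2" "\<psi> - u2 \<in> L2" using \<psi>L L1 L2' by blast+
    have n: "rip (\<psi> - u1) (\<psi> - u1) = rip (u1 - \<psi>) (u1 - \<psi>)" "rip (\<psi> - u2) (\<psi> - u2) = rip (u2 - \<psi>) (u2 - \<psi>)"
      using \<psi>L L1 L2' by (simp_all add: L2.bilin)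
    have "rip (\<psi> - m) (\<psi> - m) \<le> 2 * rip ((1/2) *\<^sub>R (\<psi> - u1)) ((1/2) *\<^sub>R (\<psi> - u1)) + 2 * rip ((1/2) *\<^sub>R (\<psi> - u2)) ((1/2) *\<^sub>R (\<psi> - u2))"
      unfolding eq by (rule L2.add_sq_le) (use D1 in blast)+
    also have "\<dots> = (rip (\<psi> - u1) (\<psi> - u1) + rip (\<psi> - u2) (\<psi> - u2)) / 2"
      using D1 by (simp add: L2.scale_left L2.scale_right L2.in_scale)
    also have "\<dots> \<le> 1/16" using near_\<psi>[OF u1] near_\<psi>[OF u2] n by simp
    finally show ?thesis .
  qed
  \<comment> \<open>The overlaps of \<open>u1\<close> and \<open>u2\<close> are real, so that of
    \<open>d\<close> is real too. Since \<open>d\<close> is orthogonal to \<open>m\<close>, only the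
    short vector \<open>\<psi> - m\<close> contributes to it.\<close>
  have od: "(cmod (overlap d))\<^sup>2 \<le> rip d d / 16"
  proof -
    have "overlap d = of_real (rip \<psi> d)"
    proof -
      have "d = (\<lambda>x. of_real (1/2) * u1 x + of_real (- 1/2) * u2 x)"
        by (simp add: d_def fun_eq_iff scaleR_conv_of_real field_simps)
      hence "overlap d = of_real (1/2) * overlap u1 + of_real (- 1/2) * overlap u2"
        unfolding overlap_def using L2_inner_add_right[OF \<psi>L L2_mult[OF L1] L2_mult[OF L2']]
        by (simp only: L2_inner_mult_right)
      hence "Im (overlap d) = 0" using u1(3) u2(3) by simp
      thus ?thesis using Re_overlap[OF dQ] by (simp add: complex_eq_iff)
    qed
    hence "(cmod (overlap d))\<^sup>2 = (rip \<psi> d)\<^sup>2" by simp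
    also have "rip \<psi> d = rip (\<psi> - m) d" using \<psi>L mL dL md by (simp add: L2.bilin)
    also have "\<dots>\<^sup>2 \<le> rip (\<psi> - m) (\<psi> - m) * rip d d"
      using \<psi>L mL dL by (intro L2.cauchy_schwarz) auto
    also have "\<dots> \<le> 1/16 * rip d d" using m\<psi> L2.nonneg[OF dL] by (intro mult_right_mono)
    finally show ?thesis by simp
  qed
  have qd: "fip V d d \<le> K2 * qf V d d"
  proof -
    have "\<gamma> * (rip d d / 2) \<le> \<gamma> * (rip d d - (cmod (overlap d))\<^sup>2)"
      using od L2.nonneg[OF dL] \<gamma> by (intro mult_left_mono) auto
    also have "\<dots> \<le> qf V d d" using gap[OF dQ] by (simp add: overlap_def)
    finally have "rip d d \<le> (2 / \<gamma>) * qf V d d" using \<gamma> by (simp add: field_simps)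
    hence "K * (qf V d d + rip d d) \<le> K * (qf V d d + (2 / \<gamma>) * qf V d d)" using K by (intro mult_left_mono) auto
    with fip_le[OF dQ] show ?thesis by (simp add: K2_def algebra_simps)
  qed
  have rm: "15/16 \<le> rip m m" "rip m m \<le> 1" using n2 dm L2.nonneg[OF dL] by auto
  define v where "v = (1 / sqrt (rip m m)) *\<^sub>R m"
  have s2: "1 / sqrt (rip m m) * (1 / sqrt (rip m m)) = 1 / rip m m" using rm by simp
  have vU: "v \<in> particle_states V"
  proof -
    have "rip v v = (1 / sqrt (rip m m) * (1 / sqrt (rip m m))) * rip m m"
      unfolding v_def using mL by (simp only: L2.scale_left L2.scale_right L2.in_scale mult.assoc)
    hence "rip v v = 1" unfolding s2 using rm by simp
    hence "(L2_norm v)\<^sup>2 = 1\<^sup>2" by (simp add: rip_self)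
    hence "L2_norm v = 1" by (rule power2_eq_imp_eq) auto
    moreover have "v \<in> Q" unfolding v_def using mQ by blast
    ultimately show ?thesis by (simp add: particle_states_def)
  qed
  have qv: "qf V v v = qf V m m / rip m m"
  proof -
    have "qf V v v = (1 / sqrt (rip m m) * (1 / sqrt (rip m m))) * qf V m m"
      unfolding v_def using mQ by (simp only: q.scale_left q.scale_right q.in_scale mult.assoc)
    thus ?thesis unfolding s2 by simp
  qed
  have psiL: "psi s u w \<in> L2" if "u \<in> Q" "w \<in> Q" for u w using that by (intro psi_L2 QD)
  \<comment> \<open>The interaction is homogeneous of degree four and
    \<open>rip m m \<le> 1\<close>, so normalizing \<open>m\<close> can only increase it. As it
    enters \<open>J\<close> with a minus sign, this error has the favorable sign.\<close>
  have Dv: "D m \<le> D v"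
  proof -
    have "psi s v v = (1 / rip m m) *\<^sub>R psi s m m" unfolding v_def psi_scale s2 ..
    hence "D v = (1 / rip m m) * ((1 / rip m m) * D m)"
      unfolding D_def using psiL[OF mQ mQ] by (simp only: L2.scale_left L2.scale_right L2.in_scale)
    moreover have "D m \<le> (1 / rip m m) * ((1 / rip m m) * D m)"
    proof -
      have le: "x \<le> (1 / rip m m) * x" if "0 \<le> x" for x
        using mult_right_mono[of 1 "1 / rip m m" x] rm that by simp
      have "D m \<le> (1 / rip m m) * D m" by (rule le[OF D_nonneg])
      also have "\<dots> \<le> (1 / rip m m) * ((1 / rip m m) * D m)"
        using order_trans[OF D_nonneg calculation] by (rule le)
      finally show ?thesis .
    qed
    ultimately show ?thesis by simp
  qed
  have qm: "qf V m m \<le> \<eta>" using parq u1(2) u2(2) q.nonneg[OF dQ] by linarith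
  \<comment> \<open>Normalization divides \<open>qf V m m\<close> by \<open>1 - rip d d\<close>.
    With \<open>rip d d \<le> 1/16\<close> the inverse is at most \<open>1 + 2 * rip d d\<close>,
    and the excess is multiplied by \<open>qf V m m \<le> \<eta>\<close>.\<close>
  have qv_le: "qf V v v \<le> qf V m m + 2 * \<eta> * fip V d d"
  proof -
    have "1 \<le> (1 - rip d d) * (1 + 2 * rip d d)"
    proof -
      have "rip d d * rip d d \<le> (1/2) * rip d d" using dm L2.nonneg[OF dL] by (intro mult_right_mono) auto
      thus ?thesis by (simp add: algebra_simps)
    qed
    hence "1 / rip m m \<le> 1 + 2 * rip d d" using rm unfolding n2 by (simp add: field_simps)
    hence "qf V m m * (1 / rip m m) \<le> qf V m m * (1 + 2 * rip d d)" using q.nonneg[OF mQ] by (intro mult_left_mono)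
    also have "\<dots> = qf V m m + 2 * (qf V m m * rip d d)" by (simp add: algebra_simps)
    also have "qf V m m * rip d d \<le> \<eta> * fip V d d"
      using qm rip_le L2.nonneg[OF dL] small(1) by (intro mult_mono) auto
    finally show ?thesis by (simp add: qv)
  qed
  \<comment> \<open>\<open>a + b\<close> is the part of \<open>psi s u1 u1\<close> even in
    \<open>d\<close>, and \<open>c\<close> is the odd part. In the sum \<open>D u1 + D u2\<close>
    the products of even and odd parts cancel, so no term linear in \<open>d\<close>
    remains.\<close>
  define a where "a = psi s m m"
  define b where "b = psi s d d"
  define c where "c = psi s m d + psi s d m"
  have abc: "a \<in> L2" "b \<in> L2" "c \<in> L2" unfolding a_def b_def c_def using psiL mQ dQ by auto
  have mH: "m \<in> H1" "d \<in> H1" using QD(1) mQ dQ by auto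
  have dneg: "psi s m (- 1 *\<^sub>R d) = - 1 *\<^sub>R psi s m d" "psi s (- 1 *\<^sub>R d) m = - 1 *\<^sub>R psi s d m"
    "psi s (- 1 *\<^sub>R d) (- 1 *\<^sub>R d) = psi s d d"
    using psi_scale[of s 1 m "-1" d] psi_scale[of s "-1" d 1 m] psi_scale[of s "-1" d "-1" d] by simp_all
  have dH: "- 1 *\<^sub>R d \<in> H1" using QD(1)[OF F.in_scale[OF dQ, of "-1"]] .
  have e1: "psi s u1 u1 = (a + b) + c"
  proof -
    have "m + d \<in> H1" using H1_add(1)[OF mH] by (simp add: plus_fun_def)
    hence "psi s u1 u1 = psi s m m + psi s m d + (psi s d m + psi s d d)"
      unfolding u1_eq using psi_add_left[OF mH, of "m + d" s] psi_add_right[OF mH mH(1), of s] psi_add_right[OF mH mH(2), of s]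
      by simp
    thus ?thesis unfolding a_def b_def c_def by (simp add: algebra_simps)
  qed
  have e2: "psi s u2 u2 = (a + b) - c"
  proof -
    have "u2 = m + - 1 *\<^sub>R d" unfolding u2_eq by simp
    moreover have "m + - 1 *\<^sub>R d \<in> H1" using H1_add(1)[OF mH(1) dH] by (simp add: plus_fun_def)
    ultimately have "psi s u2 u2 = psi s m m + psi s m (- 1 *\<^sub>R d) + (psi s (- 1 *\<^sub>R d) m + psi s (- 1 *\<^sub>R d) (- 1 *\<^sub>R d))"
      using psi_add_left[OF mH(1) dH, of "m + - 1 *\<^sub>R d" s] psi_add_right[OF mH(1) dH mH(1), of s] psi_add_right[OF mH(1) dH dH, of s]
      by simp
    thus ?thesis unfolding dneg a_def b_def c_def by (simp add: algebra_simps)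
  qed
  have Dsum: "D u1 + D u2 = 2 * D m + 4 * rip a b + 2 * rip b b + 2 * rip c c"
    unfolding D_def e1 e2 a_def[symmetric] using abc
    by (simp add: L2.bilin L2.sym[OF abc(2,1)] L2.in_add)
  have ab: "rip a b \<le> 2 * (\<kappa> * K) * fip V d d"
  proof -
    have "rip a b \<le> sqrt (rip a a) * sqrt (rip b b)" using L2.cauchy_schwarz_abs[OF abc(1,2)] by simp
    also have "\<dots> \<le> sqrt (\<kappa> * fip V m m * fip V m m) * sqrt (\<kappa> * fip V d d * fip V d d)"
      unfolding a_def b_def by (intro mult_mono real_sqrt_le_mono psi_le mQ dQ) (auto simp: rip_self intro!: mult_nonneg_nonneg F.nonneg mQ less_imp_le[OF \<kappa>])
    also have "\<dots> = \<kappa> * fip V m m * fip V d d"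
      using \<kappa> F.nonneg[OF mQ] F.nonneg[OF dQ] by (simp add: real_sqrt_mult mult.assoc)
    also have "\<dots> \<le> \<kappa> * (2 * K) * fip V d d"
      using \<kappa> Fm F.nonneg[OF dQ] by (intro mult_right_mono mult_left_mono) auto
    finally show ?thesis by simp
  qed
  have bb: "rip b b \<le> 2 * (\<kappa> * K) * fip V d d"
  proof -
    have "rip b b \<le> \<kappa> * fip V d d * fip V d d" unfolding b_def by (rule psi_le[OF dQ dQ])
    also have "\<dots> \<le> \<kappa> * (2 * K) * fip V d d"
      using \<kappa> Fd F.nonneg[OF dQ] by (intro mult_right_mono mult_left_mono) auto
    finally show ?thesis by simp
  qed
  have cc: "rip c c \<le> 8 * (\<kappa> * K) * fip V d d"
  proof -
    have "rip c c \<le> 2 * rip (psi s m d) (psi s m d) + 2 * rip (psi s d m) (psi s d m)"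
      unfolding c_def by (intro L2.add_sq_le psiL mQ dQ)
    also have "\<dots> \<le> 4 * (\<kappa> * fip V m m * fip V d d)"
      using psi_le[OF mQ dQ] psi_le[OF dQ mQ] by (simp add: mult_ac)
    also have "\<dots> \<le> 4 * (\<kappa> * (2 * K) * fip V d d)"
      using \<kappa> Fm F.nonneg[OF dQ] by (intro mult_left_mono mult_right_mono) auto
    finally show ?thesis by simp
  qed
  have "e \<le> J v" by (rule e[OF vU])
  also have "\<dots> \<le> qf V m m + 2 * \<eta> * fip V d d - D m" using qv_le Dv by (simp add: J_def)
  \<comment> \<open>The constant 28 collects \<open>4 * rip a b\<close>, \<open>2 * rip b b\<close>
    and \<open>2 * rip c c\<close>, that is 8, 4 and 16 multiples of
    \<open>\<kappa> * K * fip V d d\<close>.\<close>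
  finally have "2 * e \<le> J u1 + J u2 - 2 * qf V d d + 4 * \<eta> * fip V d d + 28 * (\<kappa> * K) * fip V d d"
    using parq Dsum ab bb cc unfolding J_def by linarith
  moreover have "fip V d d / K2 \<le> qf V d d" using qd K2 by (simp add: field_simps)
  moreover have "4 * \<eta> * fip V d d \<le> fip V d d / K2 / 2"
  proof -
    have "4 * \<eta> \<le> 1 / K2 / 2" using small(4) K2 unfolding K2_def[symmetric] by (simp add: field_simps)
    thus ?thesis using mult_right_mono[OF _ F.nonneg[OF dQ], of "4 * \<eta>" "1 / K2 / 2"] by simp
  qed
  moreover have "28 * (\<kappa> * K) * fip V d d \<le> fip V d d / K2 / 2"
  proof -
    have "28 * (\<kappa> * K) \<le> 1 / K2 / 2" using small(6) K2 unfolding K2_def[symmetric] by (simp add: field_simps)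
    thus ?thesis using mult_right_mono[OF _ F.nonneg[OF dQ], of "28 * (\<kappa> * K)" "1 / K2 / 2"] by simp
  qed
  ultimately have "fip V d d / K2 \<le> J u1 + J u2 - 2 * e" by linarith
  hence "4 * fip V d d \<le> 4 * K2 * (J u1 + J u2 - 2 * e)" using K2 by (simp add: field_simps)
  moreover have "fip V d d = fip V (u1 - u2) (u1 - u2) / 4"
    unfolding d_def using F.in_diff[OF Q1 Q2] by (simp add: F.scale_left F.scale_right F.in_scale)
  ultimately show ?thesis unfolding K2_def by simp
qed

end

section \<open>Existence and stability of minimizers\<close>

lemma sform_phase:
  assumes V: "V \<in> borel_measurable lebesgue" and u: "u \<in> form_domain V" and c: "cmod c = 1"
  shows "sform V (\<lambda>x. c * u x) (\<lambda>x. c * u x) = sform V u u"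
proof -
  note D = form_domain_D[OF V u]
  have "L2_norm (grad (\<lambda>x. c * u x)) = L2_norm (\<lambda>x. c *s grad u x)"
  proof (rule L2_norm_cong_AE[OF _ _ H1_mult(2)[OF D(1)]])
    show "grad (\<lambda>x. c * u x) \<in> borel_measurable lebesgue"
      by (rule L2_measurable[OF form_domain_D(4)[OF V form_domain_mult[OF V u]]])
    note [measurable] = L2_measurable[OF D(4)]
    show "(\<lambda>x. c *s grad u x) \<in> borel_measurable lebesgue"
      by (rule measurable_compose[OF _ borel_measurable_continuous_onI[OF linear_continuous_on[OF bounded_linear_vector_scalar]]]) measurable
  qed
  also have "\<dots> = L2_norm (grad u)" by (simp add: L2_norm_def norm_vector_scalar c)
  finally have g: "rip (grad (\<lambda>x. c * u x)) (grad (\<lambda>x. c * u x)) = rip (grad u) (grad u)" by (simp add: rip_self)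
  have "(c * u x) \<bullet> (c * u x) = u x \<bullet> u x" for x
    unfolding power2_norm_eq_inner[symmetric] by (simp add: norm_mult c)
  with g show ?thesis by (simp add: sform_def)
qed

context coupled
begin

text \<open>The overlap is linear in \<open>u\<close>, while \<open>qf\<close> on the diagonal and
  the density are invariant under unit phases. A state with nonzero overlap can thus be rotated to
  positive overlap at equal \<open>J\<close>.\<close>

lemma phase_normalize:
  assumes u: "u \<in> particle_states V" and ov: "overlap u \<noteq> 0"
  obtains u' where "u' \<in> particle_states V" "J u' = J u" "qf V u' u' = qf V u u"
    "Im (overlap u') = 0" "0 < Re (overlap u')"
proof -
  define c where "c = cnj (overlap u) / of_real (cmod (overlap u))"
  have c: "cmod c = 1" using ov by (simp add: c_def norm_divide)
  let ?u = "\<lambda>x. c * u x"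
  have "overlap ?u = c * overlap u" by (simp add: overlap_def L2_inner_mult_right)
  also have "\<dots> = of_real (cmod (overlap u))"
  proof -
    have "cnj (overlap u) * overlap u = of_real ((cmod (overlap u))\<^sup>2)" by (simp only: complex_norm_square mult.commute)
    thus ?thesis using ov by (simp add: c_def power2_eq_square)
  qed
  finally have o: "overlap ?u = of_real (cmod (overlap u))" .
  note uQ = statesD(1)[OF u]
  have q: "qf V ?u ?u = qf V u u"
    using sform_phase[OF V_meas uQ c] by (simp add: qf_def rip_self L2_norm_mult c)
  show ?thesis
  proof (rule that[of ?u])
    show "?u \<in> particle_states V"
      using u form_domain_mult[OF V_meas uQ] by (simp add: particle_states_def L2_norm_mult c)
    show "J ?u = J u" unfolding J_def D_def q psi_phase[OF c] ..
    show "Im (overlap ?u) = 0" "0 < Re (overlap ?u)" using o ov by simp_all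
  qed (rule q)
qed

lemma psiL: "\<lbrakk>u \<in> Q; w \<in> Q\<rbrakk> \<Longrightarrow> psi s u w \<in> L2"
  by (intro psi_L2 QD)

text \<open>Telescoping in the two arguments: the difference is
  \<open>psi s (u - w) u + psi s w (u - w)\<close>. This gives local Lipschitz continuity of the
  field as a function of the state, used both for the continuity of \<open>J\<close> and for
  comparing fields.\<close>

lemma psi_diff_le:
  assumes u: "u \<in> Q" and w: "w \<in> Q"
  shows "rip (psi s u u - psi s w w) (psi s u u - psi s w w)
    \<le> 2 * \<kappa> * (fip V u u + fip V w w) * fip V (u - w) (u - w)"
proof -
  have d: "u - w \<in> Q" using u w by blast
  note H = QD(1)[OF u] QD(1)[OF w] QD(1)[OF d]
  have "psi s ((u - w) + w) u = psi s (u - w) u + psi s w u" by (rule psi_add_left[OF H(3,2,1)])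
  moreover have "psi s w ((u - w) + w) = psi s w (u - w) + psi s w w" by (rule psi_add_right[OF H(3,2,2)])
  ultimately have eq: "psi s u u - psi s w w = psi s (u - w) u + psi s w (u - w)" by simp
  have "rip (psi s u u - psi s w w) (psi s u u - psi s w w)
      \<le> 2 * rip (psi s (u - w) u) (psi s (u - w) u) + 2 * rip (psi s w (u - w)) (psi s w (u - w))"
    unfolding eq by (rule L2.add_sq_le[OF psiL[OF d u] psiL[OF w d]])
  also have "\<dots> \<le> 2 * (\<kappa> * fip V (u - w) (u - w) * fip V u u) + 2 * (\<kappa> * fip V w w * fip V (u - w) (u - w))"
    using psi_le[OF d u] psi_le[OF w d] by simp
  also have "\<dots> = 2 * \<kappa> * (fip V u u + fip V w w) * fip V (u - w) (u - w)" by (simp add: algebra_simps)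
  finally show ?thesis .
qed

lemma J_tendsto:
  assumes X: "\<And>n. X n \<in> Q" and u: "u \<in> Q" and lim: "(\<lambda>n. fip V (X n - u) (X n - u)) \<longlonglongrightarrow> 0"
  shows "(\<lambda>n. J (X n)) \<longlonglongrightarrow> J u"
proof -
  have d: "X n - u \<in> Q" for n using X u by blast
  have "(\<lambda>n. qf V (X n - u) (X n - u)) \<longlonglongrightarrow> 0"
  proof (rule tendsto_sandwich[OF _ _ tendsto_const])
    show "(\<lambda>n. M * fip V (X n - u) (X n - u)) \<longlonglongrightarrow> 0" using tendsto_mult[OF tendsto_const lim, of M] by simp
  qed (use q_le d q.nonneg in auto)
  hence 1: "(\<lambda>n. qf V (X n) (X n)) \<longlonglongrightarrow> qf V u u" by (rule q.tendsto_form_diag[OF _ X u])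
  have "(\<lambda>n. rip (psi s (X n) (X n) - psi s u u) (psi s (X n) (X n) - psi s u u)) \<longlonglongrightarrow> 0"
  proof (rule tendsto_sandwich[OF _ _ tendsto_const])
    have "(\<lambda>n. 2 * \<kappa> * (fip V (X n) (X n) + fip V u u) * fip V (X n - u) (X n - u))
        \<longlonglongrightarrow> 2 * \<kappa> * (fip V u u + fip V u u) * 0"
      by (intro tendsto_mult tendsto_add tendsto_const F.tendsto_form_diag[OF lim X u] lim)
    thus "(\<lambda>n. 2 * \<kappa> * (fip V (X n) (X n) + fip V u u) * fip V (X n - u) (X n - u)) \<longlonglongrightarrow> 0" by simp
  qed (use psi_diff_le X u in \<open>auto simp: rip_self\<close>)
  hence 2: "(\<lambda>n. D (X n)) \<longlonglongrightarrow> D u" unfolding D_def by (rule L2.tendsto_form_diag) (intro psiL X u)+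
  show ?thesis unfolding J_def by (intro tendsto_diff 1 2)
qed

lemma Im_overlap: "u \<in> Q \<Longrightarrow> Im (overlap u) = rip (\<lambda>x. \<i> * \<psi> x) u"
  using rip_mult_left[OF \<psi>L QD(3), of u \<i>] by (simp add: overlap_def)

text \<open>Strict convexity with \<open>e\<close> the infimum makes a normalized minimizing
  sequence Cauchy in the form norm, so the limit is strong and \<open>J\<close> is continuous along
  it.\<close>

theorem J_minimizer_exists:
  obtains u where "u \<in> particle_states V" "Im (overlap u) = 0" "0 < Re (overlap u)"
    "\<And>v. v \<in> particle_states V \<Longrightarrow> J u \<le> J v"
proof -
  define e where "e = (INF u\<in>particle_states V. J u)"
  have bdd: "bdd_below (J ` particle_states V)" using J_lower by (intro bdd_belowI[of _ "- (\<kappa> * K)"]) auto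
  have e_le: "e \<le> J u" if "u \<in> particle_states V" for u
    unfolding e_def using that bdd by (rule cINF_lower[rotated])
  have e0: "e \<le> 0" using e_le[OF \<psi>_state] J_\<psi> by simp
  have kK: "0 < \<kappa> * K" using \<kappa> K by simp
  \<comment> \<open>The tolerance never exceeds \<open>\<kappa> * K\<close> and the infimum is at
    most 0, so every member of the sequence, from the start, is near the ground state.\<close>
  define \<delta> where "\<delta> = (\<lambda>n. \<kappa> * K * (1 / real (Suc n)))"
  have \<delta>: "0 < \<delta> n" "\<delta> n \<le> \<kappa> * K" for n
    using kK mult_left_mono[of "1 / real (Suc n)" 1 "\<kappa> * K"] by (simp_all add: \<delta>_def)
  have \<delta>_lim: "\<delta> \<longlonglongrightarrow> 0"
    using tendsto_mult[OF tendsto_const LIMSEQ_inverse_real_of_nat, of "\<kappa> * K"]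
    by (simp add: \<delta>_def inverse_eq_divide)
  have "\<exists>u\<in>particle_states V. Im (overlap u) = 0 \<and> 0 < Re (overlap u) \<and> qf V u u \<le> \<eta> \<and> J u < e + \<delta> n" for n
  proof -
    have "e < e + \<delta> n" using \<delta>(1) by simp
    then obtain u where u: "u \<in> particle_states V" "J u < e + \<delta> n"
      unfolding e_def using cInf_lessD[of "J ` particle_states V"] \<psi>_state by blast
    hence q: "qf V u u \<le> \<eta>" using near_minimum e0 \<delta>(2)[of n] by simp
    hence "overlap u \<noteq> 0" using overlap_ge[OF u(1)] by auto
    from phase_normalize[OF u(1) this] obtain u' where "u' \<in> particle_states V" "J u' = J u" "qf V u' u' = qf V u u"
      "Im (overlap u') = 0" "0 < Re (overlap u')" by blast
    with u q show ?thesis by (intro bexI[of _ u']) auto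
  qed
  then obtain X where X: "\<And>n. X n \<in> particle_states V" "\<And>n. Im (overlap (X n)) = 0"
    "\<And>n. 0 < Re (overlap (X n))" "\<And>n. qf V (X n) (X n) \<le> \<eta>" "\<And>n. J (X n) < e + \<delta> n"
    by metis
  note XQ = statesD(1)[OF X(1)]
  define C where "C = 4 * (K * (1 + 2 / \<gamma>))"
  have C: "0 < C" unfolding C_def using K \<gamma> by (intro mult_pos_pos add_pos_pos divide_pos_pos) auto
  have "F.cauchy_seq X"
  proof (rule F.cauchy_seqI[OF XQ])
    fix m n
    have "fip V (X m - X n) (X m - X n) \<le> C * (J (X m) + J (X n) - 2 * e)"
      unfolding C_def by (rule strict_convexity) (use X e_le in auto)
    also have "\<dots> \<le> C * (\<delta> m + \<delta> n)" using X(5)[of m] X(5)[of n] C by (intro mult_left_mono) auto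
    finally show "fip V (X m - X n) (X m - X n) \<le> C * \<delta> m + C * \<delta> n" by (simp add: distrib_left)
    show "(\<lambda>n. C * \<delta> n) \<longlonglongrightarrow> 0" using tendsto_mult[OF tendsto_const \<delta>_lim, of C] by simp
  qed
  then obtain u where u: "u \<in> Q" "(\<lambda>n. fip V (X n - u) (X n - u)) \<longlonglongrightarrow> 0"
    using complete_fip[OF V_meas] unfolding F.complete_form_def by blast
  note uL = QD(3)[OF u(1)] and XL = QD(3)[OF XQ]
  have rlim: "(\<lambda>n. rip (X n - u) (X n - u)) \<longlonglongrightarrow> 0"
    by (rule tendsto_sandwich[OF _ _ tendsto_const u(2)]) (simp add: rip_self, simp add: rip_le)
  have "(\<lambda>n. rip (X n) (X n)) \<longlonglongrightarrow> rip u u" by (rule L2.tendsto_form_diag[OF rlim XL uL])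
  hence "rip u u = 1" using statesD(2)[OF X(1)] by (simp add: LIMSEQ_const_iff)
  hence "(L2_norm u)\<^sup>2 = 1\<^sup>2" by (simp add: rip_self)
  hence "L2_norm u = 1" by (rule power2_eq_imp_eq) auto
  with u(1) have uU: "u \<in> particle_states V" by (simp add: particle_states_def)
  have Re_lim: "(\<lambda>n. Re (overlap (X n))) \<longlonglongrightarrow> Re (overlap u)"
    using L2.tendsto_form[OF rlim XL uL \<psi>L] L2.sym[OF \<psi>L XL] L2.sym[OF \<psi>L uL] by (simp add: Re_overlap XQ u(1))
  have "(\<lambda>n. Im (overlap (X n))) \<longlonglongrightarrow> Im (overlap u)"
    using L2.tendsto_form[OF rlim XL uL L2_mult[OF \<psi>L]] L2.sym[OF L2_mult[OF \<psi>L] XL] L2.sym[OF L2_mult[OF \<psi>L] uL]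
    by (simp add: Im_overlap XQ u(1))
  hence Im: "Im (overlap u) = 0" using X(2) by (simp add: LIMSEQ_const_iff)
  \<comment> \<open>Positivity of the overlap could be lost in the limit; the uniform lower bound on
    its square prevents this.\<close>
  have "31/32 \<le> (Re (overlap (X n)))\<^sup>2" for n
    using overlap_ge[OF X(1) X(4), of n] X(2)[of n] by (simp add: cmod_power2)
  hence "31/32 \<le> (Re (overlap u))\<^sup>2"
    using tendsto_power[OF Re_lim, of 2] by (intro LIMSEQ_le_const) auto
  moreover have "0 \<le> Re (overlap u)" using Re_lim X(3) by (intro LIMSEQ_le_const) (auto intro: less_imp_le)
  ultimately have Re: "0 < Re (overlap u)" by (cases "Re (overlap u) = 0") auto
  have "(\<lambda>n. e + \<delta> n) \<longlonglongrightarrow> e + 0" by (intro tendsto_intros \<delta>_lim)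
  hence "J u \<le> e" using J_tendsto[OF XQ u] X(5) by (intro LIMSEQ_le[of "\<lambda>n. J (X n)" "J u" "\<lambda>n. e + \<delta> n"]) (auto intro: less_imp_le)
  thus ?thesis using that[OF uU Im Re] e_le order_trans by blast
qed

lemma minimizer_near:
  assumes "u \<in> particle_states V" "\<And>v. v \<in> particle_states V \<Longrightarrow> J u \<le> J v"
  shows "qf V u u \<le> \<eta>"
proof -
  have "J u \<le> 0" using assms(2)[OF \<psi>_state] J_\<psi> by simp
  moreover have "0 \<le> \<kappa> * K" using \<kappa> K by simp
  ultimately show ?thesis by (intro near_minimum assms(1)) simp
qed

lemma fip_le_near: "\<lbrakk>u \<in> particle_states V; qf V u u \<le> \<eta>\<rbrakk> \<Longrightarrow> fip V u u \<le> 2 * K"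
proof -
  assume u: "u \<in> particle_states V" "qf V u u \<le> \<eta>"
  have "fip V u u \<le> K * (qf V u u + rip u u)" by (rule fip_le[OF statesD(1)[OF u(1)]])
  also have "\<dots> \<le> K * 2" using u statesD(2) small(2) K by (intro mult_left_mono) auto
  finally show ?thesis by simp
qed

end

section \<open>The energy functional\<close>

text \<open>The coupling is bilinear in \<open>f\<close> and the transform of the density.
  Conjugating \<open>f\<close> turns it into the inner product of this vector with
  \<open>psi\<close>, so the square can be completed.\<close>

definition fieldvec :: "(real^3 \<Rightarrow> real) \<Rightarrow> (real^3 \<Rightarrow> complex) \<Rightarrow> real^3 \<Rightarrow> complex" where
  "fieldvec \<omega> f k = cnj (sqrt (\<omega> k) *\<^sub>R f k)"

text \<open>A signed square root of the coupling function \<open>W\<close>.\<close>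

definition svec :: "(real^3 \<Rightarrow> real) \<Rightarrow> (real^3 \<Rightarrow> real) \<Rightarrow> real \<Rightarrow> real^3 \<Rightarrow> real" where
  "svec \<omega> v g k = g * v k / sqrt (\<omega> k)"

lemma fieldvec_L2: "f \<in> field_space \<omega> \<Longrightarrow> fieldvec \<omega> f \<in> L2"
  unfolding fieldvec_def[abs_def] field_space_def by (rule L2_linear[of _ cnj 1]) auto

lemma field_norm_eq: "field_norm \<omega> f = L2_norm (fieldvec \<omega> f)"
  by (simp add: field_norm_def fieldvec_def L2_norm_def)

lemma ft_dens: "ft (dens u u) k = (\<integral>x. exp (\<i> * of_real (k \<bullet> x)) * of_real ((norm (u x))\<^sup>2) \<partial>lebesgue)"
  unfolding ft_def dens_def complex_norm_square ..

text \<open>Completing the square in the field. The factors \<open>sqrt (\<omega> k)\<close> and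
  \<open>1 / sqrt (\<omega> k)\<close> cancel where \<omega> is positive, hence almost everywhere,
  and this suffices under the integral.\<close>

lemma energy_eq:
  assumes V: "V \<in> borel_measurable lebesgue" and u: "u \<in> form_domain V" and f: "f \<in> field_space \<omega>"
    and \<omega>: "\<And>k. 0 \<le> \<omega> k" "AE k in lebesgue. 0 < \<omega> k" "\<omega> \<in> borel_measurable lebesgue"
    and v: "v \<in> borel_measurable lebesgue" and psi: "psi (svec \<omega> v g) u u \<in> L2"
  shows "energy V \<omega> v g u f = sform V u u - rip (psi (svec \<omega> v g) u u) (psi (svec \<omega> v g) u u)
    + rip (fieldvec \<omega> f + psi (svec \<omega> v g) u u) (fieldvec \<omega> f + psi (svec \<omega> v g) u u)"
proof -
  let ?P = "psi (svec \<omega> v g) u u" and ?F = "fieldvec \<omega> f"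
  have FL: "?F \<in> L2" by (rule fieldvec_L2[OF f])
  note [measurable] = \<omega>(3) v L2_measurable[OF psi] L2_measurable[OF FL]
  have fm [measurable]: "f \<in> borel_measurable lebesgue" using f by (simp add: field_space_def)
  have dm [measurable]: "ft (dens u u) \<in> borel_measurable lebesgue"
    by (rule ft_measurable_lebesgue[OF L2_measurable[OF dens_facts(2)]]) (use form_domain_D[OF V u] in auto)
  have 1: "(\<integral>x. (norm (grad u x))\<^sup>2 \<partial>lebesgue) + (\<integral>x. V x * (norm (u x))\<^sup>2 \<partial>lebesgue) = sform V u u"
    by (simp add: sform_def rip_self L2_norm_sq power2_norm_eq_inner)
  have "(norm (?F k))\<^sup>2 = \<omega> k * (norm (f k))\<^sup>2" for k
    using \<omega>(1)[of k] by (simp add: fieldvec_def power_mult_distrib)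
  hence 2: "(\<integral>k. \<omega> k * (norm (f k))\<^sup>2 \<partial>lebesgue) = rip ?F ?F" by (simp add: rip_self L2_norm_sq)
  have "g * Re (\<integral>k. of_real (v k) * f k * ft (dens u u) k \<partial>lebesgue)
      = Re (\<integral>k. of_real g * (of_real (v k) * f k * ft (dens u u) k) \<partial>lebesgue)"
    by (subst integral_mult_right_zero) simp
  also have "(\<integral>k. of_real g * (of_real (v k) * f k * ft (dens u u) k) \<partial>lebesgue) = (\<integral>k. cnj (?F k) * ?P k \<partial>lebesgue)"
  proof (rule integral_cong_AE)
    show "AE k in lebesgue. of_real g * (of_real (v k) * f k * ft (dens u u) k) = cnj (?F k) * ?P k"
      using \<omega>(2)
    proof eventually_elim
      fix k assume "0 < \<omega> k"
      thus "of_real g * (of_real (v k) * f k * ft (dens u u) k) = cnj (?F k) * ?P k"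
        by (simp add: fieldvec_def psi_def svec_def scaleR_conv_of_real)
    qed
  qed measurable
  also have "\<dots> = L2_inner ?F ?P" by (simp add: L2_inner_def)
  also have "Re \<dots> = rip ?F ?P" by (rule Re_L2_inner[OF FL psi])
  finally have 3: "g * Re (\<integral>k. of_real (v k) * f k * ft (dens u u) k \<partial>lebesgue) = rip ?F ?P" .
  have "energy V \<omega> v g u f = sform V u u + rip ?F ?F + 2 * rip ?F ?P"
    unfolding energy_def ft_dens[symmetric] using 1 2 3 by simp
  thus ?thesis using FL psi L2.sym[OF psi FL] by (simp add: L2.bilin)
qed

text \<open>The field that makes the completed square vanish. Where \<omega> is zero the division
  gives the value 0; this concerns only a null set.\<close>

lemma optimal_field:
  assumes \<omega>: "AE k in lebesgue. 0 < \<omega> k" "\<omega> \<in> borel_measurable lebesgue" and p: "p \<in> L2"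
  obtains f where "f \<in> field_space \<omega>" "AE k in lebesgue. fieldvec \<omega> f k = - p k"
proof
  let ?f = "\<lambda>k. (- 1 / sqrt (\<omega> k)) *\<^sub>R cnj (p k)"
  note [measurable] = \<omega>(2) L2_measurable[OF p]
  have m [measurable]: "?f \<in> borel_measurable lebesgue" by measurable
  have eq: "AE k in lebesgue. - cnj (p k) = sqrt (\<omega> k) *\<^sub>R ?f k" using \<omega>(1) by eventually_elim simp
  have "(\<lambda>k. - cnj (p k)) \<in> L2" by (rule L2_linear[OF p, of "\<lambda>z. - cnj z" 1]) auto
  hence "(\<lambda>k. sqrt (\<omega> k) *\<^sub>R ?f k) \<in> L2" by (rule L2_cong_AE[OF _ _ eq]) measurable
  thus "?f \<in> field_space \<omega>" using m by (simp add: field_space_def)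
  show "AE k in lebesgue. fieldvec \<omega> ?f k = - p k" using \<omega>(1) by eventually_elim (simp add: fieldvec_def)
qed

text \<open>The weight is assumed to satisfy \<open>s^2 \<le> \<bar>W\<bar>\<close> rather than
  equality, so that a cutoff weight is covered by the smallness of the full
  \<open>W\<close>.\<close>

lemma psi_bounds:
  assumes eps: "0 < \<epsilon>" and W: "L1_L3w_norm W \<le> ennreal \<epsilon>"
    and s: "s \<in> borel_measurable lebesgue" "\<And>k. (s k)\<^sup>2 \<le> \<bar>W k\<bar>" and u: "u \<in> H1" and w: "w \<in> H1"
  shows "psi s u w \<in> L2" "rip (psi s u w) (psi s u w) \<le> coupK * \<epsilon> * (H1_norm u)\<^sup>2 * (H1_norm w)\<^sup>2"
    and "L2_norm u = 1 \<Longrightarrow> rip (psi s u u) (psi s u u) \<le> coupK * \<epsilon> * (H1_norm u)\<^sup>2"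
proof -
  have base: "psi s u w \<in> L2 \<and> rip (psi s u w) (psi s u w) \<le> B"
    if u: "u \<in> H1" and w: "w \<in> H1" and b: "(\<integral>\<^sup>+k. ennreal (\<bar>W k\<bar> * (norm (ft (dens u w) k))\<^sup>2) \<partial>lebesgue) \<le> ennreal B" and B: "0 \<le> B" for u w B
  proof -
    note [measurable] = s(1) ft_measurable_lebesgue[OF L2_measurable[OF dens_facts(2)[OF u w]]]
    have "(\<integral>\<^sup>+k. ennreal ((norm (psi s u w k))\<^sup>2) \<partial>lebesgue) \<le> (\<integral>\<^sup>+k. ennreal (\<bar>W k\<bar> * (norm (ft (dens u w) k))\<^sup>2) \<partial>lebesgue)"
    proof (intro nn_integral_mono ennreal_leI)
      fix k
      show "(norm (psi s u w k))\<^sup>2 \<le> \<bar>W k\<bar> * (norm (ft (dens u w) k))\<^sup>2"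
        using mult_right_mono[OF s(2)[of k], of "(norm (ft (dens u w) k))\<^sup>2"] by (simp add: psi_def power_mult_distrib)
    qed
    also note b
    finally have le: "(\<integral>\<^sup>+k. ennreal ((norm (psi s u w k))\<^sup>2) \<partial>lebesgue) \<le> ennreal B" .
    have L: "psi s u w \<in> L2"
    proof (rule L2_if_nn_integral)
      show "psi s u w \<in> borel_measurable lebesgue" unfolding psi_def[abs_def] by measurable
    qed (rule le_less_trans[OF le], simp)
    show ?thesis using L le B unfolding nn_integral_sq_L2[OF L] rip_self by (simp add: ennreal_le_iff)
  qed
  show "psi s u w \<in> L2" "rip (psi s u w) (psi s u w) \<le> coupK * \<epsilon> * (H1_norm u)\<^sup>2 * (H1_norm w)\<^sup>2"
    using base[OF u w coupling_bound(1)[OF eps W u w]] eps by (auto simp: less_imp_le)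
  show "L2_norm u = 1 \<Longrightarrow> rip (psi s u u) (psi s u u) \<le> coupK * \<epsilon> * (H1_norm u)\<^sup>2"
    using base[OF u u coupling_bound(2)[OF eps W u u]] eps by (auto simp: less_imp_le)
qed

lemma rip_eq_0_iff: "p \<in> L2 \<Longrightarrow> rip p p = 0 \<longleftrightarrow> (AE x in lebesgue. p x = 0)"
  by (simp add: rip_self L2_norm_eq_0_iff)

lemma svec_measurable:
  assumes [measurable]: "\<omega> \<in> borel_measurable lebesgue" "v \<in> borel_measurable lebesgue"
  shows "svec \<omega> v g \<in> borel_measurable lebesgue"
  unfolding svec_def[abs_def] by measurable

lemma svec_sq: "0 \<le> \<omega> k \<Longrightarrow> (svec \<omega> v g k)\<^sup>2 = coupling_W \<omega> v g k"
  by (simp add: svec_def coupling_W_def power_divide power_mult_distrib divide_inverse power_inverse)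

lemma svec_cutoff: "svec \<omega> (cutoff \<Lambda> v) g k = (if norm k \<le> \<Lambda> then svec \<omega> v g k else 0)"
  by (simp add: svec_def cutoff_def)

lemma psi_cutoff: "psi (svec \<omega> (cutoff \<Lambda> v) g) u w k = (if norm k \<le> \<Lambda> then psi (svec \<omega> v g) u w k else 0)"
  by (simp add: psi_def svec_cutoff)

section \<open>Minimizers of the full energy and removal of the cutoff\<close>

locale polaron = coupled V "\<lambda>x. complex_of_real (uV x)" \<gamma> K M \<eta> \<kappa> "svec \<omega> v g"
  for V uV \<gamma> K M \<eta> \<kappa> \<omega> v g +
  assumes \<omega>: "\<omega> \<in> borel_measurable lebesgue" "\<And>k. 0 \<le> \<omega> k" "AE k in lebesgue. 0 < \<omega> k"
    and v: "v \<in> borel_measurable lebesgue"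
begin

abbreviation "P u \<equiv> psi (svec \<omega> v g) u u"

lemma P_L2: "u \<in> Q \<Longrightarrow> P u \<in> L2" by (rule psiL)

lemma energy_J:
  assumes u: "u \<in> particle_states V" and f: "f \<in> field_space \<omega>"
  shows "energy V \<omega> v g u f = spectral_inf V + J u + rip (fieldvec \<omega> f + P u) (fieldvec \<omega> f + P u)"
  using energy_eq[OF V_meas statesD(1)[OF u] f \<omega>(2,3,1) v P_L2[OF statesD(1)[OF u]]] statesD(2)[OF u]
  by (simp add: J_def D_def qf_def)

text \<open>The field occurs in the energy only through a nonnegative square, which
  \<open>optimal_field\<close> makes vanish for every particle state. Comparing a minimizer with
  these competitors separates the two conditions.\<close>

lemma minimizer_iff:
  "minimizer V \<omega> v g u f \<longleftrightarrow> u \<in> particle_states V \<and> f \<in> field_space \<omega> \<and>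
    (\<forall>w\<in>particle_states V. J u \<le> J w) \<and> (AE k in lebesgue. fieldvec \<omega> f k = - P u k)" (is "?l \<longleftrightarrow> ?r")
proof (cases "u \<in> particle_states V \<and> f \<in> field_space \<omega>")
  case True
  hence u: "u \<in> particle_states V" and f: "f \<in> field_space \<omega>" by auto
  have L: "fieldvec \<omega> f' + P w \<in> L2" if "w \<in> particle_states V" "f' \<in> field_space \<omega>" for w f'
    using that fieldvec_L2 P_L2 statesD(1) by blast
  have zero: "rip (fieldvec \<omega> f' + P w) (fieldvec \<omega> f' + P w) = 0 \<longleftrightarrow> (AE k in lebesgue. fieldvec \<omega> f' k = - P w k)"
    if "w \<in> particle_states V" "f' \<in> field_space \<omega>" for w f'
    using rip_eq_0_iff[OF L[OF that]] by (simp add: eq_neg_iff_add_eq_0)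
  show ?thesis
  proof
    assume ?l
    hence min: "energy V \<omega> v g u f \<le> energy V \<omega> v g w f'" if "w \<in> particle_states V" "f' \<in> field_space \<omega>" for w f'
      using that by (auto simp: minimizer_def)
    have le: "J u + rip (fieldvec \<omega> f + P u) (fieldvec \<omega> f + P u) \<le> J w" if w: "w \<in> particle_states V" for w
    proof -
      obtain f' where f': "f' \<in> field_space \<omega>" "AE k in lebesgue. fieldvec \<omega> f' k = - P w k"
        by (rule optimal_field[OF \<omega>(3,1) P_L2[OF statesD(1)[OF w]]])
      thus ?thesis using min[OF w f'(1)] zero[OF w f'(1)] by (simp add: energy_J w u f)
    qed
    have n: "0 \<le> rip (fieldvec \<omega> f + P u) (fieldvec \<omega> f + P u)" by (simp add: rip_self)
    have "rip (fieldvec \<omega> f + P u) (fieldvec \<omega> f + P u) = 0" using le[OF u] n by simp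
    thus ?r using u f zero[OF u f] le by simp
  next
    assume r: ?r
    hence z: "rip (fieldvec \<omega> f + P u) (fieldvec \<omega> f + P u) = 0" using zero[OF u f] by simp
    have "energy V \<omega> v g u f \<le> energy V \<omega> v g w f'" if w: "w \<in> particle_states V" and f': "f' \<in> field_space \<omega>" for w f'
    proof -
      have "0 \<le> rip (fieldvec \<omega> f' + P w) (fieldvec \<omega> f' + P w)" by (simp add: rip_self)
      thus ?thesis using r w z by (simp add: energy_J w u f f' add_increasing2)
    qed
    thus ?l using u f by (simp add: minimizer_def)
  qed
qed (auto simp: minimizer_def)

lemma positive_overlap_iff: "positive_overlap u uV \<longleftrightarrow> Im (overlap u) = 0 \<and> 0 < Re (overlap u)"
  unfolding positive_overlap_def overlap_def L2_inner_cnj[of u "\<lambda>x. complex_of_real (uV x)"] by simp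

lemma unique_minimizer_exists: "\<exists>u f. unique_minimizer V uV \<omega> v g u f"
proof -
  obtain u where u: "u \<in> particle_states V" "Im (overlap u) = 0" "0 < Re (overlap u)"
    "\<And>w. w \<in> particle_states V \<Longrightarrow> J u \<le> J w"
    by (rule J_minimizer_exists) blast
  obtain f where f: "f \<in> field_space \<omega>" "AE k in lebesgue. fieldvec \<omega> f k = - P u k"
    by (rule optimal_field[OF \<omega>(3,1) P_L2[OF statesD(1)[OF u(1)]]])
  have "(AE x in lebesgue. u' x = u x) \<and> (AE k in lebesgue. f' k = f k)"
    if m: "minimizer V \<omega> v g u' f'" and o: "positive_overlap u' uV" for u' f'
  proof -
    have u': "u' \<in> particle_states V" "\<And>w. w \<in> particle_states V \<Longrightarrow> J u' \<le> J w"
      and f': "AE k in lebesgue. fieldvec \<omega> f' k = - P u' k" using m by (auto simp: minimizer_iff)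
    have o': "Im (overlap u') = 0" "0 < Re (overlap u')" using o by (auto simp: positive_overlap_iff)
    have "J u' = J u" using u(4)[OF u'(1)] u'(2)[OF u(1)] by simp
    hence "fip V (u' - u) (u' - u) \<le> 0"
      using strict_convexity[OF u'(1) minimizer_near[OF u'] o' u(1) minimizer_near[OF u(1,4)] u(2,3), of "J u"] u(4) by simp
    hence "rip (u' - u) (u' - u) \<le> 0" by (rule order_trans[OF rip_le])
    hence "rip (u' - u) (u' - u) = 0" by (simp add: rip_self)
    moreover have "u' - u \<in> L2" using QD(3) statesD(1) u(1) u'(1) by blast
    ultimately have AEu: "AE x in lebesgue. u' x = u x" by (simp add: rip_eq_0_iff)
    have eq: "P u' k = P u k" for k
    proof -
      have "ft (dens u' u') k = ft (dens u u) k"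
      proof (rule ft_cong_AE)
        show "AE x in lebesgue. dens u' u' x = dens u u x" using AEu by eventually_elim (simp add: dens_def)
      qed (intro L2_measurable dens_facts(2) QD(1) statesD(1) u(1) u'(1))+
      thus ?thesis by (simp add: psi_def)
    qed
    from f' f(2) \<omega>(3) have "AE k in lebesgue. f' k = f k"
    proof eventually_elim
      fix k assume k: "fieldvec \<omega> f' k = - P u' k" "fieldvec \<omega> f k = - P u k" "0 < \<omega> k"
      hence "fieldvec \<omega> f' k = fieldvec \<omega> f k" by (simp add: eq)
      thus "f' k = f k" using k(3) by (simp add: fieldvec_def)
    qed
    with AEu show ?thesis by simp
  qed
  moreover have "minimizer V \<omega> v g u f" using u f by (simp add: minimizer_iff)
  moreover have "positive_overlap u uV" using u by (simp add: positive_overlap_iff)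
  ultimately have "unique_minimizer V uV \<omega> v g u f" unfolding unique_minimizer_def by blast
  thus ?thesis by blast
qed

text \<open>The part of the interaction \<open>D u\<close> that the cutoff at \<Lambda>
  removes.\<close>

definition tail :: "real \<Rightarrow> (real^3 \<Rightarrow> complex) \<Rightarrow> real" where
  "tail \<Lambda> u = (\<integral>k. (if norm k \<le> \<Lambda> then 0 else (norm (P u k))\<^sup>2) \<partial>lebesgue)"

lemma tail_tendsto: "u \<in> Q \<Longrightarrow> ((\<lambda>\<Lambda>. tail \<Lambda> u) \<longlongrightarrow> 0) at_top"
proof -
  assume u: "u \<in> Q"
  note L = P_L2[OF u]
  note [measurable] = L2_measurable[OF L]
  have nm [measurable]: "(\<lambda>k::real^3. norm k) \<in> borel_measurable lebesgue" by (rule measurable_completion) measurable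
  have "((\<lambda>\<Lambda>. tail \<Lambda> u) \<longlongrightarrow> (\<integral>k. 0 \<partial>(lebesgue :: (real^3) measure))) at_top"
    unfolding tail_def
  proof (rule integral_dominated_convergence_at_top[where w = "\<lambda>k. (norm (P u k))\<^sup>2"])
    show "integrable lebesgue (\<lambda>k. (norm (P u k))\<^sup>2)" by (rule L2_integrable_sq[OF L])
    show "AE k in lebesgue. ((\<lambda>\<Lambda>. if norm k \<le> \<Lambda> then 0 else (norm (P u k))\<^sup>2) \<longlongrightarrow> 0) at_top"
    proof (rule AE_I2)
      fix k :: "real^3"
      have "\<forall>\<^sub>F \<Lambda> in at_top. (if norm k \<le> \<Lambda> then 0 else (norm (P u k))\<^sup>2) = 0"
        using eventually_ge_at_top[of "norm k"] by eventually_elim simp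
      thus "((\<lambda>\<Lambda>. if norm k \<le> \<Lambda> then 0 else (norm (P u k))\<^sup>2) \<longlongrightarrow> 0) at_top" by (rule tendsto_eventually)
    qed
  qed (auto intro!: always_eventually)
  thus ?thesis by simp
qed

text \<open>The cutoff minimizer \<open>w\<close> is an approximate minimizer of \<open>J\<close>,
  and strict convexity of \<open>J\<close> itself measures its distance to \<open>u\<close>. The
  error is the tail of the fixed state \<open>u\<close>; the tail of \<open>w\<close>, which varies
  with \<Lambda>, enters with the favorable sign. So convergence follows from dominated convergence
  for a single function.\<close>

theorem cutoff_distance:
  assumes cut: "polaron V uV \<gamma> K M \<eta> \<kappa> \<omega> (cutoff \<Lambda> v) g"
    and um: "minimizer V \<omega> v g u f" "positive_overlap u uV"
    and wm: "minimizer V \<omega> (cutoff \<Lambda> v) g w h" "positive_overlap w uV"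
  shows "(product_norm V \<omega> (\<lambda>x. w x - u x) (\<lambda>k. h k - f k))\<^sup>2
    \<le> (4 * (K * (1 + 2 / \<gamma>)) * (1 + 16 * \<kappa> * K) + 2) * tail \<Lambda> u"
proof -
  interpret C: polaron V uV \<gamma> K M \<eta> \<kappa> \<omega> "cutoff \<Lambda> v" g by (rule cut)
  define t where "t = tail \<Lambda> u"
  have u: "u \<in> particle_states V" "\<And>z. z \<in> particle_states V \<Longrightarrow> J u \<le> J z"
    and f: "f \<in> field_space \<omega>" "AE k in lebesgue. fieldvec \<omega> f k = - P u k" using um(1) by (auto simp: minimizer_iff)
  have w: "w \<in> particle_states V" "\<And>z. z \<in> particle_states V \<Longrightarrow> C.J w \<le> C.J z"
    and h: "h \<in> field_space \<omega>" "AE k in lebesgue. fieldvec \<omega> h k = - C.P w k" using wm(1) by (auto simp: C.minimizer_iff)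
  note uQ = statesD(1)[OF u(1)] and wQ = statesD(1)[OF w(1)]
  have split: "D z = C.D z + tail \<Lambda> z" if z: "z \<in> Q" for z
  proof -
    note L = P_L2[OF z] C.P_L2[OF z]
    have "tail \<Lambda> z = (\<integral>k. (norm (P z k))\<^sup>2 - (norm (C.P z k))\<^sup>2 \<partial>lebesgue)"
      unfolding tail_def by (intro Bochner_Integration.integral_cong) (simp_all add: psi_cutoff)
    also have "\<dots> = D z - C.D z"
      unfolding D_def C.D_def rip_self L2_norm_sq by (intro Bochner_Integration.integral_diff L2_integrable_sq L)
    finally show ?thesis by simp
  qed
  have tail0: "0 \<le> tail \<Lambda> z" for z unfolding tail_def by (intro Bochner_Integration.integral_nonneg) simp
  have near_w: "qf V w w \<le> \<eta>" by (rule C.minimizer_near[OF w])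
  have near_u: "qf V u u \<le> \<eta>" by (rule minimizer_near[OF u])
  \<comment> \<open>Restoring the high frequencies only adds to the interaction and lowers the
    functional at \<open>w\<close>.\<close>
  have "J w \<le> C.J w" using split[OF wQ] tail0[of w] by (simp add: J_def C.J_def)
  also have "\<dots> \<le> C.J u" by (rule w(2)[OF u(1)])
  also have "\<dots> = J u + t" using split[OF uQ] by (simp add: J_def C.J_def t_def)
  finally have Jw: "J w \<le> J u + t" .
  have ov: "Im (overlap w) = 0" "0 < Re (overlap w)" "Im (overlap u) = 0" "0 < Re (overlap u)"
    using um(2) wm(2) by (auto simp: positive_overlap_iff)
  have C0: "0 \<le> 4 * (K * (1 + 2 / \<gamma>))" using K \<gamma> by simp
  have "fip V (w - u) (w - u) \<le> 4 * (K * (1 + 2 / \<gamma>)) * (J w + J u - 2 * J u)"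
    by (rule strict_convexity[OF w(1) near_w ov(1,2) u(1) near_u ov(3,4) u(2)])
  also have "\<dots> \<le> 4 * (K * (1 + 2 / \<gamma>)) * t" using Jw C0 by (intro mult_left_mono) auto
  finally have F: "fip V (w - u) (w - u) \<le> 4 * (K * (1 + 2 / \<gamma>)) * t" .
  \<comment> \<open>The field difference is split at \<open>C.P u\<close>: one part is the field of
    \<open>u\<close> beyond the cutoff, with square \<open>t\<close>, the other the change of the
    cutoff field between \<open>u\<close> and \<open>w\<close>, controlled by their
    distance.\<close>
  have PL: "P u - C.P u \<in> L2" "C.P u - C.P w \<in> L2" "P u - C.P w \<in> L2"
    using P_L2[OF uQ] C.P_L2[OF uQ] C.P_L2[OF wQ] by blast+
  have t_eq: "rip (P u - C.P u) (P u - C.P u) = t"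
    unfolding t_def tail_def rip_self L2_norm_sq by (intro Bochner_Integration.integral_cong) (simp_all add: psi_cutoff)
  have "rip (C.P u - C.P w) (C.P u - C.P w) = rip (C.P w - C.P u) (C.P w - C.P u)"
    unfolding rip_self by (simp add: L2_norm_def norm_minus_commute)
  also have "\<dots> \<le> 2 * \<kappa> * (fip V w w + fip V u u) * fip V (w - u) (w - u)" by (rule C.psi_diff_le[OF wQ uQ])
  also have "\<dots> \<le> 2 * \<kappa> * (2 * K + 2 * K) * fip V (w - u) (w - u)"
    using \<kappa> wQ uQ fip_le_near[OF w(1) near_w] fip_le_near[OF u(1) near_u]
    by (intro mult_right_mono mult_left_mono add_mono F.nonneg F.in_diff) auto
  finally have P2: "rip (C.P u - C.P w) (C.P u - C.P w) \<le> 8 * \<kappa> * K * fip V (w - u) (w - u)" by simp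
  have hf: "(\<lambda>k. h k - f k) \<in> field_space \<omega>"
  proof -
    have "(\<lambda>k. sqrt (\<omega> k) *\<^sub>R h k - sqrt (\<omega> k) *\<^sub>R f k) \<in> L2"
      using h(1) f(1) by (intro L2_diff) (simp_all add: field_space_def)
    moreover have "(\<lambda>k. h k - f k) \<in> borel_measurable lebesgue"
      using h(1) f(1) by (intro borel_measurable_diff) (simp_all add: field_space_def)
    ultimately show ?thesis by (simp add: field_space_def scaleR_diff_right)
  qed
  have AE: "AE k in lebesgue. fieldvec \<omega> (\<lambda>k. h k - f k) k = (P u - C.P w) k"
    using h(2) f(2) by eventually_elim (simp add: fieldvec_def algebra_simps scaleR_diff_right)
  have "(field_norm \<omega> (\<lambda>k. h k - f k))\<^sup>2 = rip (P u - C.P w) (P u - C.P w)"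
    unfolding field_norm_eq rip_self[symmetric]
    by (rule rip_cong_AE[OF AE AE]) (intro L2_measurable fieldvec_L2 hf PL)+
  also have "P u - C.P w = (P u - C.P u) + (C.P u - C.P w)" by simp
  also have "rip \<dots> ((P u - C.P u) + (C.P u - C.P w))
      \<le> 2 * rip (P u - C.P u) (P u - C.P u) + 2 * rip (C.P u - C.P w) (C.P u - C.P w)"
    by (rule L2.add_sq_le[OF PL(1,2)])
  also have "\<dots> \<le> 2 * t + 16 * \<kappa> * K * fip V (w - u) (w - u)" using t_eq P2 by linarith
  finally have N: "(field_norm \<omega> (\<lambda>k. h k - f k))\<^sup>2 \<le> 2 * t + 16 * \<kappa> * K * fip V (w - u) (w - u)" .
  have "(product_norm V \<omega> (\<lambda>x. w x - u x) (\<lambda>k. h k - f k))\<^sup>2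
      = fip V (w - u) (w - u) + (field_norm \<omega> (\<lambda>k. h k - f k))\<^sup>2"
    by (simp add: product_norm_def fip_self fun_diff_def)
  also have "\<dots> \<le> (1 + 16 * \<kappa> * K) * fip V (w - u) (w - u) + 2 * t" using N by (simp add: algebra_simps)
  also have "\<dots> \<le> (1 + 16 * \<kappa> * K) * (4 * (K * (1 + 2 / \<gamma>)) * t) + 2 * t"
    using F \<kappa> K by (intro add_right_mono mult_left_mono) auto
  also have "\<dots> = (4 * (K * (1 + 2 / \<gamma>)) * (1 + 16 * \<kappa> * K) + 2) * t" by (simp add: algebra_simps)
  finally show ?thesis by (simp add: t_def)
qed

end

theorem proposition1p9:
  fixes V uV :: "real^3 \<Rightarrow> real"
  assumes "hypothesis_A V"
    and "hypothesis_B V uV"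
  shows "\<exists>\<epsilon>>0. \<forall>(\<omega> :: real^3 \<Rightarrow> real) (v :: real^3 \<Rightarrow> real) (g :: real).
    \<omega> \<in> borel_measurable lebesgue \<and> (\<forall>k. 0 \<le> \<omega> k) \<and> (AE k in lebesgue. 0 < \<omega> k) \<and>
    v \<in> borel_measurable lebesgue \<and>
    hypothesis_C (coupling_W \<omega> v g) \<and>
    L1_L3w_norm (coupling_W \<omega> v g) \<le> ennreal \<epsilon> \<longrightarrow>
    (\<exists>(u\<Lambda> :: real \<Rightarrow> real^3 \<Rightarrow> complex) (f\<Lambda> :: real \<Rightarrow> real^3 \<Rightarrow> complex) ugs fgs.
       (\<forall>\<Lambda>>0. unique_minimizer V uV \<omega> (cutoff \<Lambda> v) g (u\<Lambda> \<Lambda>) (f\<Lambda> \<Lambda>)) \<and>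
       unique_minimizer V uV \<omega> v g ugs fgs \<and>
       ((\<lambda>\<Lambda>. product_norm V \<omega> (\<lambda>x. u\<Lambda> \<Lambda> x - ugs x) (\<lambda>k. f\<Lambda> \<Lambda> k - fgs k)) \<longlongrightarrow> 0) at_top)"
proof -
  obtain \<gamma> K M where c: "0 < \<gamma>" "1 \<le> K" "0 < M" "psd_form (form_domain V) (qf V)"
    "\<And>u. u \<in> form_domain V \<Longrightarrow> fip V u u \<le> K * (qf V u u + rip u u)"
    "\<And>u. u \<in> form_domain V \<Longrightarrow> qf V u u \<le> M * fip V u u"
    "\<And>u. u \<in> form_domain V \<Longrightarrow> \<gamma> * (rip u u - (cmod (L2_inner (\<lambda>x. of_real (uV x)) u))\<^sup>2) \<le> qf V u u"
    "(\<lambda>x. of_real (uV x)) \<in> form_domain V" "L2_norm (\<lambda>x. complex_of_real (uV x)) = 1"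
    "qf V (\<lambda>x. of_real (uV x)) (\<lambda>x. of_real (uV x)) = 0"
    by (rule ground_state_constants[OF assms]) blast
  define K2 where "K2 = K * (1 + 2 / \<gamma>)"
  have K2: "0 < K2" unfolding K2_def using c(1,2) by (intro mult_pos_pos add_pos_pos divide_pos_pos) auto
  \<comment> \<open>The three entries are the three upper bounds on \<eta> in
    \<open>coupled\<close>; they involve only \<gamma> and \<open>K\<close>, hence only the
    potential.\<close>
  define \<eta> where "\<eta> = min 1 (min (\<gamma> / 32) (1 / (8 * K2)))"
  have \<eta>: "0 < \<eta>" "\<eta> \<le> 1" "\<eta> \<le> \<gamma> / 32" "\<eta> \<le> 1 / (8 * K2)" using c(1) K2 by (auto simp: \<eta>_def)
  \<comment> \<open>Chosen so that \<open>\<kappa> = coupK * \<epsilon>\<close> makes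
    \<open>\<kappa> * K\<close> equal to the minimum, which meets both smallness conditions on the
    coupling.\<close>
  define \<epsilon> where "\<epsilon> = min (\<eta> / 4) (1 / (56 * K2)) / (coupK * K)"
  have cK: "0 < coupK * K" using c(2) by simp
  have m0: "0 < min (\<eta> / 4) (1 / (56 * K2))" using \<eta>(1) K2 by simp
  have \<epsilon>: "0 < \<epsilon>" unfolding \<epsilon>_def by (rule divide_pos_pos[OF m0 cK])
  have "coupK * \<epsilon> * K = \<epsilon> * (coupK * K)" by simp
  also have "\<dots> = min (\<eta> / 4) (1 / (56 * K2))" using less_imp_neq[OF cK] by (simp add: \<epsilon>_def)
  finally have \<epsilon>K: "coupK * \<epsilon> * K \<le> \<eta> / 4" "coupK * \<epsilon> * K \<le> 1 / (56 * K2)" by simp_all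
  show ?thesis
  proof (intro exI[of _ \<epsilon>] conjI allI impI \<epsilon>, elim conjE)
    fix \<omega> v :: "real^3 \<Rightarrow> real" and g :: real
    assume \<omega>: "\<omega> \<in> borel_measurable lebesgue" "\<forall>k. 0 \<le> \<omega> k" "AE k in lebesgue. 0 < \<omega> k"
      and v: "v \<in> borel_measurable lebesgue" and W: "L1_L3w_norm (coupling_W \<omega> v g) \<le> ennreal \<epsilon>"
    \<comment> \<open>Stated for a form factor \<open>v'\<close> whose weight is dominated by the
      original \<open>W\<close>, to be instantiated with \<open>v\<close> and with each of its
      cutoffs at the same constants.\<close>
    have pol: "polaron V uV \<gamma> K M \<eta> (coupK * \<epsilon>) \<omega> v' g"
      if v': "v' \<in> borel_measurable lebesgue" and le: "\<And>k. (svec \<omega> v' g k)\<^sup>2 \<le> \<bar>coupling_W \<omega> v g k\<bar>" for v'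
    proof (intro polaron.intro coupled.intro polaron_axioms.intro)
      note pb = psi_bounds[OF \<epsilon> W svec_measurable[OF \<omega>(1) v'] le]
      fix u w :: "real^3 \<Rightarrow> complex" assume u: "u \<in> H1"
      show "L2_norm u = 1 \<Longrightarrow> rip (psi (svec \<omega> v' g) u u) (psi (svec \<omega> v' g) u u) \<le> coupK * \<epsilon> * (H1_norm u)\<^sup>2"
        by (rule pb(3)[OF u u])
      assume w: "w \<in> H1"
      show "psi (svec \<omega> v' g) u w \<in> L2" "rip (psi (svec \<omega> v' g) u w) (psi (svec \<omega> v' g) u w) \<le> coupK * \<epsilon> * (H1_norm u)\<^sup>2 * (H1_norm w)\<^sup>2"
        by (rule pb(1)[OF u w], rule pb(2)[OF u w])
    next
      show "\<eta> * (8 * (K * (1 + 2 / \<gamma>))) \<le> 1" using \<eta>(4) K2 unfolding K2_def[symmetric] by (simp add: field_simps)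
      show "coupK * \<epsilon> * K * (56 * (K * (1 + 2 / \<gamma>))) \<le> 1" using \<epsilon>K(2) K2 unfolding K2_def[symmetric] by (simp add: field_simps)
      show "0 < coupK * \<epsilon>" using \<epsilon> by simp
      show "\<And>k. 0 \<le> \<omega> k" using \<omega>(2) by simp
      show "psd_form (form_domain V) (qf V)" by (rule c(4))
    qed (use c \<eta> \<epsilon>K(1) \<omega> v' V_measurable[OF assms(1)] in simp_all)
    have W0: "(svec \<omega> v g k)\<^sup>2 \<le> \<bar>coupling_W \<omega> v g k\<bar>" for k using \<omega>(2) by (simp add: svec_sq)
    have cm: "cutoff \<Lambda> v \<in> borel_measurable lebesgue" for \<Lambda>
    proof -
      have "{k::real^3. norm k \<le> \<Lambda>} \<in> sets lebesgue"
        by (rule sets_completionI_sets) (simp add: borel_closed closed_Collect_le continuous_on_norm_id)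
      thus ?thesis unfolding cutoff_def[abs_def] using v by measurable
    qed
    have pc: "polaron V uV \<gamma> K M \<eta> (coupK * \<epsilon>) \<omega> (cutoff \<Lambda> v) g" for \<Lambda>
    proof (rule pol[OF cm])
      show "(svec \<omega> (cutoff \<Lambda> v) g k)\<^sup>2 \<le> \<bar>coupling_W \<omega> v g k\<bar>" for k using W0[of k] by (simp add: svec_cutoff)
    qed
    interpret polaron V uV \<gamma> K M \<eta> "coupK * \<epsilon>" \<omega> v g by (rule pol[OF v W0])
    obtain u f where uf: "unique_minimizer V uV \<omega> v g u f" using unique_minimizer_exists by blast
    \<comment> \<open>For \<Lambda> at most 0 the cutoff coupling vanishes almost everywhere and the
      same existence result applies, so the minimizers can be chosen as total functions of
      \<Lambda>.\<close>
    have "\<forall>\<Lambda>. \<exists>w h. unique_minimizer V uV \<omega> (cutoff \<Lambda> v) g w h"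
      using polaron.unique_minimizer_exists[OF pc] by blast
    then obtain w h where wh: "\<And>\<Lambda>. unique_minimizer V uV \<omega> (cutoff \<Lambda> v) g (w \<Lambda>) (h \<Lambda>)" by metis
    have uQ: "u \<in> form_domain V" using uf by (simp add: unique_minimizer_def minimizer_def particle_states_def)
    define C where "C = 4 * (K * (1 + 2 / \<gamma>)) * (1 + 16 * (coupK * \<epsilon>) * K) + 2"
    have le: "product_norm V \<omega> (\<lambda>x. w \<Lambda> x - u x) (\<lambda>k. h \<Lambda> k - f k) \<le> sqrt (C * tail \<Lambda> u)" for \<Lambda>
      unfolding C_def using uf wh[of \<Lambda>] by (intro real_le_rsqrt cutoff_distance[OF pc]) (simp_all add: unique_minimizer_def)
    have "((\<lambda>\<Lambda>. sqrt (C * tail \<Lambda> u)) \<longlongrightarrow> sqrt (C * 0)) at_top" by (intro tendsto_intros tail_tendsto uQ)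
    hence lim: "((\<lambda>\<Lambda>. sqrt (C * tail \<Lambda> u)) \<longlongrightarrow> 0) at_top" by simp
    have "((\<lambda>\<Lambda>. product_norm V \<omega> (\<lambda>x. w \<Lambda> x - u x) (\<lambda>k. h \<Lambda> k - f k)) \<longlongrightarrow> 0) at_top"
    proof (rule tendsto_sandwich[OF _ _ tendsto_const lim])
      show "\<forall>\<^sub>F \<Lambda> in at_top. product_norm V \<omega> (\<lambda>x. w \<Lambda> x - u x) (\<lambda>k. h \<Lambda> k - f k) \<le> sqrt (C * tail \<Lambda> u)"
        using le by (intro always_eventually allI)
    qed (simp add: product_norm_def)
    with uf wh show "\<exists>u\<Lambda> f\<Lambda> ugs fgs.
       (\<forall>\<Lambda>>0. unique_minimizer V uV \<omega> (cutoff \<Lambda> v) g (u\<Lambda> \<Lambda>) (f\<Lambda> \<Lambda>)) \<and>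
       unique_minimizer V uV \<omega> v g ugs fgs \<and>
       ((\<lambda>\<Lambda>. product_norm V \<omega> (\<lambda>x. u\<Lambda> \<Lambda> x - ugs x) (\<lambda>k. f\<Lambda> \<Lambda> k - fgs k)) \<longlongrightarrow> 0) at_top" by blast
  qed
qed

end
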